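(* Let $T^-<0<T^+$ and let $u\in C^0((T^-,T^+);H^1_+)$ be the unique solution of the CMDNLS equation $$i\partial_tu+\partial_x^2u+u(\mathbb{H}-i)\partial_x(|u|^2)=0$$ with initial datum $u(0)=u_0\in H^1_+$. Let $N$ be the number of eigenvalues of $\mathbb{L}_{u_0}$. Then for every $j\in\{1,\dots,N\}$ the standard eigenvector $\varphi_j^u:t\in(T^-,T^+)\mapsto\varphi_j^{u(t)}$ (defined in the context) satisfies $$\partial_t\varphi_j^u=i\partial_x^2\varphi_j^u+2u\,\partial_x\Pi(\overline u\varphi_j^u),\qquad\forall t\in(T^-,T^+).$$
   Context: All functions are complex valued on $\mathbb{R}$. $\mathbb{H}f(x)=\mathrm{P.V.}\frac1\pi\int_{\mathbb{R}}\frac{f(y)}{x-y}\,dy$ is the Hilbert transform. $\hat f(\xi)=\int_{\mathbb{R}} f(x)e^{-ix\xi}\,dx$. $H^\sigma_+=\{f\in H^\sigma(\mathbb{R};\mathbb{C}):\mathrm{supp}\,\hat f\subset[0,+\infty)\}$ for $\sigma\ge0$, $L^2_+=H^0_+$, with inner product $\langle f,g\rangle=\int f\overline g\,dx$. $\Pi=\frac12(\mathrm{id}+i\mathbb{H})$ is the Cauchy-Szegő projector, $\widehat{\Pi f}(\xi)=\mathbf{1}_{\xi\ge0}\hat f(\xi)$. For $v\in H^1_+$ the Lax operator is $\mathbb{L}_vh=-i\partial_xh-v\Pi(\overline vh)$, self-adjoint on $L^2_+$ with domain $H^1_+$. It is known that $\mathbb{L}_v$ has finitely many eigenvalues $\lambda_1^v<\dots<\lambda_N^v$,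 each simple, and that along a solution $u$ of the CMDNLS equation the operators $\mathbb{L}_{u(t)}$ are unitarily equivalent, so $N$ and the eigenvalues $\lambda_j^{u(t)}$ do not depend on $t$. The standard eigenvector $\varphi_j^v$ is the eigenvector determined by $\mathbb{L}_v\varphi_j^v=\lambda_j^v\varphi_j^v$, $\|\varphi_j^v\|_{L^2}=1$ and $\langle v,\varphi_j^v\rangle=\sqrt{2\pi}>0$ (it is known that $|\langle v,\varphi\rangle|^2=2\pi\|\varphi\|_{L^2}^2$ for any eigenvector $\varphi$ of $\mathbb{L}_v$). *)

theory Defs
  imports "HOL-Analysis.Analysis"
begin

text \<open>
  Elements of L^2(R;C) and of Sobolev spaces are handled through Borel measurable representatives
  of type \<^typ>\<open>real \<Rightarrow> complex\<close>; equality of classes is equality almost everywhere, and all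
  notions below depend on their arguments only up to null sets (or, when they choose a
  representative by \<^const>\<open>Eps\<close>, are themselves determined only up to null sets).
\<close>

definition L2 :: "(real \<Rightarrow> complex) set" where
  "L2 = {f. f \<in> borel_measurable lborel \<and> integrable lborel (\<lambda>x. (cmod (f x))\<^sup>2)}"

definition L2_norm :: "(real \<Rightarrow> complex) \<Rightarrow> real" where
  "L2_norm f = sqrt (LINT x|lborel. (cmod (f x))\<^sup>2)"

definition L2_inner :: "(real \<Rightarrow> complex) \<Rightarrow> (real \<Rightarrow> complex) \<Rightarrow> complex" where
  "L2_inner f g = (LINT x|lborel. f x * cnj (g x))"

text \<open>
  The Fourier transform on L^2: the L^2-limit of the transforms of the truncations of f, for
  which the defining integral converges absolutely.
\<close>

definition fourier :: "(real \<Rightarrow> complex) \<Rightarrow> real \<Rightarrow> complex" where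
  "fourier f = (SOME g. g \<in> L2 \<and>
     ((\<lambda>R. L2_norm (\<lambda>\<xi>. (LINT x:{-R..R}|lborel. f x * exp (- (\<i> * of_real (x * \<xi>)))) - g \<xi>))
        \<longlongrightarrow> 0) at_top)"

definition sobolev :: "real \<Rightarrow> (real \<Rightarrow> complex) set" where
  "sobolev \<sigma> = {f \<in> L2. integrable lborel (\<lambda>\<xi>. (1 + \<xi>\<^sup>2) powr \<sigma> * (cmod (fourier f \<xi>))\<^sup>2)}"

definition sobolev_norm :: "real \<Rightarrow> (real \<Rightarrow> complex) \<Rightarrow> real" where
  "sobolev_norm \<sigma> f = sqrt (LINT \<xi>|lborel. (1 + \<xi>\<^sup>2) powr \<sigma> * (cmod (fourier f \<xi>))\<^sup>2)"

text \<open>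
  The Fourier transform of f being an L^2 function, its (distributional) support lies in
  [0,\<infinity>) iff it vanishes almost everywhere on the negative half-line.
\<close>

definition sobolev_plus :: "real \<Rightarrow> (real \<Rightarrow> complex) set" where
  "sobolev_plus \<sigma> = {f \<in> sobolev \<sigma>. AE \<xi> in lborel. \<xi> < 0 \<longrightarrow> fourier f \<xi> = 0}"

definition vderiv :: "(real \<Rightarrow> complex) \<Rightarrow> real \<Rightarrow> complex" where
  "vderiv f = (\<lambda>x. vector_derivative f (at x))"

definition test_functions :: "(real \<Rightarrow> complex) set" where
  "test_functions = {\<psi>. (\<forall>n x. (vderiv ^^ n) \<psi> differentiable (at x)) \<and>
                        (\<exists>R. \<forall>x. R < \<bar>x\<bar> \<longrightarrow> \<psi> x = 0)}"

text \<open>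
  The distributional derivative of f, as an L^2 function; only meaningful where it is one.
\<close>

definition ddx :: "(real \<Rightarrow> complex) \<Rightarrow> real \<Rightarrow> complex" where
  "ddx f = (SOME g. g \<in> L2 \<and> (\<forall>\<psi>\<in>test_functions.
     (LINT x|lborel. g x * \<psi> x) = - (LINT x|lborel. f x * vderiv \<psi> x)))"

text \<open>
  For f in L^2 the truncated integrals converge absolutely and the limit exists for
  almost every x (for every x if f belongs to H^1).
\<close>

definition hilbert :: "(real \<Rightarrow> complex) \<Rightarrow> real \<Rightarrow> complex" where
  "hilbert f x = Lim (at_right 0)
     (\<lambda>\<epsilon>. 1 / of_real pi * (LINT y:{y. \<epsilon> < \<bar>x - y\<bar>}|lborel. f y / of_real (x - y)))"

definition szego :: "(real \<Rightarrow> complex) \<Rightarrow> real \<Rightarrow> complex" where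
  "szego f x = 1 / 2 * (f x + \<i> * hilbert f x)"

definition lax :: "(real \<Rightarrow> complex) \<Rightarrow> (real \<Rightarrow> complex) \<Rightarrow> real \<Rightarrow> complex" where
  "lax v h x = - \<i> * ddx h x - v x * szego (\<lambda>y. cnj (v y) * h y) x"

definition is_lax_eigenvector ::
    "(real \<Rightarrow> complex) \<Rightarrow> real \<Rightarrow> (real \<Rightarrow> complex) \<Rightarrow> bool" where
  "is_lax_eigenvector v l h \<longleftrightarrow> h \<in> sobolev_plus 1 \<and> \<not> (AE x in lborel. h x = 0) \<and>
     (AE x in lborel. lax v h x = of_real l * h x)"

text \<open>
  Only real eigenvalues are considered, as the Lax operator is self-adjoint.
\<close>

definition lax_eigenvalues :: "(real \<Rightarrow> complex) \<Rightarrow> real set" where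
  "lax_eigenvalues v = {l. \<exists>h. is_lax_eigenvector v l h}"

text \<open>
  The j-th eigenvalue in increasing order, with j counted from 1; meaningful for
  1 \<le> j \<le> card (lax_eigenvalues v), the set of eigenvalues being finite.
\<close>

definition lax_eigenvalue :: "(real \<Rightarrow> complex) \<Rightarrow> nat \<Rightarrow> real" where
  "lax_eigenvalue v j = sorted_list_of_set (lax_eigenvalues v) ! (j - 1)"

definition standard_eigenvector :: "(real \<Rightarrow> complex) \<Rightarrow> nat \<Rightarrow> real \<Rightarrow> complex" where
  "standard_eigenvector v j = (SOME \<phi>. is_lax_eigenvector v (lax_eigenvalue v j) \<phi> \<and>
     L2_norm \<phi> = 1 \<and> L2_inner v \<phi> = of_real (sqrt (2 * pi)))"

definition continuous_sobolev_plus ::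
    "real \<Rightarrow> real set \<Rightarrow> (real \<Rightarrow> real \<Rightarrow> complex) \<Rightarrow> bool" where
  "continuous_sobolev_plus \<sigma> I u \<longleftrightarrow> (\<forall>t\<in>I. u t \<in> sobolev_plus \<sigma>) \<and>
     (\<forall>t\<in>I. ((\<lambda>s. sobolev_norm \<sigma> (\<lambda>x. u s x - u t x)) \<longlongrightarrow> 0) (at t within I))"

text \<open>
  For u(t) in H^1 the term with two x-derivatives is only a distribution. The equation is imposed
  at every time t of the open set I in the sense of distributions in x, the time derivative being
  that of the pairing of u with a fixed test function.
\<close>

definition cmdnls_solution :: "real set \<Rightarrow> (real \<Rightarrow> real \<Rightarrow> complex) \<Rightarrow> bool" where
  "cmdnls_solution I u \<longleftrightarrow> (\<forall>t\<in>I. \<forall>\<psi>\<in>test_functions. \<exists>d.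
     ((\<lambda>s. LINT x|lborel. u s x * \<psi> x) has_vector_derivative d) (at t) \<and>
     \<i> * d + (LINT x|lborel. u t x * vderiv (vderiv \<psi>) x)
       + (LINT x|lborel. u t x *
            (let g = ddx (\<lambda>y. of_real ((cmod (u t y))\<^sup>2)) in hilbert g x - \<i> * g x) * \<psi> x) = 0)"

text \<open>
  Differentiability at t of an L^2-valued curve, in the L^2 norm.
\<close>

definition has_L2_derivative ::
    "(real \<Rightarrow> real \<Rightarrow> complex) \<Rightarrow> (real \<Rightarrow> complex) \<Rightarrow> real \<Rightarrow> bool" where
  "has_L2_derivative f f' t \<longleftrightarrow> f' \<in> L2 \<and> (\<forall>\<^sub>F s in nhds t. f s \<in> L2) \<and>
     ((\<lambda>s. L2_norm (\<lambda>x. (f s x - f t x) / of_real (s - t) - f' x)) \<longlongrightarrow> 0) (at t)"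

end

theory Submission
  imports Defs "HOL-Real_Asymp.Real_Asymp" "HOL-Computational_Algebra.Polynomial"
begin

text \<open>
  Let B_v g = i g'' + 2 v (Pi (cnj v g))'. For nonreal z, the vector g = (L_u - z)^(-1) u satisfies
  g' = B_u g in time: against a test vector (L_u - cnj z) w, the increment of g becomes an increment of u
  paired with functions built from g and w, and the equation for u turns the limit into an algebraic
  identity between E(psi) = d/dt <u, psi>, L_u and B_u. Since B_u is antisymmetric, the norm of g is
  conserved. For z = l + i e with real l, the vectors a_e = - i e g satisfy
  |a_e - a_d|^2 <= |a_e|^2 - |a_d|^2 for d <= e, where the right-hand side does not depend on time; so they
  converge uniformly in time, as e tends to 0, to the projection a of u to the kernel of L_u - l, and
  a' = B_u a with |a| conserved. As |<u, phi>|^2 = 2 pi |phi|^2 for every eigenvector phi, the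
  number l is an eigenvalue iff a is nonzero, hence the eigenvalues are the same at all times, and
  the standard eigenvector is a / sqrt (2 pi).
\<close>

text \<open>The standard eigenvectors are picked separately at each time, so nothing is known of
  their dependence on time, whereas a_e is determined by \<open>u(t)\<close> alone. The function -i
  e / (x - l - i e) is 1 at x = l and tends to 0 at every other real x, whence a projection in the
  limit. Two obstacles shape the proof. The test functions for the increment of g move with time, so
  the equation for u is needed uniformly in the test function; mean value bounds replace derivatives
  at a point. And B_u takes two derivatives while u has only one: the resolvent equation and the
  eigenvalue equation express one derivative of g and of a through undifferentiated terms, which
  yields the second derivative and its continuity in time; where this is too weak, antisymmetry puts
  B_u on a smooth vector. On the concrete side \<open>szego\<close> is a pointwise principal value
  and \<open>fourier\<close> and \<open>ddx\<close> are choices. Plancherel's theorem, almost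
  everywhere convergence of the truncated Hilbert integrals and density of test functions identify
  all three with operators on classes.\<close>

lemma borel_measurable_cnj [measurable]:
  assumes "f \<in> borel_measurable M" shows "(\<lambda>x. cnj (f x)) \<in> borel_measurable M"
  using assms by (rule borel_measurable_continuous_on[OF continuous_on_cnj[OF continuous_on_id]])

lemma L2_D: "f \<in> L2 \<Longrightarrow> f \<in> borel_measurable lborel" "f \<in> L2 \<Longrightarrow> integrable lborel (\<lambda>x. (cmod (f x))\<^sup>2)"
  by (auto simp: L2_def)

lemma L2_meas [measurable_dest]: "f \<in> L2 \<Longrightarrow> f \<in> borel_measurable borel"
  by (auto simp: L2_def)

lemma L2_zero [simp]: "(\<lambda>x. 0) \<in> L2"
  by (auto simp: L2_def)

lemma L2_bound:
  assumes "f \<in> borel_measurable borel" "g \<in> L2" "AE x in lborel. cmod (f x) \<le> C * cmod (g x)"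
  shows "f \<in> L2"
proof -
  have "integrable lborel (\<lambda>x. (cmod (f x))\<^sup>2)"
  proof (rule Bochner_Integration.integrable_bound)
    show "integrable lborel (\<lambda>x. C\<^sup>2 * (cmod (g x))\<^sup>2)" using L2_D[OF assms(2)] by simp
    show "AE x in lborel. norm ((cmod (f x))\<^sup>2) \<le> norm (C\<^sup>2 * (cmod (g x))\<^sup>2)"
      using assms(3)
    proof eventually_elim
      case (elim x)
      have "(cmod (f x))\<^sup>2 \<le> (C * cmod (g x))\<^sup>2" using elim by (intro power_mono) auto
      then show ?case by (simp add: power_mult_distrib)
    qed
  qed (use assms(1) in measurable)
  then show ?thesis using assms(1) by (auto simp: L2_def)
qed

lemma L2_add:
  assumes "f \<in> L2" "g \<in> L2" shows "(\<lambda>x. f x + g x) \<in> L2"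
proof -
  note [measurable] = L2_meas[OF assms(1)] L2_meas[OF assms(2)]
  have "integrable lborel (\<lambda>x. (cmod (f x + g x))\<^sup>2)"
  proof (rule Bochner_Integration.integrable_bound)
    show "integrable lborel (\<lambda>x. 2 * (cmod (f x))\<^sup>2 + 2 * (cmod (g x))\<^sup>2)"
      using L2_D[OF assms(1)] L2_D[OF assms(2)] by auto
    have "(cmod (f x + g x))\<^sup>2 \<le> 2 * (cmod (f x))\<^sup>2 + 2 * (cmod (g x))\<^sup>2" for x
    proof -
      have "(cmod (f x + g x))\<^sup>2 \<le> (cmod (f x) + cmod (g x))\<^sup>2"
        by (intro power_mono norm_triangle_ineq) auto
      also have "\<dots> \<le> 2 * (cmod (f x))\<^sup>2 + 2 * (cmod (g x))\<^sup>2"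
        using sum_squares_bound[of "cmod (f x)" "cmod (g x)"] by (simp add: power2_sum)
      finally show ?thesis .
    qed
    then show "AE x in lborel. norm ((cmod (f x + g x))\<^sup>2) \<le> norm (2 * (cmod (f x))\<^sup>2 + 2 * (cmod (g x))\<^sup>2)"
      by auto
  qed measurable
  then show ?thesis by (auto simp: L2_def)
qed

lemma L2_mult:
  assumes "m \<in> borel_measurable borel" "g \<in> L2" "AE x in lborel. cmod (m x) \<le> C"
  shows "(\<lambda>x. m x * g x) \<in> L2"
  using assms by (intro L2_bound[OF _ assms(2), of _ C]) (auto simp: norm_mult elim!: eventually_mono intro: mult_right_mono)

lemma L2_cmult: "g \<in> L2 \<Longrightarrow> (\<lambda>x. c * g x) \<in> L2"
  by (rule L2_mult[of _ _ "cmod c"]) auto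

lemma L2_uminus: "g \<in> L2 \<Longrightarrow> (\<lambda>x. - g x) \<in> L2"
  using L2_cmult[of g "-1"] by simp

lemma L2_diff: "f \<in> L2 \<Longrightarrow> g \<in> L2 \<Longrightarrow> (\<lambda>x. f x - g x) \<in> L2"
  using L2_add[OF _ L2_uminus] by simp

lemma L2_cnj: "g \<in> L2 \<Longrightarrow> (\<lambda>x. cnj (g x)) \<in> L2"
  by (rule L2_bound[of _ g 1]) (auto intro!: borel_measurable_cnj L2_meas)

lemma L2_cong: "f \<in> L2 \<Longrightarrow> g \<in> borel_measurable borel \<Longrightarrow> AE x in lborel. g x = f x \<Longrightarrow> g \<in> L2"
  by (rule L2_bound[of g f 1]) (auto elim!: eventually_mono)

lemma L2_integrable_mult:
  assumes "f \<in> L2" "g \<in> L2" shows "integrable lborel (\<lambda>x. f x * g x)"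
proof (rule Bochner_Integration.integrable_bound)
  note [measurable] = L2_meas[OF assms(1)] L2_meas[OF assms(2)]
  show "integrable lborel (\<lambda>x. (cmod (f x))\<^sup>2 + (cmod (g x))\<^sup>2)"
    using L2_D[OF assms(1)] L2_D[OF assms(2)] by auto
  have "cmod (f x * g x) \<le> (cmod (f x))\<^sup>2 + (cmod (g x))\<^sup>2" for x
    using sum_squares_bound[of "cmod (f x)" "cmod (g x)"]
      mult_nonneg_nonneg[OF norm_ge_zero[of "f x"] norm_ge_zero[of "g x"]] 
    unfolding norm_mult by linarith
  then show "AE x in lborel. norm (f x * g x) \<le> norm ((cmod (f x))\<^sup>2 + (cmod (g x))\<^sup>2)" by auto
qed (use assms in measurable)

lemma L2_integrable_cnj: "f \<in> L2 \<Longrightarrow> g \<in> L2 \<Longrightarrow> integrable lborel (\<lambda>x. f x * cnj (g x))"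
  by (rule L2_integrable_mult[OF _ L2_cnj])

text \<open>The chosen property involves \<open>f\<close> only through its class, so functions that
  agree almost everywhere receive literally the same representative. This turns equality of classes
  into equality in the type \<open>l2\<close>.\<close>

definition L2_rep :: "(real \<Rightarrow> complex) \<Rightarrow> real \<Rightarrow> complex" where
  "L2_rep f = (SOME g. g \<in> L2 \<and> (AE x in lborel. g x = f x))"

lemma L2_rep: assumes "f \<in> L2" shows "L2_rep f \<in> L2" "AE x in lborel. L2_rep f x = f x"
proof -
  have "\<exists>g. g \<in> L2 \<and> (AE x in lborel. g x = f x)" using assms by auto
  from someI_ex[OF this] show "L2_rep f \<in> L2" "AE x in lborel. L2_rep f x = f x"
    by (auto simp: L2_rep_def)
qed

lemma L2_rep_cong: assumes "AE x in lborel. f x = g x" shows "L2_rep f = L2_rep g"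
proof -
  have "(AE x in lborel. h x = f x) \<longleftrightarrow> (AE x in lborel. h x = g x)" for h
    using assms by (auto elim: eventually_elim2)
  then show ?thesis by (simp add: L2_rep_def)
qed

text \<open>The Hilbert space of square-integrable functions modulo null sets, realised by one chosen
  representative per class.\<close>

typedef l2 = "L2_rep ` L2" morphisms rp Abs_l2
  by (rule exI[of _ "L2_rep (\<lambda>x. 0)"]) auto

definition cl :: "(real \<Rightarrow> complex) \<Rightarrow> l2" where
  "cl f = Abs_l2 (L2_rep (if f \<in> L2 then f else (\<lambda>x. 0)))"

lemma rp_L2 [simp, intro]: "rp f \<in> L2"
  using rp[of f] L2_rep by auto

lemma rp_measurable [measurable]: "rp f \<in> borel_measurable borel"
  by (rule L2_meas) simp

lemma rp_cl: assumes "f \<in> L2" shows "AE x in lborel. rp (cl f) x = f x"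
proof -
  have "rp (cl f) = L2_rep f" using assms by (auto simp: cl_def Abs_l2_inverse)
  then show ?thesis using L2_rep[OF assms] by simp
qed

lemma cl_cong: assumes "f \<in> L2" "g \<in> L2" "AE x in lborel. f x = g x" shows "cl f = cl g"
  using L2_rep_cong[OF assms(3)] assms by (simp add: cl_def)

lemma cl_rp [simp]: "cl (rp f) = f"
proof -
  obtain g where g: "g \<in> L2" "rp f = L2_rep g" using rp[of f] by auto
  have "L2_rep (rp f) = rp f" unfolding g(2)
    using L2_rep[OF g(1)] by (intro L2_rep_cong)
  then show ?thesis by (simp add: cl_def rp_inverse)
qed

lemma l2_eqI: "AE x in lborel. rp f x = rp g x \<Longrightarrow> f = g"
  using cl_cong[of "rp f" "rp g"] by simp

lemma cl_eq_iff: "f \<in> L2 \<Longrightarrow> g \<in> L2 \<Longrightarrow> cl f = cl g \<longleftrightarrow> (AE x in lborel. f x = g x)"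
  using rp_cl[of f] rp_cl[of g] by (auto intro: cl_cong)

definition mop :: "(real \<Rightarrow> complex) \<Rightarrow> l2 \<Rightarrow> l2" where
  "mop m f = cl (\<lambda>x. m x * rp f x)"

definition cip :: "l2 \<Rightarrow> l2 \<Rightarrow> complex" where
  "cip f g = L2_inner (rp f) (rp g)"

text \<open>The type class holds the real structure only, with the real part of \<open>cip\<close>
  as inner product. The complex structure is carried by \<open>cip\<close> itself and by the scalar
  multiplication \<open>cs\<close>.\<close>

instantiation l2 :: real_inner
begin

definition zero_l2 where "0 = cl (\<lambda>x. 0)"
definition plus_l2 where "f + g = cl (\<lambda>x. rp f x + rp g x)"
definition minus_l2 where "f - g = cl (\<lambda>x. rp f x - rp g x)"
definition uminus_l2 where "- f = cl (\<lambda>x. - rp f x)"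
definition scaleR_l2 where "r *\<^sub>R f = cl (\<lambda>x. complex_of_real r * rp f x)"
definition inner_l2 where "inner f g = Re (cip f g)"
definition norm_l2 where "norm (f::l2) = sqrt (inner f f)"
definition sgn_l2 where "sgn (f::l2) = scaleR (inverse (norm f)) f"
definition dist_l2 where "dist f g = norm (f - g :: l2)"
definition uniformity_l2 :: "(l2 \<times> l2) filter" where
  "uniformity_l2 = (INF e\<in>{0<..}. principal {(x, y). dist x y < e})"
definition open_l2 :: "l2 set \<Rightarrow> bool" where
  "open_l2 U \<longleftrightarrow> (\<forall>x\<in>U. \<forall>\<^sub>F (x', y) in uniformity. x' = x \<longrightarrow> y \<in> U)"

lemma rp_zero: "AE x in lborel. rp 0 x = 0"
  unfolding zero_l2_def by (rule rp_cl) simp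
lemma rp_add: "AE x in lborel. rp (f + g) x = rp f x + rp g x"
  unfolding plus_l2_def by (rule rp_cl) (simp add: L2_add)
lemma rp_diff: "AE x in lborel. rp (f - g) x = rp f x - rp g x"
  unfolding minus_l2_def by (rule rp_cl) (simp add: L2_diff)
lemma rp_uminus: "AE x in lborel. rp (- f) x = - rp f x"
  unfolding uminus_l2_def by (rule rp_cl) (simp add: L2_uminus)
lemma rp_scaleR: "AE x in lborel. rp (r *\<^sub>R f) x = complex_of_real r * rp f x"
  unfolding scaleR_l2_def by (rule rp_cl) (simp add: L2_cmult)

lemma integrable_rp [simp]: "integrable lborel (\<lambda>x. rp f x * cnj (rp g x))"
  by (rule L2_integrable_cnj) auto

lemma cip_add_left: "cip (f + g) h = cip f h + cip g h"
proof -
  have "cip (f + g) h = (LINT x|lborel. rp f x * cnj (rp h x) + rp g x * cnj (rp h x))"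
    unfolding cip_def L2_inner_def using rp_add[of f g]
    by (intro integral_cong_AE) (auto simp: algebra_simps)
  then show ?thesis by (simp add: cip_def L2_inner_def)
qed

lemma cip_commute: "cip g f = cnj (cip f g)"
  unfolding cip_def L2_inner_def Bochner_Integration.integral_cnj[symmetric]
  by (simp add: mult.commute)

lemma cip_self: "cip f f = of_real (LINT x|lborel. (cmod (rp f x))\<^sup>2)"
  unfolding cip_def L2_inner_def by (simp add: complex_norm_square[symmetric] flip: integral_complex_of_real)

instance
proof
  fix a b c :: l2 and r s :: real
  show "dist a b = norm (a - b)" by (simp add: dist_l2_def)
  show "a + b + c = a + (b + c)"
    apply (rule l2_eqI) using rp_add[of "a+b" c] rp_add[of a b] rp_add[of a "b+c"] rp_add[of b c]
    by eventually_elim simp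
  show "a + b = b + a"
    apply (rule l2_eqI) using rp_add[of a b] rp_add[of b a] by eventually_elim simp
  show "0 + a = a"
    apply (rule l2_eqI) using rp_add[of 0 a] rp_zero by eventually_elim simp
  show "- a + a = 0"
    apply (rule l2_eqI) using rp_add[of "-a" a] rp_zero rp_uminus[of a] by eventually_elim simp
  show "a - b = a + - b"
    apply (rule l2_eqI) using rp_add[of a "-b"] rp_diff[of a b] rp_uminus[of b] by eventually_elim simp
  show "r *\<^sub>R (a + b) = r *\<^sub>R a + r *\<^sub>R b"
    apply (rule l2_eqI) using rp_add[of a b] rp_scaleR[of r "a+b"] rp_scaleR[of r a] rp_scaleR[of r b]
      rp_add[of "r *\<^sub>R a" "r *\<^sub>R b"] by eventually_elim (simp add: algebra_simps)
  show "(r + s) *\<^sub>R a = r *\<^sub>R a + s *\<^sub>R a"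
    apply (rule l2_eqI) using rp_scaleR[of "r+s" a] rp_scaleR[of r a] rp_scaleR[of s a]
      rp_add[of "r *\<^sub>R a" "s *\<^sub>R a"] by eventually_elim (simp add: algebra_simps)
  show "r *\<^sub>R s *\<^sub>R a = (r * s) *\<^sub>R a"
    apply (rule l2_eqI) using rp_scaleR[of "r * s" a] rp_scaleR[of r "s *\<^sub>R a"] rp_scaleR[of s a]
    by eventually_elim (simp add: algebra_simps)
  show "1 *\<^sub>R a = a"
    apply (rule l2_eqI) using rp_scaleR[of 1 a] by eventually_elim simp
  show "sgn a = scaleR (inverse (norm a)) a" by (simp add: sgn_l2_def)
  show "inner a b = inner b a" by (simp add: inner_l2_def cip_commute[of a b])
  show "inner (a + b) c = inner a c + inner b c" by (simp add: inner_l2_def cip_add_left)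
  have "cip (r *\<^sub>R a) b = (LINT x|lborel. of_real r * (rp a x * cnj (rp b x)))"
    unfolding cip_def L2_inner_def using rp_scaleR[of r a]
    by (intro integral_cong_AE) (auto simp: algebra_simps)
  then show "inner (r *\<^sub>R a) b = r * inner a b"
    by (simp add: inner_l2_def cip_def L2_inner_def)
  show "0 \<le> inner a a" by (simp add: inner_l2_def cip_self)
  show "inner a a = 0 \<longleftrightarrow> a = 0"
  proof
    assume "inner a a = 0"
    then have "(LINT x|lborel. (cmod (rp a x))\<^sup>2) = 0" by (simp add: inner_l2_def cip_self)
    then have "AE x in lborel. (cmod (rp a x))\<^sup>2 = 0"
      using integral_nonneg_eq_0_iff_AE[OF L2_D(2)[OF rp_L2]] by auto
    then have "AE x in lborel. rp a x = rp 0 x" using rp_zero by eventually_elim auto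
    then show "a = 0" by (rule l2_eqI)
  next
    assume "a = 0"
    moreover have "(LINT x|lborel. (cmod (rp 0 x))\<^sup>2) = (LINT x::real|lborel. 0::real)"
      using rp_zero by (intro integral_cong_AE) auto
    ultimately show "inner a a = 0" by (simp add: inner_l2_def cip_self)
  qed
  show "norm a = sqrt (inner a a)" by (simp add: norm_l2_def)
qed (simp_all add: uniformity_l2_def open_l2_def)

end

lemma norm_l2: "norm f = L2_norm (rp f)"
  by (simp add: norm_l2_def inner_l2_def cip_self L2_norm_def)

lemma norm_l2_sq: "(norm f)\<^sup>2 = (LINT x|lborel. (cmod (rp f x))\<^sup>2)"
  by (simp add: norm_l2 L2_norm_def)

lemma L2_norm_cong: "f \<in> borel_measurable borel \<Longrightarrow> g \<in> borel_measurable borel \<Longrightarrow> AE x in lborel. f x = g x \<Longrightarrow> L2_norm f = L2_norm g"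
  unfolding L2_norm_def by (intro arg_cong[where f=sqrt] integral_cong_AE) (auto elim!: eventually_mono)

lemma L2_inner_cong:
  assumes "f \<in> borel_measurable borel" "g \<in> borel_measurable borel" "f' \<in> borel_measurable borel" "g' \<in> borel_measurable borel"
    "AE x in lborel. f x = f' x" "AE x in lborel. g x = g' x"
  shows "L2_inner f g = L2_inner f' g'"
  unfolding L2_inner_def using assms by (intro integral_cong_AE) auto

lemma norm_cl: "f \<in> L2 \<Longrightarrow> norm (cl f) = L2_norm f"
  unfolding norm_l2 by (intro L2_norm_cong rp_cl) (auto intro: L2_meas)

lemma cip_cl: "f \<in> L2 \<Longrightarrow> g \<in> L2 \<Longrightarrow> cip (cl f) (cl g) = L2_inner f g"
  unfolding cip_def by (intro L2_inner_cong rp_cl) (auto intro: L2_meas)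

lemma cl_add: assumes "f \<in> L2" "g \<in> L2" shows "cl (\<lambda>x. f x + g x) = cl f + cl g"
  unfolding plus_l2_def using rp_cl[OF assms(1)] rp_cl[OF assms(2)]
  by (intro cl_cong L2_add assms) auto

lemma cl_diff: assumes "f \<in> L2" "g \<in> L2" shows "cl (\<lambda>x. f x - g x) = cl f - cl g"
  unfolding minus_l2_def using rp_cl[OF assms(1)] rp_cl[OF assms(2)]
  by (intro cl_cong L2_diff assms) auto

section \<open>Multiplication by essentially bounded functions, complex scalars, conjugation\<close>

definition bmult :: "(real \<Rightarrow> complex) \<Rightarrow> bool" where
  "bmult m \<longleftrightarrow> m \<in> borel_measurable borel \<and> (\<exists>C. AE x in lborel. cmod (m x) \<le> C)"

lemma bmultI: "m \<in> borel_measurable borel \<Longrightarrow> (\<And>x. cmod (m x) \<le> C) \<Longrightarrow> bmult m"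
  by (auto simp: bmult_def)

lemma bmult_const [simp]: "bmult (\<lambda>x. c)" by (rule bmultI[of _ "cmod c"]) auto

lemma bmult_times: assumes "bmult m" "bmult n" shows "bmult (\<lambda>x. m x * n x)"
proof -
  obtain C D where C: "AE x in lborel. cmod (m x) \<le> C" "AE x in lborel. cmod (n x) \<le> D"
    using assms by (auto simp: bmult_def)
  have "AE x in lborel. cmod (m x * n x) \<le> \<bar>C\<bar> * \<bar>D\<bar>"
    using C by eventually_elim (auto simp: norm_mult intro!: mult_mono)
  then show ?thesis using assms by (auto simp: bmult_def)
qed

lemma bmult_cnj: "bmult m \<Longrightarrow> bmult (\<lambda>x. cnj (m x))"
  by (auto simp: bmult_def)

lemma bmult_L2: "bmult m \<Longrightarrow> f \<in> L2 \<Longrightarrow> (\<lambda>x. m x * f x) \<in> L2"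
  by (auto simp: bmult_def intro: L2_mult)

lemma rp_mop: "bmult m \<Longrightarrow> AE x in lborel. rp (mop m f) x = m x * rp f x"
  unfolding mop_def by (intro rp_cl bmult_L2) auto

lemma mop_cl: assumes "bmult m" "f \<in> L2" shows "mop m (cl f) = cl (\<lambda>x. m x * f x)"
  unfolding mop_def using rp_cl[OF assms(2)] assms by (intro cl_cong bmult_L2) auto

lemma mop_add: assumes "bmult m" shows "mop m (f + g) = mop m f + mop m g"
  apply (rule l2_eqI)
  using rp_mop[OF assms, of "f+g"] rp_mop[OF assms, of f] rp_mop[OF assms, of g] rp_add[of f g] rp_add[of "mop m f" "mop m g"]
  by eventually_elim (simp add: algebra_simps)

lemma mop_mop: assumes "bmult m" "bmult n" shows "mop m (mop n f) = mop (\<lambda>x. m x * n x) f"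
  apply (rule l2_eqI)
  using rp_mop[OF assms(1), of "mop n f"] rp_mop[OF assms(2), of f] rp_mop[OF bmult_times[OF assms], of f]
  by eventually_elim (simp add: algebra_simps)

lemma mop_commute: "bmult m \<Longrightarrow> bmult n \<Longrightarrow> mop m (mop n f) = mop n (mop m f)"
  by (simp add: mop_mop mult.commute)

lemma mop_cong: "bmult m \<Longrightarrow> bmult n \<Longrightarrow> AE x in lborel. m x = n x \<Longrightarrow> mop m f = mop n f"
  unfolding mop_def by (intro cl_cong bmult_L2) auto

lemma mop_one [simp]: "mop (\<lambda>x. 1) f = f"
  by (simp add: mop_def)

lemma scaleR_mop: "r *\<^sub>R f = mop (\<lambda>x. of_real r) f"
  by (simp add: scaleR_l2_def mop_def)

lemma mop_scaleR: "bmult m \<Longrightarrow> mop m (r *\<^sub>R f) = r *\<^sub>R mop m f"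
  unfolding scaleR_mop by (rule mop_commute) auto

lemma mop_add_left: assumes "bmult m" "bmult n" "bmult (\<lambda>x. m x + n x)"
  shows "mop (\<lambda>x. m x + n x) f = mop m f + mop n f"
  apply (rule l2_eqI)
  using rp_mop[OF assms(1), of f] rp_mop[OF assms(2), of f] rp_mop[OF assms(3), of f] rp_add[of "mop m f" "mop n f"]
  by eventually_elim (simp add: algebra_simps)

lemma norm_le_rp:
  assumes "0 \<le> C" "AE x in lborel. cmod (rp f x) \<le> C * cmod (rp g x)"
  shows "norm f \<le> C * norm g"
proof (rule power2_le_imp_le)
  have "(norm f)\<^sup>2 \<le> (LINT x|lborel. C\<^sup>2 * (cmod (rp g x))\<^sup>2)"
    unfolding norm_l2_sq
  proof (rule integral_mono_AE)
    show "AE x in lborel. (cmod (rp f x))\<^sup>2 \<le> C\<^sup>2 * (cmod (rp g x))\<^sup>2"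
      using assms(2) by eventually_elim (metis norm_ge_zero power_mono power_mult_distrib)
  qed (use L2_D[OF rp_L2] in auto)
  then show "(norm f)\<^sup>2 \<le> (C * norm g)\<^sup>2" by (simp add: norm_l2_sq power_mult_distrib)
qed (use assms in auto)

lemma norm_mop_le:
  assumes "bmult m" "0 \<le> C" "AE x in lborel. cmod (m x) \<le> C"
  shows "norm (mop m f) \<le> C * norm f"
proof (rule norm_le_rp[OF assms(2)])
  show "AE x in lborel. cmod (rp (mop m f) x) \<le> C * cmod (rp f x)"
    using rp_mop[OF assms(1), of f] assms(3)
    by eventually_elim (simp add: norm_mult mult_right_mono)
qed

lemma bounded_linear_mop: assumes "bmult m" shows "bounded_linear (mop m)"
proof -
  obtain C where C: "AE x in lborel. cmod (m x) \<le> C" using assms by (auto simp: bmult_def)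
  have "AE x in lborel. cmod (m x) \<le> \<bar>C\<bar>" using C by eventually_elim auto
  then show ?thesis
    using norm_mop_le[OF assms, of "\<bar>C\<bar>"]
    by (intro bounded_linear_intro[of _ "\<bar>C\<bar>"]) (auto simp: mop_add mop_scaleR assms mult.commute)
qed

lemma cip_mop_left: assumes "bmult m" shows "cip (mop m f) g = cip f (mop (\<lambda>x. cnj (m x)) g)"
  unfolding cip_def L2_inner_def
  apply (rule integral_cong_AE, measurable)
  using rp_mop[OF assms, of f] rp_mop[OF bmult_cnj[OF assms], of g]
  by eventually_elim (simp add: algebra_simps)

definition cs :: "complex \<Rightarrow> l2 \<Rightarrow> l2" where "cs c = mop (\<lambda>x. c)"

lemma rp_cs: "AE x in lborel. rp (cs c f) x = c * rp f x"
  unfolding cs_def by (rule rp_mop) simp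
lemma cs_add: "cs c (f + g) = cs c f + cs c g"
  by (simp add: cs_def mop_add)
lemma cs_add_left: "cs (c + d) f = cs c f + cs d f"
  by (simp add: cs_def mop_add_left)
lemma cs_cs [simp]: "cs c (cs d f) = cs (c * d) f"
  by (simp add: cs_def mop_mop)
lemma cs_one [simp]: "cs 1 f = f" by (simp add: cs_def)
lemma cs_of_real: "cs (of_real r) f = r *\<^sub>R f" by (simp add: cs_def scaleR_mop)
lemma cs_zero [simp]: "cs 0 f = 0" using cs_of_real[of 0 f] by simp
lemma bounded_linear_cs: "bounded_linear (cs c)" unfolding cs_def by (rule bounded_linear_mop) simp
lemma cs_zero_right [simp]: "cs c 0 = 0" using bounded_linear_cs[THEN bounded_linear.linear] linear_0 by blast
lemma cs_minus [simp]: "cs c (- f) = - cs c f" using bounded_linear_cs[THEN bounded_linear.linear] linear_neg by blast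
lemma cs_diff: "cs c (f - g) = cs c f - cs c g" using bounded_linear_cs[THEN bounded_linear.linear] linear_diff by blast
lemma cs_minus_left [simp]: "cs (- c) f = - cs c f" 
  using cs_cs[of "-1" c f] cs_of_real[of "-1" "cs c f"] by simp
lemma mop_cs: "bmult m \<Longrightarrow> mop m (cs c f) = cs c (mop m f)" 
  unfolding cs_def by (rule mop_commute) auto

lemma cip_cs_left [simp]: "cip (cs c f) g = c * cip f g"
proof -
  have "cip (cs c f) g = (LINT x|lborel. c * (rp f x * cnj (rp g x)))"
    unfolding cip_def L2_inner_def using rp_cs[of c f]
    by (intro integral_cong_AE) (auto simp: algebra_simps)
  then show ?thesis by (simp add: cip_def L2_inner_def)
qed

lemma cip_cs_right [simp]: "cip f (cs c g) = cnj c * cip f g"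
  using cip_cs_left[of c g f] by (metis cip_commute complex_cnj_mult)
lemma cip_add_right: "cip h (f + g) = cip h f + cip h g"
  using cip_add_left[of f g h] by (metis cip_commute complex_cnj_add)
lemma cip_minus_left [simp]: "cip (- f) g = - cip f g"
  using cip_cs_left[of "-1" f g] by simp
lemma cip_minus_right [simp]: "cip f (- g) = - cip f g"
  using cip_cs_right[of f "-1" g] by simp
lemma cip_diff_left: "cip (f - g) h = cip f h - cip g h"
  using cip_add_left[of f "-g" h] by simp
lemma cip_diff_right: "cip h (f - g) = cip h f - cip h g"
  using cip_add_right[of h f "-g"] by simp
lemma cip_zero [simp]: "cip 0 f = 0" "cip f 0 = 0"
  using cip_cs_left[of 0 0 f] cip_cs_right[of f 0 0] by auto
lemma cip_scaleR_left [simp]: "cip (r *\<^sub>R f) g = of_real r * cip f g"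
  unfolding cs_of_real[symmetric] by (rule cip_cs_left)
lemma cip_scaleR_right [simp]: "cip f (r *\<^sub>R g) = of_real r * cip f g"
  unfolding cs_of_real[symmetric] by simp
lemma cip_self_norm: "cip f f = of_real ((norm f)\<^sup>2)"
  by (simp add: cip_self norm_l2_sq)
lemma norm_cs [simp]: "norm (cs c f) = cmod c * norm f"
proof (rule power2_eq_imp_eq)
  have "complex_of_real ((norm (cs c f))\<^sup>2) = of_real ((cmod c * norm f)\<^sup>2)"
    by (simp only: cip_self_norm[symmetric] cip_cs_left cip_cs_right power_mult_distrib of_real_mult)
      (simp add: complex_norm_square[symmetric] cip_self_norm mult.commute[of "cnj c"] power2_eq_square)
  then show "(norm (cs c f))\<^sup>2 = (cmod c * norm f)\<^sup>2" using of_real_eq_iff by blast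
qed auto

lemma cip_inner: "cip f g = Complex (inner f g) (inner f (cs \<i> g))"
  by (rule complex_eqI) (simp_all add: inner_l2_def)

lemma cmod_cip_le: "cmod (cip f g) \<le> norm f * norm g"
proof (cases "cip f g = 0")
  case False
  \<comment> \<open>Rotating \<open>f\<close> by this phase makes the pairing real and nonnegative,
    so that the real Cauchy-Schwarz inequality applies.\<close>
  define c where "c = cnj (cip f g) / of_real (cmod (cip f g))"
  have c: "cmod c = 1" using False by (simp add: c_def norm_divide)
  have "cip (cs c f) g = of_real (cmod (cip f g))" using False
    using complex_norm_square[of "cip f g"] by (simp add: c_def field_simps power2_eq_square)
  then have "cmod (cip f g) = inner (cs c f) g" by (simp add: inner_l2_def)
  also have "\<dots> \<le> norm (cs c f) * norm g" by (rule norm_cauchy_schwarz)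
  finally show ?thesis using c by simp
qed auto

lemma bounded_bilinear_cip: "bounded_bilinear cip"
  by (rule bounded_bilinear.intro)
    (auto simp: cip_add_left cip_add_right scaleR_conv_of_real intro!: exI[of _ 1] cmod_cip_le)

lemmas tendsto_cip = bounded_bilinear.tendsto[OF bounded_bilinear_cip]
lemmas tendsto_cs [tendsto_intros] = bounded_linear.tendsto[OF bounded_linear_cs]

lemma tendsto_mop: "bmult m \<Longrightarrow> (f \<longlongrightarrow> l) F \<Longrightarrow> ((\<lambda>x. mop m (f x)) \<longlongrightarrow> mop m l) F"
  by (rule bounded_linear.tendsto[OF bounded_linear_mop])

definition cj :: "l2 \<Rightarrow> l2" where "cj f = cl (\<lambda>x. cnj (rp f x))"

lemma rp_cj: "AE x in lborel. rp (cj f) x = cnj (rp f x)"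
  unfolding cj_def by (intro rp_cl L2_cnj) auto

lemma cj_cj [simp]: "cj (cj f) = f"
  apply (rule l2_eqI) using rp_cj[of f] rp_cj[of "cj f"] by eventually_elim simp
lemma cj_add: "cj (f + g) = cj f + cj g"
  apply (rule l2_eqI) using rp_cj[of f] rp_cj[of g] rp_cj[of "f+g"] rp_add[of f g] rp_add[of "cj f" "cj g"] by eventually_elim simp
lemma cj_cs: "cj (cs c f) = cs (cnj c) (cj f)"
  apply (rule l2_eqI) using rp_cj[of f] rp_cj[of "cs c f"] rp_cs[of c f] rp_cs[of "cnj c" "cj f"] by eventually_elim simp
lemma cj_minus: "cj (- f) = - cj f" using cj_cs[of "-1" f] by simp
lemma cj_diff: "cj (f - g) = cj f - cj g" using cj_add[of f "-g"] by (simp add: cj_minus)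
lemma cip_cj: "cip (cj f) (cj g) = cnj (cip f g)"
  unfolding cip_def L2_inner_def Bochner_Integration.integral_cnj[symmetric]
  apply (rule integral_cong_AE, measurable) using rp_cj[of f] rp_cj[of g] by eventually_elim simp
lemma norm_cj [simp]: "norm (cj f) = norm f"
  using cip_cj[of f f] by (simp add: cip_self_norm of_real_eq_iff flip: of_real_power)
lemma cj_mop: assumes "bmult m" shows "cj (mop m f) = mop (\<lambda>x. cnj (m x)) (cj f)"
  apply (rule l2_eqI) using rp_cj[of f] rp_cj[of "mop m f"] rp_mop[OF assms, of f] rp_mop[OF bmult_cnj[OF assms], of "cj f"]
  by eventually_elim simp
lemma cj_cl: assumes "f \<in> L2" shows "cj (cl f) = cl (\<lambda>x. cnj (f x))"
  unfolding cj_def using rp_cl[OF assms] by (intro cl_cong L2_cnj assms) auto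
lemma bounded_linear_cj: "bounded_linear cj"
  using cj_cs[of "of_real _"] by (intro bounded_linear_intro[of _ 1]) (auto simp: cj_add cs_of_real)

lemma cip_right_eqI: assumes "\<And>h. cip f h = cip g h" shows "f = g"
proof -
  have "cip (f - g) (f - g) = 0" by (subst cip_diff_left) (simp add: assms)
  then show ?thesis by (simp add: cip_self_norm)
qed

subsection \<open>Completeness\<close>

lemma norm_cl_nn: "f \<in> L2 \<Longrightarrow> ennreal ((norm (cl f))\<^sup>2) = (\<integral>\<^sup>+ x. ennreal ((cmod (f x))\<^sup>2) \<partial>lborel)"
  by (subst nn_integral_eq_integral) (auto simp: norm_cl L2_norm_def L2_D)

text \<open>Weighting the k-th squared increment by \<open>4 ^ k\<close> still leaves integrals of
  size at most \<open>(1/4) ^ k\<close>. The weighted sum is therefore finite almost everywhere, and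
  there the increments are dominated by a geometric series of ratio 1/2.\<close>

lemma l2_subseq_AE:
  fixes X :: "nat \<Rightarrow> l2"
  assumes fast: "\<And>k. norm (X (Suc k) - X k) \<le> (1/4) ^ k"
  shows "AE x in lborel. convergent (\<lambda>k. rp (X k) x)"
proof -
  let ?d = "\<lambda>k x. (cmod (rp (X (Suc k)) x - rp (X k) x))\<^sup>2"
  have 1: "(\<integral>\<^sup>+ x. ennreal (4 ^ k * ?d k x) \<partial>lborel) \<le> ennreal ((1/4) ^ k)" for k
  proof -
    have L: "(\<lambda>x. rp (X (Suc k)) x - rp (X k) x) \<in> L2" by (intro L2_diff) auto
    have "(\<integral>\<^sup>+ x. ennreal (4 ^ k * ?d k x) \<partial>lborel) = ennreal (4 ^ k) * (\<integral>\<^sup>+ x. ennreal (?d k x) \<partial>lborel)"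
      by (subst nn_integral_cmult[symmetric]) (auto simp: ennreal_mult')
    also have "(\<integral>\<^sup>+ x. ennreal (?d k x) \<partial>lborel) = ennreal ((norm (X (Suc k) - X k))\<^sup>2)"
      by (subst norm_cl_nn[OF L, symmetric]) (simp add: minus_l2_def)
    also have "\<dots> \<le> ennreal (((1/4) ^ k)\<^sup>2)" by (intro ennreal_leI power_mono fast) auto
    finally have "(\<integral>\<^sup>+ x. ennreal (4 ^ k * ?d k x) \<partial>lborel) \<le> ennreal (4 ^ k) * ennreal (((1/4) ^ k)\<^sup>2)"
      by (simp add: mult_left_mono)
    also have "\<dots> = ennreal ((1/4) ^ k)"
      by (simp add: power2_eq_square power_one_over field_simps flip: ennreal_mult')
    finally show ?thesis .
  qed
  have "(\<integral>\<^sup>+ x. (\<Sum>k. ennreal (4 ^ k * ?d k x)) \<partial>lborel) = (\<Sum>k. \<integral>\<^sup>+ x. ennreal (4 ^ k * ?d k x) \<partial>lborel)"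
    by (rule nn_integral_suminf) measurable
  also have "\<dots> \<le> (\<Sum>k. ennreal ((1/4) ^ k))" using 1 by (intro suminf_le) auto
  also have "\<dots> < \<infinity>" by (subst suminf_ennreal2) (auto simp: summable_geometric)
  finally have "AE x in lborel. (\<Sum>k. ennreal (4 ^ k * ?d k x)) \<noteq> \<infinity>"
    by (intro nn_integral_noteq_infinite) auto
  then show ?thesis
  proof eventually_elim
    case (elim x)
    have fin: "\<exists>S\<ge>0. t = ennreal S" if "t \<noteq> \<infinity>" for t
      using that by (cases t) auto
    obtain S where S0: "0 \<le> S" and S: "(\<Sum>k. ennreal (4 ^ k * ?d k x)) = ennreal S"
      using fin[OF elim] by blast
    have le: "4 ^ k * ?d k x \<le> S" for k
    proof -
      have single: "(\<Sum>j\<in>{k}. f j) \<le> suminf f" for f :: "nat \<Rightarrow> ennreal"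
        by (rule sum_le_suminf) auto
      have "ennreal (4 ^ k * ?d k x) \<le> ennreal S"
        using single[of "\<lambda>k. ennreal (4 ^ k * ?d k x)"] unfolding S by (simp only: sum.insert sum.empty finite.emptyI empty_iff not_False_eq_True add_0_right)
      then show ?thesis by (rule ennreal_le_iff[OF S0, THEN iffD1])
    qed
    have "cmod (rp (X (Suc k)) x - rp (X k) x) \<le> sqrt S * (1/2)^k" for k
    proof (rule power2_le_imp_le)
      have q: "((1/2::real)^k)\<^sup>2 = (1/4)^k" by (simp add: power2_eq_square flip: power_mult_distrib)
      have "?d k x \<le> S / 4 ^ k" using le[of k] by (simp add: field_simps)
      also have "\<dots> = (sqrt S * (1/2)^k)\<^sup>2" using S0
        by (simp add: power_mult_distrib[of "sqrt S"] q) (simp add: power_one_over)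
      finally show "?d k x \<le> (sqrt S * (1/2)^k)\<^sup>2" .
    qed (use S0 in auto)
    moreover have "summable (\<lambda>k. sqrt S * (1/2)^k)" by (rule summable_mult[OF summable_geometric]) simp
    ultimately have "summable (\<lambda>k. rp (X (Suc k)) x - rp (X k) x)"
      by (rule summable_comparison_test'[rotated])
    then have "convergent (\<lambda>n. \<Sum>k<n. rp (X (Suc k)) x - rp (X k) x)" by (simp add: summable_iff_convergent)
    moreover have "(\<lambda>n. \<Sum>k<n. rp (X (Suc k)) x - rp (X k) x) = (\<lambda>n. rp (X n) x - rp (X 0) x)"
      by (rule ext, rule sum_lessThan_telescope)
    ultimately have "convergent (\<lambda>n. rp (X n) x - rp (X 0) x)" by simp
    then have "convergent (\<lambda>n. (rp (X n) x - rp (X 0) x) + rp (X 0) x)" by (intro convergent_add convergent_const)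
    then show ?case by simp
  qed
qed

text \<open>Fatou's lemma bounds the distance from \<open>X n\<close> to the pointwise limit by the
  Cauchy modulus. Besides completeness, this serves to identify an abstract L^2 limit with a
  function that is known pointwise.\<close>

lemma l2_limit_AE:
  fixes X :: "nat \<Rightarrow> l2"
  assumes C: "Cauchy X" and h: "h \<in> borel_measurable borel" and lim: "AE x in lborel. (\<lambda>k. rp (X k) x) \<longlonglongrightarrow> h x"
  shows "h \<in> L2 \<and> X \<longlonglongrightarrow> cl h"
proof -
  have F: "\<exists>N. \<forall>n\<ge>N. (\<integral>\<^sup>+ x. ennreal ((cmod (h x - rp (X n) x))\<^sup>2) \<partial>lborel) \<le> ennreal (e\<^sup>2)" if e0: "e > 0" for e :: real
  proof -
    obtain N where N: "\<And>m n. m \<ge> N \<Longrightarrow> n \<ge> N \<Longrightarrow> norm (X m - X n) < e"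
      using CauchyD[OF C e0] by blast
    have "(\<integral>\<^sup>+ x. ennreal ((cmod (h x - rp (X n) x))\<^sup>2) \<partial>lborel) \<le> ennreal (e\<^sup>2)" if n: "n \<ge> N" for n
    proof -
      have "(\<integral>\<^sup>+ x. ennreal ((cmod (h x - rp (X n) x))\<^sup>2) \<partial>lborel) = (\<integral>\<^sup>+ x. liminf (\<lambda>m. ennreal ((cmod (rp (X m) x - rp (X n) x))\<^sup>2)) \<partial>lborel)"
      proof (rule nn_integral_cong_AE)
        show "AE x in lborel. ennreal ((cmod (h x - rp (X n) x))\<^sup>2) = liminf (\<lambda>m. ennreal ((cmod (rp (X m) x - rp (X n) x))\<^sup>2))"
          using lim
        proof eventually_elim
          case (elim x)
          have "(\<lambda>m. ennreal ((cmod (rp (X m) x - rp (X n) x))\<^sup>2)) \<longlonglongrightarrow> ennreal ((cmod (h x - rp (X n) x))\<^sup>2)"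
            by (intro tendsto_intros elim tendsto_ennrealI)
          from lim_imp_Liminf[OF _ this] show ?case by simp
        qed
      qed
      also have "\<dots> \<le> liminf (\<lambda>m. \<integral>\<^sup>+ x. ennreal ((cmod (rp (X m) x - rp (X n) x))\<^sup>2) \<partial>lborel)"
        by (rule nn_integral_liminf) auto
      also have "\<dots> \<le> liminf (\<lambda>m. ennreal (e\<^sup>2))"
      proof (rule Liminf_mono, rule eventually_sequentiallyI[of N])
        fix m assume "m \<ge> N"
        have L: "(\<lambda>x. rp (X m) x - rp (X n) x) \<in> L2" by (intro L2_diff) auto
        have "(\<integral>\<^sup>+ x. ennreal ((cmod (rp (X m) x - rp (X n) x))\<^sup>2) \<partial>lborel) = ennreal ((norm (X m - X n))\<^sup>2)"
          by (subst norm_cl_nn[OF L, symmetric]) (simp add: minus_l2_def)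
        also have "\<dots> \<le> ennreal (e\<^sup>2)" using N[OF \<open>m \<ge> N\<close> n] by (intro ennreal_leI power_mono) auto
        finally show "(\<integral>\<^sup>+ x. ennreal ((cmod (rp (X m) x - rp (X n) x))\<^sup>2) \<partial>lborel) \<le> ennreal (e\<^sup>2)" .
      qed
      finally show ?thesis by (simp add: Liminf_const)
    qed
    then show ?thesis by blast
  qed
  have diffL2: "(\<lambda>x. h x - rp (X n) x) \<in> L2" if le: "(\<integral>\<^sup>+ x. ennreal ((cmod (h x - rp (X n) x))\<^sup>2) \<partial>lborel) \<le> ennreal (e\<^sup>2)" for n e
  proof -
    have "integrable lborel (\<lambda>x. (cmod (h x - rp (X n) x))\<^sup>2)"
      using h order.strict_trans1[OF le ennreal_less_top] by (intro integrableI_bounded) auto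
    then show ?thesis using h by (auto simp: L2_def)
  qed
  obtain N where N: "(\<integral>\<^sup>+ x. ennreal ((cmod (h x - rp (X N) x))\<^sup>2) \<partial>lborel) \<le> ennreal (1\<^sup>2)"
    using F[of 1] by auto
  have hL2: "h \<in> L2" using L2_add[OF diffL2[OF N], of "rp (X N)"] by simp
  have "X \<longlonglongrightarrow> cl h"
  proof (rule LIMSEQ_I)
    fix e :: real assume "e > 0"
    obtain N where N: "\<And>n. n \<ge> N \<Longrightarrow> (\<integral>\<^sup>+ x. ennreal ((cmod (h x - rp (X n) x))\<^sup>2) \<partial>lborel) \<le> ennreal ((e/2)\<^sup>2)"
      using F[of "e/2"] \<open>e > 0\<close> by auto
    have "norm (X n - cl h) < e" if "n \<ge> N" for n
    proof -
      have "ennreal ((norm (cl h - X n))\<^sup>2) \<le> ennreal ((e/2)\<^sup>2)"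
        using N[OF that] norm_cl_nn[OF diffL2[OF N[OF that]]] cl_diff[OF hL2 rp_L2, of "X n"] by simp
      then have "(norm (cl h - X n))\<^sup>2 \<le> (e/2)\<^sup>2" by (subst (asm) ennreal_le_iff) auto
      then have "norm (cl h - X n) \<le> e/2" by (rule power2_le_imp_le) (use \<open>e > 0\<close> in simp)
      then show ?thesis using \<open>e > 0\<close> by (simp add: norm_minus_commute)
    qed
    then show "\<exists>N. \<forall>n\<ge>N. norm (X n - cl h) < e" by blast
  qed
  with hL2 show ?thesis by simp
qed

lemma Cauchy_fast_subseq:
  fixes X :: "nat \<Rightarrow> 'a :: real_normed_vector"
  assumes "Cauchy X"
  obtains r where "strict_mono r" "\<And>k. norm (X (r (Suc k)) - X (r k)) \<le> (1/4::real) ^ k"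
proof -
  have "\<exists>N. \<forall>m\<ge>N. \<forall>n\<ge>N. norm (X m - X n) < (1/4::real)^k" for k
    using CauchyD[OF assms, of "(1/4)^k"] by simp
  then obtain N where N: "\<And>k m n. m \<ge> N k \<Longrightarrow> n \<ge> N k \<Longrightarrow> norm (X m - X n) < (1/4::real)^k" by metis
  define r where "r = rec_nat (N 0) (\<lambda>k p. max (Suc p) (N (Suc k)))"
  have r: "r (Suc k) = max (Suc (r k)) (N (Suc k))" "r 0 = N 0" for k by (auto simp: r_def)
  have ge: "r k \<ge> N k" for k by (cases k) (auto simp: r)
  have sm: "strict_mono r" unfolding strict_mono_Suc_iff by (auto simp: r less_max_iff_disj)
  show ?thesis
  proof
    show "norm (X (r (Suc k)) - X (r k)) \<le> (1/4) ^ k" for k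
      using N[of k "r (Suc k)" "r k"] ge[of k] strict_monoD[OF sm, of k "Suc k"] by simp
  qed (fact sm)
qed

instance l2 :: banach
proof
  fix X :: "nat \<Rightarrow> l2" assume C: "Cauchy X"
  obtain r where r: "strict_mono r" "\<And>k. norm (X (r (Suc k)) - X (r k)) \<le> (1/4::real) ^ k"
    using Cauchy_fast_subseq[OF C] by blast
  define h where "h x = lim (\<lambda>k. rp (X (r k)) x)" for x
  have m: "h \<in> borel_measurable borel"
    unfolding h_def by (rule borel_measurable_lim_metric) simp
  have "AE x in lborel. (\<lambda>k. rp ((X \<circ> r) k) x) \<longlonglongrightarrow> h x"
    using l2_subseq_AE[of "X \<circ> r"] r(2) by (auto simp: h_def convergent_LIMSEQ_iff)
  then have "(X \<circ> r) \<longlonglongrightarrow> cl h"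
    using l2_limit_AE[OF Cauchy_subseq_Cauchy[OF C r(1)] m] by simp
  then have "X \<longlonglongrightarrow> cl h" using Cauchy_converges_subseq[OF C r(1)] by simp
  then show "convergent X" by (auto simp: convergent_def)
qed

lemma l2_tendsto_AE_subseq:
  assumes "X \<longlonglongrightarrow> (l::l2)"
  obtains r where "strict_mono r" "AE x in lborel. (\<lambda>k. rp (X (r k)) x) \<longlonglongrightarrow> rp l x"
proof -
  have C: "Cauchy X" using assms by (rule LIMSEQ_imp_Cauchy)
  obtain r where r: "strict_mono r" "\<And>k. norm (X (r (Suc k)) - X (r k)) \<le> (1/4::real) ^ k"
    using Cauchy_fast_subseq[OF C] by blast
  define h where "h x = lim (\<lambda>k. rp (X (r k)) x)" for x
  have m: "h \<in> borel_measurable borel"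
    unfolding h_def by (rule borel_measurable_lim_metric) simp
  have ae: "AE x in lborel. (\<lambda>k. rp ((X \<circ> r) k) x) \<longlonglongrightarrow> h x"
    using l2_subseq_AE[of "X \<circ> r"] r(2) by (auto simp: h_def convergent_LIMSEQ_iff)
  then have "h \<in> L2" "(X \<circ> r) \<longlonglongrightarrow> cl h"
    using l2_limit_AE[OF Cauchy_subseq_Cauchy[OF C r(1)] m] by auto
  moreover have "(X \<circ> r) \<longlonglongrightarrow> l" using assms r(1) by (rule LIMSEQ_subseq_LIMSEQ)
  ultimately have "AE x in lborel. rp l x = h x" using rp_cl LIMSEQ_unique by blast
  with ae have "AE x in lborel. (\<lambda>k. rp (X (r k)) x) \<longlonglongrightarrow> rp l x" by eventually_elim simp
  with r(1) show ?thesis by (rule that)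
qed


lemma l2_dominated_seq:
  fixes f :: "nat \<Rightarrow> real \<Rightarrow> complex"
  assumes m: "\<And>n. f n \<in> borel_measurable borel" "h \<in> borel_measurable borel" and g: "g \<in> L2"
    and le: "\<And>n. AE x in lborel. cmod (f n x) \<le> cmod (g x)"
    and lim: "AE x in lborel. (\<lambda>n. f n x) \<longlonglongrightarrow> h x"
  shows "h \<in> L2" "(\<lambda>n. cl (f n)) \<longlonglongrightarrow> cl h"
proof -
  have fL2: "f n \<in> L2" for n by (rule L2_bound[OF m(1) g, of _ 1]) (use le in auto)
  have ale: "AE x in lborel. \<forall>n. cmod (f n x) \<le> cmod (g x)" using le by (simp add: AE_all_countable)
  have hle: "AE x in lborel. cmod (h x) \<le> cmod (g x)"
    using ale lim by eventually_elim (rule LIMSEQ_le_const2[OF tendsto_norm], auto)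
  show hL2: "h \<in> L2" by (rule L2_bound[OF m(2) g, of 1]) (use hle in auto)
  have "(\<lambda>n. LINT x|lborel. (cmod (f n x - h x))\<^sup>2) \<longlonglongrightarrow> (LINT x::real|lborel. (0::real))"
  proof (rule integral_dominated_convergence[where w = "\<lambda>x. (2 * cmod (g x))\<^sup>2"])
    show "integrable lborel (\<lambda>x. (2 * cmod (g x))\<^sup>2)" using L2_D[OF g] by (simp add: power_mult_distrib)
    show "AE x in lborel. (\<lambda>n. (cmod (f n x - h x))\<^sup>2) \<longlonglongrightarrow> 0" using lim
      by eventually_elim (auto intro!: tendsto_eq_intros)
    show "AE x in lborel. norm ((cmod (f n x - h x))\<^sup>2) \<le> (2 * cmod (g x))\<^sup>2" for n
      using ale hle
    proof eventually_elim
      case (elim x)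
      have "cmod (f n x - h x) \<le> 2 * cmod (g x)" using elim norm_triangle_ineq4[of "f n x" "h x"] 
        by (smt (verit))
      then have "(cmod (f n x - h x))\<^sup>2 \<le> (2 * cmod (g x))\<^sup>2" by (rule power_mono) simp
      then show ?case by simp
    qed
  qed (use m in simp_all)
  then have "(\<lambda>n. (norm (cl (f n) - cl h))\<^sup>2) \<longlonglongrightarrow> 0"
    by (simp add: cl_diff[OF fL2 hL2, symmetric] norm_cl L2_diff fL2 hL2 L2_norm_def)
  then have "(\<lambda>n. norm (cl (f n) - cl h)) \<longlonglongrightarrow> 0"
    using tendsto_real_sqrt[of "\<lambda>n. (norm (cl (f n) - cl h))\<^sup>2"] by force
  then show "(\<lambda>n. cl (f n)) \<longlonglongrightarrow> cl h" by (simp add: tendsto_norm_zero_iff LIM_zero_cancel)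
qed

text \<open>Step functions are the dense class on which Plancherel's theorem is checked by hand: the
  Poisson integral of an interval is a difference of two arctangents, so its boundedness and its
  limit are explicit.\<close>

inductive step :: "(real \<Rightarrow> complex) \<Rightarrow> bool" where
  step_interval: "step (indicator {a..b})"
| step_cmult: "step f \<Longrightarrow> step (\<lambda>x. c * f x)"
| step_add: "step f \<Longrightarrow> step g \<Longrightarrow> step (\<lambda>x. f x + g x)"

lemma step_diff: "step f \<Longrightarrow> step g \<Longrightarrow> step (\<lambda>x. f x - g x)"
  using step_add[OF _ step_cmult[of g "-1"], of f] by simp

lemma step_measurable: "step f \<Longrightarrow> f \<in> borel_measurable borel"
  by (induction rule: step.induct) auto

lemma integrable_indicator_Icc [simp]: "integrable lborel (indicator {a..b} :: real \<Rightarrow> complex)"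
proof -
  have "integrable lborel (\<lambda>x. complex_of_real (indicator {a..b} x))"
    by (intro integrable_of_real integrable_real_indicator) (auto simp: emeasure_lborel_Icc_eq)
  moreover have "(\<lambda>x. complex_of_real (indicator {a..b} x)) = indicator {a..b}"
    by (auto simp: indicator_def)
  ultimately show ?thesis by simp
qed

lemma step_integrable: "step f \<Longrightarrow> integrable lborel f"
  by (induction rule: step.induct) (auto simp: integrable_indicator_Icc)

lemma indicator_L2:
  assumes "A \<in> sets borel" "emeasure lborel A < \<infinity>" shows "(indicator A :: real \<Rightarrow> complex) \<in> L2"
proof -
  have "(\<lambda>x. (cmod (indicator A x))\<^sup>2) = (indicator A :: real \<Rightarrow> real)"
    by (auto simp: indicator_def)
  then show ?thesis using assms by (simp add: L2_def)
qed

lemma indicator_Icc_L2 [simp]: "(indicator {a..b} :: real \<Rightarrow> complex) \<in> L2"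
  by (rule indicator_L2) (auto simp: emeasure_lborel_Icc_eq)

lemma step_L2: "step f \<Longrightarrow> f \<in> L2"
  by (induction rule: step.induct) (auto intro: L2_cmult L2_add)

lemma step_restrict: "step f \<Longrightarrow> step (\<lambda>x. indicator {c..d} x * f x)"
proof (induction rule: step.induct)
  case (step_interval a b)
  have "(\<lambda>x. indicator {c..d} x * indicator {a..b} x :: complex) = indicator {max c a..min d b}"
    by (auto simp: indicator_def)
  then show ?case using step.step_interval by simp
next
  case (step_cmult f k)
  from step.step_cmult[OF step_cmult.IH, of k] show ?case by (simp add: mult.left_commute)
next
  case (step_add f g)
  from step.step_add[OF step_add.IH] show ?case by (simp add: algebra_simps)
qed

subsection \<open>Density of step functions\<close>

definition step_closure :: "l2 set" where "step_closure = closure (cl ` {f. step f})"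

lemma step_closureI: "step f \<Longrightarrow> cl f \<in> step_closure"
  unfolding step_closure_def by (rule subsetD[OF closure_subset]) auto

lemma step_closure_lim: "(\<And>n. X n \<in> step_closure) \<Longrightarrow> X \<longlonglongrightarrow> l \<Longrightarrow> l \<in> step_closure"
  unfolding step_closure_def by (rule closed_sequentially[OF closed_closure])

lemma step_closure_obtain:
  assumes "f \<in> step_closure"
  obtains s where "\<And>n. step (s n)" "(\<lambda>n. cl (s n)) \<longlonglongrightarrow> f"
proof -
  from assms obtain X where X: "\<And>n. X n \<in> cl ` {f. step f}" "X \<longlonglongrightarrow> f"
    unfolding step_closure_def closure_sequential by auto
  have "\<forall>n. \<exists>s. step s \<and> X n = cl s" using X(1) by auto
  then obtain s where s: "\<And>n. step (s n)" "\<And>n. X n = cl (s n)" by metis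
  have "X = (\<lambda>n. cl (s n))" using s(2) by auto
  with X(2) s(1) show ?thesis using that by blast
qed

lemma cl_cmult: "f \<in> L2 \<Longrightarrow> cl (\<lambda>x. c * f x) = cs c (cl f)"
  unfolding cs_def by (simp add: mop_cl)

lemma step_closure_add: assumes "f \<in> step_closure" "g \<in> step_closure" shows "f + g \<in> step_closure"
proof -
  obtain s where s: "\<And>n. step (s n)" "(\<lambda>n. cl (s n)) \<longlonglongrightarrow> f" using step_closure_obtain[OF assms(1)] by blast
  obtain t where t: "\<And>n. step (t n)" "(\<lambda>n. cl (t n)) \<longlonglongrightarrow> g" using step_closure_obtain[OF assms(2)] by blast
  have "cl (s n) + cl (t n) \<in> step_closure" for n
    using step_closureI[OF step_add[OF s(1) t(1)], of n n] s(1) t(1) by (simp add: cl_add step_L2)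
  then show ?thesis by (rule step_closure_lim[OF _ tendsto_add[OF s(2) t(2)]])
qed

lemma step_closure_cs: assumes "f \<in> step_closure" shows "cs c f \<in> step_closure"
proof -
  obtain s where s: "\<And>n. step (s n)" "(\<lambda>n. cl (s n)) \<longlonglongrightarrow> f" using step_closure_obtain[OF assms(1)] by blast
  have "cs c (cl (s n)) \<in> step_closure" for n
    using step_closureI[OF step_cmult[OF s(1)], of c n] s(1) by (simp add: cl_cmult step_L2)
  then show ?thesis by (rule step_closure_lim[OF _ tendsto_cs[OF s(2)]])
qed

lemma step_closure_diff: "f \<in> step_closure \<Longrightarrow> g \<in> step_closure \<Longrightarrow> f - g \<in> step_closure"
  using step_closure_add[OF _ step_closure_cs[of g "-1"], of f] by simp

lemma cl_zero [simp]: "cl (\<lambda>x. 0) = 0" by (simp add: zero_l2_def)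

lemma zero_step_closure: "0 \<in> step_closure"
  using step_closure_cs[OF step_closureI[OF step_interval], of 0] by simp

text \<open>Induction on Borel sets. The window keeps all measures finite, so that a complement
  becomes a difference in L^2 and a countable disjoint union becomes a dominated limit of finite
  sums.\<close>

lemma step_closure_indicator:
  assumes "A \<in> sets borel"
  shows "cl (indicator (A \<inter> {-real n..real n})) \<in> step_closure"
proof -
  let ?I = "{-real n..real n}"
  have fin: "emeasure lborel (A \<inter> ?I) < \<infinity>" if "A \<in> sets borel" for A
    using emeasure_mono[of "A \<inter> ?I" ?I lborel] that by (auto simp: emeasure_lborel_Icc_eq top_unique less_top[symmetric])
  have L: "(indicator (A \<inter> ?I) :: real \<Rightarrow> complex) \<in> L2" if "A \<in> sets borel" for A
    using that fin[OF that] by (intro indicator_L2) auto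
  show ?thesis using assms
  proof (induction rule: borel_set_induct)
    case empty
    have "(indicator ({} \<inter> ?I) :: real \<Rightarrow> complex) = (\<lambda>x. 0)" by (auto simp: indicator_def)
    then show ?case using zero_step_closure by simp
  next
    case (interval a b)
    have "{a..b} \<inter> ?I = {max a (- real n)..min b (real n)}" by auto
    then show ?case using step_closureI[OF step_interval] by simp
  next
    case (compl A)
    have "(\<lambda>x. indicator ?I x - indicator (A \<inter> ?I) x :: complex) = indicator (- A \<inter> ?I)"
      by (auto simp: indicator_def)
    then have "cl (indicator (- A \<inter> ?I)) = cl (indicator ?I) - cl (indicator (A \<inter> ?I))"
      using cl_diff[OF indicator_Icc_L2 L[OF compl(1)], of "-real n" "real n"] by simp
    then show ?case using step_closure_diff[OF step_closureI[OF step_interval] compl(2)] by simp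
  next
    case (union f)
    have disj: "f i \<inter> f j = {}" if "i \<noteq> j" for i j
      using union(1) that by (auto simp: disjoint_family_on_def)
    have part: "cl (indicator ((\<Union>i<k. f i) \<inter> ?I)) \<in> step_closure" for k
    proof (induction k)
      case 0
      have "(indicator ((\<Union>i<0. f i) \<inter> ?I) :: real \<Rightarrow> complex) = (\<lambda>x. 0)" by (auto simp: indicator_def)
      then show ?case using zero_step_closure by simp
    next
      case (Suc k)
      have "x \<in> f k \<Longrightarrow> i < k \<Longrightarrow> x \<notin> f i" for x i using disj[of i k] by auto
      then have "(indicator ((\<Union>i<Suc k. f i) \<inter> ?I) :: real \<Rightarrow> complex) = (\<lambda>x. indicator ((\<Union>i<k. f i) \<inter> ?I) x + indicator (f k \<inter> ?I) x)"
        by (auto simp: indicator_def lessThan_Suc fun_eq_iff)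
      moreover have "(\<Union>i<k. f i) \<in> sets borel" using union(2) by auto
      ultimately have "cl (indicator ((\<Union>i<Suc k. f i) \<inter> ?I)) = cl (indicator ((\<Union>i<k. f i) \<inter> ?I)) + cl (indicator (f k \<inter> ?I))"
        using cl_add[OF L L[OF union(2)]] by simp
      then show ?case using step_closure_add[OF Suc union(3)] by simp
    qed
    have Um: "(\<Union>i. f i) \<in> sets borel" "\<And>k. (\<Union>i<k. f i) \<in> sets borel" using union(2) by auto
    have "(\<lambda>k. cl (indicator ((\<Union>i<k. f i) \<inter> ?I))) \<longlonglongrightarrow> cl (indicator ((\<Union>i. f i) \<inter> ?I))"
    proof (rule l2_dominated_seq(2)[where g = "indicator ?I"])
      show "AE x in lborel. (\<lambda>k. indicator ((\<Union>i<k. f i) \<inter> ?I) x :: complex) \<longlonglongrightarrow> indicator ((\<Union>i. f i) \<inter> ?I) x"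
      proof (rule AE_I2)
        fix x
        show "(\<lambda>k. indicator ((\<Union>i<k. f i) \<inter> ?I) x :: complex) \<longlonglongrightarrow> indicator ((\<Union>i. f i) \<inter> ?I) x"
        proof (cases "x \<in> (\<Union>i. f i) \<inter> ?I")
          case True
          then obtain i where i: "x \<in> f i" "x \<in> ?I" by auto
          have "\<forall>\<^sub>F k in sequentially. indicator ((\<Union>i<k. f i) \<inter> ?I) x = (1::complex)"
            using i by (intro eventually_sequentiallyI[of "Suc i"]) (auto simp: indicator_def)
          then show ?thesis using True by (auto intro: tendsto_eventually)
        next
          case False
          then have "(\<lambda>k. indicator ((\<Union>i<k. f i) \<inter> ?I) x :: complex) = (\<lambda>k. 0)" by (auto simp: indicator_def)
          then show ?thesis using False by simp
        qed
      qed
    qed (use Um in \<open>auto simp: indicator_def\<close>)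
    from step_closure_lim[OF part this] show ?case .
  qed
qed

text \<open>Simple functions with pointwise bound 2 |f| are cut to a growing window; each is a
  finite combination of windowed Borel sets, and dominated convergence does the rest.\<close>

lemma step_closure_UNIV: "f \<in> step_closure"
proof -
  obtain F where F: "\<And>i. simple_function lborel (F i)" "\<And>x. (\<lambda>i. F i x) \<longlonglongrightarrow> rp f x" 
    "\<And>i x. dist (F i x) 0 \<le> 2 * dist (rp f x) 0"
    using borel_measurable_implies_sequence_metric[of "rp f" lborel 0] by auto
  have sum: "cl (\<lambda>x. \<Sum>y\<in>S. y * indicator (A y \<inter> {-real n..real n}) x) \<in> step_closure \<and>
      (\<lambda>x. \<Sum>y\<in>S. y * indicator (A y \<inter> {-real n..real n}) x) \<in> L2"
    if "finite S" "\<And>y. y \<in> S \<Longrightarrow> A y \<in> sets borel" for S :: "complex set" and A n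
    using that
  proof (induction S rule: finite_induct)
    case empty
    then show ?case using zero_step_closure by simp
  next
    case (insert y S)
    have L: "(indicator (A y \<inter> {-real n..real n}) :: real \<Rightarrow> complex) \<in> L2"
      using emeasure_mono[of "A y \<inter> {-real n..real n}" "{-real n..real n}" lborel] insert.prems[of y]
      by (intro indicator_L2) (auto simp: emeasure_lborel_Icc_eq top_unique less_top[symmetric])
    have A: "A y \<in> sets borel" using insert.prems[of y] by simp
    have IH: "cl (\<lambda>x. \<Sum>y\<in>S. y * indicator (A y \<inter> {-real n..real n}) x) \<in> step_closure"
      "(\<lambda>x. \<Sum>y\<in>S. y * indicator (A y \<inter> {-real n..real n}) x) \<in> L2" using insert.IH insert.prems by auto
    have eq: "(\<lambda>x. \<Sum>y\<in>insert y S. y * indicator (A y \<inter> {-real n..real n}) x) =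
      (\<lambda>x. y * indicator (A y \<inter> {-real n..real n}) x + (\<Sum>y\<in>S. y * indicator (A y \<inter> {-real n..real n}) x))"
      by (simp only: sum.insert[OF insert.hyps])
    show ?case
      unfolding eq cl_add[OF L2_cmult[OF L] IH(2)] cl_cmult[OF L]
      using L2_add[OF L2_cmult[OF L] IH(2)] step_closure_add[OF step_closure_cs[OF step_closure_indicator[OF A]] IH(1)] by blast
  qed
  define G where "G n x = indicator {-real n..real n} x * F n x" for n x
  have Geq: "G n x = (\<Sum>y\<in>range (F n). y * indicator ((F n -` {y}) \<inter> {-real n..real n}) x)" for n x
  proof -
    have "F n x = (\<Sum>y\<in>range (F n). indicator (F n -` {y}) x *\<^sub>R y)"
      by (rule simple_function_indicator_representation_banach[of lborel "F n" x, unfolded space_lborel space_borel Int_UNIV_right, OF F(1) UNIV_I])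
    from arg_cong[OF this, of "\<lambda>z. indicator {-real n..real n} x * z"] show ?thesis unfolding G_def sum_distrib_left
      by (rule trans) (rule sum.cong, auto simp: indicator_def)
  qed
  have meas: "F n \<in> borel_measurable borel" for n
    using borel_measurable_simple_function[OF F(1)] by simp
  have Gc: "cl (G n) \<in> step_closure" for n
  proof -
    have "F n -` {y} \<in> sets borel" for y using measurable_sets[OF meas, of "{y}"] by simp
    then show ?thesis unfolding Geq[abs_def] using simple_functionD(1)[OF F(1)[of n]]
      by (intro sum[THEN conjunct1]) auto
  qed
  have "(\<lambda>n. cl (G n)) \<longlonglongrightarrow> cl (rp f)"
  proof (rule l2_dominated_seq(2)[where g = "\<lambda>x. 2 * rp f x"])
    show "AE x in lborel. (\<lambda>n. G n x) \<longlonglongrightarrow> rp f x"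
    proof (rule AE_I2)
      fix x
      obtain N :: nat where N: "\<bar>x\<bar> \<le> real N" using real_arch_simple by blast
      have "\<forall>\<^sub>F n in sequentially. F n x = G n x"
        using N by (intro eventually_sequentiallyI[of N]) (auto simp: G_def indicator_def)
      then show "(\<lambda>n. G n x) \<longlonglongrightarrow> rp f x" using F(2)[of x] by (rule Lim_transform_eventually[rotated])
    qed
    show "AE x in lborel. cmod (G n x) \<le> cmod (2 * rp f x)" for n
      using F(3)[of n] by (auto simp: G_def indicator_def norm_mult)
    show "G n \<in> borel_measurable borel" for n unfolding G_def using meas by measurable
  qed (auto intro: L2_cmult)
  then show ?thesis using step_closure_lim[OF Gc] by simp
qed

lemma step_dense:
  obtains s where "\<And>n. step (s n)" "(\<lambda>n. cl (s n)) \<longlonglongrightarrow> f"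
  using step_closure_obtain[OF step_closure_UNIV] by blast

subsection \<open>The Fourier transform of integrable functions\<close>

definition ft :: "(real \<Rightarrow> complex) \<Rightarrow> real \<Rightarrow> complex" where
  "ft f \<xi> = (LINT x|lborel. f x * exp (- (\<i> * of_real (x * \<xi>))))"

lemma cmod_exp_char [simp]: "cmod (exp (- (\<i> * of_real x))) = 1" "cmod (exp (\<i> * of_real x)) = 1"
  "cmod (exp (- (\<i> * (of_real x * of_real y)))) = 1" "cmod (exp (\<i> * (of_real x * of_real y))) = 1"
  by (simp_all add: norm_exp_eq_Re)

lemma integrable_ft: "integrable lborel f \<Longrightarrow> integrable lborel (\<lambda>x. f x * exp (- (\<i> * of_real (x * \<xi>))))"
  by (rule Bochner_Integration.integrable_bound[of _ f]) (auto simp: norm_mult)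

lemma ft_measurable [measurable]: assumes [measurable]: "f \<in> borel_measurable borel"
  shows "ft f \<in> borel_measurable borel"
  unfolding ft_def by measurable

lemma cmod_ft_le: "cmod (ft f \<xi>) \<le> (LINT x|lborel. cmod (f x))"
proof -
  have "cmod (ft f \<xi>) \<le> (LINT x|lborel. cmod (f x * exp (- (\<i> * of_real (x * \<xi>)))))"
    unfolding ft_def by (rule integral_norm_bound)
  then show ?thesis by (simp add: norm_mult)
qed

lemma ft_add: "integrable lborel f \<Longrightarrow> integrable lborel g \<Longrightarrow> ft (\<lambda>x. f x + g x) \<xi> = ft f \<xi> + ft g \<xi>"
  unfolding ft_def using integrable_ft[of f \<xi>] integrable_ft[of g \<xi>] by (simp add: algebra_simps)
lemma ft_diff: "integrable lborel f \<Longrightarrow> integrable lborel g \<Longrightarrow> ft (\<lambda>x. f x - g x) \<xi> = ft f \<xi> - ft g \<xi>"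
  unfolding ft_def using integrable_ft[of f \<xi>] integrable_ft[of g \<xi>] by (simp add: algebra_simps)
lemma ft_cmult: "ft (\<lambda>x. c * f x) \<xi> = c * ft f \<xi>"
  unfolding ft_def by (simp add: mult.assoc)

text \<open>Fubini's theorem. Plancherel's identity, the adjoint of the transform and the stability
  of the Hardy space under products all come from this exchange.\<close>

lemma ft_multiplication:
  assumes f: "integrable lborel f" and g: "integrable lborel g"
  shows "(LINT \<xi>|lborel. ft f \<xi> * g \<xi>) = (LINT x|lborel. f x * ft g x)"
proof -
  note [measurable] = borel_measurable_integrable[OF f] borel_measurable_integrable[OF g]
  have int: "integrable (lborel \<Otimes>\<^sub>M lborel) (\<lambda>(x, \<xi>). f x * exp (- (\<i> * of_real (x * \<xi>))) * g \<xi>)"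
  proof (rule lborel_pair.Fubini_integrable)
    show "integrable lborel (\<lambda>x. LINT \<xi>|lborel. cmod (case (x, \<xi>) of (x, \<xi>) \<Rightarrow> f x * exp (- (\<i> * of_real (x * \<xi>))) * g \<xi>))"
      using f by (simp add: norm_mult)
    show "AE x in lborel. integrable lborel (\<lambda>\<xi>. case (x, \<xi>) of (x, \<xi>) \<Rightarrow> f x * exp (- (\<i> * of_real (x * \<xi>))) * g \<xi>)"
      using integrable_mult_right[OF integrable_ft[OF g]] by (auto simp: mult_ac)
  qed measurable
  have "(LINT \<xi>|lborel. ft f \<xi> * g \<xi>) = (LINT \<xi>|lborel. LINT x|lborel. f x * exp (- (\<i> * of_real (x * \<xi>))) * g \<xi>)"
    unfolding ft_def by simp
  also have "\<dots> = (LINT x|lborel. LINT \<xi>|lborel. f x * exp (- (\<i> * of_real (x * \<xi>))) * g \<xi>)"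
    by (rule lborel_pair.Fubini_integral[OF int])
  also have "\<dots> = (LINT x|lborel. f x * ft g x)"
    unfolding ft_def by (simp add: mult_ac flip: Bochner_Integration.integral_mult_right_zero)
  finally show ?thesis .
qed

lemma integral_exp_half_line:
  assumes "Re c > 0"
  shows "integrable lborel (\<lambda>x. indicator {0..} x *\<^sub>R exp (- (c * of_real x)))"
    "(LINT x|lborel. indicator {0..} x *\<^sub>R exp (- (c * of_real x))) = 1 / c"
proof -
  let ?f = "\<lambda>x::real. indicator {0..} x *\<^sub>R exp (- (c * of_real x))"
  have c0: "c \<noteq> 0" using assms by auto
  have "(\<integral>\<^sup>+x. ennreal (exp (- (Re c * x))) * indicator {0..} x \<partial>lborel) = ennreal (0 - (- exp (- (Re c * 0)) / Re c))"
  proof (rule nn_integral_FTC_atLeast)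
    show "DERIV (\<lambda>x. - exp (- (Re c * x)) / Re c) x :> exp (- (Re c * x))" for x
      using assms by (auto intro!: derivative_eq_intros)
    show "((\<lambda>x. - exp (- (Re c * x)) / Re c) \<longlongrightarrow> 0) at_top" using assms by real_asymp
  qed auto
  also have "(\<integral>\<^sup>+x. ennreal (exp (- (Re c * x))) * indicator {0..} x \<partial>lborel) = (\<integral>\<^sup>+x. ennreal (norm (?f x)) \<partial>lborel)"
    by (intro nn_integral_cong) (auto simp: indicator_def)
  finally have bd: "(\<integral>\<^sup>+x. ennreal (norm (?f x)) \<partial>lborel) < \<infinity>" by simp
  show int: "integrable lborel ?f"
    by (rule integrableI_bounded) (use bd in \<open>auto intro!: borel_measurable_scaleR borel_measurable_exp\<close>)
  have part: "(LINT x|lborel. indicator {0..real n} x *\<^sub>R exp (- (c * of_real x))) = (1 - exp (- (c * of_real n))) / c" for n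
  proof -
    have "((\<lambda>x. - exp (- (c * of_real x)) / c) has_vector_derivative exp (- (c * of_real x))) (at x within A)" for x A
      by (rule has_vector_derivative_real_field[THEN has_vector_derivative_at_within])
        (use c0 in \<open>auto intro!: derivative_eq_intros\<close>)
    then have "(LINT x|lborel. indicator {0..real n} x *\<^sub>R exp (- (c * of_real x))) = - exp (- (c * of_real (real n))) / c - (- exp (- (c * of_real 0)) / c)"
      by (intro integral_FTC_Icc) (auto intro!: continuous_intros)
    then show ?thesis by (simp add: diff_divide_distrib)
  qed
  have "(\<lambda>n. LINT x|lborel. indicator {0..real n} x *\<^sub>R exp (- (c * of_real x))) \<longlonglongrightarrow> (LINT x|lborel. ?f x)"
  proof (rule integral_dominated_convergence[where w = "\<lambda>x. norm (?f x)"])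
    show "AE x in lborel. (\<lambda>n. indicator {0..real n} x *\<^sub>R exp (- (c * complex_of_real x))) \<longlonglongrightarrow> ?f x"
    proof (rule AE_I2)
      fix x
      obtain N :: nat where N: "x \<le> real N" using real_arch_simple by blast
      have "\<forall>\<^sub>F n in sequentially. indicator {0..real n} x *\<^sub>R exp (- (c * complex_of_real x)) = ?f x"
        using N by (intro eventually_sequentiallyI[of N]) (auto simp: indicator_def)
      then show "(\<lambda>n. indicator {0..real n} x *\<^sub>R exp (- (c * complex_of_real x))) \<longlonglongrightarrow> ?f x" by (rule tendsto_eventually)
    qed
    show "integrable lborel (\<lambda>x. norm (?f x))" by (rule integrable_norm[OF int])
  qed (auto simp: indicator_def intro!: borel_measurable_scaleR borel_measurable_exp)
  moreover have "(\<lambda>n. (1 - exp (- (c * of_real (real n)))) / c) \<longlonglongrightarrow> (1 - 0) / c"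
  proof (intro tendsto_intros)
    have "(\<lambda>n. norm (exp (- (c * of_real (real n))))) \<longlonglongrightarrow> 0"
      using assms by (simp add: norm_exp_eq_Re) real_asymp
    then show "(\<lambda>n. exp (- (c * of_real (real n)))) \<longlonglongrightarrow> 0" by (rule tendsto_norm_zero_cancel)
  qed (rule c0)
  ultimately show "(LINT x|lborel. ?f x) = 1 / c" unfolding part using LIMSEQ_unique by fastforce
qed

text \<open>The parameter \<open>s\<close> is the value of a symbol on the negative half-line:
  \<open>s = 1\<close> produces the Poisson kernel and \<open>s = - 1\<close>, the sign function,
  produces the conjugate Poisson kernel.\<close>

lemma integral_exp_abs:
  fixes \<epsilon> y :: real and s :: complex
  assumes "\<epsilon> > 0"
  defines "k \<equiv> \<lambda>\<xi>. (if \<xi> \<ge> 0 then 1 else s) * of_real (exp (- (\<epsilon> * \<bar>\<xi>\<bar>)))"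
  shows "integrable lborel k" "ft k y = 1 / (of_real \<epsilon> + \<i> * of_real y) + s / (of_real \<epsilon> - \<i> * of_real y)"
proof -
  let ?p = "\<lambda>c \<xi>. indicator {0..} \<xi> *\<^sub>R exp (- (c * of_real \<xi>)) :: complex"
  have key: "integrable lborel (\<lambda>\<xi>. k \<xi> * exp (- (\<i> * of_real (\<xi> * y)))) \<and>
    (LINT \<xi>|lborel. k \<xi> * exp (- (\<i> * of_real (\<xi> * y)))) = 1 / (of_real \<epsilon> + \<i> * of_real y) + s / (of_real \<epsilon> - \<i> * of_real y)" for y
  proof -
    define c1 c2 where "c1 = of_real \<epsilon> + \<i> * of_real y" and "c2 = of_real \<epsilon> - \<i> * of_real y"
    have re: "Re c1 > 0" "Re c2 > 0" using assms by (auto simp: c1_def c2_def)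
    note i1 = integral_exp_half_line[OF re(1)] and i2 = integral_exp_half_line[OF re(2)]
    have i3: "integrable lborel (\<lambda>\<xi>. ?p c2 (-\<xi>))" "(LINT \<xi>|lborel. ?p c2 (-\<xi>)) = 1 / c2"
      using lborel_integrable_real_affine[OF i2(1), of "-1" 0] lborel_integral_real_affine[of "-1" "?p c2" 0] i2 by auto
    have ae: "AE \<xi> in lborel. k \<xi> * exp (- (\<i> * of_real (\<xi> * y))) = ?p c1 \<xi> + s * ?p c2 (-\<xi>)"
      using AE_lborel_singleton[of 0]
    proof eventually_elim
      case (elim \<xi>)
      show ?case
      proof (cases "\<xi> > 0")
        case True
        then show ?thesis by (simp add: k_def c1_def exp_of_real[symmetric] algebra_simps flip: exp_add)
      next
        case False
        with elim have "\<xi> < 0" by simp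
        then show ?thesis by (simp add: k_def c2_def exp_of_real[symmetric] algebra_simps flip: exp_add)
      qed
    qed
    have int: "integrable lborel (\<lambda>\<xi>. ?p c1 \<xi> + s * ?p c2 (-\<xi>))"
      by (rule Bochner_Integration.integrable_add[OF i1(1)], rule integrable_mult_right, rule i3(1))
    have m: "(\<lambda>\<xi>. k \<xi> * exp (- (\<i> * of_real (\<xi> * y)))) \<in> borel_measurable lborel"
      unfolding k_def by measurable
    have "(LINT \<xi>|lborel. k \<xi> * exp (- (\<i> * of_real (\<xi> * y)))) = (LINT \<xi>|lborel. ?p c1 \<xi> + s * ?p c2 (-\<xi>))"
      using ae m int by (intro integral_cong_AE) auto
    also have "\<dots> = (LINT \<xi>|lborel. ?p c1 \<xi>) + (LINT \<xi>|lborel. s * ?p c2 (-\<xi>))"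
      by (rule Bochner_Integration.integral_add[OF i1(1)], rule integrable_mult_right, rule i3(1))
    also have "\<dots> = 1 / c1 + s / c2" by (simp only: integral_mult_right_zero i1(2) i3(2)) simp
    finally have "(LINT \<xi>|lborel. k \<xi> * exp (- (\<i> * of_real (\<xi> * y)))) = 1 / c1 + s / c2" .
    moreover have "integrable lborel (\<lambda>\<xi>. k \<xi> * exp (- (\<i> * of_real (\<xi> * y))))"
      using integrable_cong_AE[OF m borel_measurable_integrable[OF int] ae] int by blast
    ultimately show ?thesis unfolding c1_def c2_def by blast
  qed
  show "integrable lborel k" using key[of 0] by simp
  show "ft k y = 1 / (of_real \<epsilon> + \<i> * of_real y) + s / (of_real \<epsilon> - \<i> * of_real y)"
    unfolding ft_def using key by simp
qed

text \<open>This is 2 pi times the Poisson kernel of the half-plane at height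
  \<open>\<epsilon>\<close>, the factor being forced by the unnormalised Fourier transform.\<close>

definition pk :: "real \<Rightarrow> real \<Rightarrow> real" where "pk \<epsilon> y = 2 * \<epsilon> / (y\<^sup>2 + \<epsilon>\<^sup>2)"

lemma exp_abs_integrable: "\<epsilon> > 0 \<Longrightarrow> integrable lborel (\<lambda>\<xi>. complex_of_real (exp (- (\<epsilon> * \<bar>\<xi>\<bar>))))"
  using integral_exp_abs(1)[of \<epsilon> 1] by simp

lemma ft_exp_abs: assumes "\<epsilon> > 0" shows "ft (\<lambda>\<xi>. complex_of_real (exp (- (\<epsilon> * \<bar>\<xi>\<bar>)))) y = of_real (pk \<epsilon> y)"
proof -
  have "complex_of_real \<epsilon> + \<i> * of_real y \<noteq> 0" "complex_of_real \<epsilon> - \<i> * of_real y \<noteq> 0"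
    using assms by (auto simp: complex_eq_iff)
  moreover have "complex_of_real (y\<^sup>2 + \<epsilon>\<^sup>2) \<noteq> 0" using assms by (smt (verit) of_real_eq_0_iff power2_less_0 zero_less_power)
  ultimately have "1 / (complex_of_real \<epsilon> + \<i> * of_real y) + 1 / (of_real \<epsilon> - \<i> * of_real y) = of_real (pk \<epsilon> y)"
    unfolding pk_def of_real_divide
    by (simp add: divide_simps) (simp add: algebra_simps power2_eq_square)
  then show ?thesis using integral_exp_abs(2)[OF assms, of 1 y] by simp
qed

lemma ft_modulate: "ft (\<lambda>x. g x * exp (\<i> * of_real (a * x))) \<xi> = ft g (\<xi> - a)"
  unfolding ft_def by (intro Bochner_Integration.integral_cong) (auto simp: algebra_simps simp flip: exp_add)

lemma pk_le: assumes "\<epsilon> > 0" shows "0 \<le> pk \<epsilon> y" "pk \<epsilon> y \<le> 2 / \<epsilon>"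
proof -
  show "0 \<le> pk \<epsilon> y" using assms by (simp add: pk_def)
  have "0 < y\<^sup>2 + \<epsilon>\<^sup>2" using assms by (intro add_nonneg_pos) auto
  then have "2 * \<epsilon> / (y\<^sup>2 + \<epsilon>\<^sup>2) \<le> 2 * \<epsilon> / \<epsilon>\<^sup>2" using assms by (intro divide_left_mono) auto
  then show "pk \<epsilon> y \<le> 2 / \<epsilon>" using assms by (simp add: pk_def power2_eq_square)
qed

lemma pk_measurable [measurable]: "pk \<epsilon> \<in> borel_measurable borel" unfolding pk_def by measurable

definition pois :: "real \<Rightarrow> (real \<Rightarrow> complex) \<Rightarrow> real \<Rightarrow> complex" where
  "pois \<epsilon> h x = (LINT y|lborel. h y * of_real (pk \<epsilon> (y - x)))"

text \<open>The factor \<open>exp (- (\<epsilon> * \<bar>\<xi>\<bar>))\<close> makes the square of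
  the transform integrable before Plancherel's theorem is available. The multiplication formula then
  trades it for a Poisson integral of \<open>h\<close>.\<close>

lemma ft_sq_exp:
  assumes h: "integrable lborel h" and e: "\<epsilon> > 0"
  shows "integrable lborel (\<lambda>\<xi>. (cmod (ft h \<xi>))\<^sup>2 * exp (- (\<epsilon> * \<bar>\<xi>\<bar>)))"
   "complex_of_real (LINT \<xi>|lborel. (cmod (ft h \<xi>))\<^sup>2 * exp (- (\<epsilon> * \<bar>\<xi>\<bar>))) = (LINT x|lborel. h x * cnj (pois \<epsilon> h x))"
proof -
  let ?e = "\<lambda>\<xi>. complex_of_real (exp (- (\<epsilon> * \<bar>\<xi>\<bar>)))"
  define k where "k = (\<lambda>\<xi>. cnj (ft h \<xi>) * ?e \<xi>)"
  define C where "C = (LINT x|lborel. cmod (h x))"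
  have C0: "0 \<le> C" unfolding C_def by simp
  note [measurable] = borel_measurable_integrable[OF h]
  have k: "integrable lborel k"
  proof (rule Bochner_Integration.integrable_bound)
    show "integrable lborel (\<lambda>\<xi>. of_real C * ?e \<xi>)" using exp_abs_integrable[OF e] by auto
    show "AE x in lborel. cmod (k x) \<le> cmod (of_real C * ?e x)"
      using cmod_ft_le[of h] C0 by (auto simp: k_def norm_mult C_def intro!: mult_right_mono)
  qed (unfold k_def, measurable)
  have "integrable lborel (\<lambda>\<xi>. of_real ((cmod (ft h \<xi>))\<^sup>2 * exp (- (\<epsilon> * \<bar>\<xi>\<bar>))) :: complex)"
  proof (rule Bochner_Integration.integrable_bound)
    show "integrable lborel (\<lambda>\<xi>. of_real C * k \<xi>)" using k by auto
    show "AE x in lborel. cmod (of_real ((cmod (ft h x))\<^sup>2 * exp (- (\<epsilon> * \<bar>x\<bar>)))) \<le> cmod (of_real C * k x)"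
      using cmod_ft_le[of h] C0 by (auto simp: k_def norm_mult C_def power2_eq_square mult.assoc intro!: mult_right_mono)
  qed measurable
  then show "integrable lborel (\<lambda>\<xi>. (cmod (ft h \<xi>))\<^sup>2 * exp (- (\<epsilon> * \<bar>\<xi>\<bar>)))"
    using integrable_Re by fastforce
  have ftk: "ft k x = cnj (pois \<epsilon> h x)" for x
  proof -
    have "ft k x = cnj (LINT \<xi>|lborel. ft h \<xi> * (?e \<xi> * exp (\<i> * of_real (x * \<xi>))))"
      unfolding ft_def[of k] Bochner_Integration.integral_cnj[symmetric]
      by (intro Bochner_Integration.integral_cong) (auto simp: k_def exp_cnj mult_ac)
    also have "\<dots> = cnj (LINT y|lborel. h y * ft (\<lambda>\<xi>. ?e \<xi> * exp (\<i> * of_real (x * \<xi>))) y)"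
    proof (subst ft_multiplication[OF h])
      show "integrable lborel (\<lambda>\<xi>. ?e \<xi> * exp (\<i> * of_real (x * \<xi>)))"
        by (rule Bochner_Integration.integrable_bound[OF exp_abs_integrable[OF e]]) (auto simp: norm_mult)
    qed simp
    also have "\<dots> = cnj (pois \<epsilon> h x)" unfolding ft_modulate ft_exp_abs[OF e] pois_def ..
    finally show ?thesis .
  qed
  have "complex_of_real (LINT \<xi>|lborel. (cmod (ft h \<xi>))\<^sup>2 * exp (- (\<epsilon> * \<bar>\<xi>\<bar>))) = (LINT \<xi>|lborel. ft h \<xi> * k \<xi>)"
    unfolding integral_complex_of_real[symmetric] k_def
    by (intro Bochner_Integration.integral_cong) (auto simp: complex_norm_square simp flip: of_real_power)
  also have "\<dots> = (LINT x|lborel. h x * cnj (pois \<epsilon> h x))" by (simp add: ft_multiplication[OF h k] ftk)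
  finally show "complex_of_real (LINT \<xi>|lborel. (cmod (ft h \<xi>))\<^sup>2 * exp (- (\<epsilon> * \<bar>\<xi>\<bar>))) = (LINT x|lborel. h x * cnj (pois \<epsilon> h x))" .
qed

lemma pois_indicator:
  assumes "a \<le> b" "\<epsilon> > 0"
  shows "pois \<epsilon> (indicator {a..b}) x = of_real (2 * (arctan ((b - x) / \<epsilon>) - arctan ((a - x) / \<epsilon>)))"
proof -
  have "pois \<epsilon> (indicator {a..b}) x = (LINT y|lborel. of_real (pk \<epsilon> (y - x) * indicator {a..b} y))"
    unfolding pois_def by (intro Bochner_Integration.integral_cong) (auto simp: indicator_def)
  also have "\<dots> = of_real (LINT y|lborel. pk \<epsilon> (y - x) * indicator {a..b} y)" by (rule integral_complex_of_real)
  also have "(LINT y|lborel. pk \<epsilon> (y - x) * indicator {a..b} y) = 2 * arctan ((b - x) / \<epsilon>) - 2 * arctan ((a - x) / \<epsilon>)"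
  proof (rule integral_FTC_Icc_real[OF assms(1)])
    fix y
    have nz: "(y - x)\<^sup>2 + \<epsilon>\<^sup>2 > 0" using assms by (simp add: add_nonneg_pos)
    have "1 + ((y - x) / \<epsilon>)\<^sup>2 = ((y - x)\<^sup>2 + \<epsilon>\<^sup>2) / \<epsilon>\<^sup>2" using assms by (simp add: field_simps)
    then have "inverse (1 + ((y - x) / \<epsilon>)\<^sup>2) * (1 / \<epsilon>) * 2 = pk \<epsilon> (y - x)"
      using assms nz by (simp add: pk_def field_simps power2_eq_square)
    then show "DERIV (\<lambda>y. 2 * arctan ((y - x) / \<epsilon>)) y :> pk \<epsilon> (y - x)"
      using assms by (auto intro!: derivative_eq_intros simp: algebra_simps)
    show "isCont (\<lambda>y. pk \<epsilon> (y - x)) y" unfolding pk_def using nz by (auto intro!: continuous_intros)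
  qed
  finally show ?thesis by simp
qed

text \<open>The bound uniform in \<open>\<epsilon>\<close> permits dominated convergence.
  Convergence holds only almost everywhere because at an endpoint of a nondegenerate interval the
  limit is half of the jump.\<close>

lemma pois_step:
  assumes "step h"
  shows "(\<exists>C. \<forall>\<epsilon>>0. \<forall>x. cmod (pois \<epsilon> h x) \<le> C) \<and> (AE x in lborel. ((\<lambda>\<epsilon>. pois \<epsilon> h x) \<longlongrightarrow> of_real (2 * pi) * h x) (at_right 0))"
  using assms
proof (induction rule: step.induct)
  case (step_interval a b)
  show ?case
  proof (cases "a \<le> b")
    case True
    have bd: "cmod (pois \<epsilon> (indicator {a..b}) x) \<le> 2 * pi" if "\<epsilon> > 0" for \<epsilon> x
      unfolding pois_indicator[OF True that] norm_of_real
      using arctan_ubound[of "(b - x) / \<epsilon>"] arctan_lbound[of "(b - x) / \<epsilon>"] arctan_ubound[of "(a - x) / \<epsilon>"] arctan_lbound[of "(a - x) / \<epsilon>"]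
      by (auto simp: abs_le_iff)
    have lim: "((\<lambda>\<epsilon>. pois \<epsilon> (indicator {a..b}) x) \<longlongrightarrow> of_real (2 * pi) * indicator {a..b} x) (at_right 0)" if x: "x \<noteq> a" "x \<noteq> b" for x
    proof -
      have ev: "\<forall>\<^sub>F \<epsilon> in at_right 0. of_real (2 * (arctan ((b - x) / \<epsilon>) - arctan ((a - x) / \<epsilon>))) = pois \<epsilon> (indicator {a..b}) x"
        using eventually_at_right_less[of 0] by eventually_elim (simp add: pois_indicator[OF True])
      have "((\<lambda>\<epsilon>. complex_of_real (2 * (arctan ((b - x) / \<epsilon>) - arctan ((a - x) / \<epsilon>)))) \<longlongrightarrow> of_real (2 * pi * indicator {a..b} x)) (at_right 0)"
      proof (rule tendsto_of_real)
        have pos: "((\<lambda>\<epsilon>. arctan (c / \<epsilon>)) \<longlongrightarrow> pi/2) (at_right 0)" if "c > 0" for c :: real using that by real_asymp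
        have neg: "((\<lambda>\<epsilon>. arctan (c / \<epsilon>)) \<longlongrightarrow> -(pi/2)) (at_right 0)" if "c < 0" for c :: real using that by real_asymp
        consider "x < a" | "a < x" "x < b" | "b < x" using x by linarith
        then show "((\<lambda>\<epsilon>. 2 * (arctan ((b - x) / \<epsilon>) - arctan ((a - x) / \<epsilon>))) \<longlongrightarrow> 2 * pi * indicator {a..b} x) (at_right 0)"
        proof cases
          case 1
          then show ?thesis using True tendsto_mult[OF tendsto_const tendsto_diff[OF pos[of "b - x"] pos[of "a - x"]], of 2] by simp
        next
          case 2
          then show ?thesis using tendsto_mult[OF tendsto_const tendsto_diff[OF pos[of "b - x"] neg[of "a - x"]], of 2] by simp
        next
          case 3
          then show ?thesis using True tendsto_mult[OF tendsto_const tendsto_diff[OF neg[of "b - x"] neg[of "a - x"]], of 2] by simp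
        qed
      qed
      from Lim_transform_eventually[OF this ev] show ?thesis by (auto simp: indicator_def)
    qed
    have "AE x in lborel. x \<noteq> a \<and> x \<noteq> b" using AE_lborel_singleton[of a] AE_lborel_singleton[of b] by eventually_elim auto
    then have "AE x in lborel. ((\<lambda>\<epsilon>. pois \<epsilon> (indicator {a..b}) x) \<longlongrightarrow> of_real (2 * pi) * indicator {a..b} x) (at_right 0)"
      by eventually_elim (rule lim, auto)
    then show ?thesis using bd by blast
  next
    case False
    then have "(indicator {a..b} :: real \<Rightarrow> complex) = (\<lambda>x. 0)" by (auto simp: indicator_def)
    then show ?thesis by (auto simp: pois_def)
  qed
next
  case (step_cmult f c)
  have eq: "pois \<epsilon> (\<lambda>x. c * f x) = (\<lambda>x. c * pois \<epsilon> f x)" for \<epsilon> by (auto simp: pois_def mult.assoc)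
  from step_cmult.IH obtain C where C: "\<And>\<epsilon> x. \<epsilon>>0 \<Longrightarrow> cmod (pois \<epsilon> f x) \<le> C" by blast
  have "cmod (c * pois \<epsilon> f x) \<le> cmod c * C" if "\<epsilon> > 0" for \<epsilon> x
    using C[OF that] by (simp add: norm_mult mult_left_mono)
  moreover have "AE x in lborel. ((\<lambda>\<epsilon>. c * pois \<epsilon> f x) \<longlongrightarrow> of_real (2 * pi) * (c * f x)) (at_right 0)"
    using step_cmult.IH[THEN conjunct2] by eventually_elim (auto intro!: tendsto_eq_intros)
  ultimately show ?case unfolding eq by blast
next
  case (step_add f g)
  have int: "integrable lborel (\<lambda>y. h y * complex_of_real (pk \<epsilon> (y - x)))" if "step h" "\<epsilon> > 0" for h \<epsilon> x
  proof (rule Bochner_Integration.integrable_bound)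
    show "integrable lborel (\<lambda>y. complex_of_real (2 / \<epsilon>) * h y)" using step_integrable[OF that(1)] by auto
    have "cmod (h y * complex_of_real (pk \<epsilon> (y - x))) \<le> cmod (complex_of_real (2 / \<epsilon>) * h y)" for y
      unfolding norm_mult norm_of_real mult.commute[of "cmod (h _)"]
      using pk_le[OF that(2), of "y - x"] that(2) by (intro mult_right_mono) auto
    then show "AE y in lborel. cmod (h y * complex_of_real (pk \<epsilon> (y - x))) \<le> cmod (complex_of_real (2 / \<epsilon>) * h y)" by simp
  qed (use step_measurable[OF that(1)] in measurable)
  have eq: "pois \<epsilon> (\<lambda>x. f x + g x) x = pois \<epsilon> f x + pois \<epsilon> g x" if "\<epsilon> > 0" for \<epsilon> x
    unfolding pois_def using int[OF step_add.hyps(1) that, of x] int[OF step_add.hyps(2) that, of x]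
    by (simp add: distrib_right)
  from step_add.IH obtain C D where C: "\<And>\<epsilon> x. \<epsilon>>0 \<Longrightarrow> cmod (pois \<epsilon> f x) \<le> C" "\<And>\<epsilon> x. \<epsilon>>0 \<Longrightarrow> cmod (pois \<epsilon> g x) \<le> D" by blast
  have "cmod (pois \<epsilon> (\<lambda>x. f x + g x) x) \<le> C + D" if "\<epsilon> > 0" for \<epsilon> x
    unfolding eq[OF that] using C(1)[OF that, of x] C(2)[OF that, of x] norm_triangle_ineq[of "pois \<epsilon> f x" "pois \<epsilon> g x"] by linarith
  moreover have "AE x in lborel. ((\<lambda>\<epsilon>. pois \<epsilon> (\<lambda>x. f x + g x) x) \<longlongrightarrow> of_real (2 * pi) * (f x + g x)) (at_right 0)"
    using step_add.IH(1)[THEN conjunct2] step_add.IH(2)[THEN conjunct2]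
  proof eventually_elim
    case (elim x)
    have ev: "\<forall>\<^sub>F \<epsilon> in at_right 0. pois \<epsilon> f x + pois \<epsilon> g x = pois \<epsilon> (\<lambda>x. f x + g x) x"
      using eventually_at_right_less[of 0] by eventually_elim (simp add: eq)
    from Lim_transform_eventually[OF tendsto_add[OF elim] ev] show ?case by (simp add: algebra_simps)
  qed
  ultimately show ?case by blast
qed

lemma pois_measurable [measurable]: assumes [measurable]: "h \<in> borel_measurable borel"
  shows "pois \<epsilon> h \<in> borel_measurable borel"
  unfolding pois_def by measurable

text \<open>Let \<open>\<epsilon>\<close> tend to 0 in \<open>ft_sq_exp\<close>: monotone
  convergence on the frequency side gives integrability together with the value, dominated
  convergence handles the Poisson side.\<close>

lemma plancherel_step:
  assumes h: "step h"
  shows "ft h \<in> L2" "L2_norm (ft h) = sqrt (2 * pi) * L2_norm h"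
proof -
  note [measurable] = step_measurable[OF h]
  obtain C where C: "\<And>\<epsilon> x. \<epsilon>>0 \<Longrightarrow> cmod (pois \<epsilon> h x) \<le> C" using pois_step[OF h] by blast
  define e where "e n = 1 / (1 + real n)" for n
  have e: "e n > 0" for n by (simp add: e_def)
  have elim0: "filterlim e (at_right 0) sequentially" unfolding e_def by real_asymp
  have "(\<lambda>n. LINT x|lborel. h x * cnj (pois (e n) h x)) \<longlonglongrightarrow> (LINT x|lborel. of_real (2 * pi * (cmod (h x))\<^sup>2))"
  proof (rule integral_dominated_convergence[where w = "\<lambda>x. C * cmod (h x)"])
    show "AE x in lborel. (\<lambda>n. h x * cnj (pois (e n) h x)) \<longlonglongrightarrow> of_real (2 * pi * (cmod (h x))\<^sup>2)"
      using pois_step[OF h, THEN conjunct2]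
    proof eventually_elim
      case (elim x)
      have "(\<lambda>n. pois (e n) h x) \<longlonglongrightarrow> of_real (2 * pi) * h x" using elim elim0 by (rule filterlim_compose)
      then have "(\<lambda>n. h x * cnj (pois (e n) h x)) \<longlonglongrightarrow> h x * cnj (of_real (2 * pi) * h x)" by (intro tendsto_intros)
      moreover have "h x * cnj (of_real (2 * pi) * h x) = of_real (2 * pi) * (h x * cnj (h x))" by simp
      ultimately show ?case by (simp only: of_real_mult[of "2 * pi"] complex_norm_square)
    qed
    show "AE x in lborel. cmod (h x * cnj (pois (e n) h x)) \<le> C * cmod (h x)" for n
      using C[OF e] by (auto simp: norm_mult mult.commute[of C] intro!: mult_left_mono)
  qed (use step_integrable[OF h] in auto)
  then have "(\<lambda>n. complex_of_real (LINT \<xi>|lborel. (cmod (ft h \<xi>))\<^sup>2 * exp (- (e n * \<bar>\<xi>\<bar>)))) \<longlonglongrightarrow> of_real (LINT x|lborel. 2 * pi * (cmod (h x))\<^sup>2)"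
    unfolding ft_sq_exp(2)[OF step_integrable[OF h] e] integral_complex_of_real .
  then have lim: "(\<lambda>n. LINT \<xi>|lborel. (cmod (ft h \<xi>))\<^sup>2 * exp (- (e n * \<bar>\<xi>\<bar>))) \<longlonglongrightarrow> (LINT x|lborel. 2 * pi * (cmod (h x))\<^sup>2)"
    using tendsto_of_real_iff by blast
  have mono: "AE \<xi> in lborel. mono (\<lambda>n. (cmod (ft h \<xi>))\<^sup>2 * exp (- (e n * \<bar>\<xi>\<bar>)))"
    by (intro AE_I2 monoI mult_left_mono) (auto simp: e_def frac_le intro!: mult_right_mono)
  have pw: "AE \<xi> in lborel. (\<lambda>n. (cmod (ft h \<xi>))\<^sup>2 * exp (- (e n * \<bar>\<xi>\<bar>))) \<longlonglongrightarrow> (cmod (ft h \<xi>))\<^sup>2"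
  proof (rule AE_I2)
    fix \<xi>
    have "e \<longlonglongrightarrow> 0" using elim0 by (simp add: filterlim_at)
    then have "(\<lambda>n. (cmod (ft h \<xi>))\<^sup>2 * exp (- (e n * \<bar>\<xi>\<bar>))) \<longlonglongrightarrow> (cmod (ft h \<xi>))\<^sup>2 * exp (- (0 * \<bar>\<xi>\<bar>))"
      by (intro tendsto_intros)
    then show "(\<lambda>n. (cmod (ft h \<xi>))\<^sup>2 * exp (- (e n * \<bar>\<xi>\<bar>))) \<longlonglongrightarrow> (cmod (ft h \<xi>))\<^sup>2" by simp
  qed
  have m: "(\<lambda>\<xi>. (cmod (ft h \<xi>))\<^sup>2) \<in> borel_measurable lborel" by measurable
  note mc = ft_sq_exp(1)[OF step_integrable[OF h] e] mono pw lim m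
  show "ft h \<in> L2" unfolding L2_def using integrable_monotone_convergence[OF mc] by simp
  show "L2_norm (ft h) = sqrt (2 * pi) * L2_norm h"
    unfolding L2_norm_def using integral_monotone_convergence[OF mc] by (simp add: real_sqrt_mult)
qed

section \<open>Plancherel's theorem for truncations and the limit of growing windows\<close>

lemma bmult_indicator [simp]: "A \<in> sets borel \<Longrightarrow> bmult (indicator A)"
  by (rule bmultI[of _ 1]) (auto simp: indicator_def)

definition tr :: "real \<Rightarrow> l2 \<Rightarrow> l2" where "tr R = mop (indicator {-R..R})"

lemma bounded_linear_tr: "bounded_linear (tr R)"
  unfolding tr_def by (rule bounded_linear_mop) simp

lemma tr_cl: "h \<in> L2 \<Longrightarrow> tr R (cl h) = cl (\<lambda>x. indicator {-R..R} x * h x)"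
  unfolding tr_def by (rule mop_cl) auto

lemma trunc_L2: "h \<in> L2 \<Longrightarrow> (\<lambda>x. indicator {-R..R} x * h x) \<in> L2"
  by (rule bmult_L2) auto

lemma trunc_integrable: "h \<in> L2 \<Longrightarrow> integrable lborel (\<lambda>x. indicator {-R..R} x * h x)"
  by (rule L2_integrable_mult) auto

text \<open>At a fixed frequency the truncated transform is the inner product with one fixed L^2
  vector. Hence L^2 convergence of the functions forces pointwise convergence of their truncated
  transforms.\<close>

lemma ft_trunc_cip:
  assumes h: "h \<in> L2"
  shows "ft (\<lambda>x. indicator {-R..R} x * h x) \<xi> = cip (cl h) (cl (\<lambda>x. indicator {-R..R} x * exp (\<i> * of_real (x * \<xi>))))"
proof -
  have L: "(\<lambda>x. indicator {-R..R} x * exp (\<i> * of_real (x * \<xi>))) \<in> L2"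
    by (rule L2_bound[of _ "indicator {-R..R}" 1]) (auto simp: norm_mult)
  show ?thesis unfolding cip_cl[OF h L] ft_def L2_inner_def
    by (intro Bochner_Integration.integral_cong) (auto simp: exp_cnj indicator_def)
qed

text \<open>Transforms of truncated step approximations are Cauchy by \<open>plancherel_step\<close>
  and converge at every frequency by \<open>ft_trunc_cip\<close>; \<open>l2_limit_AE\<close> says
  that the two limits agree.\<close>

lemma plancherel_trunc:
  assumes h: "h \<in> L2"
  shows "ft (\<lambda>x. indicator {-R..R} x * h x) \<in> L2"
    "L2_norm (ft (\<lambda>x. indicator {-R..R} x * h x)) = sqrt (2 * pi) * norm (tr R (cl h))"
proof -
  obtain s where s: "\<And>n. step (s n)" "(\<lambda>n. cl (s n)) \<longlonglongrightarrow> cl h" using step_dense[of "cl h"] by blast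
  define g where "g n x = indicator {-R..R} x * s n x" for n x
  have g: "step (g n)" for n unfolding g_def by (rule step_restrict[OF s(1)])
  define X where "X n = cl (ft (g n))" for n
  have trg: "cl (g n) = tr R (cl (s n))" for n unfolding g_def using tr_cl[OF step_L2[OF s(1)]] by simp
  have trlim: "(\<lambda>n. tr R (cl (s n))) \<longlonglongrightarrow> tr R (cl h)"
    by (rule bounded_linear.tendsto[OF bounded_linear_tr s(2)])
  have Xd: "norm (X n - X m) = sqrt (2 * pi) * norm (tr R (cl (s n)) - tr R (cl (s m)))" for n m
  proof -
    have "X n - X m = cl (\<lambda>\<xi>. ft (g n) \<xi> - ft (g m) \<xi>)"
      unfolding X_def by (rule cl_diff[symmetric]) (auto intro: plancherel_step g)
    also have "(\<lambda>\<xi>. ft (g n) \<xi> - ft (g m) \<xi>) = ft (\<lambda>x. g n x - g m x)"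
      by (auto simp: ft_diff step_integrable g)
    finally show ?thesis
      using plancherel_step[OF step_diff[OF g g], of n m]
      by (simp add: norm_cl cl_diff[OF step_L2 step_L2, OF g g, symmetric] trg[symmetric] norm_cl[OF step_L2, OF step_diff[OF g g]])
  qed
  have C: "Cauchy X"
  proof (rule CauchyI)
    fix e :: real assume e: "e > 0"
    have "e / sqrt (2 * pi) > 0" using e by simp
    from CauchyD[OF LIMSEQ_imp_Cauchy[OF trlim] this] obtain M where
      M: "\<And>m n. m \<ge> M \<Longrightarrow> n \<ge> M \<Longrightarrow> norm (tr R (cl (s m)) - tr R (cl (s n))) < e / sqrt (2 * pi)" by blast
    have "norm (X m - X n) < e" if "m \<ge> M" "n \<ge> M" for m n
      using M[OF that] unfolding Xd by (simp add: field_simps)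
    then show "\<exists>M. \<forall>m\<ge>M. \<forall>n\<ge>M. norm (X m - X n) < e" by blast
  qed
  let ?F = "ft (\<lambda>x. indicator {-R..R} x * h x)"
  have m: "?F \<in> borel_measurable borel" using L2_meas[OF trunc_L2[OF h, of R]] by measurable
  have pw: "(\<lambda>n. ft (g n) \<xi>) \<longlonglongrightarrow> ?F \<xi>" for \<xi>
    unfolding g_def ft_trunc_cip[OF step_L2[OF s(1)]] ft_trunc_cip[OF h]
    by (intro tendsto_cip s tendsto_const)
  have ae: "AE \<xi> in lborel. (\<lambda>n. rp (X n) \<xi>) \<longlonglongrightarrow> ?F \<xi>"
  proof -
    have "AE \<xi> in lborel. \<forall>n. rp (X n) \<xi> = ft (g n) \<xi>"
      unfolding AE_all_countable X_def by (intro allI rp_cl plancherel_step g)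
    then show ?thesis by eventually_elim (simp add: pw)
  qed
  from l2_limit_AE[OF C m ae] have F: "?F \<in> L2" "X \<longlonglongrightarrow> cl ?F" by auto
  show "?F \<in> L2" by fact
  have nX: "norm (X n) = sqrt (2 * pi) * norm (tr R (cl (s n)))" for n
    unfolding X_def trg[symmetric] using plancherel_step[OF g] by (simp add: norm_cl step_L2 g)
  have "(\<lambda>n. norm (X n)) \<longlonglongrightarrow> sqrt (2 * pi) * norm (tr R (cl h))"
    unfolding nX by (intro tendsto_mult tendsto_const tendsto_norm trlim)
  with tendsto_norm[OF F(2)] have "norm (cl ?F) = sqrt (2 * pi) * norm (tr R (cl h))" by (rule LIMSEQ_unique)
  then show "L2_norm ?F = sqrt (2 * pi) * norm (tr R (cl h))" by (simp add: norm_cl F)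
qed

definition FR :: "real \<Rightarrow> l2 \<Rightarrow> l2" where "FR R f = cl (ft (\<lambda>x. indicator {-R..R} x * rp f x))"

lemma ft_cong_AE: "f \<in> borel_measurable borel \<Longrightarrow> g \<in> borel_measurable borel \<Longrightarrow> AE x in lborel. f x = g x \<Longrightarrow> ft f \<xi> = ft g \<xi>"
  unfolding ft_def by (intro integral_cong_AE) (auto elim!: eventually_mono)

lemma FR_cl: assumes h: "h \<in> L2" shows "FR R (cl h) = cl (ft (\<lambda>x. indicator {-R..R} x * h x))"
proof -
  have "ft (\<lambda>x. indicator {-R..R} x * rp (cl h) x) = ft (\<lambda>x. indicator {-R..R} x * h x)"
    using rp_cl[OF h] by (intro ext ft_cong_AE) (auto intro!: borel_measurable_times L2_meas[OF h])
  then show ?thesis by (simp add: FR_def)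
qed

lemma FR_add: "FR R (f + g) = FR R f + FR R g"
  unfolding plus_l2_def[of f g] FR_cl[OF L2_add[OF rp_L2 rp_L2]]
  unfolding FR_def cl_add[OF plancherel_trunc(1)[OF rp_L2] plancherel_trunc(1)[OF rp_L2], symmetric]
  by (simp add: ft_add[symmetric] trunc_integrable distrib_left)

lemma FR_cs: "FR R (cs c f) = cs c (FR R f)"
proof -
  have "FR R (cs c f) = cl (ft (\<lambda>x. c * (indicator {-R..R} x * rp f x)))"
    unfolding cs_def mop_def by (subst FR_cl) (auto intro: L2_cmult simp: mult.left_commute)
  then show ?thesis by (simp add: FR_def ft_cmult[abs_def] cl_cmult plancherel_trunc)
qed

lemma norm_FR: "norm (FR R f) = sqrt (2 * pi) * norm (tr R f)"
  unfolding FR_def using plancherel_trunc[OF rp_L2, of R f] by (simp add: norm_cl)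

text \<open>Both truncations are supported in the larger window, where the difference of the
  transforms is one truncated transform of \<open>tr R f - tr S f\<close>. So the truncated
  transforms are Cauchy exactly as the truncations are.\<close>

lemma FR_diff_norm: "norm (FR R f - FR S f) = sqrt (2 * pi) * norm (tr R f - tr S f)"
proof -
  define M where "M = max R S"
  define h where "h = tr R f - tr S f"
  have rest: "FR M (tr Q f) = FR Q f" "tr M (tr Q f) = tr Q f" if "Q \<le> M" for Q
  proof -
    have eq: "(\<lambda>x. indicator {-M..M} x * (indicator {-Q..Q} x * rp f x)) = (\<lambda>x. indicator {-Q..Q} x * rp f x)"
      using that by (auto simp: indicator_def)
    have t: "tr Q f = cl (\<lambda>x. indicator {-Q..Q} x * rp f x)" using tr_cl[of "rp f" Q] by simp
    show "FR M (tr Q f) = FR Q f" unfolding t FR_cl[OF trunc_L2[OF rp_L2]] eq by (simp add: FR_def)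
    show "tr M (tr Q f) = tr Q f" unfolding t tr_cl[OF trunc_L2[OF rp_L2]] eq ..
  qed
  have M: "R \<le> M" "S \<le> M" by (auto simp: M_def)
  have "FR R f - FR S f = FR M (tr R f) + cs (-1) (FR M (tr S f))"
    by (simp add: rest(1)[OF M(1)] rest(1)[OF M(2)])
  also have "\<dots> = FR M (tr R f) + FR M (cs (-1) (tr S f))" unfolding FR_cs ..
  also have "\<dots> = FR M h" unfolding FR_add[symmetric] h_def by simp
  finally have "norm (FR R f - FR S f) = sqrt (2 * pi) * norm (tr M h)" by (simp add: norm_FR)
  also have "tr M h = h" unfolding h_def 
    using linear_diff[OF bounded_linear.linear[OF bounded_linear_tr]] by (simp add: rest(2)[OF M(1)] rest(2)[OF M(2)])
  finally show ?thesis by (simp add: h_def)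
qed

lemma tr_lim: "((\<lambda>R. tr R f) \<longlongrightarrow> f) at_top"
proof (rule tendsto_at_topI_sequentially)
  fix X :: "nat \<Rightarrow> real" assume X: "filterlim X at_top sequentially"
  have "(\<lambda>n. cl (\<lambda>x. indicator {-X n..X n} x * rp f x)) \<longlonglongrightarrow> cl (rp f)"
  proof (rule l2_dominated_seq(2)[where g = "rp f"])
    show "AE x in lborel. (\<lambda>n. indicator {- X n..X n} x * rp f x) \<longlonglongrightarrow> rp f x"
    proof (rule AE_I2)
      fix x
      have "\<forall>\<^sub>F n in sequentially. \<bar>x\<bar> \<le> X n" using X by (simp add: filterlim_at_top)
      then have "\<forall>\<^sub>F n in sequentially. indicator {- X n..X n} x * rp f x = rp f x"
        by eventually_elim (auto simp: indicator_def)
      then show "(\<lambda>n. indicator {- X n..X n} x * rp f x) \<longlonglongrightarrow> rp f x" by (rule tendsto_eventually)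
    qed
  qed (auto simp: norm_mult indicator_def)
  then show "(\<lambda>n. tr (X n) f) \<longlonglongrightarrow> f" by (simp add: tr_def mop_def)
qed

lemma FR_lim_ex: "\<exists>G. ((\<lambda>R. FR R f) \<longlongrightarrow> G) at_top"
proof -
  have tn: "(\<lambda>n. tr (real n) f) \<longlonglongrightarrow> f" by (rule filterlim_compose[OF tr_lim filterlim_real_sequentially])
  have "Cauchy (\<lambda>n. FR (real n) f)"
  proof (rule CauchyI)
    fix e :: real assume e: "e > 0"
    have "e / sqrt (2 * pi) > 0" using e by simp
    from CauchyD[OF LIMSEQ_imp_Cauchy[OF tn] this] obtain M where
      M: "\<And>m n. m \<ge> M \<Longrightarrow> n \<ge> M \<Longrightarrow> norm (tr (real m) f - tr (real n) f) < e / sqrt (2 * pi)" by blast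
    have "norm (FR (real m) f - FR (real n) f) < e" if "m \<ge> M" "n \<ge> M" for m n
      using M[OF that] unfolding FR_diff_norm by (simp add: field_simps)
    then show "\<exists>M. \<forall>m\<ge>M. \<forall>n\<ge>M. norm (FR (real m) f - FR (real n) f) < e" by blast
  qed
  then obtain G where G: "(\<lambda>n. FR (real n) f) \<longlonglongrightarrow> G" using Cauchy_convergent convergent_def by blast
  have eq: "norm (FR R f - G) = sqrt (2 * pi) * norm (tr R f - f)" for R
  proof (rule LIMSEQ_unique)
    show "(\<lambda>n. norm (FR R f - FR (real n) f)) \<longlonglongrightarrow> norm (FR R f - G)" by (intro tendsto_intros G)
    show "(\<lambda>n. norm (FR R f - FR (real n) f)) \<longlonglongrightarrow> sqrt (2 * pi) * norm (tr R f - f)"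
      unfolding FR_diff_norm by (intro tendsto_intros tn)
  qed
  have "((\<lambda>R. sqrt (2 * pi) * norm (tr R f - f)) \<longlongrightarrow> sqrt (2 * pi) * norm (f - f)) at_top"
    by (intro tendsto_intros tr_lim)
  then have "((\<lambda>R. norm (FR R f - G)) \<longlongrightarrow> 0) at_top" by (simp add: eq)
  from LIM_zero_cancel[OF tendsto_norm_zero_cancel[OF this]] show ?thesis by blast
qed

text \<open>The choice in \<open>fourier\<close> is satisfiable because the truncated transforms
  converge in a complete space. Only the class of the chosen function is determined, and only the
  class is used.\<close>

lemma fourier_L2:
  assumes f: "f \<in> L2"
  shows "fourier f \<in> L2" "((\<lambda>R. FR R (cl f)) \<longlongrightarrow> cl (fourier f)) at_top"
proof -
  have eq: "L2_norm (\<lambda>\<xi>. (LINT x:{-R..R}|lborel. f x * exp (- (\<i> * of_real (x * \<xi>)))) - g \<xi>) = norm (FR R (cl f) - cl g)"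
    if g: "g \<in> L2" for g R
  proof -
    have "(LINT x:{-R..R}|lborel. f x * exp (- (\<i> * of_real (x * \<xi>)))) = ft (\<lambda>x. indicator {-R..R} x * f x) \<xi>" for \<xi>
      unfolding set_lebesgue_integral_def ft_def
      by (intro Bochner_Integration.integral_cong) (auto simp: indicator_def)
    then show ?thesis unfolding FR_cl[OF f]
      by (simp add: cl_diff[OF plancherel_trunc(1)[OF f] g, symmetric] norm_cl L2_diff[OF plancherel_trunc(1)[OF f] g])
  qed
  obtain G where G: "((\<lambda>R. FR R (cl f)) \<longlongrightarrow> G) at_top" using FR_lim_ex by blast
  have "((\<lambda>R. norm (FR R (cl f) - cl (rp G))) \<longlongrightarrow> 0) at_top"
    unfolding cl_rp by (rule tendsto_norm_zero[OF LIM_zero[OF G]])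
  then have "\<exists>g. g \<in> L2 \<and> ((\<lambda>R. L2_norm (\<lambda>\<xi>. (LINT x:{-R..R}|lborel. f x * exp (- (\<i> * of_real (x * \<xi>)))) - g \<xi>)) \<longlongrightarrow> 0) at_top"
    by (intro exI[of _ "rp G"]) (simp only: eq[OF rp_L2] rp_L2)
  from someI_ex[OF this] have *: "fourier f \<in> L2" "((\<lambda>R. L2_norm (\<lambda>\<xi>. (LINT x:{-R..R}|lborel. f x * exp (- (\<i> * of_real (x * \<xi>)))) - fourier f \<xi>)) \<longlongrightarrow> 0) at_top"
    by (auto simp only: fourier_def)
  show "fourier f \<in> L2" by fact
  have "((\<lambda>R. norm (FR R (cl f) - cl (fourier f))) \<longlongrightarrow> 0) at_top" using *(2) by (simp only: eq[OF *(1)])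
  then show "((\<lambda>R. FR R (cl f)) \<longlongrightarrow> cl (fourier f)) at_top"
    by (rule LIM_zero_cancel[OF tendsto_norm_zero_cancel])
qed

subsection \<open>The Fourier transform as an operator\<close>

definition Fo :: "l2 \<Rightarrow> l2" where "Fo f = cl (fourier (rp f))"

lemma Fo_lim: "((\<lambda>R. FR R f) \<longlongrightarrow> Fo f) at_top"
  using fourier_L2(2)[OF rp_L2, of f] by (simp add: Fo_def)

lemma cl_fourier: assumes "f \<in> L2" shows "cl (fourier f) = Fo (cl f)"
  using tendsto_unique[OF _ fourier_L2(2)[OF assms] Fo_lim] by simp

lemma rp_Fo: assumes "f \<in> L2" shows "AE \<xi> in lborel. rp (Fo (cl f)) \<xi> = fourier f \<xi>"
  unfolding cl_fourier[OF assms, symmetric] by (rule rp_cl[OF fourier_L2(1)[OF assms]])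

lemma Fo_add: "Fo (f + g) = Fo f + Fo g"
  by (rule tendsto_unique[OF _ Fo_lim]) (auto simp: FR_add intro!: tendsto_add Fo_lim)

lemma Fo_cs: "Fo (cs c f) = cs c (Fo f)"
  by (rule tendsto_unique[OF _ Fo_lim]) (auto simp: FR_cs intro!: tendsto_cs Fo_lim)

lemma norm_Fo: "norm (Fo f) = sqrt (2 * pi) * norm f"
proof (rule tendsto_unique)
  show "((\<lambda>R. norm (FR R f)) \<longlongrightarrow> norm (Fo f)) at_top" by (intro tendsto_norm Fo_lim)
  show "((\<lambda>R. norm (FR R f)) \<longlongrightarrow> sqrt (2 * pi) * norm f) at_top"
    unfolding norm_FR by (intro tendsto_mult tendsto_const tendsto_norm tr_lim)
qed simp

lemma bounded_linear_Fo: "bounded_linear Fo"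
  using Fo_cs[of "of_real _"] by (intro bounded_linear_intro[of _ "sqrt (2 * pi)"]) (auto simp: Fo_add cs_of_real norm_Fo)

lemma Fo_diff: "Fo (f - g) = Fo f - Fo g"
  using linear_diff[OF bounded_linear.linear[OF bounded_linear_Fo]] .
lemma Fo_0 [simp]: "Fo 0 = 0" using linear_0[OF bounded_linear.linear[OF bounded_linear_Fo]] .
lemmas tendsto_Fo = bounded_linear.tendsto[OF bounded_linear_Fo]

lemma cip_Fo: "cip (Fo f) (Fo g) = of_real (2 * pi) * cip f g"
proof -
  have i: "inner (Fo f) (Fo g) = 2 * pi * inner f g" for f g
    unfolding dot_norm[of f g] dot_norm[of "Fo f" "Fo g"] Fo_add[symmetric] norm_Fo by (simp add: power_mult_distrib field_simps)
  show ?thesis unfolding cip_inner[of "Fo f"] cip_inner[of f] Fo_cs[symmetric] i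
    by (simp add: complex_eq_iff)
qed

text \<open>Truncated transforms converge to \<open>Fo\<close> in L^2 by construction and to the
  absolutely convergent integral at every point by dominated convergence, so the two limits
  coincide.\<close>

lemma Fo_L1:
  assumes h: "h \<in> L2" and hi: "integrable lborel h"
  shows "ft h \<in> L2" "Fo (cl h) = cl (ft h)"
proof -
  have C: "(\<lambda>n. FR (real n) (cl h)) \<longlonglongrightarrow> Fo (cl h)" by (rule filterlim_compose[OF Fo_lim filterlim_real_sequentially])
  have ptw: "(\<lambda>n. ft (\<lambda>x. indicator {-real n..real n} x * h x) \<xi>) \<longlonglongrightarrow> ft h \<xi>" for \<xi>
    unfolding ft_def
  proof (rule integral_dominated_convergence[where w = "\<lambda>x. cmod (h x)"])
    show "AE x in lborel. (\<lambda>n. indicator {- real n..real n} x * h x * exp (- (\<i> * of_real (x * \<xi>)))) \<longlonglongrightarrow> h x * exp (- (\<i> * of_real (x * \<xi>)))"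
    proof (rule AE_I2)
      fix x
      obtain N :: nat where N: "\<bar>x\<bar> \<le> real N" using real_arch_simple by blast
      have "\<forall>\<^sub>F n in sequentially. indicator {- real n..real n} x * h x * exp (- (\<i> * of_real (x * \<xi>))) = h x * exp (- (\<i> * of_real (x * \<xi>)))"
        using N by (intro eventually_sequentiallyI[of N]) (auto simp: indicator_def)
      then show "(\<lambda>n. indicator {- real n..real n} x * h x * exp (- (\<i> * of_real (x * \<xi>)))) \<longlonglongrightarrow> h x * exp (- (\<i> * of_real (x * \<xi>)))"
        by (rule tendsto_eventually)
    qed
  qed (use L2_meas[OF h] hi in \<open>auto simp: norm_mult indicator_def\<close>)
  have ae: "AE \<xi> in lborel. (\<lambda>n. rp (FR (real n) (cl h)) \<xi>) \<longlonglongrightarrow> ft h \<xi>"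
  proof -
    have "AE \<xi> in lborel. \<forall>n. rp (FR (real n) (cl h)) \<xi> = ft (\<lambda>x. indicator {-real n..real n} x * h x) \<xi>"
      unfolding AE_all_countable FR_cl[OF h] by (intro allI rp_cl plancherel_trunc h)
    then show ?thesis by eventually_elim (simp add: ptw)
  qed
  have m: "ft h \<in> borel_measurable borel" using L2_meas[OF h] by measurable
  from l2_limit_AE[OF LIMSEQ_imp_Cauchy[OF C] m ae] have "ft h \<in> L2" "(\<lambda>n. FR (real n) (cl h)) \<longlonglongrightarrow> cl (ft h)" by auto
  then show "ft h \<in> L2" "Fo (cl h) = cl (ft h)" using LIMSEQ_unique[OF C] by auto
qed

definition Fo' :: "l2 \<Rightarrow> l2" where "Fo' g = cj (Fo (cj g))"

lemma tr_integrable: "integrable lborel (\<lambda>x. indicator {-R..R} x * rp f x)"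
  by (rule trunc_integrable) simp

text \<open>For two truncations this is the multiplication formula, with conjugations because
  \<open>cip\<close> is sesquilinear. The windows are then removed one argument at a time.\<close>

lemma cip_Fo_adjoint: "cip (Fo f) g = cip f (Fo' g)"
proof -
  have 1: "cip (Fo (tr n f)) (cj (tr m g)) = cip (tr n f) (cj (Fo (tr m g)))" for n m f g
  proof -
    define a where "a = (\<lambda>x. indicator {-n..n} x * rp f x)"
    define b where "b = (\<lambda>x. indicator {-m..m} x * rp g x)"
    have ab: "a \<in> L2" "b \<in> L2" "integrable lborel a" "integrable lborel b"
      by (auto simp: a_def b_def trunc_L2 tr_integrable)
    have t: "tr n f = cl a" "tr m g = cl b" using tr_cl[of "rp f" n] tr_cl[of "rp g" m] by (auto simp: a_def b_def)
    show ?thesis unfolding t Fo_L1(2)[OF ab(1,3)] Fo_L1(2)[OF ab(2,4)] cj_cl[OF ab(2)] cj_cl[OF Fo_L1(1)[OF ab(2,4)]]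
      using ft_multiplication[OF ab(3,4)]
      by (simp add: cip_cl L2_cnj ab Fo_L1(1)[OF ab(1,3)] Fo_L1(1)[OF ab(2,4)] L2_inner_def)
  qed
  have 2: "cip (Fo (tr n f)) (cj g) = cip (tr n f) (cj (Fo g))" for n f g
  proof (rule tendsto_unique)
    show "((\<lambda>m. cip (Fo (tr n f)) (cj (tr m g))) \<longlongrightarrow> cip (Fo (tr n f)) (cj g)) at_top"
      by (intro tendsto_cip tendsto_const bounded_linear.tendsto[OF bounded_linear_cj] tr_lim)
    show "((\<lambda>m. cip (Fo (tr n f)) (cj (tr m g))) \<longlongrightarrow> cip (tr n f) (cj (Fo g))) at_top"
      unfolding 1 by (intro tendsto_cip tendsto_const bounded_linear.tendsto[OF bounded_linear_cj] tendsto_Fo tr_lim)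
  qed simp
  have 3: "cip (Fo f) (cj g) = cip f (cj (Fo g))" for f g
  proof (rule tendsto_unique)
    show "((\<lambda>m. cip (Fo (tr m f)) (cj g)) \<longlongrightarrow> cip (Fo f) (cj g)) at_top"
      by (intro tendsto_cip tendsto_const tendsto_Fo tr_lim)
    show "((\<lambda>m. cip (Fo (tr m f)) (cj g)) \<longlongrightarrow> cip f (cj (Fo g))) at_top"
      unfolding 2 by (intro tendsto_cip tendsto_const tr_lim)
  qed simp
  show ?thesis using 3[of f "cj g"] by (simp add: Fo'_def)
qed

definition Fi :: "l2 \<Rightarrow> l2" where "Fi g = (1 / (2 * pi)) *\<^sub>R Fo' g"

lemma Fi_Fo [simp]: "Fi (Fo f) = f"
proof (rule cip_right_eqI)
  fix h
  have "cip (Fo' (Fo f)) h = cnj (cip h (Fo' (Fo f)))" by (rule cip_commute)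
  also have "\<dots> = of_real (2 * pi) * cip f h"
    unfolding cip_Fo_adjoint[symmetric] cip_Fo by (simp add: cip_commute[of f h])
  finally show "cip (Fi (Fo f)) h = cip f h" by (simp add: Fi_def)
qed

text \<open>Surjectivity of the transform: \<open>Fo'\<close> is \<open>Fo\<close> between two
  conjugations, hence scales inner products by 2 pi as well, and \<open>Fo\<close> is its
  adjoint.\<close>

lemma Fo_Fi [simp]: "Fo (Fi f) = f"
proof (rule cip_right_eqI)
  fix h
  have adj: "cip (Fo' a) b = cip a (Fo b)" for a b
    using cip_Fo_adjoint[of b a] by (metis cip_commute)
  have "cip (Fo' f) (Fo' h) = of_real (2 * pi) * cip f h"
    unfolding Fo'_def cip_cj cip_Fo by (simp add: cip_cj)
  then have "cip (Fo (Fo' f)) h = of_real (2 * pi) * cip f h" by (simp add: cip_Fo_adjoint)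
  then show "cip (Fo (Fi f)) h = cip f h" by (simp add: Fi_def cs_of_real[symmetric] Fo_cs)
qed

lemma Fo_inj: "Fo f = Fo g \<Longrightarrow> f = g" by (metis Fi_Fo)

lemma Fi_L1:
  assumes h: "h \<in> L2" and hi: "integrable lborel h"
  shows "Fi (cl h) = cl (\<lambda>x. ft h (- x) / of_real (2 * pi))" "(\<lambda>x. ft h (- x)) \<in> L2"
proof -
  have hc: "(\<lambda>x. cnj (h x)) \<in> L2" "integrable lborel (\<lambda>x. cnj (h x))" using h hi by (auto intro: L2_cnj)
  have eq: "(\<lambda>x. cnj (ft (\<lambda>x. cnj (h x)) x)) = (\<lambda>x. ft h (- x))"
    unfolding ft_def Bochner_Integration.integral_cnj[symmetric] by (auto simp: exp_cnj)
  show L: "(\<lambda>x. ft h (- x)) \<in> L2" using L2_cnj[OF Fo_L1(1)[OF hc]] by (simp only: eq)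
  have "Fo' (cl h) = cl (\<lambda>x. ft h (- x))"
    unfolding Fo'_def cj_cl[OF h] Fo_L1(2)[OF hc] cj_cl[OF Fo_L1(1)[OF hc]] eq ..
  then show "Fi (cl h) = cl (\<lambda>x. ft h (- x) / of_real (2 * pi))"
    unfolding Fi_def cs_of_real[symmetric] using cl_cmult[OF L, of "of_real (1 / (2 * pi))"] by simp
qed

lemma Fi_cs: "Fi (cs c f) = cs c (Fi f)"
  by (rule Fo_inj) (simp add: Fo_cs)
lemma Fi_add: "Fi (f + g) = Fi f + Fi g"
  by (rule Fo_inj) (simp add: Fo_add)
lemma norm_Fi: "norm (Fi f) = norm f / sqrt (2 * pi)"
  using norm_Fo[of "Fi f"] by (simp add: field_simps)
lemma bounded_linear_Fi: "bounded_linear Fi"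
  using Fi_cs[of "of_real _"] by (intro bounded_linear_intro[of _ "1 / sqrt (2 * pi)"]) (auto simp: Fi_add cs_of_real norm_Fi)

section \<open>Fourier multipliers\<close>

definition fm :: "(real \<Rightarrow> complex) \<Rightarrow> l2 \<Rightarrow> l2" where "fm m f = Fi (mop m (Fo f))"

lemma Fo_fm [simp]: "Fo (fm m f) = mop m (Fo f)" by (simp add: fm_def)

lemma fm_add: "bmult m \<Longrightarrow> fm m (f + g) = fm m f + fm m g"
  by (simp add: fm_def Fo_add mop_add Fi_add)
lemma fm_cs: "bmult m \<Longrightarrow> fm m (cs c f) = cs c (fm m f)"
  by (simp add: fm_def Fo_cs mop_cs Fi_cs)
lemma bounded_linear_fm: assumes "bmult m" shows "bounded_linear (fm m)"
  unfolding fm_def[abs_def]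
  using bounded_linear_compose[OF bounded_linear_Fi bounded_linear_compose[OF bounded_linear_mop[OF assms] bounded_linear_Fo]] .

lemma cip_fm: assumes "bmult m" shows "cip (fm m f) g = cip f (fm (\<lambda>x. cnj (m x)) g)"
proof -
  have "of_real (2 * pi) * cip (fm m f) g = of_real (2 * pi) * cip f (fm (\<lambda>x. cnj (m x)) g)"
    unfolding cip_Fo[symmetric] Fo_fm cip_mop_left[OF assms] ..
  then show ?thesis by simp
qed

lemma fm_fm: "bmult m \<Longrightarrow> bmult n \<Longrightarrow> fm m (fm n f) = fm (\<lambda>x. m x * n x) f"
  by (rule Fo_inj) (simp add: mop_mop)

lemma fm_commute: "bmult m \<Longrightarrow> bmult n \<Longrightarrow> fm m (fm n f) = fm n (fm m f)"
  by (rule Fo_inj) (simp add: mop_commute)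

lemma norm_fm_le:
  assumes "bmult m" "0 \<le> C" "AE x in lborel. cmod (m x) \<le> C"
  shows "norm (fm m f) \<le> C * norm f"
proof -
  have "norm (fm m f) \<le> C * norm (Fo f) / sqrt (2 * pi)"
    unfolding fm_def norm_Fi by (intro divide_right_mono norm_mop_le assms) auto
  then show ?thesis by (simp add: norm_Fo)
qed

subsection \<open>Translations\<close>

definition tau :: "real \<Rightarrow> l2 \<Rightarrow> l2" where "tau a f = cl (\<lambda>x. rp f (x + a))"

lemma AE_shift: assumes "AE x in lborel. P x" shows "AE x in lborel. P (x + a :: real)"
proof -
  have "AE x in distr lborel borel ((+) a). P x" by (subst lborel_distr_plus) (rule assms)
  then have "AE x in lborel. P (a + x)" by (rule AE_distrD[rotated]) simp
  then show ?thesis by (simp add: add.commute)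
qed

lemma AE_reflect: assumes "AE x in lborel. P x" shows "AE x in lborel. P (- x :: real)"
proof -
  have "AE x in distr lborel borel uminus. P x" by (subst lborel_distr_uminus) (rule assms)
  then show ?thesis by (rule AE_distrD[rotated]) simp
qed

lemma L2_shift: assumes "f \<in> L2" shows "(\<lambda>x. f (x + a)) \<in> L2"
  using L2_meas[OF assms] lborel_integrable_real_affine[OF L2_D(2)[OF assms], of 1 a]
  by (auto simp: L2_def add.commute)

lemma rp_tau: "AE x in lborel. rp (tau a f) x = rp f (x + a)"
  unfolding tau_def by (rule rp_cl[OF L2_shift]) simp

lemma tau_cl: assumes "f \<in> L2" shows "tau a (cl f) = cl (\<lambda>x. f (x + a))"
  unfolding tau_def using AE_shift[OF rp_cl[OF assms], of a] by (intro cl_cong L2_shift assms) auto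

lemma tau_add: "tau a (f + g) = tau a f + tau a g"
  apply (rule l2_eqI) using rp_tau[of a "f + g"] AE_shift[OF rp_add[of f g], of a] rp_tau[of a f] rp_tau[of a g] rp_add[of "tau a f" "tau a g"]
  by eventually_elim simp

lemma tau_scaleR: "tau a (r *\<^sub>R f) = r *\<^sub>R tau a f"
  apply (rule l2_eqI) using rp_tau[of a "r *\<^sub>R f"] AE_shift[OF rp_scaleR[of r f], of a] rp_tau[of a f] rp_scaleR[of r "tau a f"]
  by eventually_elim simp

lemma norm_tau [simp]: "norm (tau a f) = norm f"
proof -
  have "norm (tau a f) = L2_norm (\<lambda>x. rp f (x + a))" unfolding tau_def by (rule norm_cl[OF L2_shift]) simp
  also have "\<dots> = norm f" unfolding norm_l2 L2_norm_def
    using lborel_integral_real_affine[of 1 "\<lambda>x. (cmod (rp f x))\<^sup>2" a] by (simp add: add.commute)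
  finally show ?thesis .
qed

lemma bounded_linear_tau: "bounded_linear (tau a)"
  by (intro bounded_linear_intro[of _ 1]) (auto simp: tau_add tau_scaleR)

abbreviation ch :: "real \<Rightarrow> real \<Rightarrow> complex" where "ch a \<equiv> \<lambda>x. exp (\<i> * of_real (a * x))"

lemma bmult_ch [simp]: "bmult (\<lambda>x. exp (\<i> * of_real (a * x)))"
  by (rule bmultI[of _ 1]) (auto simp del: of_real_mult)

lemma bmult_ch' [simp]: "bmult (\<lambda>x. exp (\<i> * (of_real a * of_real x)))"
  using bmult_ch[of a] by simp

lemma ft_shift: "ft (\<lambda>x. h (x + a)) \<xi> = exp (\<i> * of_real (a * \<xi>)) * ft h \<xi>"
proof -
  have "ft h \<xi> = (LINT x|lborel. h (a + 1 * x) * exp (- (\<i> * of_real ((a + 1 * x) * \<xi>))))"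
    unfolding ft_def by (subst lborel_integral_real_affine[of 1 _ a]) auto
  also have "\<dots> = (LINT x|lborel. exp (- (\<i> * of_real (a * \<xi>))) * (h (x + a) * exp (- (\<i> * of_real (x * \<xi>)))))"
    by (intro Bochner_Integration.integral_cong) (auto simp: algebra_simps simp flip: exp_add)
  finally have "ft h \<xi> = exp (- (\<i> * of_real (a * \<xi>))) * ft (\<lambda>x. h (x + a)) \<xi>" unfolding ft_def by simp
  then show ?thesis by (simp flip: mult.assoc exp_add)
qed

text \<open>Checked on truncations, which are integrable so that the transform is an honest
  integral, and extended by continuity of both sides.\<close>

lemma Fo_tau: "Fo (tau a f) = mop (ch a) (Fo f)"
proof -
  have 1: "Fo (tau a (tr n f)) = mop (ch a) (Fo (tr n f))" for n
  proof -
    define h where "h = (\<lambda>x. indicator {-n..n} x * rp f x)"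
    have h: "h \<in> L2" "integrable lborel h" "tr n f = cl h" 
      using tr_cl[of "rp f" n] by (auto simp: h_def trunc_L2 tr_integrable)
    have hs: "integrable lborel (\<lambda>x. h (x + a))" using lborel_integrable_real_affine[OF h(2), of 1 a] by (simp add: add.commute)
    show ?thesis unfolding h(3) tau_cl[OF h(1)] Fo_L1(2)[OF L2_shift[OF h(1)] hs] Fo_L1(2)[OF h(1,2)]
      by (subst mop_cl) (auto simp: Fo_L1(1)[OF h(1,2)] ft_shift[abs_def])
  qed
  show ?thesis
  proof (rule tendsto_unique)
    show "((\<lambda>n. Fo (tau a (tr n f))) \<longlongrightarrow> Fo (tau a f)) at_top"
      by (intro tendsto_Fo bounded_linear.tendsto[OF bounded_linear_tau] tr_lim)
    show "((\<lambda>n. Fo (tau a (tr n f))) \<longlongrightarrow> mop (ch a) (Fo f)) at_top"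
      unfolding 1 by (intro tendsto_mop tendsto_Fo tr_lim) simp
  qed simp
qed

lemma Fo_mop_ch: "Fo (mop (ch a) f) = tau (- a) (Fo f)"
proof -
  have 1: "Fo (mop (ch a) (tr n f)) = tau (- a) (Fo (tr n f))" for n
  proof -
    define h where "h = (\<lambda>x. indicator {-n..n} x * rp f x)"
    have h: "h \<in> L2" "integrable lborel h" "tr n f = cl h" 
      using tr_cl[of "rp f" n] by (auto simp: h_def trunc_L2 tr_integrable)
    have hs: "integrable lborel (\<lambda>x. h x * exp (\<i> * of_real (a * x)))"
      by (rule Bochner_Integration.integrable_bound[OF h(2)]) (use L2_meas[OF h(1)] in \<open>auto simp: norm_mult\<close>)
    have L: "(\<lambda>x. h x * exp (\<i> * of_real (a * x))) \<in> L2"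
      using bmult_L2[OF bmult_ch h(1), of a] by (simp add: mult.commute)
    have mch: "mop (ch a) (cl h) = cl (\<lambda>x. h x * exp (\<i> * of_real (a * x)))"
      using mop_cl[OF bmult_ch h(1), of a] by (simp add: mult.commute)
    show ?thesis unfolding h(3) Fo_L1(2)[OF h(1,2)] tau_cl[OF Fo_L1(1)[OF h(1,2)]] 
      unfolding mch Fo_L1(2)[OF L hs] ft_modulate[abs_def] by simp
  qed
  show ?thesis
  proof (rule tendsto_unique)
    show "((\<lambda>n. Fo (mop (ch a) (tr n f))) \<longlongrightarrow> Fo (mop (ch a) f)) at_top"
      by (intro tendsto_Fo tendsto_mop tr_lim) simp
    show "((\<lambda>n. Fo (mop (ch a) (tr n f))) \<longlongrightarrow> tau (- a) (Fo f)) at_top"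
      unfolding 1 by (intro bounded_linear.tendsto[OF bounded_linear_tau] tendsto_Fo tr_lim)
  qed simp
qed

text \<open>The weak derivative is expressed on the Fourier side: \<open>hasd f g\<close> means that \<open>g\<close> is the derivative of \<open>f\<close>.\<close>

definition hasd :: "l2 \<Rightarrow> l2 \<Rightarrow> bool" where
  "hasd f g \<longleftrightarrow> (AE \<xi> in lborel. rp (Fo g) \<xi> = \<i> * of_real \<xi> * rp (Fo f) \<xi>)"

lemma hasd_unique: assumes "hasd f g" "hasd f h" shows "g = h"
proof (rule Fo_inj, rule l2_eqI)
  show "AE x in lborel. rp (Fo g) x = rp (Fo h) x"
    using assms unfolding hasd_def by eventually_elim simp
qed

lemma hasd_add: assumes "hasd f f'" "hasd g g'" shows "hasd (f + g) (f' + g')"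
  unfolding hasd_def Fo_add
  using assms[unfolded hasd_def] rp_add[of "Fo f" "Fo g"] rp_add[of "Fo f'" "Fo g'"]
  by eventually_elim (simp add: algebra_simps)

lemma hasd_cs: assumes "hasd f f'" shows "hasd (cs c f) (cs c f')"
  unfolding hasd_def Fo_cs
  using assms[unfolded hasd_def] rp_cs[of c "Fo f"] rp_cs[of c "Fo f'"]
  by eventually_elim (simp add: algebra_simps)

lemma hasd_minus: "hasd f f' \<Longrightarrow> hasd (- f) (- f')"
  using hasd_cs[of f f' "-1"] by simp

lemma hasd_diff: "hasd f f' \<Longrightarrow> hasd g g' \<Longrightarrow> hasd (f - g) (f' - g')"
  using hasd_add[OF _ hasd_minus, of f f' g g'] by simp

lemma hasd_zero: "hasd 0 0"
  unfolding hasd_def using rp_zero by simp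

lemma hasd_fm: assumes "hasd f f'" "bmult m" shows "hasd (fm m f) (fm m f')"
  unfolding hasd_def Fo_fm
  using assms(1)[unfolded hasd_def] rp_mop[OF assms(2), of "Fo f"] rp_mop[OF assms(2), of "Fo f'"]
  by eventually_elim (simp add: algebra_simps)

lemma hasd_tau: assumes "hasd f f'" shows "hasd (tau a f) (tau a f')"
  unfolding hasd_def Fo_tau
  using assms(1)[unfolded hasd_def] rp_mop[OF bmult_ch[of a], of "Fo f"] rp_mop[OF bmult_ch[of a], of "Fo f'"]
  by eventually_elim (simp add: algebra_simps)

lemma hasd_ibp: assumes "hasd f f'" "hasd g g'" shows "cip f' g = - cip f g'"
proof -
  have "cip (Fo f') (Fo g) = - cip (Fo f) (Fo g')"
    unfolding cip_def L2_inner_def Bochner_Integration.integral_minus[symmetric]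
    apply (rule integral_cong_AE, measurable)
    using assms[unfolded hasd_def] by eventually_elim simp
  then have "complex_of_real (2 * pi) * cip f' g = complex_of_real (2 * pi) * (- cip f g')" by (simp add: cip_Fo)
  moreover have "complex_of_real (2 * pi) \<noteq> 0" by simp
  ultimately show ?thesis using mult_left_cancel by blast
qed

text \<open>On the Fourier side the relation is a pointwise equation, which survives along a
  subsequence converging almost everywhere. Two successive extractions are made, one for the
  functions and one for the derivatives.\<close>

lemma hasd_closed:
  assumes "\<And>n. hasd (f n) (f' n)" "f \<longlonglongrightarrow> l" "f' \<longlonglongrightarrow> l'"
  shows "hasd l l'"
proof -
  obtain r where r: "strict_mono r" "AE x in lborel. (\<lambda>k. rp (Fo (f (r k))) x) \<longlonglongrightarrow> rp (Fo l) x"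
    using l2_tendsto_AE_subseq[OF tendsto_Fo[OF assms(2)]] by blast
  have "(\<lambda>k. Fo (f' (r k))) \<longlonglongrightarrow> Fo l'"
    using LIMSEQ_subseq_LIMSEQ[OF tendsto_Fo[OF assms(3)] r(1)] by (simp add: o_def)
  then obtain s where s: "strict_mono s" "AE x in lborel. (\<lambda>k. rp (Fo (f' (r (s k)))) x) \<longlonglongrightarrow> rp (Fo l') x"
    using l2_tendsto_AE_subseq by blast
  have "AE x in lborel. \<forall>k. rp (Fo (f' (r (s k)))) x = \<i> * of_real x * rp (Fo (f (r (s k)))) x"
    unfolding AE_all_countable using assms(1) by (simp add: hasd_def)
  then show ?thesis unfolding hasd_def using r(2) s(2)
  proof eventually_elim
    case (elim x)
    have "(\<lambda>k. rp (Fo (f (r (s k)))) x) \<longlonglongrightarrow> rp (Fo l) x"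
      using LIMSEQ_subseq_LIMSEQ[OF elim(2) s(1)] by (simp add: o_def)
    then have "(\<lambda>k. \<i> * of_real x * rp (Fo (f (r (s k)))) x) \<longlonglongrightarrow> \<i> * of_real x * rp (Fo l) x"
      by (intro tendsto_intros)
    then have "(\<lambda>k. rp (Fo (f' (r (s k)))) x) \<longlonglongrightarrow> \<i> * of_real x * rp (Fo l) x" using elim(1) by simp
    then show ?case using elim(3) LIMSEQ_unique by blast
  qed
qed

lemma mop_dominated_seq:
  assumes m: "\<And>n. bmult (m n)"
    and le: "\<And>n. AE x in lborel. cmod (m n x * rp F x) \<le> cmod (rp K x)"
    and lim: "AE x in lborel. (\<lambda>n. m n x * rp F x) \<longlonglongrightarrow> rp G x"
  shows "(\<lambda>n. mop (m n) F) \<longlonglongrightarrow> G"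
proof -
  have "(\<lambda>n. cl (\<lambda>x. m n x * rp F x)) \<longlonglongrightarrow> cl (rp G)"
  proof (rule l2_dominated_seq(2)[where g = "rp K"])
    have [measurable]: "m n \<in> borel_measurable borel" for n using m by (auto simp: bmult_def)
    show "(\<lambda>x. m n x * rp F x) \<in> borel_measurable borel" for n by measurable
  qed (use le lim in auto)
  then show ?thesis by (simp add: mop_def)
qed

lemma cmod_ch_diff: "cmod (exp (\<i> * of_real t) - 1) \<le> \<bar>t\<bar>"
  using dist_exp_i_1[of t] abs_sin_x_le_abs_x[of "t/2"] by simp

lemma ch_diffq_lim: "((\<lambda>a. (exp (\<i> * of_real (a * \<xi>)) - 1) / of_real a) \<longlongrightarrow> \<i> * of_real \<xi>) (at (0::real))"
proof -
  have "((\<lambda>z. exp (\<i> * z * of_real \<xi>)) has_field_derivative (\<i> * of_real \<xi>)) (at 0)"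
    by (auto intro!: derivative_eq_intros)
  then have 1: "((\<lambda>h. (exp (\<i> * h * of_real \<xi>) - 1) / h) \<longlongrightarrow> \<i> * of_real \<xi>) (at 0)"
    by (simp add: DERIV_def)
  have "filterlim complex_of_real (at 0) (at 0)"
    unfolding filterlim_at by (auto simp: eventually_at_filter intro!: tendsto_eq_intros)
  from filterlim_compose[OF 1 this] show ?thesis by (simp add: mult.assoc)
qed

lemma tau_cont: "((\<lambda>a. tau a f) \<longlongrightarrow> f) (at 0)"
  unfolding tendsto_at_iff_sequentially
proof (intro allI impI)
  fix X :: "nat \<Rightarrow> real" assume X: "X \<longlonglongrightarrow> 0"
  have "(\<lambda>n. mop (ch (X n)) (Fo f)) \<longlonglongrightarrow> Fo f"
  proof (rule mop_dominated_seq[where K = "Fo f"])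
    have "(\<lambda>n. ch (X n) x * rp (Fo f) x) \<longlonglongrightarrow> rp (Fo f) x" for x
      using X by (auto intro!: tendsto_eq_intros)
    then show "AE x in lborel. (\<lambda>n. ch (X n) x * rp (Fo f) x) \<longlonglongrightarrow> rp (Fo f) x" by simp
  qed (auto simp: norm_mult)
  then have "(\<lambda>n. Fi (Fo (tau (X n) f))) \<longlonglongrightarrow> Fi (Fo f)"
    unfolding Fo_tau by (rule bounded_linear.tendsto[OF bounded_linear_Fi])
  then show "((\<lambda>a. tau a f) \<circ> X) \<longlonglongrightarrow> f" by (simp add: o_def)
qed

definition dq :: "real \<Rightarrow> l2 \<Rightarrow> l2" where "dq a f = (1 / a) *\<^sub>R (tau a f - f)"

lemma bmult_diff: assumes "bmult m" "bmult n" shows "bmult (\<lambda>x. m x - n x)"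
proof -
  obtain C D where C: "AE x in lborel. cmod (m x) \<le> C" "AE x in lborel. cmod (n x) \<le> D"
    using assms by (auto simp: bmult_def)
  have "AE x in lborel. cmod (m x - n x) \<le> C + D"
    using C by eventually_elim (rule order_trans[OF norm_triangle_ineq4], simp)
  then show ?thesis using assms by (auto simp: bmult_def)
qed

lemma bmult_ch_dq: "bmult (\<lambda>\<xi>. (exp (\<i> * of_real (a * \<xi>)) - 1) / of_real a)"
  using bmult_times[OF bmult_const[of "1 / of_real a"] bmult_diff[OF bmult_ch[of a] bmult_const[of 1]]] by simp

lemma Fo_dq: "Fo (dq a f) = mop (\<lambda>\<xi>. (exp (\<i> * of_real (a * \<xi>)) - 1) / of_real a) (Fo f)"
proof (rule l2_eqI)
  have E: "Fo (dq a f) = (1 / a) *\<^sub>R (mop (ch a) (Fo f) - Fo f)"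
    unfolding dq_def cs_of_real[symmetric] Fo_cs Fo_diff Fo_tau ..
  show "AE x in lborel. rp (Fo (dq a f)) x = rp (mop (\<lambda>\<xi>. (exp (\<i> * of_real (a * \<xi>)) - 1) / of_real a) (Fo f)) x"
    unfolding E
    using rp_mop[OF bmult_ch_dq, of a "Fo f"] rp_mop[OF bmult_ch, of a "Fo f"] rp_diff[of "mop (ch a) (Fo f)" "Fo f"]
      rp_scaleR[of "1/a" "mop (ch a) (Fo f) - Fo f"]
  proof eventually_elim
    case (elim x)
    show ?case unfolding elim by (simp add: algebra_simps divide_inverse)
  qed
qed

text \<open>Forwards, |exp(i a xi) - 1| <= |a xi| dominates the symbol of the difference quotient by
  that of the derivative; backwards, an almost everywhere convergent subsequence suffices.
  Difference quotients interact directly with products and with conjugation, which the Fourier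
  description does not.\<close>

lemma hasd_iff_dq: "hasd f g \<longleftrightarrow> ((\<lambda>a. dq a f) \<longlongrightarrow> g) (at 0)"
proof
  assume h: "hasd f g"
  show "((\<lambda>a. dq a f) \<longlongrightarrow> g) (at 0)" unfolding tendsto_at_iff_sequentially
  proof (intro allI impI)
    fix X :: "nat \<Rightarrow> real" assume X0: "\<forall>i. X i \<in> UNIV - {0}" and X: "X \<longlonglongrightarrow> 0"
    have fl: "filterlim X (at 0) sequentially" using X0 X by (auto simp: filterlim_at)
    have "(\<lambda>n. mop (\<lambda>\<xi>. (exp (\<i> * of_real (X n * \<xi>)) - 1) / of_real (X n)) (Fo f)) \<longlonglongrightarrow> Fo g"
    proof (rule mop_dominated_seq[where K = "Fo g"])
      show "AE x in lborel. cmod ((exp (\<i> * of_real (X n * x)) - 1) / of_real (X n) * rp (Fo f) x) \<le> cmod (rp (Fo g) x)" for n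
        using h unfolding hasd_def
      proof eventually_elim
        case (elim x)
        have "cmod ((exp (\<i> * of_real (X n * x)) - 1) / of_real (X n)) \<le> \<bar>X n * x\<bar> / \<bar>X n\<bar>"
          unfolding norm_divide norm_of_real by (intro divide_right_mono cmod_ch_diff) auto
        also have "\<dots> = \<bar>x\<bar>" using X0 by (simp add: abs_mult)
        finally show ?case unfolding elim norm_mult by (intro mult_right_mono) auto
      qed
      show "AE x in lborel. (\<lambda>n. (exp (\<i> * of_real (X n * x)) - 1) / of_real (X n) * rp (Fo f) x) \<longlonglongrightarrow> rp (Fo g) x"
        using h unfolding hasd_def
        by eventually_elim (simp only:, intro tendsto_mult tendsto_const filterlim_compose[OF ch_diffq_lim fl])
    qed (rule bmult_ch_dq)
    then have "(\<lambda>n. Fi (Fo (dq (X n) f))) \<longlonglongrightarrow> Fi (Fo g)"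
      unfolding Fo_dq by (rule bounded_linear.tendsto[OF bounded_linear_Fi])
    then show "((\<lambda>a. dq a f) \<circ> X) \<longlonglongrightarrow> g" by (simp add: o_def)
  qed
next
  assume l: "((\<lambda>a. dq a f) \<longlongrightarrow> g) (at 0)"
  define X where "X n = 1 / (1 + real n)" for n
  have fl: "filterlim X (at 0) sequentially" unfolding X_def by real_asymp
  have "(\<lambda>n. Fo (dq (X n) f)) \<longlonglongrightarrow> Fo g" by (intro tendsto_Fo filterlim_compose[OF l fl])
  then obtain r where r: "strict_mono r" "AE x in lborel. (\<lambda>k. rp (Fo (dq (X (r k)) f)) x) \<longlonglongrightarrow> rp (Fo g) x"
    using l2_tendsto_AE_subseq by blast
  have fl': "filterlim (\<lambda>k. X (r k)) (at 0) sequentially"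
    by (rule filterlim_compose[OF fl filterlim_subseq[OF r(1)]])
  have "AE x in lborel. \<forall>k. rp (Fo (dq (X (r k)) f)) x = (exp (\<i> * of_real (X (r k) * x)) - 1) / of_real (X (r k)) * rp (Fo f) x"
    unfolding AE_all_countable Fo_dq using rp_mop[OF bmult_ch_dq] by blast
  then show "hasd f g" unfolding hasd_def using r(2)
  proof eventually_elim
    case (elim x)
    have "(\<lambda>k. (exp (\<i> * of_real (X (r k) * x)) - 1) / of_real (X (r k)) * rp (Fo f) x) \<longlonglongrightarrow> \<i> * of_real x * rp (Fo f) x"
      by (intro tendsto_mult tendsto_const filterlim_compose[OF ch_diffq_lim fl'])
    moreover have "(\<lambda>k. (exp (\<i> * of_real (X (r k) * x)) - 1) / of_real (X (r k)) * rp (Fo f) x) \<longlonglongrightarrow> rp (Fo g) x"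
      using elim(2) unfolding elim(1)[rule_format] .
    ultimately show ?case using LIMSEQ_unique by blast
  qed
qed

lemma tau_cj: "tau a (cj f) = cj (tau a f)"
  apply (rule l2_eqI)
  using rp_tau[of a "cj f"] AE_shift[OF rp_cj[of f], of a] rp_cj[of "tau a f"] rp_tau[of a f]
  by eventually_elim simp

lemma cj_scaleR: "cj (r *\<^sub>R f) = r *\<^sub>R cj f"
  using cj_cs[of "of_real r" f] by (simp add: cs_of_real)

lemma hasd_cj: assumes "hasd f g" shows "hasd (cj f) (cj g)"
proof -
  have "dq a (cj f) = cj (dq a f)" for a unfolding dq_def tau_cj cj_scaleR cj_diff ..
  then show ?thesis using assms unfolding hasd_iff_dq by (simp add: bounded_linear.tendsto[OF bounded_linear_cj])
qed

subsection \<open>Sobolev functions are bounded\<close>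

definition kap :: "real \<Rightarrow> complex" where "kap \<xi> = of_real (1 / (1 + \<bar>\<xi>\<bar>))"

text \<open>The modulus of 1 / (1 + i xi) dominates \<open>kap\<close>, and this function is the
  transform of exp(-x) on the positive half-line; its square integrability is thus a case of
  Plancherel's theorem.\<close>

lemma kap_L2: "kap \<in> L2"
proof -
  let ?h = "\<lambda>x::real. indicator {0..} x *\<^sub>R exp (- (1 * complex_of_real x))"
  have re: "Re 1 > 0" "Re 2 > 0" by auto
  note i = integral_exp_half_line(1)[OF re(1)]
  have m: "?h \<in> borel_measurable borel" using borel_measurable_integrable[OF i] by simp
  have "(cmod (?h x))\<^sup>2 = Re (indicator {0..} x *\<^sub>R exp (- (2 * complex_of_real x)))" for x
    by (auto simp: indicator_def power2_eq_square Re_exp simp flip: exp_add)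
  then have "integrable lborel (\<lambda>x. (cmod (?h x))\<^sup>2)"
    using integrable_Re[OF integral_exp_half_line(1)[OF re(2)]] by simp
  then have h: "?h \<in> L2" using m by (simp add: L2_def)
  have ft: "ft ?h \<xi> = 1 / (1 + \<i> * of_real \<xi>)" for \<xi>
  proof -
    have r: "Re (1 + \<i> * of_real \<xi>) > 0" by simp
    have "ft ?h \<xi> = (LINT x|lborel. indicator {0..} x *\<^sub>R exp (- ((1 + \<i> * of_real \<xi>) * of_real x)))"
      unfolding ft_def by (intro Bochner_Integration.integral_cong) (auto simp: algebra_simps simp flip: exp_add)
    then show ?thesis using integral_exp_half_line(2)[OF r] by simp
  qed
  show ?thesis
  proof (rule L2_bound[OF _ Fo_L1(1)[OF h i], of _ 1])
    have "cmod (kap \<xi>) \<le> cmod (ft ?h \<xi>)" for \<xi>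
    proof -
      have "cmod (1 + \<i> * of_real \<xi>) \<le> 1 + \<bar>\<xi>\<bar>" using norm_triangle_ineq[of 1 "\<i> * of_real \<xi>"] by (simp add: norm_mult)
      moreover have "cmod (1 + \<i> * of_real \<xi>) > 0" by (auto simp: complex_eq_iff)
      ultimately show ?thesis unfolding ft kap_def norm_of_real norm_divide by (simp add: frac_le)
    qed
    then show "AE x in lborel. cmod (kap x) \<le> 1 * cmod (ft ?h x)" by simp
  qed (unfold kap_def, measurable)
qed

text \<open>A constant for the embedding of H^1 into bounded functions: the L^2 norm of
  \<open>kap\<close> from Cauchy-Schwarz, sqrt (2 pi) from Plancherel and 1 / (2 pi) from Fourier
  inversion.\<close>

definition Ksup :: real where "Ksup = norm (cl kap) * sqrt (2 * pi) / (2 * pi)"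

lemma Ksup_nonneg: "0 \<le> Ksup" by (simp add: Ksup_def)

text \<open>(1 + |xi|) times the modulus of the transform of \<open>f\<close> is the sum of the
  moduli of the transforms of \<open>f\<close> and \<open>f'\<close>, both in L^2. Pairing this sum
  with \<open>kap\<close> cancels the weight.\<close>

lemma hasd_Fo_integrable:
  assumes "hasd f f'"
  shows "integrable lborel (rp (Fo f))" "(LINT \<xi>|lborel. cmod (rp (Fo f) \<xi>)) \<le> 2 * pi * Ksup * (norm f + norm f')"
proof -
  define A where "A h = cl (\<lambda>\<xi>. complex_of_real (cmod (rp h \<xi>)))" for h
  have AL: "(\<lambda>\<xi>. complex_of_real (cmod (rp h \<xi>))) \<in> L2" for h
    by (rule L2_bound[of _ "rp h" 1]) auto
  have nA: "norm (A h) = norm h" for h unfolding A_def norm_cl[OF AL] norm_l2[of h] L2_norm_def by simp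
  define B where "B = (\<lambda>\<xi>. complex_of_real (cmod (rp (Fo f) \<xi>)) + complex_of_real (cmod (rp (Fo f') \<xi>)))"
  have BL: "B \<in> L2" unfolding B_def by (intro L2_add AL)
  have int: "integrable lborel (\<lambda>\<xi>. B \<xi> * cnj (kap \<xi>))" by (rule L2_integrable_cnj[OF BL kap_L2])
  have ae: "AE \<xi> in lborel. B \<xi> * cnj (kap \<xi>) = complex_of_real (cmod (rp (Fo f) \<xi>))"
    using assms unfolding hasd_def
  proof eventually_elim
    case (elim \<xi>)
    have "B \<xi> = complex_of_real ((1 + \<bar>\<xi>\<bar>) * cmod (rp (Fo f) \<xi>))" by (simp add: B_def elim norm_mult algebra_simps)
    moreover have "(1 + \<bar>\<xi>\<bar>) * c * (1 / (1 + \<bar>\<xi>\<bar>)) = c" for c by (simp add: field_simps)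
    ultimately show ?case by (simp only: kap_def complex_cnj_complex_of_real flip: of_real_mult)
  qed
  have "integrable lborel (\<lambda>\<xi>. complex_of_real (cmod (rp (Fo f) \<xi>)))"
    by (rule integrable_cong_AE_imp[OF int]) (use ae in \<open>auto elim!: eventually_mono\<close>)
  then have "integrable lborel (\<lambda>\<xi>. norm (complex_of_real (cmod (rp (Fo f) \<xi>))))" by (rule integrable_norm)
  then show "integrable lborel (rp (Fo f))" by (simp add: integrable_norm_iff)
  have "complex_of_real (LINT \<xi>|lborel. cmod (rp (Fo f) \<xi>)) = cip (cl B) (cl kap)"
    unfolding cip_cl[OF BL kap_L2] L2_inner_def integral_complex_of_real[symmetric]
    by (rule integral_cong_AE) (use ae L2_meas[OF BL] L2_meas[OF kap_L2] in \<open>auto elim!: eventually_mono\<close>)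
  then have "(LINT \<xi>|lborel. cmod (rp (Fo f) \<xi>)) = Re (cip (cl B) (cl kap))" by (metis Re_complex_of_real)
  also have "\<dots> \<le> norm (cl B) * norm (cl kap)" 
    using complex_Re_le_cmod[of "cip (cl B) (cl kap)"] cmod_cip_le[of "cl B" "cl kap"] by linarith
  also have "norm (cl B) \<le> norm (Fo f) + norm (Fo f')"
    unfolding B_def cl_add[OF AL AL] A_def[symmetric] using norm_triangle_ineq[of "A (Fo f)" "A (Fo f')"] by (simp add: nA)
  finally have "(LINT \<xi>|lborel. cmod (rp (Fo f) \<xi>)) \<le> (norm (Fo f) + norm (Fo f')) * norm (cl kap)"
    by (simp add: mult_right_mono)
  also have "\<dots> = 2 * pi * Ksup * (norm f + norm f')" unfolding norm_Fo Ksup_def by (simp add: field_simps)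
  finally show "(LINT \<xi>|lborel. cmod (rp (Fo f) \<xi>)) \<le> 2 * pi * Ksup * (norm f + norm f')" .
qed

lemma hasd_repr:
  assumes "hasd f f'"
  shows "AE x in lborel. rp f x = ft (rp (Fo f)) (- x) / of_real (2 * pi)"
proof -
  note i = hasd_Fo_integrable(1)[OF assms]
  have "f = cl (\<lambda>x. ft (rp (Fo f)) (- x) / of_real (2 * pi))"
    using Fi_L1(1)[OF rp_L2 i] by simp
  moreover have "(\<lambda>x. ft (rp (Fo f)) (- x) / of_real (2 * pi)) \<in> L2"
    using L2_cmult[OF Fi_L1(2)[OF rp_L2 i], of "1 / of_real (2 * pi)"] by simp
  ultimately show ?thesis using rp_cl by metis
qed

lemma hasd_sup: assumes "hasd f f'" shows "AE x in lborel. cmod (rp f x) \<le> Ksup * (norm f + norm f')"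
  using hasd_repr[OF assms]
proof eventually_elim
  case (elim x)
  have "cmod (rp f x) = cmod (ft (rp (Fo f)) (- x)) / (2 * pi)"
    unfolding elim norm_divide norm_of_real by simp
  also have "\<dots> \<le> (2 * pi * Ksup * (norm f + norm f')) / (2 * pi)"
    by (intro divide_right_mono order_trans[OF cmod_ft_le hasd_Fo_integrable(2)[OF assms]]) auto
  finally show ?case by simp
qed

lemma hasd_bmult: "hasd f f' \<Longrightarrow> bmult (rp f)"
  unfolding bmult_def using hasd_sup rp_measurable by blast

lemma norm_mop_hasd: assumes "hasd f f'" shows "norm (mop (rp f) g) \<le> Ksup * (norm f + norm f') * norm g"
  by (rule norm_mop_le[OF hasd_bmult[OF assms] _ hasd_sup[OF assms]]) (simp add: Ksup_nonneg)

lemma mop_swap: "mop (rp f) g = mop (rp g) f"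
  unfolding mop_def by (simp add: mult.commute)

lemma mop_diff: "bmult m \<Longrightarrow> mop m (f - g) = mop m f - mop m g"
  using linear_diff[OF bounded_linear.linear[OF bounded_linear_mop]] .

lemma mop_rp_diff: assumes "bmult (rp f)" "bmult (rp g)" shows "mop (rp (f - g)) h = mop (rp f) h - mop (rp g) h"
  unfolding minus_l2_def[of "mop (rp f) h"] mop_def[of "rp (f - g)"]
  apply (rule cl_cong)
  subgoal
  proof -
    have "bmult (\<lambda>x. rp f x - rp g x)" by (rule bmult_diff[OF assms])
    then obtain C where "AE x in lborel. cmod (rp f x - rp g x) \<le> C" by (auto simp: bmult_def)
    then have "AE x in lborel. cmod (rp (f - g) x) \<le> C" using rp_diff[of f g] by eventually_elim simp
    then show ?thesis by (intro bmult_L2) (auto simp: bmult_def)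
  qed
  subgoal by (intro L2_diff) auto
  using rp_diff[of f g] rp_mop[OF assms(1), of h] rp_mop[OF assms(2), of h]
  by eventually_elim (simp only: left_diff_distrib)

lemma tau_mop: assumes "bmult (rp f)" shows "tau a (mop (rp f) g) = mop (rp (tau a f)) (tau a g)" "bmult (rp (tau a f))"
proof -
  obtain C where C: "AE x in lborel. cmod (rp f x) \<le> C" using assms by (auto simp: bmult_def)
  have "AE x in lborel. cmod (rp (tau a f) x) \<le> C" using AE_shift[OF C, of a] rp_tau[of a f] by eventually_elim simp
  then show b: "bmult (rp (tau a f))" by (auto simp: bmult_def)
  show "tau a (mop (rp f) g) = mop (rp (tau a f)) (tau a g)"
    apply (rule l2_eqI)
    using rp_tau[of a "mop (rp f) g"] AE_shift[OF rp_mop[OF assms, of g], of a] rp_mop[OF b, of "tau a g"] rp_tau[of a f] rp_tau[of a g]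
    by eventually_elim simp
qed

text \<open>The Leibniz rule for difference quotients leaves one factor translated. As a translate
  converges in H^1, it converges in the supremum norm, and can accompany the L^2 convergence of the
  other quotient.\<close>

lemma hasd_mul:
  assumes f: "hasd f f'" and g: "hasd g g'"
  shows "hasd (mop (rp f) g) (mop (rp g) f' + mop (rp f) g')"
  unfolding hasd_iff_dq
proof -
  note bf = hasd_bmult[OF f] and bg = hasd_bmult[OF g]
  have bt: "bmult (rp (tau a f))" for a by (rule tau_mop(2)[OF bf])
  have eq: "dq a (mop (rp f) g) = mop (rp g) (dq a f) + mop (rp (tau a f)) (dq a g)" for a
  proof -
    have "tau a (mop (rp f) g) - mop (rp f) g = mop (rp (tau a f)) (tau a g) - mop (rp (tau a f)) g + (mop (rp g) (tau a f) - mop (rp g) f)"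
      unfolding tau_mop(1)[OF bf] mop_swap[of g] by simp
    also have "\<dots> = mop (rp (tau a f)) (tau a g - g) + mop (rp g) (tau a f - f)"
      by (simp add: mop_diff bt bg)
    finally show ?thesis by (simp add: dq_def scaleR_add_right mop_scaleR bt bg)
  qed
  have l1: "((\<lambda>a. mop (rp g) (dq a f)) \<longlongrightarrow> mop (rp g) f') (at 0)"
    using f unfolding hasd_iff_dq by (rule tendsto_mop[OF bg])
  have l2: "((\<lambda>a. mop (rp (tau a f)) (dq a g)) \<longlongrightarrow> mop (rp f) g') (at 0)"
  proof (rule LIM_zero_cancel, rule Lim_null_comparison)
    have "norm (mop (rp (tau a f)) (dq a g) - mop (rp f) g') \<le> Ksup * (norm f + norm f') * norm (dq a g - g')
        + Ksup * (norm (tau a f - f) + norm (tau a f' - f')) * norm g'" for a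
    proof -
      have "mop (rp (tau a f)) (dq a g) - mop (rp f) g' = mop (rp (tau a f)) (dq a g - g') + mop (rp (tau a f - f)) g'"
        by (simp add: mop_diff bt mop_rp_diff bf)
      also have "norm \<dots> \<le> norm (mop (rp (tau a f)) (dq a g - g')) + norm (mop (rp (tau a f - f)) g')" by (rule norm_triangle_ineq)
      also have "\<dots> \<le> Ksup * (norm (tau a f) + norm (tau a f')) * norm (dq a g - g')
        + Ksup * (norm (tau a f - f) + norm (tau a f' - f')) * norm g'"
        by (intro add_mono norm_mop_hasd hasd_tau f hasd_diff)
      finally show ?thesis by simp
    qed
    then show "\<forall>\<^sub>F a in at 0. norm (mop (rp (tau a f)) (dq a g) - mop (rp f) g') \<le> Ksup * (norm f + norm f') * norm (dq a g - g')
        + Ksup * (norm (tau a f - f) + norm (tau a f' - f')) * norm g'" by simp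
    have "((\<lambda>a. dq a g) \<longlongrightarrow> g') (at 0)" using g by (simp add: hasd_iff_dq)
    then have "((\<lambda>a. Ksup * (norm f + norm f') * norm (dq a g - g')
        + Ksup * (norm (tau a f - f) + norm (tau a f' - f')) * norm g') \<longlongrightarrow> 
        Ksup * (norm f + norm f') * norm (g' - g') + Ksup * (norm (f - f) + norm (f' - f')) * norm g') (at 0)"
      by (intro tendsto_intros tau_cont)
    then show "((\<lambda>a. Ksup * (norm f + norm f') * norm (dq a g - g')
        + Ksup * (norm (tau a f - f) + norm (tau a f' - f')) * norm g') \<longlongrightarrow> 0) (at 0)" by simp
  qed
  show "((\<lambda>a. dq a (mop (rp f) g)) \<longlongrightarrow> mop (rp g) f' + mop (rp f) g') (at 0)"
    unfolding eq by (intro tendsto_add l1 l2)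
qed

subsection \<open>The Szego projector\<close>

definition Sz :: "l2 \<Rightarrow> l2" where "Sz = fm (indicator {0..})"

lemma Sz_idem [simp]: "Sz (Sz f) = Sz f"
proof -
  have "(\<lambda>x::real. indicator {0..} x * indicator {0..} x :: complex) = indicator {0..}" by (auto simp: indicator_def)
  then show ?thesis unfolding Sz_def by (simp add: fm_fm)
qed

lemma cip_Sz: "cip (Sz f) g = cip f (Sz g)"
proof -
  have "(\<lambda>x::real. cnj (indicator {0..} x)) = indicator {0..}" by (auto simp: indicator_def)
  then show ?thesis unfolding Sz_def by (simp add: cip_fm)
qed

lemma bounded_linear_Sz: "bounded_linear Sz" unfolding Sz_def by (rule bounded_linear_fm) simp
lemma Sz_add: "Sz (f + g) = Sz f + Sz g" unfolding Sz_def by (rule fm_add) simp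
lemma Sz_diff: "Sz (f - g) = Sz f - Sz g" using linear_diff[OF bounded_linear.linear[OF bounded_linear_Sz]] .
lemma Sz_cs: "Sz (cs c f) = cs c (Sz f)" unfolding Sz_def by (rule fm_cs) simp
lemma hasd_Sz: "hasd f f' \<Longrightarrow> hasd (Sz f) (Sz f')" unfolding Sz_def by (rule hasd_fm) simp_all
lemma norm_Sz_le: "norm (Sz f) \<le> norm f"
  using norm_fm_le[of "indicator {0..}" 1 f] unfolding Sz_def by (simp add: indicator_def)
lemmas tendsto_Sz = bounded_linear.tendsto[OF bounded_linear_Sz]

lemma Sz_eq_iff: "Sz f = f \<longleftrightarrow> (AE \<xi> in lborel. \<xi> < 0 \<longrightarrow> rp (Fo f) \<xi> = 0)"
proof
  assume "Sz f = f"
  then have "Fo f = mop (indicator {0..}) (Fo f)" by (metis Sz_def Fo_fm)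
  moreover have "AE \<xi> in lborel. rp (mop (indicator {0..}) (Fo f)) \<xi> = indicator {0..} \<xi> * rp (Fo f) \<xi>" by (rule rp_mop) simp
  ultimately have "AE \<xi> in lborel. rp (Fo f) \<xi> = indicator {0..} \<xi> * rp (Fo f) \<xi>" by simp
  then show "AE \<xi> in lborel. \<xi> < 0 \<longrightarrow> rp (Fo f) \<xi> = 0" by eventually_elim (auto simp: indicator_def split: if_splits)
next
  assume a: "AE \<xi> in lborel. \<xi> < 0 \<longrightarrow> rp (Fo f) \<xi> = 0"
  have m: "AE \<xi> in lborel. rp (mop (indicator {0..}) (Fo f)) \<xi> = indicator {0..} \<xi> * rp (Fo f) \<xi>" by (rule rp_mop) simp
  show "Sz f = f" unfolding Sz_def
    apply (rule Fo_inj, unfold Fo_fm, rule l2_eqI) using a m by eventually_elim (auto simp: indicator_def)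
qed

definition rflc :: "l2 \<Rightarrow> l2" where "rflc f = cl (\<lambda>x. rp f (- x))"

lemma L2_reflect: assumes "f \<in> L2" shows "(\<lambda>x. f (- x)) \<in> L2"
  using L2_meas[OF assms] lborel_integrable_real_affine[OF L2_D(2)[OF assms], of "-1" 0]
  by (auto simp: L2_def)

lemma rp_rflc: "AE x in lborel. rp (rflc f) x = rp f (- x)"
  unfolding rflc_def by (rule rp_cl[OF L2_reflect]) simp

lemma rflc_cl: assumes "f \<in> L2" shows "rflc (cl f) = cl (\<lambda>x. f (- x))"
  unfolding rflc_def using AE_reflect[OF rp_cl[OF assms]] by (intro cl_cong L2_reflect assms) auto

lemma bounded_linear_rflc: "bounded_linear rflc"
proof (rule bounded_linear_intro[of _ 1])
  show "rflc (f + g) = rflc f + rflc g" for f g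
    apply (rule l2_eqI) using rp_rflc[of "f + g"] AE_reflect[OF rp_add[of f g]] rp_rflc[of f] rp_rflc[of g] rp_add[of "rflc f" "rflc g"]
    by eventually_elim simp
  show "rflc (r *\<^sub>R f) = r *\<^sub>R rflc f" for r f
    apply (rule l2_eqI) using rp_rflc[of "r *\<^sub>R f"] AE_reflect[OF rp_scaleR[of r f]] rp_rflc[of f] rp_scaleR[of r "rflc f"]
    by eventually_elim simp
  have "norm (rflc f) = norm f" for f
  proof -
    have "norm (rflc f) = L2_norm (\<lambda>x. rp f (- x))" unfolding rflc_def by (rule norm_cl[OF L2_reflect]) simp
    also have "\<dots> = norm f" unfolding norm_l2 L2_norm_def
      using lborel_integral_real_affine[of "-1" "\<lambda>x. (cmod (rp f x))\<^sup>2" 0] by simp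
    finally show ?thesis .
  qed
  then show "norm (rflc f) \<le> norm f * 1" for f by simp
qed

lemma Fo'_rflc: "Fo' f = rflc (Fo f)"
proof (rule tendsto_unique)
  have 1: "Fo' (tr n f) = rflc (Fo (tr n f))" for n
  proof -
    define h where "h = (\<lambda>x. indicator {-n..n} x * rp f x)"
    have h: "h \<in> L2" "integrable lborel h" "tr n f = cl h" 
      using tr_cl[of "rp f" n] by (auto simp: h_def trunc_L2 tr_integrable)
    have "Fo' (cl h) = (2 * pi) *\<^sub>R Fi (cl h)" by (simp add: Fi_def)
    also have "\<dots> = cl (\<lambda>x. ft h (- x))"
    proof -
      have L: "(\<lambda>x. ft h (- x) / of_real (2 * pi)) \<in> L2"
        using L2_cmult[OF Fi_L1(2)[OF h(1,2)], of "1 / of_real (2 * pi)"] by simp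
      show ?thesis unfolding Fi_L1(1)[OF h(1,2)] cs_of_real[symmetric] cl_cmult[OF L, symmetric] by simp
    qed
    finally show ?thesis unfolding h(3) Fo_L1(2)[OF h(1,2)] rflc_cl[OF Fo_L1(1)[OF h(1,2)]] .
  qed
  show "((\<lambda>n. Fo' (tr n f)) \<longlongrightarrow> Fo' f) at_top"
    unfolding Fo'_def by (intro bounded_linear.tendsto[OF bounded_linear_cj] tendsto_Fo tr_lim)
  show "((\<lambda>n. Fo' (tr n f)) \<longlongrightarrow> rflc (Fo f)) at_top"
    unfolding 1 by (intro bounded_linear.tendsto[OF bounded_linear_rflc] tendsto_Fo tr_lim)
qed simp

lemma rp_Fo_cj: "AE \<xi> in lborel. rp (Fo (cj f)) \<xi> = cnj (rp (Fo f) (- \<xi>))"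
proof -
  have "Fo' (cj (cj f)) = rflc (Fo (cj (cj f)))" by (rule Fo'_rflc)
  then have E: "Fo (cj f) = cj (rflc (Fo f))" unfolding Fo'_def by (metis cj_cj)
  show ?thesis unfolding E using rp_cj[of "rflc (Fo f)"] rp_rflc[of "Fo f"] by eventually_elim simp
qed

text \<open>Conjugation reflects the spectrum, so the second summand is the part of \<open>f\<close>
  at frequencies at most 0. The frequency 0 is counted twice, which concerns a null set.\<close>

lemma Sz_plus_cj: "Sz f + cj (Sz (cj f)) = f"
proof (rule Fo_inj, rule l2_eqI)
  have m: "AE \<xi> in lborel. rp (Fo (Sz g)) \<xi> = indicator {0..} \<xi> * rp (Fo g) \<xi>" for g
    unfolding Sz_def Fo_fm by (rule rp_mop) simp
  show "AE x in lborel. rp (Fo (Sz f + cj (Sz (cj f)))) x = rp (Fo f) x"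
    unfolding Fo_add
    using rp_add[of "Fo (Sz f)" "Fo (cj (Sz (cj f)))"] rp_Fo_cj[of "Sz (cj f)"] AE_reflect[OF m[of "cj f"]] 
      AE_reflect[OF rp_Fo_cj[of f]] m[of f] AE_lborel_singleton[of 0]
    by eventually_elim (auto simp: indicator_def)
qed

lemma Sz_ch: assumes "Sz h = h" "0 \<le> a" shows "Sz (mop (ch a) h) = mop (ch a) h"
proof -
  have "AE \<xi> in lborel. \<xi> < 0 \<longrightarrow> rp (Fo h) \<xi> = 0" using assms by (simp add: Sz_eq_iff)
  from AE_shift[OF this, of "- a"] have "AE \<xi> in lborel. \<xi> < 0 \<longrightarrow> rp (Fo (mop (ch a) h)) \<xi> = 0"
    unfolding Fo_mop_ch using rp_tau[of "-a" "Fo h"] by eventually_elim (use assms in auto)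
  then show ?thesis by (simp add: Sz_eq_iff)
qed

lemma Sz_orthI:
  assumes "\<And>k. Sz k = 0 \<Longrightarrow> cip h k = 0" shows "Sz h = h"
proof -
  have "cip h (h - Sz h) = 0" by (rule assms) (simp add: Sz_diff)
  moreover have "cip (Sz h) (h - Sz h) = 0" by (simp add: cip_Sz Sz_diff)
  ultimately have "cip (h - Sz h) (h - Sz h) = 0" by (simp add: cip_diff_left)
  then show ?thesis by (simp add: cip_self_norm)
qed

text \<open>Fourier inversion writes \<open>f\<close> as a superposition of characters of
  nonnegative frequency, and each of these preserves the Hardy space by \<open>Sz_ch\<close>. The
  superposition is evaluated weakly, against vectors \<open>k\<close> that \<open>Sz\<close>
  annihilates.\<close>

lemma Sz_mul:
  assumes f: "hasd f f'" and Sf: "Sz f = f" and Sh: "Sz h = h"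
  shows "Sz (mop (rp f) h) = mop (rp f) h"
proof (rule Sz_orthI)
  fix k assume k: "Sz k = 0"
  \<comment> \<open>The reflection accounts for the argument \<open>- x\<close> in the inversion
    formula \<open>hasd_repr\<close>.\<close>
  define G where "G y = rp h (- y) * cnj (rp k (- y))" for y
  have G: "integrable lborel G" 
    unfolding G_def using lborel_integrable_real_affine[OF integrable_rp[of h k], of "-1" 0] by simp
  have ftG: "ft G \<xi> = cip (mop (ch \<xi>) h) k" for \<xi>
  proof -
    have "ft G \<xi> = (LINT x|lborel. rp h x * cnj (rp k x) * exp (- (\<i> * of_real ((- x) * \<xi>))))"
      unfolding ft_def G_def using lborel_integral_real_affine[of "-1" "\<lambda>x. rp h (- x) * cnj (rp k (- x)) * exp (- (\<i> * of_real (x * \<xi>)))" 0] by simp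
    also have "\<dots> = cip (mop (ch \<xi>) h) k" unfolding cip_def L2_inner_def
      apply (rule integral_cong_AE, measurable)
      using rp_mop[OF bmult_ch[of \<xi>], of h] by eventually_elim (simp add: mult_ac)
    finally show ?thesis .
  qed
  have z: "ft G \<xi> = 0" if "0 \<le> \<xi>" for \<xi>
    unfolding ftG using cip_Sz[of "mop (ch \<xi>) h" k] k Sz_ch[OF Sh that] by simp
  have "of_real (2 * pi) * cip (mop (rp f) h) k = (LINT x|lborel. ft (rp (Fo f)) (- x) * (rp h x * cnj (rp k x)))"
    unfolding cip_def L2_inner_def integral_mult_right_zero[symmetric]
    apply (rule integral_cong_AE, measurable)
    using rp_mop[OF hasd_bmult[OF f], of h] hasd_repr[OF f] by eventually_elim (simp add: field_simps)
  also have "\<dots> = (LINT y|lborel. ft (rp (Fo f)) y * G y)"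
    using lborel_integral_real_affine[of "-1" "\<lambda>x. ft (rp (Fo f)) (- x) * (rp h x * cnj (rp k x))" 0] by (simp add: G_def)
  also have "\<dots> = (LINT \<xi>|lborel. rp (Fo f) \<xi> * ft G \<xi>)"
    by (rule ft_multiplication[OF hasd_Fo_integrable(1)[OF f] G])
  also have "\<dots> = (LINT \<xi>::real|lborel. 0)"
  proof (rule integral_cong_AE)
    show "AE \<xi> in lborel. rp (Fo f) \<xi> * ft G \<xi> = 0"
      using Sf unfolding Sz_eq_iff by eventually_elim (use z in force)
  qed (use borel_measurable_integrable[OF G] in measurable)
  finally show "cip (mop (rp f) h) k = 0" by simp
qed

subsection \<open>The Hilbert transform\<close>

text \<open>The weak type (1,1) bound for the maximal function by Vitali's covering lemma: disjoint
  balls of radius r, each of mass above \<open>\<beta> * r\<close>, cover the set once enlarged to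
  radius 5 r, that is to length 10 r. An open cover takes the place of the set itself, whose
  measurability is not at issue.\<close>

lemma maximal_cover:
  fixes g :: "real \<Rightarrow> ennreal"
  assumes g [measurable]: "g \<in> borel_measurable borel" and b: "\<beta> > 0"
  obtains U where "open U"
    "{x. \<exists>r. 0 < r \<and> r \<le> 1 \<and> ennreal (\<beta> * r) < (\<integral>\<^sup>+y. g y * indicator (cball x r) y \<partial>lborel)} \<subseteq> U"
    "ennreal \<beta> * emeasure lborel U \<le> 10 * (\<integral>\<^sup>+y. g y \<partial>lborel)"
proof -
  define E where "E = {x. \<exists>r. 0 < r \<and> r \<le> 1 \<and> ennreal (\<beta> * r) < (\<integral>\<^sup>+y. g y * indicator (cball x r) y \<partial>lborel)}"
  have "\<forall>x\<in>E. \<exists>r. 0 < r \<and> r \<le> 1 \<and> ennreal (\<beta> * r) < (\<integral>\<^sup>+y. g y * indicator (cball x r) y \<partial>lborel)" by (auto simp: E_def)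
  then obtain r where r: "\<And>x. x \<in> E \<Longrightarrow> 0 < r x \<and> r x \<le> 1"
    "\<And>x. x \<in> E \<Longrightarrow> ennreal (\<beta> * r x) < (\<integral>\<^sup>+y. g y * indicator (cball x (r x)) y \<partial>lborel)" by metis
  obtain C where C: "countable C" "C \<subseteq> E"
     "pairwise (\<lambda>i j. disjnt (cball (id i) (r i)) (cball (id j) (r j))) C"
     "\<And>i. i \<in> E \<Longrightarrow> \<exists>j. j \<in> C \<and> \<not> disjnt (cball (id i) (r i)) (cball (id j) (r j)) \<and> cball (id i) (r i) \<subseteq> ball (id j) (5 * r j)"
    using Vitali_covering_lemma_cballs_balls[of E r 1 id] r(1) by blast
  define U where "U = (\<Union>x\<in>C. ball x (5 * r x))"
  define N where "N = to_nat_on C ` C"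
  define c where "c = from_nat_into C"
  have cN: "c n \<in> C" if "n \<in> N" for n using that C(1) by (auto simp: N_def c_def)
  have cinj: "m = n" if "m \<in> N" "n \<in> N" "c m = c n" for m n
    using that C(1) by (auto simp: N_def c_def)
  define B where "B n = (if n \<in> N then ball (c n) (5 * r (c n)) else {})" for n
  define D where "D n = (if n \<in> N then cball (c n) (r (c n)) else {})" for n
  \<comment> \<open>With \<open>g\<close> as a density, disjointness of the balls becomes additivity
    of a measure bounded by the integral of \<open>g\<close>.\<close>
  define \<nu> where "\<nu> = density lborel g"
  have Bm: "B n \<in> sets lborel" and Dm: "D n \<in> sets \<nu>" for n by (auto simp: B_def D_def \<nu>_def)
  have UB: "U \<subseteq> (\<Union>n. B n)"
  proof
    fix x assume "x \<in> U"
    then obtain y where y: "y \<in> C" "x \<in> ball y (5 * r y)" by (auto simp: U_def)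
    then have "to_nat_on C y \<in> N" "c (to_nat_on C y) = y" using C(1) by (auto simp: N_def c_def)
    then have "x \<in> B (to_nat_on C y)" using y by (simp add: B_def)
    then show "x \<in> (\<Union>n. B n)" by blast
  qed
  have disj: "disjoint_family D"
    unfolding disjoint_family_on_def
  proof (intro ballI impI)
    fix m n :: nat assume "m \<noteq> n"
    show "D m \<inter> D n = {}"
    proof (cases "m \<in> N \<and> n \<in> N")
      case True
      then have "c m \<noteq> c n" using cinj \<open>m \<noteq> n\<close> by blast
      then show ?thesis using C(3) True cN unfolding pairwise_def disjnt_def by (auto simp: D_def)
    qed (auto simp: D_def)
  qed
  have le: "ennreal \<beta> * emeasure lborel (B n) \<le> 10 * emeasure \<nu> (D n)" for n
  proof (cases "n \<in> N")
    case True
    have x: "c n \<in> E" using cN[OF True] C(2) by auto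
    have "emeasure lborel (B n) = ennreal (10 * r (c n))"
      using r(1)[OF x] True by (simp add: B_def ball_eq_greaterThanLessThan)
    then have "ennreal \<beta> * emeasure lborel (B n) = 10 * ennreal (\<beta> * r (c n))"
      using b r(1)[OF x] by (simp add: ennreal_mult[symmetric] ennreal_numeral[symmetric] del: ennreal_numeral)
    also have "\<dots> \<le> 10 * emeasure \<nu> (D n)"
      using r(2)[OF x] True by (intro mult_left_mono) (auto simp: \<nu>_def D_def emeasure_density less_imp_le)
    finally show ?thesis .
  qed (simp add: B_def)
  have "ennreal \<beta> * emeasure lborel U \<le> ennreal \<beta> * emeasure lborel (\<Union>n. B n)"
    using UB Bm by (intro mult_left_mono emeasure_mono) auto
  also have "\<dots> \<le> ennreal \<beta> * (\<Sum>n. emeasure lborel (B n))"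
    using Bm by (intro mult_left_mono emeasure_subadditive_countably) auto
  also have "\<dots> = (\<Sum>n. ennreal \<beta> * emeasure lborel (B n))" by simp
  also have "\<dots> \<le> (\<Sum>n. 10 * emeasure \<nu> (D n))" using le by (intro suminf_le) auto
  also have "\<dots> = 10 * (\<Sum>n. emeasure \<nu> (D n))" by simp
  also have "(\<Sum>n. emeasure \<nu> (D n)) = emeasure \<nu> (\<Union>n. D n)"
    using Dm disj by (intro suminf_emeasure) auto
  also have "\<dots> \<le> emeasure \<nu> (space \<nu>)" by (rule emeasure_space)
  also have "\<dots> = (\<integral>\<^sup>+y. g y \<partial>lborel)" by (simp add: \<nu>_def emeasure_density)
  finally have 1: "ennreal \<beta> * emeasure lborel U \<le> 10 * (\<integral>\<^sup>+y. g y \<partial>lborel)" by (simp add: mult_left_mono)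
  have 2: "E \<subseteq> U"
  proof
    fix x assume x: "x \<in> E"
    then obtain j where j: "j \<in> C" "cball x (r x) \<subseteq> ball j (5 * r j)" using C(4)[OF x] by auto
    moreover have "x \<in> cball x (r x)" using r(1)[OF x] by simp
    ultimately have "x \<in> ball j (5 * r j)" by blast
    then show "x \<in> U" using j(1) unfolding U_def by blast
  qed
  have 3: "open U" unfolding U_def by auto
  from 3 2 1 show ?thesis by (intro that[of U]) (auto simp: E_def)
qed

lemma step_locally_const:
  assumes "step s" shows "AE x in lborel. \<exists>\<delta>>0. \<forall>y\<in>cball x \<delta>. s y = s x"
  using assms
proof (induction rule: step.induct)
  case (step_interval a b)
  show ?case using AE_lborel_singleton[of a] AE_lborel_singleton[of b]
  proof eventually_elim
    case (elim x)
    define d where "d = min \<bar>x - a\<bar> \<bar>x - b\<bar> / 2"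
    have d: "d > 0" using elim by (simp add: d_def)
    have "indicator {a..b} y = (indicator {a..b} x :: complex)" if "y \<in> cball x d" for y
    proof -
      have "\<bar>x - y\<bar> \<le> d" using that by (simp add: dist_real_def)
      moreover have "d \<le> \<bar>x - a\<bar> / 2" "d \<le> \<bar>x - b\<bar> / 2" by (auto simp: d_def)
      moreover have "\<bar>x - a\<bar> > 0" "\<bar>x - b\<bar> > 0" using elim by auto
      ultimately have "\<bar>x - y\<bar> < \<bar>x - a\<bar> \<and> \<bar>x - y\<bar> < \<bar>x - b\<bar>" by (intro conjI; linarith)
      then have "(y \<in> {a..b}) = (x \<in> {a..b})" by auto
      then show ?thesis by (simp add: indicator_def)
    qed
    with d show ?case by blast
  qed
next
  case (step_cmult f c)
  from step_cmult.IH show ?case by eventually_elim (metis (no_types))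
next
  case (step_add f g)
  from step_add.IH show ?case
  proof eventually_elim
    case (elim x)
    then obtain d e where d: "d > 0" "\<forall>y\<in>cball x d. f y = f x" "e > 0" "\<forall>y\<in>cball x e. g y = g x" by blast
    show ?case
    proof (intro exI[of _ "min d e"] conjI ballI)
      show "min d e > 0" using d(1,3) by simp
      fix y assume "y \<in> cball x (min d e)"
      then have "y \<in> cball x d" "y \<in> cball x e" by auto
      then have "f y = f x" "g y = g x" using d(2,4) by blast+
      then show "f y + g y = f x + g x" by (simp only:)
    qed
  qed
qed

lemma cmod_diff_sq_le: "(cmod (a - c))\<^sup>2 \<le> 2 * (cmod (a - b))\<^sup>2 + 2 * (cmod (b - c))\<^sup>2"
proof -
  have "(cmod (a - c))\<^sup>2 \<le> (cmod (a - b) + cmod (b - c))\<^sup>2"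
    using norm_triangle_ineq[of "a - b" "b - c"] by (intro power_mono) auto
  also have "\<dots> \<le> 2 * (cmod (a - b))\<^sup>2 + 2 * (cmod (b - c))\<^sup>2"
    using sum_squares_bound[of "cmod (a - b)" "cmod (b - c)"] by (simp add: power2_sum)
  finally show ?thesis .
qed

text \<open>A Lebesgue point in quadratic mean, up to the error \<open>\<eta>\<close>; the radius
  stands for the length of the ball. The quadratic version fits functions in L^2 and still controls
  integrals against the Poisson kernel.\<close>

definition lpt :: "(real \<Rightarrow> complex) \<Rightarrow> real \<Rightarrow> real \<Rightarrow> bool" where
  "lpt f \<eta> x \<longleftrightarrow> (\<exists>\<delta>>0. \<forall>r. 0 < r \<longrightarrow> r \<le> \<delta> \<longrightarrow>
     (\<integral>\<^sup>+y. ennreal ((cmod (f y - f x))\<^sup>2) * indicator (cball x r) y \<partial>lborel) \<le> ennreal (\<eta> * r))"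

text \<open>Write \<open>f\<close> as a step function \<open>h\<close> plus a remainder small in
  L^2. Off a null set \<open>h\<close> is constant near the point, so only the remainder
  contributes: its means are controlled by \<open>maximal_cover\<close> and its value at the point
  by Markov's inequality.\<close>

lemma lpt_cover:
  assumes f: "f \<in> L2" and eta: "\<eta> > 0" and e: "e > 0"
  obtains W where "W \<in> sets lborel" "{x. \<not> lpt f \<eta> x} \<subseteq> W" "emeasure lborel W \<le> ennreal e"
proof -
  note [measurable] = L2_meas[OF f]
  \<comment> \<open>With this value the sets \<open>U\<close> and \<open>V\<close> below have
    measure at most 5 e / 6 and e / 6.\<close>
  define e' where "e' = e * \<eta> / 48"
  have e': "e' > 0" using e eta by (simp add: e'_def)
  obtain s where s: "\<And>n. step (s n)" "(\<lambda>n. cl (s n)) \<longlonglongrightarrow> cl f" using step_dense[of "cl f"] by blast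
  have "sqrt e' > 0" using e' by simp
  from LIMSEQ_D[OF s(2) this] obtain n where n: "norm (cl (s n) - cl f) < sqrt e'" by blast
  define h where "h = s n"
  have h: "step h" by (simp add: h_def s)
  note [measurable] = step_measurable[OF h]
  define g where "g y = ennreal ((cmod (f y - h y))\<^sup>2)" for y
  have gm [measurable]: "g \<in> borel_measurable borel" unfolding g_def by measurable
  have "(\<integral>\<^sup>+y. g y \<partial>lborel) = ennreal ((norm (cl f - cl h))\<^sup>2)"
    unfolding g_def cl_diff[OF f step_L2[OF h], symmetric] by (rule norm_cl_nn[symmetric, OF L2_diff[OF f step_L2[OF h]]])
  also have "\<dots> \<le> ennreal e'"
  proof (rule ennreal_leI)
    have "(norm (cl f - cl h))\<^sup>2 \<le> (sqrt e')\<^sup>2"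
      using n by (intro power_mono) (auto simp: h_def norm_minus_commute)
    then show "(norm (cl f - cl h))\<^sup>2 \<le> e'" using e' by simp
  qed
  finally have ge: "(\<integral>\<^sup>+y. g y \<partial>lborel) \<le> ennreal e'" .
  have b4: "\<eta> / 4 > 0" using eta by simp
  obtain U where U: "open U" "{x. \<exists>r. 0 < r \<and> r \<le> 1 \<and> ennreal (\<eta> / 4 * r) < (\<integral>\<^sup>+y. g y * indicator (cball x r) y \<partial>lborel)} \<subseteq> U"
    "ennreal (\<eta> / 4) * emeasure lborel U \<le> 10 * (\<integral>\<^sup>+y. g y \<partial>lborel)"
    using maximal_cover[OF gm b4] by blast
  obtain N where N: "{x \<in> space lborel. \<not> (\<exists>\<delta>>0. \<forall>y\<in>cball x \<delta>. h y = h x)} \<subseteq> N" "emeasure lborel N = 0" "N \<in> sets lborel"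
    using step_locally_const[OF h] by (rule AE_E)
  define V where "V = {x\<in>UNIV. 1 \<le> ennreal (8 / \<eta>) * g x}"
  have Vm: "V \<in> sets lborel" unfolding V_def by measurable
  have "emeasure lborel V \<le> ennreal (8 / \<eta>) * (\<integral>\<^sup>+y. g y * indicator UNIV y \<partial>lborel)"
    unfolding V_def by (rule nn_integral_Markov_inequality) auto
  also have "\<dots> \<le> ennreal (8 / \<eta>) * ennreal e'" using ge by (intro mult_left_mono) auto
  also have "\<dots> = ennreal (e / 6)" using eta e' by (simp add: ennreal_mult[symmetric] e'_def)
  finally have Ve: "emeasure lborel V \<le> ennreal (e / 6)" .
  have Ue: "emeasure lborel U \<le> ennreal (5 * e / 6)"
  proof -
    have "ennreal (4 / \<eta>) * (ennreal (\<eta> / 4) * emeasure lborel U) \<le> ennreal (4 / \<eta>) * (10 * ennreal e')"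
      using order_trans[OF U(3) mult_left_mono[OF ge]] by (intro mult_left_mono) auto
    also have "\<dots> = ennreal (5 * e / 6)"
      using eta e' e by (simp add: ennreal_mult[symmetric] ennreal_numeral[symmetric] e'_def del: ennreal_numeral)
    also have "ennreal (4 / \<eta>) * (ennreal (\<eta> / 4) * emeasure lborel U) = ennreal (4 / \<eta> * (\<eta> / 4)) * emeasure lborel U"
      using eta by (subst ennreal_mult) (auto simp: mult.assoc)
    finally show ?thesis using eta by simp
  qed
  define W where "W = U \<union> V \<union> N"
  have Wm: "W \<in> sets lborel" unfolding W_def using U(1) Vm N(3) by auto
  have "emeasure lborel W \<le> emeasure lborel U + emeasure lborel V + emeasure lborel N"
    unfolding W_def using U(1) Vm N(3)
    by (intro order_trans[OF emeasure_subadditive] add_mono emeasure_subadditive) auto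
  also have "\<dots> \<le> ennreal (5 * e / 6) + ennreal (e / 6) + 0" using Ue Ve N(2) by (intro add_mono) auto
  also have "\<dots> = ennreal e" using e by (simp add: ennreal_plus[symmetric] del: ennreal_plus)
  finally have We: "emeasure lborel W \<le> ennreal e" .
  have "lpt f \<eta> x" if x: "x \<notin> W" for x
  proof -
    have xU: "\<And>r. 0 < r \<Longrightarrow> r \<le> 1 \<Longrightarrow> (\<integral>\<^sup>+y. g y * indicator (cball x r) y \<partial>lborel) \<le> ennreal (\<eta> / 4 * r)"
      using x U(2) unfolding W_def by (fastforce simp: not_less[symmetric])
    have "\<exists>\<delta>>0. \<forall>y\<in>cball x \<delta>. h y = h x" 
    proof (rule ccontr)
      assume "\<not> (\<exists>\<delta>>0. \<forall>y\<in>cball x \<delta>. h y = h x)"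
      then have "x \<in> {x \<in> space lborel. \<not> (\<exists>\<delta>>0. \<forall>y\<in>cball x \<delta>. h y = h x)}" by (intro CollectI conjI) simp_all
      then show False using x N(1) unfolding W_def by blast
    qed
    then obtain d where d: "d > 0" "\<And>y. y \<in> cball x d \<Longrightarrow> h y = h x" by blast
    have "\<not> (1 \<le> ennreal (8 / \<eta>) * g x)" using x unfolding W_def V_def by auto
    moreover have "ennreal (8 / \<eta> * (cmod (f x - h x))\<^sup>2) = ennreal (8 / \<eta>) * g x"
      unfolding g_def using eta by (intro ennreal_mult) auto
    ultimately have "\<not> (ennreal 1 \<le> ennreal (8 / \<eta> * (cmod (f x - h x))\<^sup>2))" by simp
    then have "8 / \<eta> * (cmod (f x - h x))\<^sup>2 < 1" using ennreal_leI not_le by blast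
    then have fx: "(cmod (h x - f x))\<^sup>2 \<le> \<eta> / 8" using eta by (simp add: field_simps norm_minus_commute)
    show ?thesis unfolding lpt_def
    proof (intro exI[of _ "min 1 d"] conjI allI impI)
      show "0 < min 1 d" using d by simp
      fix r assume r: "0 < r" "r \<le> min 1 d"
      have [measurable]: "cball x r \<in> sets borel" by simp
      have "(\<integral>\<^sup>+y. ennreal ((cmod (f y - f x))\<^sup>2) * indicator (cball x r) y \<partial>lborel) \<le>
         (\<integral>\<^sup>+y. 2 * (g y * indicator (cball x r) y) + ennreal (\<eta> / 4) * indicator (cball x r) y \<partial>lborel)"
      proof (rule nn_integral_mono)
        fix y
        show "ennreal ((cmod (f y - f x))\<^sup>2) * indicator (cball x r) y \<le> 2 * (g y * indicator (cball x r) y) + ennreal (\<eta> / 4) * indicator (cball x r) y"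
        proof (cases "y \<in> cball x r")
          case True
          then have "h y = h x" using r by (intro d) auto
          have "(cmod (f y - f x))\<^sup>2 \<le> 2 * (cmod (f y - h y))\<^sup>2 + 2 * (cmod (h y - f x))\<^sup>2" by (rule cmod_diff_sq_le)
          also have "\<dots> \<le> 2 * (cmod (f y - h y))\<^sup>2 + \<eta> / 4" using fx unfolding \<open>h y = h x\<close> by simp
          finally have "ennreal ((cmod (f y - f x))\<^sup>2) \<le> ennreal (2 * (cmod (f y - h y))\<^sup>2 + \<eta> / 4)" by (rule ennreal_leI)
          also have "\<dots> = 2 * g y + ennreal (\<eta> / 4)" using eta by (simp add: g_def ennreal_mult' ennreal_plus)
          finally show ?thesis using True by simp
        qed simp
      qed
      also have "\<dots> = 2 * (\<integral>\<^sup>+y. g y * indicator (cball x r) y \<partial>lborel) + ennreal (\<eta> / 4) * emeasure lborel (cball x r)"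
        by (simp add: nn_integral_add nn_integral_cmult nn_integral_cmult_indicator)
      also have "\<dots> \<le> 2 * ennreal (\<eta> / 4 * r) + ennreal (\<eta> / 4) * ennreal (2 * r)"
        using r xU[of r] by (intro add_mono mult_left_mono) (auto simp: cball_eq_atLeastAtMost)
      also have "\<dots> = ennreal (2 * (\<eta> / 4 * r) + \<eta> / 4 * (2 * r))"
      proof -
        have "2 * ennreal (\<eta> / 4 * r) = ennreal (2 * (\<eta> / 4 * r))" using eta r by (subst ennreal_mult) auto
        moreover have "ennreal (\<eta> / 4) * ennreal (2 * r) = ennreal (\<eta> / 4 * (2 * r))" using eta r by (subst ennreal_mult) auto
        ultimately show ?thesis using eta r by (subst ennreal_plus) auto
      qed
      also have "2 * (\<eta> / 4 * r) + \<eta> / 4 * (2 * r) = \<eta> * r" by simp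
      finally show "(\<integral>\<^sup>+y. ennreal ((cmod (f y - f x))\<^sup>2) * indicator (cball x r) y \<partial>lborel) \<le> ennreal (\<eta> * r)" .
    qed
  qed
  then have "{x. \<not> lpt f \<eta> x} \<subseteq> W" by auto
  with Wm We show ?thesis using that by blast
qed

text \<open>Covers of measure 1 / (1 + n) intersect in a null set, and the property weakens as
  \<open>\<eta>\<close> grows, so that a sequence of values tending to 0 decides all of
  them.\<close>

lemma lpt_AE: assumes f: "f \<in> L2" shows "AE x in lborel. \<forall>\<eta>>0. lpt f \<eta> x"
proof -
  have one: "AE x in lborel. lpt f \<eta> x" if eta: "\<eta> > 0" for \<eta>
  proof -
    have "\<forall>n. \<exists>W. W \<in> sets lborel \<and> {x. \<not> lpt f \<eta> x} \<subseteq> W \<and> emeasure lborel W \<le> ennreal (1 / (1 + real n))"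
    proof
      fix n :: nat
      have "1 / (1 + real n) > 0" by simp
      from lpt_cover[OF f eta this] show "\<exists>W. W \<in> sets lborel \<and> {x. \<not> lpt f \<eta> x} \<subseteq> W \<and> emeasure lborel W \<le> ennreal (1 / (1 + real n))" by metis
    qed
    then obtain W where W: "\<And>n. W n \<in> sets lborel" "\<And>n. {x. \<not> lpt f \<eta> x} \<subseteq> W n" "\<And>n. emeasure lborel (W n) \<le> ennreal (1 / (1 + real n))"
      by metis
    have "emeasure lborel (\<Inter>n. W n) \<le> 0"
    proof (rule LIMSEQ_le_const)
      have "(\<lambda>n. 1 / (1 + real n)) \<longlonglongrightarrow> 0" by real_asymp
      from tendsto_ennrealI[OF this] show "(\<lambda>n. ennreal (1 / (1 + real n))) \<longlonglongrightarrow> 0" by simp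
      show "\<exists>N. \<forall>n\<ge>N. emeasure lborel (\<Inter>n. W n) \<le> ennreal (1 / (1 + real n))"
        using W by (intro exI[of _ 0] allI impI order_trans[OF emeasure_mono W(3)]) auto
    qed
    then have "(\<Inter>n. W n) \<in> null_sets lborel" using W(1) by auto
    then show ?thesis using W(2) by (intro AE_I'[of "\<Inter>n. W n"]) auto
  qed
  have "AE x in lborel. \<forall>n::nat. lpt f (1 / (1 + real n)) x" unfolding AE_all_countable using one by simp
  then show ?thesis
  proof eventually_elim
    case (elim x)
    show ?case
    proof (intro allI impI)
      fix \<eta> :: real assume eta: "\<eta> > 0"
      obtain n where n: "1 / (1 + real n) < \<eta>" using reals_Archimedean[OF eta] by (auto simp: inverse_eq_divide)
      from elim[rule_format, of n] obtain d where d: "d > 0" "\<And>r. 0 < r \<Longrightarrow> r \<le> d \<Longrightarrow>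
         (\<integral>\<^sup>+y. ennreal ((cmod (f y - f x))\<^sup>2) * indicator (cball x r) y \<partial>lborel) \<le> ennreal (1 / (1 + real n) * r)"
        unfolding lpt_def by blast
      have "(\<integral>\<^sup>+y. ennreal ((cmod (f y - f x))\<^sup>2) * indicator (cball x r) y \<partial>lborel) \<le> ennreal (\<eta> * r)" if "0 < r" "r \<le> d" for r
      proof -
        have "1 / (1 + real n) * r \<le> \<eta> * r" using n that by (intro mult_right_mono) auto
        from order_trans[OF d(2)[OF that] ennreal_leI[OF this]] show ?thesis .
      qed
      then show "lpt f \<eta> x" unfolding lpt_def using d(1) by blast
    qed
  qed
qed

section \<open>Poisson averages at Lebesgue points (\<open>qk\<close> is pi times the Poisson
  kernel)\<close>

definition qk :: "real \<Rightarrow> real \<Rightarrow> real" where "qk \<epsilon> y = \<epsilon> / (y\<^sup>2 + \<epsilon>\<^sup>2)"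

lemma qk_nonneg: "\<epsilon> > 0 \<Longrightarrow> 0 \<le> qk \<epsilon> y" by (simp add: qk_def)

lemma qk_measurable [measurable]: "qk \<epsilon> \<in> borel_measurable borel" unfolding qk_def by measurable

text \<open>Near \<open>x\<close> the kernel is majorised by a series of constants on balls of
  dyadic radii \<open>2 ^ j * \<epsilon>\<close>. The hypothesis bounds the j-th term by
  \<open>4 * \<eta> * (1/2) ^ j\<close>, uniformly in \<open>\<epsilon>\<close>.\<close>

lemma qk_dyadic:
  fixes g :: "real \<Rightarrow> ennreal"
  assumes g [measurable]: "g \<in> borel_measurable borel" and eta: "\<eta> \<ge> 0" and d: "\<delta> > 0" and e: "\<epsilon> > 0"
    and le: "\<And>r. 0 < r \<Longrightarrow> r \<le> \<delta> \<Longrightarrow> (\<integral>\<^sup>+y. g y * indicator (cball x r) y \<partial>lborel) \<le> ennreal (\<eta> * r)"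
  shows "(\<integral>\<^sup>+y. g y * indicator (cball x \<delta>) y * ennreal (qk \<epsilon> (y - x)) \<partial>lborel) \<le> ennreal (8 * \<eta>)"
proof -
  define R where "R j = min (2 ^ j * \<epsilon>) \<delta>" for j :: nat
  \<comment> \<open>If j >= 1 is the least index with |y - x| <= 2^j eps, then |y - x| > 2^(j-1)
    eps, so the kernel is at most eps / (4^(j-1) eps^2) = 4 (1/4)^j / eps; for j = 0 its maximum 1 /
    eps is smaller still.\<close>
  define c where "c j = 4 * (1/4) ^ j / \<epsilon>" for j :: nat
  have c0: "c j \<ge> 0" for j using e by (simp add: c_def)
  have R0: "R j > 0" "R j \<le> \<delta>" "R j \<le> 2 ^ j * \<epsilon>" for j using e d by (auto simp: R_def)
  have [measurable]: "cball x (R j) \<in> sets borel" for j by simp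
  have pt: "g y * indicator (cball x \<delta>) y * ennreal (qk \<epsilon> (y - x)) \<le> (\<Sum>j. ennreal (c j) * (g y * indicator (cball x (R j)) y))" for y
  proof (cases "y \<in> cball x \<delta>")
    case True
    have yd: "\<bar>y - x\<bar> \<le> \<delta>" using True by (simp add: dist_real_def abs_minus_commute)
    have "\<exists>j. \<bar>y - x\<bar> \<le> 2 ^ j * \<epsilon> \<and> qk \<epsilon> (y - x) \<le> c j"
    proof -
      obtain m :: nat where "\<bar>y - x\<bar> / \<epsilon> < 2 ^ m" using real_arch_pow[of 2 "\<bar>y - x\<bar> / \<epsilon>"] by auto
      then have ex: "\<exists>j. \<bar>y - x\<bar> \<le> 2 ^ j * \<epsilon>" using e by (intro exI[of _ m]) (simp add: field_simps)
      define j where "j = (LEAST j. \<bar>y - x\<bar> \<le> 2 ^ j * \<epsilon>)"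
      have j: "\<bar>y - x\<bar> \<le> 2 ^ j * \<epsilon>" unfolding j_def using ex by (rule LeastI_ex)
      have "qk \<epsilon> (y - x) \<le> c j"
      proof (cases j)
        case 0
        have "qk \<epsilon> (y - x) \<le> \<epsilon> / \<epsilon>\<^sup>2" unfolding qk_def using e by (intro divide_left_mono) (auto intro!: mult_pos_pos add_nonneg_pos)
        also have "\<dots> \<le> c j" using e by (simp add: 0 c_def power2_eq_square field_simps)
        finally show ?thesis .
      next
        case (Suc i)
        have "i < j" using Suc by simp
        then have i: "2 ^ i * \<epsilon> < \<bar>y - x\<bar>" using not_less_Least[of i "\<lambda>j. \<bar>y - x\<bar> \<le> 2 ^ j * \<epsilon>"] unfolding j_def by simp
        have "(2 ^ i * \<epsilon>)\<^sup>2 \<le> (y - x)\<^sup>2" using i e by (subst abs_le_square_iff[symmetric]) auto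
        then have "(2 ^ i * \<epsilon>)\<^sup>2 \<le> (y - x)\<^sup>2 + \<epsilon>\<^sup>2" by (smt (verit) zero_le_power2)
        then have "qk \<epsilon> (y - x) \<le> \<epsilon> / (2 ^ i * \<epsilon>)\<^sup>2" unfolding qk_def using e
          by (intro divide_left_mono) (auto intro!: mult_pos_pos add_nonneg_pos)
        also have "\<dots> = c j"
        proof -
          have "((2::real) ^ i)\<^sup>2 = 4 ^ i" by (simp add: power2_eq_square flip: power_mult_distrib)
          then show ?thesis using e by (simp add: Suc c_def power_mult_distrib power_one_over) (simp add: power2_eq_square)
        qed
        finally show ?thesis .
      qed
      with j show ?thesis by blast
    qed
    then obtain j where j: "\<bar>y - x\<bar> \<le> 2 ^ j * \<epsilon>" "qk \<epsilon> (y - x) \<le> c j" by blast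
    have yR: "y \<in> cball x (R j)" using j(1) yd by (simp add: R_def dist_real_def abs_minus_commute)
    have single: "(\<Sum>j\<in>{k}. f j) \<le> suminf f" for k and f :: "nat \<Rightarrow> ennreal"
      by (rule sum_le_suminf) auto
    have "g y * indicator (cball x \<delta>) y * ennreal (qk \<epsilon> (y - x)) \<le> ennreal (c j) * (g y * indicator (cball x (R j)) y)"
      using True yR j(2) by (simp add: mult.commute[of "g y"] ennreal_leI mult_right_mono)
    also have "\<dots> \<le> (\<Sum>j. ennreal (c j) * (g y * indicator (cball x (R j)) y))"
      using single[of "\<lambda>j. ennreal (c j) * (g y * indicator (cball x (R j)) y)" j] by (simp only: sum.insert sum.empty finite.emptyI empty_iff not_False_eq_True add_0_right)
    finally show ?thesis .
  qed simp
  have "(\<integral>\<^sup>+y. g y * indicator (cball x \<delta>) y * ennreal (qk \<epsilon> (y - x)) \<partial>lborel) \<le>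
      (\<integral>\<^sup>+y. (\<Sum>j. ennreal (c j) * (g y * indicator (cball x (R j)) y)) \<partial>lborel)" by (rule nn_integral_mono[OF pt])
  also have "\<dots> = (\<Sum>j. \<integral>\<^sup>+y. ennreal (c j) * (g y * indicator (cball x (R j)) y) \<partial>lborel)"
    by (rule nn_integral_suminf) measurable
  also have "\<dots> = (\<Sum>j. ennreal (c j) * (\<integral>\<^sup>+y. g y * indicator (cball x (R j)) y \<partial>lborel))"
    by (simp add: nn_integral_cmult)
  also have "\<dots> \<le> (\<Sum>j. ennreal (4 * \<eta> * (1/2) ^ j))"
  proof (rule suminf_le)
    fix j
    have "ennreal (c j) * (\<integral>\<^sup>+y. g y * indicator (cball x (R j)) y \<partial>lborel) \<le> ennreal (c j) * ennreal (\<eta> * (2 ^ j * \<epsilon>))"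
      using R0[of j] eta by (intro mult_left_mono order_trans[OF le ennreal_leI] mult_left_mono) auto
    also have "\<dots> = ennreal (c j * (\<eta> * (2 ^ j * \<epsilon>)))" using c0 eta e by (simp add: ennreal_mult)
    also have "c j * (\<eta> * (2 ^ j * \<epsilon>)) = 4 * \<eta> * ((1/4) ^ j * 2 ^ j)" using e by (simp add: c_def)
    also have "((1/4::real) ^ j * 2 ^ j) = (1/2) ^ j" by (simp flip: power_mult_distrib)
    finally show "ennreal (c j) * (\<integral>\<^sup>+y. g y * indicator (cball x (R j)) y \<partial>lborel) \<le> ennreal (4 * \<eta> * (1/2) ^ j)" .
  qed auto
  also have "\<dots> = ennreal (\<Sum>j. 4 * \<eta> * (1/2) ^ j)"
    using eta by (intro suminf_ennreal2 summable_mult summable_geometric) auto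
  also have "(\<Sum>j. 4 * \<eta> * (1/2::real) ^ j) = 8 * \<eta>" by (subst suminf_mult) (auto simp: suminf_geometric summable_geometric)
  finally show ?thesis .
qed

lemma pk_eq: "pk \<epsilon> y = 2 * qk \<epsilon> y" by (simp add: qk_def pk_def)

lemma qk_le_kap:
  assumes e: "\<epsilon> > 0" and d: "\<delta> > 0" and u: "\<delta> < \<bar>u\<bar>"
  shows "qk \<epsilon> u \<le> \<epsilon> * (1 + 1 / \<delta>)\<^sup>2 * (cmod (kap u))\<^sup>2"
proof -
  have "1 \<le> \<bar>u\<bar> / \<delta>" using u d by (simp add: field_simps)
  then have "1 + \<bar>u\<bar> \<le> (1 + 1 / \<delta>) * \<bar>u\<bar>" by (simp add: algebra_simps)
  then have "(1 + \<bar>u\<bar>)\<^sup>2 \<le> ((1 + 1 / \<delta>) * \<bar>u\<bar>)\<^sup>2" by (intro power_mono) auto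
  then have "(1 + \<bar>u\<bar>)\<^sup>2 \<le> (1 + 1 / \<delta>)\<^sup>2 * u\<^sup>2" by (simp add: power_mult_distrib)
  moreover have u2: "u\<^sup>2 > 0" "(1 + \<bar>u\<bar>)\<^sup>2 > 0" using u d by (auto intro!: zero_less_power)
  ultimately have "1 / u\<^sup>2 \<le> (1 + 1 / \<delta>)\<^sup>2 / (1 + \<bar>u\<bar>)\<^sup>2" by (simp add: field_simps)
  moreover have "qk \<epsilon> u \<le> \<epsilon> * (1 / u\<^sup>2)" unfolding qk_def using e u2 by (simp add: frac_le)
  ultimately have "qk \<epsilon> u \<le> \<epsilon> * ((1 + 1 / \<delta>)\<^sup>2 / (1 + \<bar>u\<bar>)\<^sup>2)"
    using e by (meson mult_left_mono less_imp_le order_trans)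
  moreover have "(cmod (kap u))\<^sup>2 = 1 / (1 + \<bar>u\<bar>)\<^sup>2" unfolding kap_def norm_of_real by (simp add: power_divide)
  ultimately show ?thesis by simp
qed

lemma kap_le_1: "(cmod (kap u))\<^sup>2 \<le> 1"
  unfolding kap_def norm_of_real by (simp add: power_le_one)

lemma lborel_nn_shift: 
  assumes [measurable]: "g \<in> borel_measurable borel"
  shows "(\<integral>\<^sup>+y. g (y - x :: real) \<partial>lborel) = (\<integral>\<^sup>+y. g y \<partial>lborel)"
  using nn_integral_real_affine[of g 1 "-x"] by (simp add: add.commute)

text \<open>Away from \<open>x\<close> the kernel is \<open>\<epsilon>\<close> times a multiple of
  the square of \<open>kap\<close>, which is bounded, to serve the square of f(y), and integrable,
  to serve the constant f(x).\<close>

lemma qk_tail: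
  assumes f: "f \<in> L2" and d: "\<delta> > 0"
  shows "\<exists>C. \<forall>\<epsilon>>0. (\<integral>\<^sup>+y. ennreal ((cmod (f y - f x))\<^sup>2) * indicator (- cball x \<delta>) y * ennreal (qk \<epsilon> (y - x)) \<partial>lborel) \<le> ennreal (\<epsilon> * C) \<and> 0 \<le> C"
proof -
  note [measurable] = L2_meas[OF f]
  have [measurable]: "cball x \<delta> \<in> sets borel" by simp
  define A where "A = (1 + 1 / \<delta>)\<^sup>2"
  have A: "A \<ge> 0" by (simp add: A_def)
  define C where "C = A * (2 * (norm (cl f))\<^sup>2 + 2 * (cmod (f x))\<^sup>2 * (norm (cl kap))\<^sup>2)"
  have "(\<integral>\<^sup>+y. ennreal ((cmod (f y - f x))\<^sup>2) * indicator (- cball x \<delta>) y * ennreal (qk \<epsilon> (y - x)) \<partial>lborel) \<le> ennreal (\<epsilon> * C)" if e: "\<epsilon> > 0" for \<epsilon>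
  proof -
    have km: "kap \<in> borel_measurable borel" by (rule L2_meas[OF kap_L2])
    note [measurable] = km
    have "(\<integral>\<^sup>+y. ennreal ((cmod (f y - f x))\<^sup>2) * indicator (- cball x \<delta>) y * ennreal (qk \<epsilon> (y - x)) \<partial>lborel)
      \<le> (\<integral>\<^sup>+y. ennreal (2 * \<epsilon> * A) * ennreal ((cmod (f y))\<^sup>2) + ennreal (2 * \<epsilon> * A * (cmod (f x))\<^sup>2) * ennreal ((cmod (kap (y - x)))\<^sup>2) \<partial>lborel)"
    proof (rule nn_integral_mono)
      fix y
      show "ennreal ((cmod (f y - f x))\<^sup>2) * indicator (- cball x \<delta>) y * ennreal (qk \<epsilon> (y - x)) \<le>
        ennreal (2 * \<epsilon> * A) * ennreal ((cmod (f y))\<^sup>2) + ennreal (2 * \<epsilon> * A * (cmod (f x))\<^sup>2) * ennreal ((cmod (kap (y - x)))\<^sup>2)"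
      proof (cases "y \<in> cball x \<delta>")
        case False
        then have u: "\<delta> < \<bar>y - x\<bar>" by (simp add: dist_real_def abs_minus_commute)
        define k where "k = (cmod (kap (y - x)))\<^sup>2"
        have k: "0 \<le> k" "k \<le> 1" using kap_le_1 by (auto simp: k_def)
        have q: "qk \<epsilon> (y - x) \<le> \<epsilon> * A * k" using qk_le_kap[OF e d u] by (simp add: A_def k_def)
        have "(cmod (f y - f x))\<^sup>2 \<le> 2 * (cmod (f y))\<^sup>2 + 2 * (cmod (f x))\<^sup>2"
          using cmod_diff_sq_le[of "f y" "f x" 0] by simp
        then have "(cmod (f y - f x))\<^sup>2 * qk \<epsilon> (y - x) \<le> (2 * (cmod (f y))\<^sup>2 + 2 * (cmod (f x))\<^sup>2) * (\<epsilon> * A * k)"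
          using q qk_nonneg[OF e] by (intro mult_mono) auto
        also have "\<dots> = 2 * \<epsilon> * A * (cmod (f y))\<^sup>2 * k + 2 * \<epsilon> * A * (cmod (f x))\<^sup>2 * k" by (simp add: algebra_simps)
        also have "\<dots> \<le> 2 * \<epsilon> * A * (cmod (f y))\<^sup>2 * 1 + 2 * \<epsilon> * A * (cmod (f x))\<^sup>2 * k"
          using e A k by (intro add_mono mult_left_mono) auto
        finally have "ennreal ((cmod (f y - f x))\<^sup>2 * qk \<epsilon> (y - x)) \<le> ennreal (2 * \<epsilon> * A * (cmod (f y))\<^sup>2 + 2 * \<epsilon> * A * (cmod (f x))\<^sup>2 * k)"
          by (intro ennreal_leI) simp
        then show ?thesis using False e A k qk_nonneg[OF e, of "y - x"] 
          by (simp add: ennreal_mult ennreal_plus k_def[symmetric])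
      qed simp
    qed
    also have "\<dots> = ennreal (2 * \<epsilon> * A) * (\<integral>\<^sup>+y. ennreal ((cmod (f y))\<^sup>2) \<partial>lborel) + ennreal (2 * \<epsilon> * A * (cmod (f x))\<^sup>2) * (\<integral>\<^sup>+y. ennreal ((cmod (kap (y - x)))\<^sup>2) \<partial>lborel)"
      by (simp add: nn_integral_add nn_integral_cmult)
    also have "(\<integral>\<^sup>+y. ennreal ((cmod (kap (y - x)))\<^sup>2) \<partial>lborel) = (\<integral>\<^sup>+y. ennreal ((cmod (kap y))\<^sup>2) \<partial>lborel)"
      by (rule lborel_nn_shift[of "\<lambda>y. ennreal ((cmod (kap y))\<^sup>2)"]) measurable
    also have "ennreal (2 * \<epsilon> * A) * (\<integral>\<^sup>+y. ennreal ((cmod (f y))\<^sup>2) \<partial>lborel) + ennreal (2 * \<epsilon> * A * (cmod (f x))\<^sup>2) * (\<integral>\<^sup>+y. ennreal ((cmod (kap y))\<^sup>2) \<partial>lborel)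
      = ennreal (\<epsilon> * C)"
      unfolding norm_cl_nn[OF f, symmetric] norm_cl_nn[OF kap_L2, symmetric] C_def using e A
      by (simp add: ennreal_mult[symmetric] ennreal_plus[symmetric] del: ennreal_plus) (simp add: algebra_simps)
    finally show ?thesis .
  qed
  moreover have "C \<ge> 0" using A by (simp add: C_def)
  ultimately show ?thesis by blast
qed

lemma nn_integral_qk: assumes e: "\<epsilon> > 0" shows "(\<integral>\<^sup>+y. ennreal (qk \<epsilon> (y - x)) \<partial>lborel) = ennreal pi"
proof -
  have half: "(\<integral>\<^sup>+y. ennreal (qk \<epsilon> y) * indicator {0..} y \<partial>lborel) = ennreal (pi / 2)"
  proof -
    have "(\<integral>\<^sup>+y. ennreal (qk \<epsilon> y) * indicator {0..} y \<partial>lborel) = ennreal (pi / 2 - arctan (0 / \<epsilon>))"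
    proof (rule nn_integral_FTC_atLeast)
      fix y :: real
      have nz: "y\<^sup>2 + \<epsilon>\<^sup>2 > 0" using e by (simp add: add_nonneg_pos)
      have "1 + (y / \<epsilon>)\<^sup>2 = (y\<^sup>2 + \<epsilon>\<^sup>2) / \<epsilon>\<^sup>2" using e by (simp add: field_simps)
      then have "inverse (1 + (y / \<epsilon>)\<^sup>2) * (1 / \<epsilon>) = qk \<epsilon> y"
        using e nz by (simp add: qk_def field_simps power2_eq_square)
      then show "DERIV (\<lambda>y. arctan (y / \<epsilon>)) y :> qk \<epsilon> y"
        using e by (auto intro!: derivative_eq_intros)
      show "0 \<le> qk \<epsilon> y" by (rule qk_nonneg[OF e])
    next
      show "((\<lambda>y. arctan (y / \<epsilon>)) \<longlongrightarrow> pi / 2) at_top" using e by real_asymp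
    qed simp
    then show ?thesis by simp
  qed
  have "(\<integral>\<^sup>+y. ennreal (qk \<epsilon> y) * indicator {..0} y \<partial>lborel) = (\<integral>\<^sup>+y. ennreal (qk \<epsilon> y) * indicator {0..} y \<partial>lborel)"
    using nn_integral_real_affine[of "\<lambda>y. ennreal (qk \<epsilon> y) * indicator {..0} y" "-1" 0]
    by (simp add: qk_def indicator_def)
  then have "(\<integral>\<^sup>+y. ennreal (qk \<epsilon> y) * indicator {0..} y + ennreal (qk \<epsilon> y) * indicator {..0} y \<partial>lborel) = ennreal (pi / 2) + ennreal (pi / 2)"
    by (subst nn_integral_add) (auto simp: half)
  moreover have "(\<integral>\<^sup>+y. ennreal (qk \<epsilon> y) * indicator {0..} y + ennreal (qk \<epsilon> y) * indicator {..0} y \<partial>lborel) = (\<integral>\<^sup>+y. ennreal (qk \<epsilon> y) \<partial>lborel)"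
  proof (rule nn_integral_cong_AE)
    show "AE y in lborel. ennreal (qk \<epsilon> y) * indicator {0..} y + ennreal (qk \<epsilon> y) * indicator {..0} y = ennreal (qk \<epsilon> y)"
      using AE_lborel_singleton[of 0] by eventually_elim (auto simp: indicator_def)
  qed
  ultimately have "(\<integral>\<^sup>+y. ennreal (qk \<epsilon> y) \<partial>lborel) = ennreal pi" by (simp flip: ennreal_plus)
  then show ?thesis using lborel_nn_shift[of "\<lambda>y. ennreal (qk \<epsilon> y)" x] by simp
qed

lemma integrable_qk: assumes e: "\<epsilon> > 0" shows "integrable lborel (\<lambda>y. qk \<epsilon> (y - x))" "(LINT y|lborel. qk \<epsilon> (y - x)) = pi"
proof -
  show i: "integrable lborel (\<lambda>y. qk \<epsilon> (y - x))"
    using nn_integral_qk[OF e, of x] qk_nonneg[OF e] by (intro integrableI_bounded) auto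
  show "(LINT y|lborel. qk \<epsilon> (y - x)) = pi"
    using nn_integral_eq_integral[OF i] nn_integral_qk[OF e, of x] qk_nonneg[OF e] 
    by (simp add: ennreal_inj integral_nonneg_AE)
qed

lemma qk_L2: assumes e: "\<epsilon> > 0" shows "(\<lambda>y. complex_of_real (qk \<epsilon> (y - x))) \<in> L2"
proof -
  have "integrable lborel (\<lambda>y. (cmod (complex_of_real (qk \<epsilon> (y - x))))\<^sup>2)"
  proof (rule Bochner_Integration.integrable_bound)
    show "integrable lborel (\<lambda>y. (1 / \<epsilon>) * qk \<epsilon> (y - x))" using integrable_qk(1)[OF e] by (intro integrable_mult_right)
    have "(qk \<epsilon> u)\<^sup>2 \<le> 1 / \<epsilon> * qk \<epsilon> u" for u
      unfolding power2_eq_square using qk_nonneg[OF e, of u] pk_le(2)[OF e, of u] by (intro mult_right_mono) (auto simp: pk_eq)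
    then show "AE y in lborel. norm ((cmod (complex_of_real (qk \<epsilon> (y - x))))\<^sup>2) \<le> norm (1 / \<epsilon> * qk \<epsilon> (y - x))"
      using qk_nonneg[OF e] e by auto
  qed measurable
  then show ?thesis by (simp add: L2_def)
qed

text \<open>The quadratic mean tends to 0 by \<open>qk_dyadic\<close> near the point and
  \<open>qk_tail\<close> away from it. As the kernel has total mass pi, the inequality a <= v / 2 +
  a^2 / (2 v) passes from squares to first powers.\<close>

lemma qk_L1_lim:
  assumes f: "f \<in> L2" and x: "\<forall>\<eta>>0. lpt f \<eta> x"
  shows "\<And>\<epsilon>. \<epsilon> > 0 \<Longrightarrow> integrable lborel (\<lambda>y. cmod (f y - f x) * qk \<epsilon> (y - x))"
    "((\<lambda>\<epsilon>. LINT y|lborel. cmod (f y - f x) * qk \<epsilon> (y - x)) \<longlongrightarrow> 0) (at_right 0)"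
proof -
  note [measurable] = L2_meas[OF f]
  show int: "integrable lborel (\<lambda>y. cmod (f y - f x) * qk \<epsilon> (y - x))" if e: "\<epsilon> > 0" for \<epsilon>
  proof -
    have "integrable lborel (\<lambda>y. f y * complex_of_real (qk \<epsilon> (y - x)) - f x * complex_of_real (qk \<epsilon> (y - x)))"
      using integrable_qk(1)[OF e, of x] by (intro Bochner_Integration.integrable_diff L2_integrable_mult[OF f qk_L2[OF e]] integrable_mult_right integrable_of_real)
    from integrable_norm[OF this] show ?thesis
      by (simp add: norm_mult qk_nonneg[OF e] flip: left_diff_distrib)
  qed
  show "((\<lambda>\<epsilon>. LINT y|lborel. cmod (f y - f x) * qk \<epsilon> (y - x)) \<longlongrightarrow> 0) (at_right 0)"
  proof (rule tendstoI)
    fix \<theta> :: real assume th: "\<theta> > 0"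
    \<comment> \<open>The final bound is v pi / 2 + v / 2, at most 5 v / 2 because pi < 4. The
      choices of \<open>\<eta>\<close> and \<open>e0\<close> below make the near and the far part of
      the quadratic mean at most v^2 / 2 each.\<close>
    define v where "v = \<theta> / 8"
    have v: "v > 0" using th by (simp add: v_def)
    define \<eta> where "\<eta> = v\<^sup>2 / 16"
    have eta: "\<eta> > 0" using v by (simp add: \<eta>_def)
    from x eta have "lpt f \<eta> x" by blast
    then obtain d where d: "d > 0" "\<And>r. 0 < r \<Longrightarrow> r \<le> d \<Longrightarrow>
      (\<integral>\<^sup>+y. ennreal ((cmod (f y - f x))\<^sup>2) * indicator (cball x r) y \<partial>lborel) \<le> ennreal (\<eta> * r)" unfolding lpt_def by blast
    obtain C where C0: "\<forall>\<epsilon>>0. (\<integral>\<^sup>+y. ennreal ((cmod (f y - f x))\<^sup>2) * indicator (- cball x d) y * ennreal (qk \<epsilon> (y - x)) \<partial>lborel) \<le> ennreal (\<epsilon> * C) \<and> 0 \<le> C"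
      using qk_tail[OF f d(1), of x] by blast
    have C: "C \<ge> 0" "\<And>\<epsilon>. \<epsilon> > 0 \<Longrightarrow> (\<integral>\<^sup>+y. ennreal ((cmod (f y - f x))\<^sup>2) * indicator (- cball x d) y * ennreal (qk \<epsilon> (y - x)) \<partial>lborel) \<le> ennreal (\<epsilon> * C)"
      using C0[rule_format, OF zero_less_one] C0 by blast+
    have [measurable]: "cball x d \<in> sets borel" by simp
    define e0 where "e0 = v\<^sup>2 / (2 * (C + 1))"
    have e0: "e0 > 0" using v C(1) by (simp add: e0_def)
    have main: "(LINT y|lborel. cmod (f y - f x) * qk \<epsilon> (y - x)) < \<theta>" if e: "0 < \<epsilon>" "\<epsilon> < e0" for \<epsilon>
    proof -
      have J: "(\<integral>\<^sup>+y. ennreal ((cmod (f y - f x))\<^sup>2 * qk \<epsilon> (y - x)) \<partial>lborel) \<le> ennreal (v\<^sup>2)"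
      proof -
        have "(\<integral>\<^sup>+y. ennreal ((cmod (f y - f x))\<^sup>2 * qk \<epsilon> (y - x)) \<partial>lborel) =
          (\<integral>\<^sup>+y. ennreal ((cmod (f y - f x))\<^sup>2) * indicator (cball x d) y * ennreal (qk \<epsilon> (y - x)) +
             ennreal ((cmod (f y - f x))\<^sup>2) * indicator (- cball x d) y * ennreal (qk \<epsilon> (y - x)) \<partial>lborel)"
          using qk_nonneg[OF e(1)] by (intro nn_integral_cong) (auto simp: indicator_def ennreal_mult)
        also have "\<dots> = (\<integral>\<^sup>+y. ennreal ((cmod (f y - f x))\<^sup>2) * indicator (cball x d) y * ennreal (qk \<epsilon> (y - x)) \<partial>lborel) +
             (\<integral>\<^sup>+y. ennreal ((cmod (f y - f x))\<^sup>2) * indicator (- cball x d) y * ennreal (qk \<epsilon> (y - x)) \<partial>lborel)"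
          by (rule nn_integral_add) measurable
        also have "\<dots> \<le> ennreal (8 * \<eta>) + ennreal (\<epsilon> * C)"
          using eta by (intro add_mono qk_dyadic[OF _ _ d(1) e(1)] C(2)[OF e(1)] d(2)) auto
        also have "\<dots> = ennreal (8 * \<eta> + \<epsilon> * C)" using eta e C(1) by (simp add: ennreal_plus)
        also have "\<dots> \<le> ennreal (v\<^sup>2)"
        proof (rule ennreal_leI)
          have "\<epsilon> * C \<le> e0 * (C + 1)" using e C(1) by (intro mult_mono) auto
          also have "\<dots> = v\<^sup>2 / 2" using C(1) by (simp add: e0_def field_simps)
          finally show "8 * \<eta> + \<epsilon> * C \<le> v\<^sup>2" by (simp add: \<eta>_def)
        qed
        finally show ?thesis .
      qed
      have iJ: "integrable lborel (\<lambda>y. (cmod (f y - f x))\<^sup>2 * qk \<epsilon> (y - x))"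
        using order.strict_trans1[OF J ennreal_less_top] qk_nonneg[OF e(1)] by (intro integrableI_bounded) auto
      have lJ: "(LINT y|lborel. (cmod (f y - f x))\<^sup>2 * qk \<epsilon> (y - x)) \<le> v\<^sup>2"
        using J nn_integral_eq_integral[OF iJ] qk_nonneg[OF e(1)] by (simp add: ennreal_le_iff)
      have "(LINT y|lborel. cmod (f y - f x) * qk \<epsilon> (y - x)) \<le> (LINT y|lborel. v / 2 * qk \<epsilon> (y - x) + 1 / (2 * v) * ((cmod (f y - f x))\<^sup>2 * qk \<epsilon> (y - x)))"
      proof (rule integral_mono)
        show "integrable lborel (\<lambda>y. v / 2 * qk \<epsilon> (y - x) + 1 / (2 * v) * ((cmod (f y - f x))\<^sup>2 * qk \<epsilon> (y - x)))"
          by (intro Bochner_Integration.integrable_add integrable_mult_right integrable_qk(1)[OF e(1)] iJ)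
        fix y
        have "a \<le> v / 2 + 1 / (2 * v) * a\<^sup>2" for a
        proof -
          have "0 \<le> (v - a)\<^sup>2 / (2 * v)" using v by simp
          also have "(v - a)\<^sup>2 / (2 * v) = v / 2 + 1 / (2 * v) * a\<^sup>2 - a" using v by (simp add: power2_diff field_simps power2_eq_square)
          finally show ?thesis by simp
        qed
        from mult_right_mono[OF this qk_nonneg[OF e(1)], of "cmod (f y - f x)" "y - x"]
        show "cmod (f y - f x) * qk \<epsilon> (y - x) \<le> v / 2 * qk \<epsilon> (y - x) + 1 / (2 * v) * ((cmod (f y - f x))\<^sup>2 * qk \<epsilon> (y - x))"
          by (simp add: algebra_simps)
      qed (rule int[OF e(1)])
      also have "\<dots> = v / 2 * pi + 1 / (2 * v) * (LINT y|lborel. (cmod (f y - f x))\<^sup>2 * qk \<epsilon> (y - x))"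
        using integrable_qk[OF e(1), of x] iJ by (subst Bochner_Integration.integral_add) auto
      also have "\<dots> \<le> v / 2 * 4 + 1 / (2 * v) * v\<^sup>2"
        using lJ v pi_less_4 by (intro add_mono mult_left_mono) auto
      also have "\<dots> < \<theta>" using th by (simp add: v_def power2_eq_square)
      finally show ?thesis .
    qed
    have "\<forall>\<^sub>F \<epsilon> in at_right 0. 0 < \<epsilon> \<and> \<epsilon> < e0" using e0 by (auto simp: eventually_at_right_field)
    then show "\<forall>\<^sub>F \<epsilon> in at_right 0. dist (LINT y|lborel. cmod (f y - f x) * qk \<epsilon> (y - x)) 0 < \<theta>"
    proof eventually_elim
      case (elim \<epsilon>)
      have "0 \<le> (LINT y|lborel. cmod (f y - f x) * qk \<epsilon> (y - x))" using qk_nonneg elim by (intro integral_nonneg_AE) auto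
      then show ?case using main elim by simp
    qed
  qed
qed

lemma qk_pois_lim:
  assumes f: "f \<in> L2" and x: "\<forall>\<eta>>0. lpt f \<eta> x"
  shows "((\<lambda>\<epsilon>. LINT y|lborel. f y * of_real (qk \<epsilon> (y - x))) \<longlongrightarrow> of_real pi * f x) (at_right 0)"
proof (rule LIM_zero_cancel, rule Lim_null_comparison[OF _ qk_L1_lim(2)[OF f x]])
  show "\<forall>\<^sub>F \<epsilon> in at_right 0. norm ((LINT y|lborel. f y * of_real (qk \<epsilon> (y - x))) - of_real pi * f x) \<le> (LINT y|lborel. cmod (f y - f x) * qk \<epsilon> (y - x))"
    using eventually_at_right_less[of 0]
  proof eventually_elim
    case (elim \<epsilon>)
    have i1: "integrable lborel (\<lambda>y. f y * complex_of_real (qk \<epsilon> (y - x)))" by (rule L2_integrable_mult[OF f qk_L2[OF elim]])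
    have i2: "integrable lborel (\<lambda>y. f x * complex_of_real (qk \<epsilon> (y - x)))" 
      by (intro integrable_mult_right integrable_of_real integrable_qk(1)[OF elim])
    have "(LINT y|lborel. f x * complex_of_real (qk \<epsilon> (y - x))) = of_real pi * f x"
      using integrable_qk(2)[OF elim, of x] by simp
    from this[symmetric] have "(LINT y|lborel. f y * of_real (qk \<epsilon> (y - x))) - of_real pi * f x = (LINT y|lborel. (f y - f x) * complex_of_real (qk \<epsilon> (y - x)))"
      by (simp only: left_diff_distrib Bochner_Integration.integral_diff[OF i1 i2])
    also have "norm \<dots> \<le> (LINT y|lborel. norm ((f y - f x) * complex_of_real (qk \<epsilon> (y - x))))" by (rule integral_norm_bound)
    finally show ?case using qk_nonneg[OF elim] by (simp add: norm_mult)
  qed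
qed

text \<open>The error made in replacing the truncated kernel 1 / u by the conjugate Poisson kernel.
  It is odd and bounded by \<open>qk\<close>, hence tends to 0 against \<open>f\<close> at Lebesgue
  points.\<close>

definition dk :: "real \<Rightarrow> real \<Rightarrow> real" where
  "dk \<epsilon> u = (if \<epsilon> < \<bar>u\<bar> then 1 / u else 0) - u / (u\<^sup>2 + \<epsilon>\<^sup>2)"

lemma dk_measurable [measurable]: "dk \<epsilon> \<in> borel_measurable borel" unfolding dk_def by measurable

lemma dk_le_qk: assumes e: "\<epsilon> > 0" shows "\<bar>dk \<epsilon> u\<bar> \<le> qk \<epsilon> u"
proof (cases "\<epsilon> < \<bar>u\<bar>")
  case True
  have p: "u\<^sup>2 + \<epsilon>\<^sup>2 > 0" using e by (simp add: add_nonneg_pos)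
  have u: "u \<noteq> 0" using True e by auto
  have "dk \<epsilon> u = \<epsilon>\<^sup>2 / (u * (u\<^sup>2 + \<epsilon>\<^sup>2))" using True u p by (simp add: dk_def field_simps power2_eq_square)
  then have "\<bar>dk \<epsilon> u\<bar> = \<epsilon>\<^sup>2 / (\<bar>u\<bar> * (u\<^sup>2 + \<epsilon>\<^sup>2))" using p by (simp add: abs_mult)
  also have "\<dots> \<le> \<epsilon>\<^sup>2 / (\<epsilon> * (u\<^sup>2 + \<epsilon>\<^sup>2))" using e True p by (intro divide_left_mono mult_right_mono mult_pos_pos) auto
  also have "\<dots> = qk \<epsilon> u" using e by (simp add: qk_def power2_eq_square)
  finally show ?thesis .
next
  case False
  have p: "u\<^sup>2 + \<epsilon>\<^sup>2 > 0" using e by (simp add: add_nonneg_pos)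
  have "\<bar>dk \<epsilon> u\<bar> = \<bar>u\<bar> / (u\<^sup>2 + \<epsilon>\<^sup>2)" using False p by (simp add: dk_def)
  also have "\<dots> \<le> qk \<epsilon> u" unfolding qk_def using False p by (intro divide_right_mono) auto
  finally show ?thesis .
qed

lemma dk_odd: "dk \<epsilon> (- u) = - dk \<epsilon> u" by (simp add: dk_def)

lemma integrable_dk: assumes e: "\<epsilon> > 0" shows "integrable lborel (\<lambda>y. dk \<epsilon> (x - y))" "(LINT y|lborel. dk \<epsilon> (x - y)) = 0"
proof -
  have q: "qk \<epsilon> (x - y) = qk \<epsilon> (y - x)" for y by (simp add: qk_def power2_commute)
  show "integrable lborel (\<lambda>y. dk \<epsilon> (x - y))"
    by (rule Bochner_Integration.integrable_bound[OF integrable_qk(1)[OF e, of x]])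
      (use dk_le_qk[OF e] qk_nonneg[OF e] in \<open>auto simp: q[symmetric]\<close>)
  have "(LINT y|lborel. dk \<epsilon> (x - y)) = (LINT y|lborel. dk \<epsilon> y)"
    using lborel_integral_real_affine[of "-1" "dk \<epsilon>" x] by simp
  moreover have "(LINT y|lborel. dk \<epsilon> y) = - (LINT y|lborel. dk \<epsilon> y)"
    using lborel_integral_real_affine[of "-1" "dk \<epsilon>" 0] by (simp add: dk_odd)
  ultimately show "(LINT y|lborel. dk \<epsilon> (x - y)) = 0" by simp
qed

lemma dk_L2: assumes e: "\<epsilon> > 0" shows "(\<lambda>y. complex_of_real (dk \<epsilon> (x - y))) \<in> L2"
proof (rule L2_bound[OF _ qk_L2[OF e, of x], of _ 1])
  have q: "qk \<epsilon> (x - y) = qk \<epsilon> (y - x)" for y by (simp add: qk_def power2_commute)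
  show "AE y in lborel. cmod (complex_of_real (dk \<epsilon> (x - y))) \<le> 1 * cmod (complex_of_real (qk \<epsilon> (y - x)))"
    using dk_le_qk[OF e] qk_nonneg[OF e] by (auto simp: q[symmetric])
qed measurable

text \<open>The kernel has integral 0, so f(x) may be subtracted from f(y) at no cost;
  \<open>qk_L1_lim\<close> then bounds what remains.\<close>

lemma dk_lim:
  assumes f: "f \<in> L2" and x: "\<forall>\<eta>>0. lpt f \<eta> x"
  shows "((\<lambda>\<epsilon>. LINT y|lborel. f y * of_real (dk \<epsilon> (x - y))) \<longlongrightarrow> 0) (at_right 0)"
proof (rule Lim_null_comparison[OF _ qk_L1_lim(2)[OF f x]])
  have q: "qk \<epsilon> (x - y) = qk \<epsilon> (y - x)" for y \<epsilon> by (simp add: qk_def power2_commute)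
  show "\<forall>\<^sub>F \<epsilon> in at_right 0. norm (LINT y|lborel. f y * of_real (dk \<epsilon> (x - y))) \<le> (LINT y|lborel. cmod (f y - f x) * qk \<epsilon> (y - x))"
    using eventually_at_right_less[of 0]
  proof eventually_elim
    case (elim \<epsilon>)
    have i1: "integrable lborel (\<lambda>y. f y * complex_of_real (dk \<epsilon> (x - y)))" by (rule L2_integrable_mult[OF f dk_L2[OF elim]])
    have i2: "integrable lborel (\<lambda>y. f x * complex_of_real (dk \<epsilon> (x - y)))" 
      by (intro integrable_mult_right integrable_of_real integrable_dk(1)[OF elim])
    have "(LINT y|lborel. f x * complex_of_real (dk \<epsilon> (x - y))) = 0"
      using integrable_dk(2)[OF elim, of x] by simp
    then have "(LINT y|lborel. f y * of_real (dk \<epsilon> (x - y))) = (LINT y|lborel. (f y - f x) * complex_of_real (dk \<epsilon> (x - y)))"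
      using Bochner_Integration.integral_diff[OF i1 i2] by (simp add: left_diff_distrib)
    also have "norm \<dots> \<le> (LINT y|lborel. cmod (f y - f x) * qk \<epsilon> (y - x))"
    proof (rule Bochner_Integration.integral_norm_bound_integral[OF _ qk_L1_lim(1)[OF f x elim]])
      show "integrable lborel (\<lambda>y. (f y - f x) * complex_of_real (dk \<epsilon> (x - y)))"
        using Bochner_Integration.integrable_diff[OF i1 i2] by (simp add: left_diff_distrib)
      show "norm ((f y - f x) * complex_of_real (dk \<epsilon> (x - y))) \<le> cmod (f y - f x) * qk \<epsilon> (y - x)" for y
        unfolding norm_mult norm_of_real q[symmetric] by (intro mult_left_mono dk_le_qk[OF elim]) auto
    qed
    finally show ?case .
  qed
qed

text \<open>The symbol is -i times the sign, with the sign of 0 taken as 1. This makes (1 + i Hil) /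
  2 agree with the indicator of the closed half-line at every frequency.\<close>

definition Hil :: "l2 \<Rightarrow> l2" where "Hil = fm (\<lambda>\<xi>. - \<i> * (if \<xi> \<ge> 0 then 1 else - 1))"

lemma bmult_sgn: "bmult (\<lambda>\<xi>::real. c * (if \<xi> \<ge> 0 then 1 else - 1 :: complex))"
  by (rule bmultI[of _ "cmod c"]) (auto simp: norm_mult)

lemma Sz_Hil: "cs (1 / 2) (f + cs \<i> (Hil f)) = Sz f"
proof (rule Fo_inj, rule l2_eqI)
  have m: "AE \<xi> in lborel. rp (Fo (Sz f)) \<xi> = indicator {0..} \<xi> * rp (Fo f) \<xi>"
    unfolding Sz_def Fo_fm by (rule rp_mop) simp
  have h: "AE \<xi> in lborel. rp (Fo (Hil f)) \<xi> = - \<i> * (if \<xi> \<ge> 0 then 1 else - 1) * rp (Fo f) \<xi>"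
    unfolding Hil_def Fo_fm by (rule rp_mop[OF bmult_sgn])
  show "AE x in lborel. rp (Fo (cs (1 / 2) (f + cs \<i> (Hil f)))) x = rp (Fo (Sz f)) x"
    unfolding Fo_cs Fo_add
    using m h rp_cs[of "1/2" "Fo f + cs \<i> (Fo (Hil f))"] rp_add[of "Fo f" "cs \<i> (Fo (Hil f))"] rp_cs[of \<i> "Fo (Hil f)"]
  proof eventually_elim
    case (elim x)
    show ?case unfolding elim by (simp add: indicator_def)
  qed
qed

text \<open>The adjoint multiplier is moved onto the Poisson kernel. On the Fourier side this kernel
  is \<open>K 1\<close>, a modulated two-sided exponential, and the sign turns it into a multiple of
  \<open>K (- 1)\<close>, whose inverse transform is the conjugate Poisson kernel centred at
  \<open>x\<close>.\<close>

lemma conj_poisson: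
  assumes f: "f \<in> L2" and e: "\<epsilon> > 0"
  shows "(LINT y|lborel. rp (Hil (cl f)) y * of_real (qk \<epsilon> (y - x))) = (LINT y|lborel. f y * of_real ((x - y) / ((x - y)\<^sup>2 + \<epsilon>\<^sup>2)))"
    "(\<lambda>y. complex_of_real ((x - y) / ((x - y)\<^sup>2 + \<epsilon>\<^sup>2))) \<in> L2"
proof -
  define k where "k = (\<lambda>s \<xi>::real. (if \<xi> \<ge> 0 then 1 else s) * complex_of_real (exp (- (\<epsilon> * \<bar>\<xi>\<bar>))))"
  define K where "K = (\<lambda>s \<xi>::real. k s \<xi> * exp (\<i> * of_real ((- x) * \<xi>)))"
  have ki: "integrable lborel (k s)" for s using integral_exp_abs(1)[OF e, of s] unfolding k_def .
  have km [measurable]: "k s \<in> borel_measurable borel" for s unfolding k_def by measurable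
  have Ki: "integrable lborel (K s)" for s
    by (rule Bochner_Integration.integrable_bound[OF ki[of s]]) (auto simp: K_def norm_mult)
  have KL: "K s \<in> L2" if "cmod s = 1" for s
  proof -
    have "integrable lborel (\<lambda>\<xi>. (cmod (K s \<xi>))\<^sup>2)"
    proof (rule Bochner_Integration.integrable_bound[OF ki[of 1]])
      have "(exp (- (\<epsilon> * \<bar>\<xi>\<bar>)))\<^sup>2 \<le> exp (- (\<epsilon> * \<bar>\<xi>\<bar>))" for \<xi> unfolding power2_eq_square using e by (intro mult_left_le_one_le) auto
      moreover have "cmod (K s \<xi>) = exp (- (\<epsilon> * \<bar>\<xi>\<bar>))" "cmod (k 1 \<xi>) = exp (- (\<epsilon> * \<bar>\<xi>\<bar>))" for \<xi>
        using that by (simp_all add: K_def k_def norm_mult del: of_real_mult)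
      ultimately show "AE \<xi> in lborel. norm ((cmod (K s \<xi>))\<^sup>2) \<le> norm (k 1 \<xi>)" by simp
    qed (unfold K_def, measurable)
    then show ?thesis using borel_measurable_integrable[OF Ki[of s]] by (simp add: L2_def)
  qed
  have ftK: "ft (K s) (- y) = 1 / (of_real \<epsilon> + \<i> * of_real (x - y)) + s / (of_real \<epsilon> - \<i> * of_real (x - y))" for s y
    unfolding K_def ft_modulate using integral_exp_abs(2)[OF e, of s "- y - - x"] by (simp add: k_def)
  have nz: "complex_of_real \<epsilon> + \<i> * of_real u \<noteq> 0" "complex_of_real \<epsilon> - \<i> * of_real u \<noteq> 0" "complex_of_real (u\<^sup>2 + \<epsilon>\<^sup>2) \<noteq> 0" for u
  proof -
    show "complex_of_real \<epsilon> + \<i> * of_real u \<noteq> 0" "complex_of_real \<epsilon> - \<i> * of_real u \<noteq> 0" using e by (auto simp: complex_eq_iff)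
    have "u\<^sup>2 + \<epsilon>\<^sup>2 \<noteq> 0" using e by (simp add: add_nonneg_pos less_imp_neq[symmetric] sum_power2_eq_zero_iff)
    then show "complex_of_real (u\<^sup>2 + \<epsilon>\<^sup>2) \<noteq> 0" using of_real_eq_0_iff by blast
  qed
  have prod: "(complex_of_real \<epsilon> + \<i> * of_real u) * (complex_of_real \<epsilon> - \<i> * of_real u) = of_real (u\<^sup>2 + \<epsilon>\<^sup>2)" for u
    by (simp add: algebra_simps power2_eq_square)
  have A: "ft (K 1) (- y) = of_real (2 * qk \<epsilon> (y - x))" for y
  proof -
    have "1 / (complex_of_real \<epsilon> + \<i> * of_real u) + 1 / (of_real \<epsilon> - \<i> * of_real u) = 2 * of_real \<epsilon> / of_real (u\<^sup>2 + \<epsilon>\<^sup>2)" for u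
      unfolding add_frac_eq[OF nz(1,2)] prod by simp
    from this[of "x - y"] have "ft (K 1) (- y) = 2 * of_real \<epsilon> / of_real ((x - y)\<^sup>2 + \<epsilon>\<^sup>2)" unfolding ftK .
    then show ?thesis unfolding qk_def power2_commute[of x y] by simp
  qed
  have B: "ft (K (-1)) (- y) = - \<i> * of_real (2 * ((x - y) / ((x - y)\<^sup>2 + \<epsilon>\<^sup>2)))" for y
  proof -
    have "1 / (complex_of_real \<epsilon> + \<i> * of_real u) + (-1) / (of_real \<epsilon> - \<i> * of_real u) = - \<i> * (2 * of_real u / of_real (u\<^sup>2 + \<epsilon>\<^sup>2))" for u
      unfolding add_frac_eq[OF nz(1,2)] prod by simp
    from this[of "x - y"] show ?thesis unfolding ftK by (simp only: of_real_mult of_real_divide of_real_numeral times_divide_eq_right)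
  qed
  let ?q = "\<lambda>y. complex_of_real ((x - y) / ((x - y)\<^sup>2 + \<epsilon>\<^sup>2))"
  have "(\<lambda>y. \<i> / 2 * ft (K (-1)) (- y)) \<in> L2" using Fi_L1(2)[OF KL Ki, of "-1"] by (intro L2_cmult) simp
  moreover have "\<i> / 2 * (- \<i> * complex_of_real (2 * w)) = of_real w" for w by simp
  then have "(\<lambda>y. \<i> / 2 * ft (K (-1)) (- y)) = ?q" unfolding B by (simp only:)
  ultimately show q: "?q \<in> L2" by simp
  have mK: "mop (\<lambda>\<xi>. \<i> * (if \<xi> \<ge> 0 then 1 else - 1)) (cl (K 1)) = cs \<i> (cl (K (-1)))"
    unfolding mop_cl[OF bmult_sgn KL[of 1, simplified]] cl_cmult[OF KL[of "-1", simplified], symmetric]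
    by (intro arg_cong[where f = cl] ext) (auto simp: K_def k_def)
  have F1: "Fi (cl (K 1)) = cl (\<lambda>y. complex_of_real (1 / pi) * of_real (qk \<epsilon> (y - x)))"
    unfolding Fi_L1(1)[OF KL Ki, of 1, simplified] using A by (intro arg_cong[where f = cl] ext) simp
  have F2: "Fi (cs \<i> (cl (K (-1)))) = cl (\<lambda>y. complex_of_real (1 / pi) * ?q y)"
    unfolding Fi_cs Fi_L1(1)[OF KL Ki, of "-1", simplified] 
    apply (subst cl_cmult[symmetric])
    subgoal using L2_cmult[OF Fi_L1(2)[OF KL Ki, of "-1", simplified], of "1 / (of_real (2 * pi))"] by simp
  proof (intro arg_cong[where f = cl] ext)
    fix y
    have "\<i> * (- \<i> * complex_of_real (2 * w) / (2 * complex_of_real pi)) = of_real (1 / pi) * of_real w" 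
      "\<i> * (- \<i> * complex_of_real (2 * w) / complex_of_real (2 * pi)) = of_real (1 / pi) * of_real w" for w by simp_all
    then show "\<i> * (ft (K (- 1)) (- y) / (2 * complex_of_real pi)) = complex_of_real (1 / pi) * ?q y" by (simp only: B)
  qed
  have "cip (Hil (cl f)) (Fi (cl (K 1))) = cip (cl f) (Fi (cs \<i> (cl (K (-1)))))"
  proof -
    have c: "(\<lambda>\<xi>::real. cnj (- \<i> * (if \<xi> \<ge> 0 then 1 else - 1))) = (\<lambda>\<xi>. \<i> * (if \<xi> \<ge> 0 then 1 else - 1))" by auto
    show ?thesis unfolding Hil_def cip_fm[OF bmult_sgn[of "-\<i>"]] c unfolding fm_def Fo_Fi mK ..
  qed
  then have "cip (cl (rp (Hil (cl f)))) (cs (of_real (1 / pi)) (cl (\<lambda>y. of_real (qk \<epsilon> (y - x))))) = cip (cl f) (cs (of_real (1 / pi)) (cl ?q))"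
    unfolding F1 F2 cl_cmult[OF q] cl_cmult[OF qk_L2[OF e]] by simp
  then have "cip (cl (rp (Hil (cl f)))) (cl (\<lambda>y. of_real (qk \<epsilon> (y - x)))) = cip (cl f) (cl ?q)"
    by (simp del: cl_rp)
  then show "(LINT y|lborel. rp (Hil (cl f)) y * of_real (qk \<epsilon> (y - x))) = (LINT y|lborel. f y * of_real ((x - y) / ((x - y)\<^sup>2 + \<epsilon>\<^sup>2)))"
    unfolding cip_cl[OF rp_L2 qk_L2[OF e]] cip_cl[OF f q] L2_inner_def by simp
qed

definition hilt :: "(real \<Rightarrow> complex) \<Rightarrow> real \<Rightarrow> real \<Rightarrow> complex" where
  "hilt f \<epsilon> x = 1 / of_real pi * (LINT y:{y. \<epsilon> < \<bar>x - y\<bar>}|lborel. f y / of_real (x - y))"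

lemma hilt_eq: "hilt f \<epsilon> x = 1 / of_real pi * (LINT y|lborel. f y * of_real (if \<epsilon> < \<bar>x - y\<bar> then 1 / (x - y) else 0))"
  unfolding hilt_def set_lebesgue_integral_def
  by (intro arg_cong[where f = "\<lambda>z. 1 / of_real pi * z"] Bochner_Integration.integral_cong) (auto simp: indicator_def)

text \<open>A truncated Hilbert integral is 1 / pi times the sum of the Poisson average of
  \<open>Hil (cl f)\<close> and the \<open>dk\<close> error. Both limits exist at common Lebesgue
  points of \<open>f\<close> and of \<open>Hil (cl f)\<close>.\<close>

lemma hilt_lim_AE:
  assumes f: "f \<in> L2"
  shows "AE x in lborel. ((\<lambda>\<epsilon>. hilt f \<epsilon> x) \<longlongrightarrow> rp (Hil (cl f)) x) (at_right 0)"
  using lpt_AE[OF f] lpt_AE[OF rp_L2[of "Hil (cl f)"]]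
proof eventually_elim
  case (elim x)
  have ev: "\<forall>\<^sub>F \<epsilon> in at_right 0. 1 / of_real pi * ((LINT y|lborel. rp (Hil (cl f)) y * of_real (qk \<epsilon> (y - x))) + (LINT y|lborel. f y * of_real (dk \<epsilon> (x - y)))) = hilt f \<epsilon> x"
    using eventually_at_right_less[of 0]
  proof eventually_elim
    case (elim \<epsilon>)
    note c = conj_poisson[OF f elim, of x]
    have "(LINT y|lborel. f y * of_real ((x - y) / ((x - y)\<^sup>2 + \<epsilon>\<^sup>2))) + (LINT y|lborel. f y * of_real (dk \<epsilon> (x - y))) =
      (LINT y|lborel. f y * of_real ((x - y) / ((x - y)\<^sup>2 + \<epsilon>\<^sup>2)) + f y * of_real (dk \<epsilon> (x - y)))"
      by (rule Bochner_Integration.integral_add[symmetric, OF L2_integrable_mult[OF f c(2)] L2_integrable_mult[OF f dk_L2[OF elim]]])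
    also have "\<dots> = (LINT y|lborel. f y * of_real (if \<epsilon> < \<bar>x - y\<bar> then 1 / (x - y) else 0))"
      unfolding distrib_left[symmetric] of_real_add[symmetric] dk_def by simp
    finally show ?case unfolding c(1) hilt_eq by simp
  qed
  have "((\<lambda>\<epsilon>. 1 / of_real pi * ((LINT y|lborel. rp (Hil (cl f)) y * of_real (qk \<epsilon> (y - x))) + (LINT y|lborel. f y * of_real (dk \<epsilon> (x - y)))))
    \<longlongrightarrow> 1 / of_real pi * (of_real pi * rp (Hil (cl f)) x + 0)) (at_right 0)"
    by (intro tendsto_mult tendsto_add tendsto_const qk_pois_lim[OF rp_L2 elim(2)] dk_lim[OF f elim(1)])
  from Lim_transform_eventually[OF this ev] show ?case by simp
qed

lemma hilbert_eq: "hilbert f x = Lim (at_right 0) (\<lambda>\<epsilon>. hilt f \<epsilon> x)"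
  by (simp add: hilbert_def hilt_def)

lemma hilbert_AE: assumes "f \<in> L2" shows "AE x in lborel. hilbert f x = rp (Hil (cl f)) x"
  using hilt_lim_AE[OF assms] by eventually_elim (simp add: hilbert_eq tendsto_Lim)

lemma kernel_L2: assumes e: "\<epsilon> > 0" shows "(\<lambda>y. complex_of_real (if \<epsilon> < \<bar>x - y\<bar> then 1 / (x - y) else 0)) \<in> L2"
proof -
  have "(\<lambda>y. complex_of_real ((x - y) / ((x - y)\<^sup>2 + \<epsilon>\<^sup>2)) + complex_of_real (dk \<epsilon> (x - y))) \<in> L2"
    by (intro L2_add conj_poisson(2)[OF L2_zero e] dk_L2[OF e])
  moreover have "(\<lambda>y. complex_of_real ((x - y) / ((x - y)\<^sup>2 + \<epsilon>\<^sup>2)) + complex_of_real (dk \<epsilon> (x - y))) = (\<lambda>y. complex_of_real (if \<epsilon> < \<bar>x - y\<bar> then 1 / (x - y) else 0))"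
    unfolding of_real_add[symmetric] dk_def by simp
  ultimately show ?thesis by simp
qed

text \<open>The inequality in the truncation is strict, so as the parameter decreases to
  \<open>\<epsilon>\<close> the truncated regions exhaust the one for \<open>\<epsilon>\<close>,
  whose integrand dominates.\<close>

lemma hilt_right_cont:
  assumes f: "f \<in> L2" and e: "\<epsilon> > 0" and X: "\<And>n. \<epsilon> \<le> X n" "X \<longlonglongrightarrow> \<epsilon>"
  shows "(\<lambda>n. hilt f (X n) x) \<longlonglongrightarrow> hilt f \<epsilon> x"
  unfolding hilt_eq
proof (intro tendsto_mult tendsto_const integral_dominated_convergence[where w = "\<lambda>y. cmod (f y * of_real (if \<epsilon> < \<bar>x - y\<bar> then 1 / (x - y) else 0))"])
  note [measurable] = L2_meas[OF f]
  show "(\<lambda>y. f y * complex_of_real (if \<epsilon> < \<bar>x - y\<bar> then 1 / (x - y) else 0)) \<in> borel_measurable lborel"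
    "(\<lambda>y. f y * complex_of_real (if X n < \<bar>x - y\<bar> then 1 / (x - y) else 0)) \<in> borel_measurable lborel" for n by measurable
  show "integrable lborel (\<lambda>y. cmod (f y * complex_of_real (if \<epsilon> < \<bar>x - y\<bar> then 1 / (x - y) else 0)))"
    by (intro integrable_norm L2_integrable_mult[OF f kernel_L2[OF e]])
  show "AE y in lborel. (\<lambda>n. f y * complex_of_real (if X n < \<bar>x - y\<bar> then 1 / (x - y) else 0)) \<longlonglongrightarrow> f y * complex_of_real (if \<epsilon> < \<bar>x - y\<bar> then 1 / (x - y) else 0)"
  proof (rule AE_I2)
    fix y
    have "\<forall>\<^sub>F n in sequentially. (X n < \<bar>x - y\<bar>) = (\<epsilon> < \<bar>x - y\<bar>)"
    proof (cases "\<epsilon> < \<bar>x - y\<bar>")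
      case True
      then show ?thesis using order_tendstoD(2)[OF X(2) True] by simp
    next
      case False
      then have "\<not> X n < \<bar>x - y\<bar>" for n using X(1)[of n] by linarith
      then show ?thesis using False by simp
    qed
    then have "\<forall>\<^sub>F n in sequentially. f y * complex_of_real (if X n < \<bar>x - y\<bar> then 1 / (x - y) else 0) = f y * complex_of_real (if \<epsilon> < \<bar>x - y\<bar> then 1 / (x - y) else 0)"
      by eventually_elim simp
    then show "(\<lambda>n. f y * complex_of_real (if X n < \<bar>x - y\<bar> then 1 / (x - y) else 0)) \<longlonglongrightarrow> f y * complex_of_real (if \<epsilon> < \<bar>x - y\<bar> then 1 / (x - y) else 0)"
      by (rule tendsto_eventually)
  qed
  show "AE y in lborel. norm (f y * complex_of_real (if X n < \<bar>x - y\<bar> then 1 / (x - y) else 0)) \<le> cmod (f y * complex_of_real (if \<epsilon> < \<bar>x - y\<bar> then 1 / (x - y) else 0))" for n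
    using X(1)[of n] by (intro AE_I2) (auto simp: norm_mult)
qed

lemma hilt_measurable [measurable]: assumes f: "f \<in> L2" shows "hilt f \<epsilon> \<in> borel_measurable borel"
proof -
  note [measurable] = L2_meas[OF f]
  show ?thesis unfolding hilt_eq[abs_def] by measurable
qed

text \<open>Only almost everywhere convergence of the truncated integrals is known, so measurability of
  \<^const>\<open>hilbert\<close> is not automatic: the set of convergence is cut out by countably many Cauchy conditions
  because the truncations are right-continuous in the truncation parameter.\<close>

lemma hilbert_measurable [measurable]:
  assumes f: "f \<in> L2" shows "hilbert f \<in> borel_measurable borel"
proof -
  define Q where "Q = {p::real \<in> \<rat>. 0 < p}"
  define Qn where "Qn n = {p \<in> Q. p < 1 / (1 + real n)}" for n
  define U where "U x \<longleftrightarrow> (\<forall>k::nat. \<exists>n::nat. \<forall>p\<in>Q. \<forall>q\<in>Q. p < 1 / (1 + real n) \<longrightarrow> q < 1 / (1 + real n) \<longrightarrow> dist (hilt f p x) (hilt f q x) \<le> 1 / (1 + real k))" for x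
  note [measurable] = hilt_measurable[OF f]
  have Um: "Measurable.pred borel U"
  proof -
    have "(\<lambda>x. dist (hilt f p x) (hilt f q x) \<le> 1 / (1 + real k)) \<in> measurable borel (count_space UNIV)" for p q k by measurable
    moreover have "U = (\<lambda>x. \<forall>k::nat. \<exists>n::nat. \<forall>p\<in>{r::rat. of_rat r \<in> Qn n}. \<forall>q\<in>{r::rat. of_rat r \<in> Qn n}. dist (hilt f (of_rat p) x) (hilt f (of_rat q) x) \<le> 1 / (1 + real k))"
    proof -
      have im: "(\<forall>p\<in>Qn n. P p) \<longleftrightarrow> (\<forall>r\<in>{r::rat. of_rat r \<in> Qn n}. P (of_rat r))" for n P
        by (auto simp: Qn_def Q_def elim!: Rats_cases)
      have "U = (\<lambda>x. \<forall>k::nat. \<exists>n::nat. \<forall>p\<in>Qn n. \<forall>q\<in>Qn n. dist (hilt f p x) (hilt f q x) \<le> 1 / (1 + real k))"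
        unfolding U_def Qn_def by (intro ext) blast
      then show ?thesis by (simp only: im)
    qed
    ultimately show ?thesis
      by (simp only:) (intro pred_intros_countable pred_intros_countable_bounded)
  qed
  have conv: "U x \<longleftrightarrow> (\<exists>l. ((\<lambda>\<epsilon>. hilt f \<epsilon> x) \<longlongrightarrow> l) (at_right 0))" for x
  proof
    assume "\<exists>l. ((\<lambda>\<epsilon>. hilt f \<epsilon> x) \<longlongrightarrow> l) (at_right 0)"
    then obtain l where l: "((\<lambda>\<epsilon>. hilt f \<epsilon> x) \<longlongrightarrow> l) (at_right 0)" by blast
    show "U x" unfolding U_def
    proof
      fix k :: nat
      have "1 / (1 + real k) / 2 > 0" by simp
      from tendstoD[OF l this] obtain b where b: "b > 0" "\<And>p. 0 < p \<Longrightarrow> p < b \<Longrightarrow> dist (hilt f p x) l < 1 / (1 + real k) / 2"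
        unfolding eventually_at_right_field by auto
      obtain n where n: "1 / (1 + real n) < b" using reals_Archimedean[OF b(1)] by (auto simp: inverse_eq_divide)
      have "dist (hilt f p x) (hilt f q x) \<le> 1 / (1 + real k)" if "p \<in> Q" "q \<in> Q" "p < 1 / (1 + real n)" "q < 1 / (1 + real n)" for p q
      proof -
        have "dist (hilt f p x) l < 1 / (1 + real k) / 2" "dist (hilt f q x) l < 1 / (1 + real k) / 2"
          using b(2)[of p] b(2)[of q] that n by (auto simp: Q_def)
        then show ?thesis using dist_triangle2[of "hilt f p x" "hilt f q x" l] by linarith
      qed
      then show "\<exists>n::nat. \<forall>p\<in>Q. \<forall>q\<in>Q. p < 1 / (1 + real n) \<longrightarrow> q < 1 / (1 + real n) \<longrightarrow> dist (hilt f p x) (hilt f q x) \<le> 1 / (1 + real k)" by blast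
    qed
  next
    assume U: "U x"
    \<comment> \<open>Rational parameters must approach from above, the side on which the
      truncations are continuous.\<close>
    have approx: "\<exists>X. (\<forall>n. X n \<in> Q \<and> p \<le> X n \<and> X n < b) \<and> X \<longlonglongrightarrow> p" if "0 < p" "p < b" for p b
    proof -
      have "\<exists>r\<in>\<rat>. p < r \<and> r < min b (p + 1 / (1 + real n))" for n using Rats_dense_in_real[of p "min b (p + 1 / (1 + real n))"] that by auto
      then obtain X where X: "\<And>n. X n \<in> \<rat>" "\<And>n. p < X n" "\<And>n. X n < min b (p + 1 / (1 + real n))" by metis
      have l0: "(\<lambda>n. p + 1 / (1 + real n)) \<longlonglongrightarrow> p" by real_asymp
      have "X \<longlonglongrightarrow> p"
        by (rule tendsto_sandwich[OF _ _ tendsto_const l0]) (use X in \<open>auto intro!: always_eventually simp: less_imp_le\<close>)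
      moreover have "X n \<in> Q \<and> p \<le> X n \<and> X n < b" for n using X(1,2)[of n] X(3)[of n] that by (auto simp: Q_def)
      ultimately show ?thesis by blast
    qed
    have C: "\<exists>b>0. \<forall>p q. 0 < p \<longrightarrow> p < b \<longrightarrow> 0 < q \<longrightarrow> q < b \<longrightarrow> dist (hilt f p x) (hilt f q x) \<le> 1 / (1 + real k)" for k
    proof -
      obtain n where n: "\<And>p q. p\<in>Q \<Longrightarrow> q\<in>Q \<Longrightarrow> p < 1 / (1 + real n) \<Longrightarrow> q < 1 / (1 + real n) \<Longrightarrow> dist (hilt f p x) (hilt f q x) \<le> 1 / (1 + real k)"
        using U unfolding U_def by blast
      have "dist (hilt f p x) (hilt f q x) \<le> 1 / (1 + real k)" if p: "0 < p" "p < 1 / (1 + real n)" and q: "0 < q" "q < 1 / (1 + real n)" for p q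
      proof -
        obtain X where X: "\<And>m. X m \<in> Q \<and> p \<le> X m \<and> X m < 1 / (1 + real n)" "X \<longlonglongrightarrow> p" using approx[OF p] by blast
        obtain Y where Y: "\<And>m. Y m \<in> Q \<and> q \<le> Y m \<and> Y m < 1 / (1 + real n)" "Y \<longlonglongrightarrow> q" using approx[OF q] by blast
        have "(\<lambda>m. dist (hilt f (X m) x) (hilt f (Y m) x)) \<longlonglongrightarrow> dist (hilt f p x) (hilt f q x)"
          using X Y p q by (intro tendsto_dist hilt_right_cont[OF f]) auto
        then show ?thesis by (rule LIMSEQ_le_const2) (use X Y n in blast)
      qed
      moreover have "1 / (1 + real n) > 0" by simp
      ultimately show ?thesis by blast
    qed
    define e where "e n = 1 / (1 + real n)" for n
    have e: "e n > 0" "filterlim e (at_right 0) sequentially" for n unfolding e_def by (simp, real_asymp)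
    have "Cauchy (\<lambda>n. hilt f (e n) x)"
    proof (rule metric_CauchyI)
      fix \<theta> :: real assume "\<theta> > 0"
      then obtain k where k: "1 / (1 + real k) < \<theta>" using reals_Archimedean[of \<theta>] by (auto simp: inverse_eq_divide)
      obtain b where b: "b > 0" "\<And>p q. 0 < p \<Longrightarrow> p < b \<Longrightarrow> 0 < q \<Longrightarrow> q < b \<Longrightarrow> dist (hilt f p x) (hilt f q x) \<le> 1 / (1 + real k)"
        using C[of k] by blast
      have "\<forall>\<^sub>F n in sequentially. e n < b"
        using e(2) b(1) unfolding filterlim_at by (auto dest: order_tendstoD(2))
      then obtain N where "\<And>n. n \<ge> N \<Longrightarrow> e n < b" unfolding eventually_sequentially by blast
      then show "\<exists>M. \<forall>m\<ge>M. \<forall>n\<ge>M. dist (hilt f (e m) x) (hilt f (e n) x) < \<theta>"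
        using b(2) e(1) k by (meson le_less_trans)
    qed
    then obtain l where l: "(\<lambda>n. hilt f (e n) x) \<longlonglongrightarrow> l" using Cauchy_convergent convergent_def by blast
    have "((\<lambda>\<epsilon>. hilt f \<epsilon> x) \<longlongrightarrow> l) (at_right 0)"
    proof (rule tendstoI)
      fix \<theta> :: real assume "\<theta> > 0"
      then obtain k where k: "1 / (1 + real k) < \<theta>" using reals_Archimedean[of \<theta>] by (auto simp: inverse_eq_divide)
      obtain b where b: "b > 0" "\<And>p q. 0 < p \<Longrightarrow> p < b \<Longrightarrow> 0 < q \<Longrightarrow> q < b \<Longrightarrow> dist (hilt f p x) (hilt f q x) \<le> 1 / (1 + real k)"
        using C[of k] by blast
      have "dist (hilt f p x) l < \<theta>" if p: "0 < p" "p < b" for p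
      proof -
        have "(\<lambda>n. dist (hilt f p x) (hilt f (e n) x)) \<longlonglongrightarrow> dist (hilt f p x) l" by (intro tendsto_intros l)
        moreover have "\<forall>\<^sub>F n in sequentially. e n < b"
          using e(2) b(1) unfolding filterlim_at by (auto dest: order_tendstoD(2))
        then have "\<exists>N. \<forall>n\<ge>N. dist (hilt f p x) (hilt f (e n) x) \<le> 1 / (1 + real k)"
          unfolding eventually_sequentially using b(2)[OF p] e(1) by blast
        ultimately have "dist (hilt f p x) l \<le> 1 / (1 + real k)" by (rule LIMSEQ_le_const2)
        then show ?thesis using k by simp
      qed
      then show "\<forall>\<^sub>F \<epsilon> in at_right 0. dist (hilt f \<epsilon> x) l < \<theta>" unfolding eventually_at_right_field using b(1) by blast
    qed
    then show "\<exists>l. ((\<lambda>\<epsilon>. hilt f \<epsilon> x) \<longlongrightarrow> l) (at_right 0)" by blast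
  qed
  \<comment> \<open>Where no limit exists, \<open>Lim\<close> is a definite description over an
    empty predicate; its value is the same at all such points, so it does not disturb
    measurability.\<close>
  define c0 where "c0 = (THE l::complex. False)"
  define e where "e n = 1 / (1 + real n)" for n
  have e: "filterlim e (at_right 0) sequentially" unfolding e_def by real_asymp
  have "hilbert f x = (if U x then lim (\<lambda>n. hilt f (e n) x) else c0)" for x
  proof (cases "U x")
    case True
    then obtain l where l: "((\<lambda>\<epsilon>. hilt f \<epsilon> x) \<longlongrightarrow> l) (at_right 0)" using conv by blast
    have "hilbert f x = l" unfolding hilbert_eq by (rule tendsto_Lim[OF _ l]) simp
    moreover have "lim (\<lambda>n. hilt f (e n) x) = l" by (rule limI[OF filterlim_compose[OF l e]])
    ultimately show ?thesis using True by simp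
  next
    case False
    then have "(\<lambda>l. ((\<lambda>\<epsilon>. hilt f \<epsilon> x) \<longlongrightarrow> l) (at_right 0)) = (\<lambda>l. False)" using conv by blast
    then show ?thesis using False unfolding hilbert_eq t2_space_class.Lim_def c0_def by simp
  qed
  then have "hilbert f = (\<lambda>x. if U x then lim (\<lambda>n. hilt f (e n) x) else c0)" by auto
  moreover have "(\<lambda>x. if U x then lim (\<lambda>n. hilt f (e n) x) else c0) \<in> borel_measurable borel"
    using Um by measurable
  ultimately show ?thesis by simp
qed

lemma hilbert_L2: assumes "f \<in> L2" shows "hilbert f \<in> L2" "cl (hilbert f) = Hil (cl f)"
proof -
  show L: "hilbert f \<in> L2" by (rule L2_cong[OF rp_L2 hilbert_measurable[OF assms] hilbert_AE[OF assms]])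
  show "cl (hilbert f) = Hil (cl f)" using cl_cong[OF L rp_L2 hilbert_AE[OF assms]] by simp
qed

lemma szego_L2: assumes f: "f \<in> L2" shows "szego f \<in> L2" "cl (szego f) = Sz (cl f)"
proof -
  note h = hilbert_L2[OF f]
  have L: "(\<lambda>x. f x + \<i> * hilbert f x) \<in> L2" by (intro L2_add f L2_cmult h)
  have eq: "szego f = (\<lambda>x. 1 / 2 * (f x + \<i> * hilbert f x))" by (auto simp: szego_def)
  show "szego f \<in> L2" unfolding eq by (rule L2_cmult[OF L])
  show "cl (szego f) = Sz (cl f)" unfolding eq cl_cmult[OF L] cl_add[OF f L2_cmult[OF h(1)]] cl_cmult[OF h(1)] h(2) by (rule Sz_Hil)
qed

lemma has_vector_derivative_iff_quotient:
  fixes f :: "real \<Rightarrow> 'a::real_normed_vector"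
  shows "(f has_vector_derivative D) (at x) \<longleftrightarrow> ((\<lambda>h. (1 / h) *\<^sub>R (f (x + h) - f x)) \<longlongrightarrow> D) (at 0)"
proof -
  have "norm (f (x + h) - f x - h *\<^sub>R D) / norm h = norm ((1 / h) *\<^sub>R (f (x + h) - f x) - D)" if "h \<noteq> 0" for h
  proof -
    have "(1 / h) *\<^sub>R (f (x + h) - f x) - D = (1 / h) *\<^sub>R (f (x + h) - f x - h *\<^sub>R D)" using that by (simp add: scaleR_diff_right)
    then show ?thesis by simp
  qed
  then have ev: "\<forall>\<^sub>F h in at 0. norm (f (x + h) - f x - h *\<^sub>R D) / norm h = norm ((1 / h) *\<^sub>R (f (x + h) - f x) - D)"
    by (auto simp: eventually_at_filter)
  have "(f has_vector_derivative D) (at x) \<longleftrightarrow> ((\<lambda>h. norm (f (x + h) - f x - h *\<^sub>R D) / norm h) \<longlongrightarrow> 0) (at 0)"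
    unfolding has_vector_derivative_def has_derivative_at by (simp add: bounded_linear_scaleR_left)
  also have "\<dots> \<longleftrightarrow> ((\<lambda>h. norm ((1 / h) *\<^sub>R (f (x + h) - f x) - D)) \<longlongrightarrow> 0) (at 0)" by (rule tendsto_cong[OF ev])
  also have "\<dots> \<longleftrightarrow> ((\<lambda>h. (1 / h) *\<^sub>R (f (x + h) - f x)) \<longlongrightarrow> D) (at 0)"
    unfolding tendsto_norm_zero_iff by (rule LIM_zero_iff)
  finally show ?thesis .
qed

subsection \<open>Smooth functions of compact support\<close>

text \<open>Smoothness by coinduction: membership in a class of functions closed under
  differentiation gives all derivatives at once, without a formula for the n-th one.\<close>

lemma smooth_coinduct:
  assumes "S \<psi>" and step: "\<And>f. S f \<Longrightarrow> \<exists>g. S g \<and> (\<forall>x. (f has_vector_derivative g x) (at x))"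
  shows "S ((vderiv ^^ n) \<psi>)" "(vderiv ^^ n) \<psi> differentiable (at x)"
proof -
  have 1: "S (vderiv f) \<and> (\<forall>x. f differentiable (at x))" if Sf: "S f" for f
  proof -
    obtain g where g: "S g" "\<And>x. (f has_vector_derivative g x) (at x)" using step[OF Sf] by blast
    have "vderiv f = g" unfolding vderiv_def using vector_derivative_at[OF g(2)] by auto
    then show ?thesis using g differentiableI_vector by blast
  qed
  show "S ((vderiv ^^ n) \<psi>)" by (induction n) (use assms(1) 1 in auto)
  with 1 show "(vderiv ^^ n) \<psi> differentiable (at x)" by blast
qed

lemma test_functionsI:
  assumes "S \<psi>" and "\<And>f. S f \<Longrightarrow> \<exists>g. S g \<and> (\<forall>x. (f has_vector_derivative g x) (at x))"
    and "\<And>x. R < \<bar>x\<bar> \<Longrightarrow> \<psi> x = 0"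
  shows "\<psi> \<in> test_functions"
proof -
  have "\<forall>n x. (vderiv ^^ n) \<psi> differentiable (at x)" by (intro allI smooth_coinduct(2)[of S \<psi>, OF assms(1,2)])
  moreover have "\<exists>R. \<forall>x. R < \<bar>x\<bar> \<longrightarrow> \<psi> x = 0" using assms(3) by (intro exI[of _ R]) simp
  ultimately show ?thesis unfolding test_functions_def by simp
qed

lemma test_hvd: assumes "\<psi> \<in> test_functions" shows "(\<psi> has_vector_derivative vderiv \<psi> x) (at x)"
proof -
  have "(vderiv ^^ 0) \<psi> differentiable (at x)" using assms unfolding test_functions_def by blast
  then show ?thesis unfolding vderiv_def by (simp add: vector_derivative_works)
qed

lemma test_support: assumes "\<psi> \<in> test_functions" obtains R where "R > 0" "\<And>x. R < \<bar>x\<bar> \<Longrightarrow> \<psi> x = 0"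
proof -
  obtain R where "\<And>x. R < \<bar>x\<bar> \<Longrightarrow> \<psi> x = 0" using assms unfolding test_functions_def by blast
  then show ?thesis by (intro that[of "max R 1"]) auto
qed

lemma test_vderiv: assumes "\<psi> \<in> test_functions" shows "vderiv \<psi> \<in> test_functions"
proof -
  obtain R where R: "\<And>x. R < \<bar>x\<bar> \<Longrightarrow> \<psi> x = 0" using test_support[OF assms] by blast
  have "vderiv \<psi> x = 0" if "R < \<bar>x\<bar>" for x
  proof -
    have o: "open {y. R < \<bar>y\<bar>}" by (intro open_Collect_less continuous_intros)
    have "((\<lambda>x. 0) has_vector_derivative vderiv \<psi> x) (at x)"
      by (rule has_vector_derivative_transform_within_open[OF test_hvd[OF assms] o]) (use that R in auto)
    from vector_derivative_unique_at[OF this has_vector_derivative_const] show ?thesis .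
  qed
  moreover have "(vderiv ^^ n) (vderiv \<psi>) differentiable (at x)" for n x
  proof -
    have "(vderiv ^^ Suc n) \<psi> differentiable (at x)" using assms unfolding test_functions_def by blast
    then show ?thesis by (simp add: funpow_swap1)
  qed
  ultimately show ?thesis unfolding test_functions_def by blast
qed

lemma test_cont: assumes "\<psi> \<in> test_functions" shows "continuous_on A \<psi>"
  by (rule continuous_at_imp_continuous_on) (intro ballI has_vector_derivative_continuous[OF test_hvd[OF assms]])

lemma test_measurable: "\<psi> \<in> test_functions \<Longrightarrow> \<psi> \<in> borel_measurable borel"
  by (rule borel_measurable_continuous_onI[OF test_cont])

lemma test_bound: assumes "\<psi> \<in> test_functions" obtains M where "M > 0" "\<And>x. cmod (\<psi> x) \<le> M"
proof -
  obtain R where R: "R > 0" "\<And>x. R < \<bar>x\<bar> \<Longrightarrow> \<psi> x = 0" using test_support[OF assms] by blast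
  have "bounded (\<psi> ` {-R..R})" by (intro compact_imp_bounded compact_continuous_image test_cont[OF assms]) simp
  then obtain M where M: "\<And>x. x \<in> {-R..R} \<Longrightarrow> cmod (\<psi> x) \<le> M" unfolding bounded_iff by blast
  have "cmod (\<psi> x) \<le> max M 1" for x
  proof (cases "R < \<bar>x\<bar>")
    case False
    then have "x \<in> {-R..R}" by auto
    from M[OF this] show ?thesis by simp
  qed (use R in simp)
  then show ?thesis by (intro that[of "max M 1"]) auto
qed

lemma bounded_support_L2:
  assumes m: "f \<in> borel_measurable borel" and "\<And>x. cmod (f x) \<le> M" "\<And>x. R < \<bar>x\<bar> \<Longrightarrow> f x = 0"
  shows "f \<in> L2"
proof (rule L2_bound[OF m indicator_Icc_L2[of "-R" R], of M])
  have "cmod (f x) \<le> M * cmod (indicator {-R..R} x)" for x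
  proof (cases "R < \<bar>x\<bar>")
    case True
    then have "x \<notin> {-R..R}" by auto
    then show ?thesis using assms(3)[OF True] by simp
  next
    case False
    then have "x \<in> {-R..R}" by auto
    then show ?thesis using assms(2)[of x] by simp
  qed
  then show "AE x in lborel. cmod (f x) \<le> M * cmod (indicator {-R..R} x)" by simp
qed

lemma supported_integrable:
  assumes "f \<in> L2" "\<And>x. R < \<bar>x\<bar> \<Longrightarrow> f x = 0" shows "integrable lborel f"
proof -
  have "(\<lambda>x. indicator {-R..R} x * f x) = f"
  proof
    fix x show "indicator {-R..R} x * f x = f x"
      using assms(2)[of x] by (cases "R < \<bar>x\<bar>") (auto simp: indicator_def)
  qed
  then show ?thesis using trunc_integrable[OF assms(1), of R] by simp
qed

lemma test_L2: assumes "\<psi> \<in> test_functions" shows "\<psi> \<in> L2"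
proof -
  obtain M where M: "\<And>x. cmod (\<psi> x) \<le> M" using test_bound[OF assms] by blast
  obtain R where R: "\<And>x. R < \<bar>x\<bar> \<Longrightarrow> \<psi> x = 0" using test_support[OF assms] by blast
  from bounded_support_L2[OF test_measurable[OF assms] M R] show ?thesis .
qed

lemma test_integrable: assumes "\<psi> \<in> test_functions" shows "integrable lborel \<psi>"
proof -
  obtain R where R: "\<And>x. R < \<bar>x\<bar> \<Longrightarrow> \<psi> x = 0" using test_support[OF assms] by blast
  from supported_integrable[OF test_L2[OF assms] R] show ?thesis .
qed

lemma test_bmult: assumes "\<psi> \<in> test_functions" shows "bmult \<psi>"
proof -
  obtain M where M: "\<And>x. cmod (\<psi> x) \<le> M" using test_bound[OF assms] by blast
  from bmultI[OF test_measurable[OF assms] M] show ?thesis .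
qed

lemma test_ft_vderiv: assumes T: "\<psi> \<in> test_functions" shows "ft (vderiv \<psi>) \<xi> = \<i> * of_real \<xi> * ft \<psi> \<xi>"
proof -
  obtain R where R: "R > 0" "\<And>x. R < \<bar>x\<bar> \<Longrightarrow> \<psi> x = 0" using test_support[OF T] by blast
  obtain Q where Q: "Q > 0" "\<And>x. Q < \<bar>x\<bar> \<Longrightarrow> vderiv \<psi> x = 0" using test_support[OF test_vderiv[OF T]] by blast
  define B where "B = R + Q + 1"
  let ?e = "\<lambda>x. exp (- (\<i> * of_real (x * \<xi>)))"
  let ?D = "\<lambda>x. vderiv \<psi> x * ?e x - \<i> * of_real \<xi> * (\<psi> x * ?e x)"
  have ed: "(?e has_vector_derivative (- (\<i> * of_real \<xi>) * ?e x)) (at x)" for x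
  proof -
    have "((\<lambda>z. exp (- (\<i> * (z * of_real \<xi>)))) has_field_derivative (- (\<i> * of_real \<xi>) * exp (- (\<i> * (of_real x * of_real \<xi>))))) (at (of_real x))"
      by (auto intro!: derivative_eq_intros)
    from has_vector_derivative_real_field[OF this] show ?thesis by simp
  qed
  have d: "((\<lambda>x. \<psi> x * ?e x) has_vector_derivative ?D x) (at x)" for x
    using has_vector_derivative_mult[OF test_hvd[OF T] ed] by (rule has_vector_derivative_eq_rhs) (simp add: algebra_simps)
  have c: "continuous_on {-B..B} ?D" by (intro continuous_intros test_cont T test_vderiv)
  have "(LINT x|lborel. indicator {-B..B} x *\<^sub>R ?D x) = \<psi> B * ?e B - \<psi> (-B) * ?e (-B)"
    using R(1) Q(1) by (intro integral_FTC_Icc c has_vector_derivative_at_within[OF d]) (auto simp: B_def)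
  also have "\<dots> = 0" using R Q(1) by (simp add: B_def)
  also have "(LINT x|lborel. indicator {-B..B} x *\<^sub>R ?D x) = (LINT x|lborel. ?D x)"
  proof (rule Bochner_Integration.integral_cong[OF refl])
    fix x show "indicator {-B..B} x *\<^sub>R ?D x = ?D x"
    proof (cases "B < \<bar>x\<bar>")
      case True
      then show ?thesis using R Q by (simp add: B_def)
    next
      case False
      then have "x \<in> {-B..B}" by auto
      then show ?thesis by simp
    qed
  qed
  also have "\<dots> = ft (vderiv \<psi>) \<xi> - \<i> * of_real \<xi> * ft \<psi> \<xi>"
    unfolding ft_def using integrable_ft[OF test_integrable[OF test_vderiv[OF T]], of \<xi>] integrable_ft[OF test_integrable[OF T], of \<xi>]
    by (subst Bochner_Integration.integral_diff) (auto simp del: of_real_mult)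
  finally show ?thesis by simp
qed

lemma test_hasd: assumes T: "\<psi> \<in> test_functions" shows "hasd (cl \<psi>) (cl (vderiv \<psi>))"
proof -
  note T' = test_vderiv[OF T]
  note F = Fo_L1[OF test_L2[OF T] test_integrable[OF T]] and F' = Fo_L1[OF test_L2[OF T'] test_integrable[OF T']]
  show ?thesis unfolding hasd_def F(2) F'(2) using rp_cl[OF F(1)] rp_cl[OF F'(1)]
    by eventually_elim (simp add: test_ft_vderiv[OF T])
qed

lemma test_rescale: assumes T: "\<sigma> \<in> test_functions" and c: "c \<noteq> 0" shows "(\<lambda>x. k * \<sigma> (c * x)) \<in> test_functions"
proof -
  obtain R where R: "\<And>x. R < \<bar>x\<bar> \<Longrightarrow> \<sigma> x = 0" using test_support[OF T] by blast
  define S where "S f \<longleftrightarrow> (\<exists>k \<sigma>. \<sigma> \<in> test_functions \<and> f = (\<lambda>x. k * \<sigma> (c * x)))" for f :: "real \<Rightarrow> complex"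
  show ?thesis
  proof (rule test_functionsI[where S = S and R = "R / \<bar>c\<bar>"])
    show "S (\<lambda>x. k * \<sigma> (c * x))" using T by (auto simp: S_def)
    fix f assume "S f"
    then obtain k \<sigma> where f: "\<sigma> \<in> test_functions" "f = (\<lambda>x. k * \<sigma> (c * x))" by (auto simp: S_def)
    have "(f has_vector_derivative (k * of_real c) * vderiv \<sigma> (c * x)) (at x)" for x
    proof -
      have "((\<lambda>x. c * x) has_vector_derivative c) (at x)" by (auto intro!: derivative_eq_intros simp: has_real_derivative_iff_has_vector_derivative[symmetric])
      from vector_diff_chain_at[OF this test_hvd[OF f(1)]]
      have "((\<lambda>x. \<sigma> (c * x)) has_vector_derivative c *\<^sub>R vderiv \<sigma> (c * x)) (at x)" by (simp add: o_def)
      from has_vector_derivative_mult_right[OF this, of k] show ?thesis by (simp add: f(2) scaleR_conv_of_real mult_ac)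
    qed
    moreover have "S (\<lambda>x. (k * of_real c) * vderiv \<sigma> (c * x))" using test_vderiv[OF f(1)] unfolding S_def by blast
    ultimately show "\<exists>g. S g \<and> (\<forall>x. (f has_vector_derivative g x) (at x))" by blast
  next
    fix x assume "R / \<bar>c\<bar> < \<bar>x\<bar>"
    then have "R < \<bar>c * x\<bar>" using c by (simp add: field_simps abs_mult)
    then show "k * \<sigma> (c * x) = 0" using R by simp
  qed
qed

section \<open>A smooth bump function\<close>

lemma poly_exp_lim: "((\<lambda>y::real. poly p y * exp (- y)) \<longlongrightarrow> 0) at_top"
proof -
  have "((\<lambda>y. \<Sum>i\<le>degree p. coeff p i * (y ^ i / exp y)) \<longlongrightarrow> (\<Sum>i\<le>degree p. coeff p i * 0)) at_top"
    by (intro tendsto_sum tendsto_mult tendsto_const tendsto_power_div_exp_0)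
  then show ?thesis by (simp add: poly_altdef sum_distrib_right exp_minus divide_inverse mult.assoc)
qed

definition bx :: "real poly \<Rightarrow> real \<Rightarrow> real" where
  "bx p x = (if x > 0 then poly p (1 / x) * exp (- (1 / x)) else 0)"

text \<open>With y = 1 / x, the derivative of p(y) exp(-y) in x is y^2 (p(y) - p'(y)) exp(-y); the
  two leading zero coefficients multiply by y^2. Differentiation thus acts on the polynomial
  alone.\<close>

definition bxd :: "real poly \<Rightarrow> real poly" where "bxd p = pCons 0 (pCons 0 (p - pderiv p))"

lemma bx_deriv: "(bx p has_real_derivative bx (bxd p) x) (at x)"
proof -
  consider "x > 0" | "x < 0" | "x = 0" by linarith
  then show ?thesis
  proof cases
    case 1
    have "((\<lambda>x. poly p (1 / x) * exp (- (1 / x))) has_real_derivative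
       (poly (pderiv p) (1 / x) * (- 1 / x\<^sup>2)) * exp (- (1 / x)) + poly p (1 / x) * (exp (- (1 / x)) * (1 / x\<^sup>2))) (at x)"
      using 1 by (auto intro!: derivative_eq_intros DERIV_chain2[OF poly_DERIV] simp: power2_eq_square)
    moreover have "(poly (pderiv p) (1 / x) * (- 1 / x\<^sup>2)) * exp (- (1 / x)) + poly p (1 / x) * (exp (- (1 / x)) * (1 / x\<^sup>2)) = bx (bxd p) x"
      using 1 by (simp add: bx_def bxd_def power2_eq_square algebra_simps)
    ultimately have "((\<lambda>x. poly p (1 / x) * exp (- (1 / x))) has_real_derivative bx (bxd p) x) (at x)" by simp
    then show ?thesis
      by (rule has_field_derivative_transform_within_open[of _ _ _ "{0<..}"]) (use 1 in \<open>auto simp: bx_def\<close>)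
  next
    case 2
    have "((\<lambda>x. 0) has_real_derivative 0) (at x)" by simp
    then show ?thesis
      using has_field_derivative_transform_within_open[of "\<lambda>x. 0" 0 x "{..<0}" "bx p"] 2 by (auto simp: bx_def)
  next
    case 3
    have "((\<lambda>h. bx p h / h) \<longlongrightarrow> 0) (at_right 0)"
    proof -
      have "((\<lambda>h. poly (pCons 0 p) (1 / h) * exp (- (1 / h))) \<longlongrightarrow> 0) (at_right 0)"
        by (rule filterlim_compose[OF poly_exp_lim]) (simp add: filterlim_inverse_at_top_right flip: inverse_eq_divide)
      moreover have "\<forall>\<^sub>F h in at_right 0. poly (pCons 0 p) (1 / h) * exp (- (1 / h)) = bx p h / h"
        using eventually_at_right_less[of 0] by eventually_elim (simp add: bx_def)
      ultimately show ?thesis by (rule Lim_transform_eventually)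
    qed
    moreover have "((\<lambda>h. bx p h / h) \<longlongrightarrow> 0) (at_left 0)"
    proof (rule tendsto_eventually)
      show "\<forall>\<^sub>F h in at_left 0. bx p h / h = 0" by (auto simp: eventually_at_filter bx_def)
    qed
    ultimately have "((\<lambda>h. bx p h / h) \<longlongrightarrow> 0) (at 0)" by (simp add: filterlim_split_at)
    then show ?thesis using 3 by (simp add: DERIV_def bx_def)
  qed
qed

text \<open>A class closed under differentiation that contains the bump function. The sign enters
  through the inner derivative of 1 - x.\<close>

inductive bump_span :: "(real \<Rightarrow> complex) \<Rightarrow> bool" where
  bump: "bump_span (\<lambda>x. of_real (bx p (1 + x) * bx q (1 - x)))"
| add: "bump_span f \<Longrightarrow> bump_span g \<Longrightarrow> bump_span (\<lambda>x. f x + g x)"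
| uminus: "bump_span f \<Longrightarrow> bump_span (\<lambda>x. - f x)"

lemma bump_span_deriv: "bump_span f \<Longrightarrow> \<exists>g. bump_span g \<and> (\<forall>x. (f has_vector_derivative g x) (at x))"
proof (induction rule: bump_span.induct)
  case (bump p q)
  let ?g = "\<lambda>x. of_real (bx (bxd p) (1 + x) * bx q (1 - x)) + - of_real (bx p (1 + x) * bx (bxd q) (1 - x)) :: complex"
  have "((\<lambda>x. bx p (1 + x) * bx q (1 - x)) has_real_derivative (bx (bxd p) (1 + x) * bx q (1 - x) - bx p (1 + x) * bx (bxd q) (1 - x))) (at x)" for x
    by (auto intro!: derivative_eq_intros DERIV_chain2[OF bx_deriv])
  then have "((\<lambda>x. complex_of_real (bx p (1 + x) * bx q (1 - x))) has_vector_derivative of_real (bx (bxd p) (1 + x) * bx q (1 - x) - bx p (1 + x) * bx (bxd q) (1 - x))) (at x)" for x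
    by (intro has_vector_derivative_of_real) 
  then have "((\<lambda>x. complex_of_real (bx p (1 + x) * bx q (1 - x))) has_vector_derivative ?g x) (at x)" for x by simp
  moreover have "bump_span ?g" by (intro bump_span.intros)
  ultimately show ?case by blast
next
  case (add f g)
  then obtain f' g' where "bump_span f'" "\<And>x. (f has_vector_derivative f' x) (at x)" "bump_span g'" "\<And>x. (g has_vector_derivative g' x) (at x)" by blast
  then show ?case by (intro exI[of _ "\<lambda>x. f' x + g' x"] conjI allI bump_span.add has_vector_derivative_add)
next
  case (uminus f)
  then obtain f' where "bump_span f'" "\<And>x. (f has_vector_derivative f' x) (at x)" by blast
  then show ?case by (intro exI[of _ "\<lambda>x. - f' x"] conjI allI bump_span.uminus has_vector_derivative_minus)
qed

definition rho :: "real \<Rightarrow> complex" where "rho x = of_real (bx 1 (1 + x) * bx 1 (1 - x))"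

lemma rho_test: "rho \<in> test_functions"
proof (rule test_functionsI[where S = bump_span and R = 1])
  show "bump_span rho" unfolding rho_def[abs_def] by (rule bump_span.bump)
  show "rho x = 0" if "1 < \<bar>x\<bar>" for x using that by (auto simp: rho_def bx_def abs_if split: if_splits)
qed (rule bump_span_deriv)

lemma rho_0: "rho 0 \<noteq> 0" by (simp add: rho_def bx_def)

lemma ft_rho_0: "ft rho 0 \<noteq> 0"
proof
  assume "ft rho 0 = 0"
  define r where "r x = bx 1 (1 + x) * bx 1 (1 - x)" for x
  have rr: "rho = (\<lambda>x. of_real (r x))" by (auto simp: rho_def r_def)
  have i: "integrable lborel r" using integrable_Re[OF test_integrable[OF rho_test]] by (simp add: rr)
  have nn: "0 \<le> r x" for x by (simp add: r_def bx_def)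
  have "(LINT x|lborel. r x) = 0" using \<open>ft rho 0 = 0\<close> by (simp add: ft_def rr)
  then have ae: "AE x in lborel. r x = 0" using integral_nonneg_eq_0_iff_AE[OF i] nn by auto
  have "{-1<..<1} \<subseteq> {x \<in> space lborel. \<not> (r x = 0)}" by (auto simp: r_def bx_def)
  moreover obtain N where "{x \<in> space lborel. \<not> (r x = 0)} \<subseteq> N" "emeasure lborel N = 0" "N \<in> sets lborel"
    using ae by (rule AE_E)
  ultimately have "emeasure lborel {-1<..<1::real} \<le> 0" by (metis emeasure_mono order_trans)
  then show False by simp
qed

section \<open>Convolution, mollifiers, cutoffs and density of test functions\<close>

definition conv :: "(real \<Rightarrow> complex) \<Rightarrow> (real \<Rightarrow> complex) \<Rightarrow> real \<Rightarrow> complex" where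
  "conv \<sigma> f x = (LINT y|lborel. \<sigma> (x - y) * f y)"

lemma test_lipschitz:
  assumes T: "\<sigma> \<in> test_functions" obtains M where "M > 0" "\<And>x y. cmod (\<sigma> x - \<sigma> y) \<le> M * \<bar>x - y\<bar>"
proof -
  obtain M where M: "M > 0" "\<And>x. cmod (vderiv \<sigma> x) \<le> M" using test_bound[OF test_vderiv[OF T]] by blast
  have "cmod (\<sigma> x - \<sigma> y) \<le> M * norm (x - y)" for x y
  proof (rule differentiable_bound[of UNIV \<sigma> "\<lambda>x h. h *\<^sub>R vderiv \<sigma> x"])
    show "(\<sigma> has_derivative (\<lambda>h. h *\<^sub>R vderiv \<sigma> x)) (at x)" for x
      using test_hvd[OF T] by (simp add: has_vector_derivative_def)
    show "onorm (\<lambda>h. h *\<^sub>R vderiv \<sigma> x) \<le> M" for x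
      using M by (intro onorm_bound) (auto simp: mult.commute[of M] intro: mult_left_mono)
  qed auto
  with M(1) show ?thesis by (intro that[of M]) (auto simp: real_norm_def)
qed

lemma conv_integrable:
  assumes T: "\<sigma> \<in> test_functions" and f: "integrable lborel f"
  shows "integrable lborel (\<lambda>y. \<sigma> (x - y) * f y)"
proof -
  obtain M where M: "M > 0" "\<And>x. cmod (\<sigma> x) \<le> M" using test_bound[OF T] by blast
  note [measurable] = test_measurable[OF T] borel_measurable_integrable[OF f]
  have "integrable lborel (\<lambda>y. of_real M * f y)" using f by simp
  then show ?thesis
    by (rule Bochner_Integration.integrable_bound) (use M in \<open>auto simp: norm_mult intro!: mult_right_mono\<close>)
qed

lemma conv_deriv:
  assumes T: "\<sigma> \<in> test_functions" and f: "integrable lborel f"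
  shows "(conv \<sigma> f has_vector_derivative conv (vderiv \<sigma>) f x) (at x)"
  unfolding has_vector_derivative_iff_quotient tendsto_at_iff_sequentially
proof (intro allI impI)
  fix X :: "nat \<Rightarrow> real" assume X0: "\<forall>i. X i \<in> UNIV - {0}" and X: "X \<longlonglongrightarrow> 0"
  have fl: "filterlim X (at 0) sequentially" using X0 X by (auto simp: filterlim_at)
  obtain M where M: "M > 0" "\<And>x y. cmod (\<sigma> x - \<sigma> y) \<le> M * \<bar>x - y\<bar>" using test_lipschitz[OF T] by blast
  note [measurable] = test_measurable[OF T] test_measurable[OF test_vderiv[OF T]] borel_measurable_integrable[OF f]
  have eq: "(1 / X n) *\<^sub>R (conv \<sigma> f (x + X n) - conv \<sigma> f x) = (LINT y|lborel. (1 / X n) *\<^sub>R (\<sigma> (x - y + X n) - \<sigma> (x - y)) * f y)" for n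
  proof -
    have "conv \<sigma> f (x + X n) - conv \<sigma> f x = (LINT y|lborel. \<sigma> (x + X n - y) * f y - \<sigma> (x - y) * f y)"
      unfolding conv_def using conv_integrable[OF T f] by (intro Bochner_Integration.integral_diff[symmetric])
    also have "(1 / X n) *\<^sub>R \<dots> = (LINT y|lborel. (1 / X n) *\<^sub>R (\<sigma> (x + X n - y) * f y - \<sigma> (x - y) * f y))"
      by (rule integral_scaleR_right[symmetric])
    finally show ?thesis by (simp add: algebra_simps)
  qed
  have "(\<lambda>n. LINT y|lborel. (1 / X n) *\<^sub>R (\<sigma> (x - y + X n) - \<sigma> (x - y)) * f y) \<longlonglongrightarrow> (LINT y|lborel. vderiv \<sigma> (x - y) * f y)"
  proof (rule integral_dominated_convergence[where w = "\<lambda>y. M * cmod (f y)"])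
    show "AE y in lborel. (\<lambda>n. (1 / X n) *\<^sub>R (\<sigma> (x - y + X n) - \<sigma> (x - y)) * f y) \<longlonglongrightarrow> vderiv \<sigma> (x - y) * f y"
      using test_hvd[OF T] unfolding has_vector_derivative_iff_quotient
      by (intro AE_I2 tendsto_mult tendsto_const) (rule filterlim_compose[OF _ fl])
    show "AE y in lborel. norm ((1 / X n) *\<^sub>R (\<sigma> (x - y + X n) - \<sigma> (x - y)) * f y) \<le> M * cmod (f y)" for n
    proof (intro AE_I2)
      fix y
      have "cmod (\<sigma> (x - y + X n) - \<sigma> (x - y)) \<le> M * \<bar>X n\<bar>" using M(2)[of "x - y + X n" "x - y"] by simp
      then have "cmod ((1 / X n) *\<^sub>R (\<sigma> (x - y + X n) - \<sigma> (x - y))) \<le> 1 / \<bar>X n\<bar> * (M * \<bar>X n\<bar>)"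
        unfolding norm_scaleR abs_divide abs_one by (rule mult_left_mono) simp
      also have "\<dots> = M" using X0 by simp
      finally have "cmod ((1 / X n) *\<^sub>R (\<sigma> (x - y + X n) - \<sigma> (x - y))) \<le> M" .
      then show "norm ((1 / X n) *\<^sub>R (\<sigma> (x - y + X n) - \<sigma> (x - y)) * f y) \<le> M * cmod (f y)"
        unfolding norm_mult by (rule mult_right_mono) simp
    qed
  qed (use f in auto)
  then show "((\<lambda>h. (1 / h) *\<^sub>R (conv \<sigma> f (x + h) - conv \<sigma> f x)) \<circ> X) \<longlonglongrightarrow> conv (vderiv \<sigma>) f x"
    by (simp only: o_def eq conv_def[of "vderiv \<sigma>"])
qed

lemma conv_test:
  assumes T: "\<sigma> \<in> test_functions" and f: "integrable lborel f" and supp: "\<And>x. R < \<bar>x\<bar> \<Longrightarrow> f x = 0"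
  shows "conv \<sigma> f \<in> test_functions"
proof -
  obtain Q where Q: "\<And>x. Q < \<bar>x\<bar> \<Longrightarrow> \<sigma> x = 0" using test_support[OF T] by blast
  show ?thesis
  proof (rule test_functionsI[where S = "\<lambda>g. \<exists>\<sigma>\<in>test_functions. g = conv \<sigma> f" and R = "R + Q"])
    show "\<exists>g. (\<exists>\<sigma>\<in>test_functions. g = conv \<sigma> f) \<and> (\<forall>x. (h has_vector_derivative g x) (at x))"
      if "\<exists>\<sigma>\<in>test_functions. h = conv \<sigma> f" for h
      using that conv_deriv[OF _ f] test_vderiv by blast
    fix x assume x: "R + Q < \<bar>x\<bar>"
    have "\<sigma> (x - y) * f y = 0" for y
    proof (cases "R < \<bar>y\<bar>")
      case False
      then have "Q < \<bar>x - y\<bar>" using x by linarith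
      then show ?thesis using Q by simp
    qed (use supp in simp)
    then show "conv \<sigma> f x = 0" unfolding conv_def by (simp only: integral_zero)
  qed (use T in blast)
qed

lemma ft_conv:
  assumes T: "\<sigma> \<in> test_functions" and f: "integrable lborel f"
  shows "ft (conv \<sigma> f) \<xi> = ft \<sigma> \<xi> * ft f \<xi>"
proof -
  note [measurable] = test_measurable[OF T] borel_measurable_integrable[OF f]
  let ?e = "\<lambda>x. exp (- (\<i> * of_real (x * \<xi>)))"
  have sh: "integrable lborel (\<lambda>x. \<sigma> (x - y))" for y
    using lborel_integrable_real_affine[OF test_integrable[OF T], of 1 "-y"] by (simp add: add.commute)
  have int: "integrable (lborel \<Otimes>\<^sub>M lborel) (\<lambda>(y, x). \<sigma> (x - y) * f y * ?e x)"
  proof (rule lborel_pair.Fubini_integrable)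
    have "(LINT x|lborel. cmod (\<sigma> (x - y) * f y * ?e x)) = (LINT x|lborel. cmod (\<sigma> x)) * cmod (f y)" for y
      using lborel_integral_real_affine[of 1 "\<lambda>x. cmod (\<sigma> x)" "-y"] by (simp add: norm_mult add.commute del: of_real_mult)
    then show "integrable lborel (\<lambda>y. LINT x|lborel. cmod (case (y, x) of (y, x) \<Rightarrow> \<sigma> (x - y) * f y * ?e x))"
      using f by (simp add: integrable_mult_right)
    have "integrable lborel (\<lambda>x. f y * (\<sigma> (x - y) * ?e x))" for y
      by (intro integrable_mult_right integrable_ft sh)
    then show "AE y in lborel. integrable lborel (\<lambda>x. case (y, x) of (y, x) \<Rightarrow> \<sigma> (x - y) * f y * ?e x)"
      by (simp add: mult_ac)
  qed measurable
  have "ft (conv \<sigma> f) \<xi> = (LINT x|lborel. LINT y|lborel. \<sigma> (x - y) * f y * ?e x)"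
    unfolding ft_def conv_def by simp
  also have "\<dots> = (LINT y|lborel. LINT x|lborel. \<sigma> (x - y) * f y * ?e x)"
    by (rule lborel_pair.Fubini_integral[OF int])
  also have "\<dots> = (LINT y|lborel. ft \<sigma> \<xi> * (f y * ?e y))"
  proof (rule Bochner_Integration.integral_cong[OF refl])
    fix y
    have "(LINT x|lborel. \<sigma> (x - y) * f y * ?e x) = (LINT x|lborel. f y * (\<sigma> (x + - y) * ?e x))"
      by (simp add: mult_ac)
    also have "\<dots> = f y * ft (\<lambda>x. \<sigma> (x + - y)) \<xi>" unfolding ft_def by (rule integral_mult_right_zero)
    also have "\<dots> = ft \<sigma> \<xi> * (f y * ?e y)" unfolding ft_shift by simp
    finally show "(LINT x|lborel. \<sigma> (x - y) * f y * ?e x) = ft \<sigma> \<xi> * (f y * ?e y)" .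
  qed
  also have "\<dots> = ft \<sigma> \<xi> * ft f \<xi>" unfolding ft_def[of f] by (rule integral_mult_right_zero)
  finally show ?thesis .
qed

lemma bmult_ft: assumes "integrable lborel \<sigma>" shows "bmult (ft \<sigma>)"
proof (rule bmultI[OF _ cmod_ft_le])
  show "ft \<sigma> \<in> borel_measurable borel" using borel_measurable_integrable[OF assms] by simp
qed

lemma conv_fm:
  assumes T: "\<sigma> \<in> test_functions" and f: "f \<in> L2" and supp: "\<And>x. R < \<bar>x\<bar> \<Longrightarrow> f x = 0"
  shows "cl (conv \<sigma> f) = fm (ft \<sigma>) (cl f)"
proof (rule Fo_inj)
  have fi: "integrable lborel f" by (rule supported_integrable[OF f, of R]) (rule supp)
  have C: "conv \<sigma> f \<in> test_functions" by (rule conv_test[OF T fi, of R]) (rule supp)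
  show "Fo (cl (conv \<sigma> f)) = Fo (fm (ft \<sigma>) (cl f))"
    unfolding Fo_fm Fo_L1(2)[OF test_L2[OF C] test_integrable[OF C]] Fo_L1(2)[OF f fi]
      mop_cl[OF bmult_ft[OF test_integrable[OF T]] Fo_L1(1)[OF f fi]]
    by (simp add: ft_conv[OF T fi, abs_def])
qed

lemma ft_rescale: assumes c: "c > 0" shows "ft (\<lambda>x. k * (of_real c * \<sigma> (c * x))) \<xi> = k * ft \<sigma> (\<xi> / c)"
proof -
  have "ft \<sigma> (\<xi> / c) = c *\<^sub>R (LINT x|lborel. \<sigma> (c * x) * exp (- (\<i> * of_real ((c * x) * (\<xi> / c)))))"
    unfolding ft_def using lborel_integral_real_affine[of c "\<lambda>x. \<sigma> x * exp (- (\<i> * of_real (x * (\<xi> / c))))" 0] c by simp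
  also have "\<dots> = (LINT x|lborel. of_real c * \<sigma> (c * x) * exp (- (\<i> * of_real (x * \<xi>))))"
    unfolding scaleR_conv_of_real integral_mult_right_zero[symmetric] using c by (simp add: mult.assoc)
  finally show ?thesis unfolding ft_cmult by (simp only: ft_def integral_mult_right_zero mult.assoc)
qed

lemma ft_cont_0:
  assumes f: "integrable lborel f" and X: "X \<longlonglongrightarrow> (0::real)"
  shows "(\<lambda>n. ft f (X n)) \<longlonglongrightarrow> ft f 0"
  unfolding ft_def
proof (rule integral_dominated_convergence[where w = "\<lambda>x. cmod (f x)"])
  show "AE x in lborel. (\<lambda>n. f x * exp (- (\<i> * of_real (x * X n)))) \<longlonglongrightarrow> f x * exp (- (\<i> * of_real (x * 0)))"
    by (intro AE_I2 tendsto_intros X)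
qed (use f borel_measurable_integrable[OF f] in \<open>auto simp: norm_mult\<close>)

text \<open>Division by the transform of \<open>rho\<close> at 0, the integral of
  \<open>rho\<close>, gives total integral 1. The transforms are rescalings of one bounded function
  and tend to 1 at every frequency.\<close>

definition moll :: "nat \<Rightarrow> real \<Rightarrow> complex" where
  "moll n x = (1 / ft rho 0) * (of_real (1 + real n) * rho ((1 + real n) * x))"

lemma moll_test: "moll n \<in> test_functions"
  unfolding moll_def[abs_def] using test_rescale[OF rho_test, of "1 + real n" "1 / ft rho 0 * of_real (1 + real n)"] by (simp add: mult.assoc)

lemma moll_lim: "(\<lambda>n. fm (ft (moll n)) g) \<longlonglongrightarrow> g"
proof -
  have ftm: "ft (moll n) \<xi> = 1 / ft rho 0 * ft rho (\<xi> / (1 + real n))" for n \<xi>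
    unfolding moll_def[abs_def] by (rule ft_rescale) simp
  define C where "C = cmod (1 / ft rho 0) * (LINT x|lborel. cmod (rho x))"
  have C0: "C \<ge> 0" by (simp add: C_def)
  have C: "cmod (ft (moll n) \<xi>) \<le> C" for n \<xi>
    unfolding ftm norm_mult C_def by (intro mult_left_mono cmod_ft_le) auto
  have "(\<lambda>n. mop (ft (moll n)) (Fo g)) \<longlonglongrightarrow> Fo g"
  proof (rule mop_dominated_seq[where K = "cs (of_real C) (Fo g)"])
    show "bmult (ft (moll n))" for n by (rule bmult_ft[OF test_integrable[OF moll_test]])
    show "AE x in lborel. cmod (ft (moll n) x * rp (Fo g) x) \<le> cmod (rp (cs (of_real C) (Fo g)) x)" for n
      using rp_cs[of "of_real C" "Fo g"]
    proof eventually_elim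
      case (elim x)
      show ?case unfolding elim norm_mult using C C0 by (intro mult_right_mono) auto
    qed
    have "(\<lambda>n. ft (moll n) x * rp (Fo g) x) \<longlonglongrightarrow> 1 / ft rho 0 * ft rho 0 * rp (Fo g) x" for x
    proof -
      have "(\<lambda>n. x / (1 + real n)) \<longlonglongrightarrow> 0" by real_asymp
      from ft_cont_0[OF test_integrable[OF rho_test] this] show ?thesis
        unfolding ftm by (intro tendsto_mult tendsto_const)
    qed
    then show "AE x in lborel. (\<lambda>n. ft (moll n) x * rp (Fo g) x) \<longlonglongrightarrow> rp (Fo g) x" using ft_rho_0 by simp
  qed
  then have "(\<lambda>n. Fi (mop (ft (moll n)) (Fo g))) \<longlonglongrightarrow> Fi (Fo g)" by (rule bounded_linear.tendsto[OF bounded_linear_Fi])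
  then show ?thesis by (simp add: fm_def)
qed

text \<open>The same bump, now normalised by its value at 0 and stretched: it tends to 1 at every
  point while its derivative is of order 1 / (1 + n).\<close>

definition cutoff :: "nat \<Rightarrow> real \<Rightarrow> complex" where "cutoff n x = (1 / rho 0) * rho (1 / (1 + real n) * x)"

lemma cutoff_test: "cutoff n \<in> test_functions"
  unfolding cutoff_def[abs_def] by (rule test_rescale[OF rho_test]) simp

lemma vderiv_cutoff: "vderiv (cutoff n) x = of_real (1 / (1 + real n)) * ((1 / rho 0) * vderiv rho (1 / (1 + real n) * x))"
proof -
  let ?c = "1 / (1 + real n)"
  have "((\<lambda>x. ?c * x) has_vector_derivative ?c) (at x)" by (auto intro!: derivative_eq_intros simp: has_real_derivative_iff_has_vector_derivative[symmetric])
  from vector_diff_chain_at[OF this test_hvd[OF rho_test]]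
  have "((\<lambda>x. rho (?c * x)) has_vector_derivative ?c *\<^sub>R vderiv rho (?c * x)) (at x)" by (simp add: o_def)
  from has_vector_derivative_mult_right[OF this, of "1 / rho 0"] 
  have "(cutoff n has_vector_derivative (1 / rho 0) * (?c *\<^sub>R vderiv rho (?c * x))) (at x)" unfolding cutoff_def[abs_def] .
  from vector_derivative_at[OF this] show ?thesis unfolding vderiv_def by (simp add: scaleR_conv_of_real)
qed

lemma mop_rp_cl: assumes "bmult m" "m \<in> L2" shows "mop (rp (cl m)) f = mop m f" "bmult (rp (cl m))"
proof -
  obtain C where C: "AE x in lborel. cmod (m x) \<le> C" using assms by (auto simp: bmult_def)
  have "AE x in lborel. cmod (rp (cl m) x) \<le> C" using C rp_cl[OF assms(2)] by eventually_elim simp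
  then show b: "bmult (rp (cl m))" by (auto simp: bmult_def)
  show "mop (rp (cl m)) f = mop m f" by (rule mop_cong[OF b assms(1) rp_cl[OF assms(2)]])
qed

lemma cutoff_lim:
  "(\<lambda>n. mop (cutoff n) g) \<longlonglongrightarrow> g" "(\<lambda>n. mop (vderiv (cutoff n)) g) \<longlonglongrightarrow> 0"
proof -
  obtain M where M: "M > 0" "\<And>x. cmod (rho x) \<le> M" using test_bound[OF rho_test] by blast
  define C where "C = cmod (1 / rho 0) * M"
  have C0: "C \<ge> 0" using M by (simp add: C_def)
  have C: "cmod (cutoff n x) \<le> C" for n x unfolding cutoff_def norm_mult C_def using M by (intro mult_left_mono) auto
  show "(\<lambda>n. mop (cutoff n) g) \<longlonglongrightarrow> g"
  proof (rule mop_dominated_seq[where K = "cs (of_real C) g"])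
    show "bmult (cutoff n)" for n by (rule test_bmult[OF cutoff_test])
    show "AE x in lborel. cmod (cutoff n x * rp g x) \<le> cmod (rp (cs (of_real C) g) x)" for n
      using rp_cs[of "of_real C" g]
    proof eventually_elim
      case (elim x)
      show ?case unfolding elim norm_mult using C C0 by (intro mult_right_mono) auto
    qed
    have "(\<lambda>n. cutoff n x * rp g x) \<longlonglongrightarrow> 1 / rho 0 * rho 0 * rp g x" for x
    proof -
      have l: "(\<lambda>n. 1 / (1 + real n) * x) \<longlonglongrightarrow> 0" by real_asymp
      have "isCont rho 0" using test_cont[OF rho_test, of UNIV] by (simp add: continuous_on_eq_continuous_at)
      from isCont_tendsto_compose[OF this l] show ?thesis unfolding cutoff_def by (intro tendsto_mult tendsto_const)
    qed
    then show "AE x in lborel. (\<lambda>n. cutoff n x * rp g x) \<longlonglongrightarrow> rp g x" using rho_0 by simp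
  qed
  obtain M' where M': "M' > 0" "\<And>x. cmod (vderiv rho x) \<le> M'" using test_bound[OF test_vderiv[OF rho_test]] by blast
  define C' where "C' = cmod (1 / rho 0) * M'"
  have "norm (mop (vderiv (cutoff n)) g) \<le> 1 / (1 + real n) * C' * norm g" for n
  proof (rule norm_mop_le[OF test_bmult[OF test_vderiv[OF cutoff_test]]])
    have "cmod (vderiv (cutoff n) x) \<le> 1 / (1 + real n) * C'" for x
      unfolding vderiv_cutoff norm_mult norm_of_real C'_def using M' by (intro mult_mono) auto
    then show "AE x in lborel. cmod (vderiv (cutoff n) x) \<le> 1 / (1 + real n) * C'" by simp
  qed (use M' in \<open>simp add: C'_def\<close>)
  then have "\<forall>\<^sub>F n in sequentially. norm (mop (vderiv (cutoff n)) g) \<le> 1 / (1 + real n) * C' * norm g" by simp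
  moreover have "(\<lambda>n. 1 / (1 + real n) * C' * norm g) \<longlonglongrightarrow> 0" by real_asymp
  ultimately show "(\<lambda>n. mop (vderiv (cutoff n)) g) \<longlonglongrightarrow> 0" by (rule Lim_null_comparison)
qed

text \<open>Mollification is a Fourier multiplier, so it commutes with differentiation, and
  convergence of the function and of its derivative are two instances of
  \<open>moll_lim\<close>.\<close>

lemma test_dense_compact:
  assumes h: "hasd (cl f) f'" and f: "f \<in> L2" and supp: "\<And>x. R < \<bar>x\<bar> \<Longrightarrow> f x = 0" and e: "e > 0"
  shows "\<exists>\<psi>\<in>test_functions. norm (cl \<psi> - cl f) < e \<and> norm (cl (vderiv \<psi>) - f') < e"
proof -
  have fi: "integrable lborel f" by (rule supported_integrable[OF f, of R]) (rule supp)
  define \<psi> where "\<psi> n = conv (moll n) f" for n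
  have T: "\<psi> n \<in> test_functions" for n unfolding \<psi>_def by (rule conv_test[OF moll_test fi, of R]) (rule supp)
  have a: "cl (\<psi> n) = fm (ft (moll n)) (cl f)" for n unfolding \<psi>_def by (rule conv_fm[OF moll_test f, of R]) (rule supp)
  have b: "cl (vderiv (\<psi> n)) = fm (ft (moll n)) f'" for n
    using hasd_unique[OF test_hasd[OF T]] hasd_fm[OF h bmult_ft[OF test_integrable[OF moll_test]]] unfolding a by blast
  obtain N1 where N1: "\<And>n. n \<ge> N1 \<Longrightarrow> norm (cl (\<psi> n) - cl f) < e" using LIMSEQ_D[OF moll_lim[of "cl f"] e] unfolding a by blast
  obtain N2 where N2: "\<And>n. n \<ge> N2 \<Longrightarrow> norm (cl (vderiv (\<psi> n)) - f') < e" using LIMSEQ_D[OF moll_lim[of f'] e] unfolding b by blast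
  show ?thesis using T N1[of "max N1 N2"] N2[of "max N1 N2"] by (intro bexI[of _ "\<psi> (max N1 N2)"]) auto
qed

text \<open>First cut off, then mollify. The term in which the cutoff is differentiated vanishes in
  the limit.\<close>

lemma test_dense:
  assumes h: "hasd f f'" and e: "e > 0"
  shows "\<exists>\<psi>\<in>test_functions. norm (cl \<psi> - f) < e \<and> norm (cl (vderiv \<psi>) - f') < e"
proof -
  define g where "g n = mop (cutoff n) f" for n
  define g' where "g' n = mop (vderiv (cutoff n)) f + mop (cutoff n) f'" for n
  note bc = test_bmult[OF cutoff_test] and bc' = test_bmult[OF test_vderiv[OF cutoff_test]]
  have hg: "hasd (g n) (g' n)" for n
    using hasd_mul[OF test_hasd[OF cutoff_test] h, of n]
    unfolding mop_swap[of f "cl (vderiv (cutoff n))"] mop_rp_cl(1)[OF bc test_L2[OF cutoff_test]]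
      mop_rp_cl(1)[OF bc' test_L2[OF test_vderiv[OF cutoff_test]]] g_def g'_def .
  have l1: "g \<longlonglongrightarrow> f" unfolding g_def by (rule cutoff_lim)
  have l2: "g' \<longlonglongrightarrow> f'" unfolding g'_def using tendsto_add[OF cutoff_lim(2)[of f] cutoff_lim(1)[of f']] by simp
  have e2: "e / 2 > 0" using e by simp
  obtain N1 where N1: "\<And>n. n \<ge> N1 \<Longrightarrow> norm (g n - f) < e / 2" using LIMSEQ_D[OF l1 e2] by blast
  obtain N2 where N2: "\<And>n. n \<ge> N2 \<Longrightarrow> norm (g' n - f') < e / 2" using LIMSEQ_D[OF l2 e2] by blast
  define n where "n = max N1 N2"
  define k where "k = (\<lambda>x. cutoff n x * rp f x)"
  have kL: "k \<in> L2" unfolding k_def by (rule bmult_L2[OF bc]) simp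
  have gk: "g n = cl k" by (simp add: g_def k_def mop_def)
  obtain R where "\<And>x. R < \<bar>x\<bar> \<Longrightarrow> cutoff n x = 0" using test_support[OF cutoff_test] by blast
  then have supp: "\<And>x. R < \<bar>x\<bar> \<Longrightarrow> k x = 0" by (simp add: k_def)
  obtain \<psi> where \<psi>: "\<psi> \<in> test_functions" "norm (cl \<psi> - g n) < e / 2" "norm (cl (vderiv \<psi>) - g' n) < e / 2"
    using test_dense_compact[OF hg[of n, unfolded gk] kL supp e2] unfolding gk by blast
  have "norm (cl \<psi> - f) < e" using \<psi>(2) N1[of n] norm_triangle_ineq[of "cl \<psi> - g n" "g n - f"] by (simp add: n_def)
  moreover have "norm (cl (vderiv \<psi>) - f') < e" using \<psi>(3) N2[of n] norm_triangle_ineq[of "cl (vderiv \<psi>) - g' n" "g' n - f'"] by (simp add: n_def)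
  ultimately show ?thesis using \<psi>(1) by blast
qed

lemma hasd_dense:
  obtains X X' where "\<And>n. hasd (X n) (X' n)" "X \<longlonglongrightarrow> f"
proof -
  define X where "X n = fm (indicator {-real n..real n}) f" for n
  define m where "m n \<xi> = \<i> * of_real \<xi> * indicator {-real n..real n} \<xi>" for n and \<xi> :: real
  have m: "bmult (m n)" for n
  proof (rule bmultI[of _ "real n"])
    show "m n \<in> borel_measurable borel" unfolding m_def[abs_def] by measurable
    show "cmod (m n x) \<le> real n" for x by (auto simp: m_def norm_mult indicator_def)
  qed
  have "hasd (X n) (fm (m n) f)" for n
    unfolding hasd_def X_def Fo_fm using rp_mop[OF m, of n "Fo f"] rp_mop[OF bmult_indicator[of "{-real n..real n}"], simplified, of "Fo f"]
    by eventually_elim (simp add: m_def)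
  moreover have "X \<longlonglongrightarrow> f"
  proof -
    have "(\<lambda>n. Fi (tr (real n) (Fo f))) \<longlonglongrightarrow> Fi (Fo f)"
      by (rule bounded_linear.tendsto[OF bounded_linear_Fi filterlim_compose[OF tr_lim filterlim_real_sequentially]])
    then show ?thesis by (simp add: X_def[abs_def] fm_def tr_def)
  qed
  ultimately show ?thesis by (rule that)
qed

subsection \<open>Distributional derivatives and Sobolev spaces\<close>

lemma pairing_cip: assumes "f \<in> L2" "\<psi> \<in> L2" shows "(LINT x|lborel. f x * \<psi> x) = cip (cl f) (cj (cl \<psi>))"
  unfolding cj_cl[OF assms(2)] cip_cl[OF assms(1) L2_cnj[OF assms(2)]] L2_inner_def by simp

text \<open>Test functions are dense in H^1 and H^1 is dense in L^2. The conjugation is present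
  because distributional pairings are bilinear whereas \<open>cip\<close> is sesquilinear.\<close>

lemma pairing_zero:
  assumes "\<And>\<psi>. \<psi> \<in> test_functions \<Longrightarrow> cip h (cj (cl \<psi>)) = 0" shows "h = 0"
proof -
  have 1: "cip h (cj k) = 0" if k: "hasd k k'" for k k'
  proof -
    have "cmod (cip h (cj k)) \<le> norm h * e" if e: "e > 0" for e
    proof -
      obtain \<psi> where \<psi>: "\<psi> \<in> test_functions" "norm (cl \<psi> - k) < e" using test_dense[OF k e] by blast
      have "cip h (cj k) = - cip h (cj (cl \<psi> - k))" unfolding cj_diff cip_diff_right assms[OF \<psi>(1)] by simp
      then have "cmod (cip h (cj k)) \<le> norm h * norm (cl \<psi> - k)" using cmod_cip_le[of h "cj (cl \<psi> - k)"] by simp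
      also have "\<dots> \<le> norm h * e" using \<psi>(2) by (intro mult_left_mono) auto
      finally show ?thesis .
    qed
    then have "cmod (cip h (cj k)) \<le> norm h * e" if "e > 0" for e using that by blast
    moreover have "((\<lambda>e. norm h * e) \<longlongrightarrow> norm h * 0) (at_right 0)" by (intro tendsto_intros)
    ultimately have "cmod (cip h (cj k)) \<le> norm h * 0"
      by (intro tendsto_lowerbound[of _ _ "at_right 0"]) (auto simp: eventually_at_filter)
    then show ?thesis by simp
  qed
  obtain X X' where X: "\<And>n. hasd (X n) (X' n)" "X \<longlonglongrightarrow> cj h" using hasd_dense[of "cj h"] by blast
  have "(\<lambda>n. cip h (cj (X n))) \<longlonglongrightarrow> cip h (cj (cj h))"
    by (intro tendsto_cip tendsto_const bounded_linear.tendsto[OF bounded_linear_cj] X)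
  then have "(\<lambda>n. 0) \<longlonglongrightarrow> cip h h" by (simp add: 1[OF X(1)])
  from LIMSEQ_unique[OF this tendsto_const] have "cip h h = 0" .
  then show ?thesis by (simp add: cip_self_norm)
qed

text \<open>Integration by parts shows that \<open>g\<close> is eligible for the choice in
  \<open>ddx\<close>, and \<open>pairing_zero\<close> shows that any two eligible functions have the
  same class.\<close>

lemma ddx_hasd:
  assumes f: "f \<in> L2" and h: "hasd (cl f) g"
  shows "ddx f \<in> L2" "cl (ddx f) = g"
proof -
  have ibp: "cip g (cj (cl \<psi>)) = - (LINT x|lborel. f x * vderiv \<psi> x)" if "\<psi> \<in> test_functions" for \<psi>
    using hasd_ibp[OF h hasd_cj[OF test_hasd[OF that]]] pairing_cip[OF f test_L2[OF test_vderiv[OF that]]] by simp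
  have "(LINT x|lborel. rp g x * \<psi> x) = - (LINT x|lborel. f x * vderiv \<psi> x)" if "\<psi> \<in> test_functions" for \<psi>
    using ibp[OF that] pairing_cip[OF rp_L2[of g] test_L2[OF that]] by simp
  then have "\<exists>g. g \<in> L2 \<and> (\<forall>\<psi>\<in>test_functions. (LINT x|lborel. g x * \<psi> x) = - (LINT x|lborel. f x * vderiv \<psi> x))"
    by (intro exI[of _ "rp g"]) auto
  from someI_ex[OF this] have d: "ddx f \<in> L2" "\<And>\<psi>. \<psi> \<in> test_functions \<Longrightarrow> (LINT x|lborel. ddx f x * \<psi> x) = - (LINT x|lborel. f x * vderiv \<psi> x)"
    unfolding ddx_def by blast+
  show "ddx f \<in> L2" by fact
  have "cip (cl (ddx f) - g) (cj (cl \<psi>)) = 0" if "\<psi> \<in> test_functions" for \<psi>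
    unfolding cip_diff_left ibp[OF that] using d(2)[OF that] pairing_cip[OF d(1) test_L2[OF that]] by simp
  then have "cl (ddx f) - g = 0" by (rule pairing_zero)
  then show "cl (ddx f) = g" by simp
qed

lemma sobolev_weight:
  assumes f: "f \<in> L2" and h: "hasd (cl f) g"
  shows "integrable lborel (\<lambda>\<xi>. (1 + \<xi>\<^sup>2) powr 1 * (cmod (fourier f \<xi>))\<^sup>2)"
    "(LINT \<xi>|lborel. (1 + \<xi>\<^sup>2) powr 1 * (cmod (fourier f \<xi>))\<^sup>2) = 2 * pi * ((norm (cl f))\<^sup>2 + (norm g)\<^sup>2)"
proof -
  have ae: "AE \<xi> in lborel. (1 + \<xi>\<^sup>2) powr 1 * (cmod (fourier f \<xi>))\<^sup>2 = (cmod (rp (Fo (cl f)) \<xi>))\<^sup>2 + (cmod (rp (Fo g) \<xi>))\<^sup>2"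
    using rp_Fo[OF f] h unfolding hasd_def
  proof eventually_elim
    case (elim \<xi>)
    have "1 + \<xi>\<^sup>2 > 0" by (simp add: add_pos_nonneg)
    then show ?case using elim by (simp add: norm_mult power_mult_distrib algebra_simps)
  qed
  have i: "integrable lborel (\<lambda>\<xi>. (cmod (rp (Fo (cl f)) \<xi>))\<^sup>2 + (cmod (rp (Fo g) \<xi>))\<^sup>2)"
    by (intro Bochner_Integration.integrable_add L2_D(2)) auto
  have m: "(\<lambda>\<xi>. (1 + \<xi>\<^sup>2) powr 1 * (cmod (fourier f \<xi>))\<^sup>2) \<in> borel_measurable lborel"
    using L2_meas[OF fourier_L2(1)[OF f]] by measurable
  show "integrable lborel (\<lambda>\<xi>. (1 + \<xi>\<^sup>2) powr 1 * (cmod (fourier f \<xi>))\<^sup>2)"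
    using integrable_cong_AE[OF m borel_measurable_integrable[OF i] ae] i by blast
  have "(LINT \<xi>|lborel. (1 + \<xi>\<^sup>2) powr 1 * (cmod (fourier f \<xi>))\<^sup>2) = (norm (Fo (cl f)))\<^sup>2 + (norm (Fo g))\<^sup>2"
    using integral_cong_AE[OF m borel_measurable_integrable[OF i] ae] L2_D(2)[OF rp_L2] by (simp add: norm_l2_sq)
  then show "(LINT \<xi>|lborel. (1 + \<xi>\<^sup>2) powr 1 * (cmod (fourier f \<xi>))\<^sup>2) = 2 * pi * ((norm (cl f))\<^sup>2 + (norm g)\<^sup>2)"
    by (simp add: norm_Fo power_mult_distrib algebra_simps)
qed

lemma sobolev_1_iff: "f \<in> sobolev 1 \<longleftrightarrow> f \<in> L2 \<and> (\<exists>g. hasd (cl f) g)"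
proof (intro iffI conjI)
  assume a: "f \<in> sobolev 1"
  then show f: "f \<in> L2" by (simp add: sobolev_def)
  have i: "integrable lborel (\<lambda>\<xi>. (1 + \<xi>\<^sup>2) powr 1 * (cmod (fourier f \<xi>))\<^sup>2)" using a by (simp only: sobolev_def mem_Collect_eq)
  note [measurable] = L2_meas[OF fourier_L2(1)[OF f]]
  have "integrable lborel (\<lambda>\<xi>. (cmod (\<i> * of_real \<xi> * fourier f \<xi>))\<^sup>2)"
  proof (rule Bochner_Integration.integrable_bound[OF i])
    have "\<xi>\<^sup>2 * c \<le> (1 + \<xi>\<^sup>2) powr 1 * c" if "c \<ge> 0" for \<xi> c :: real
    proof -
      have "1 + \<xi>\<^sup>2 > 0" by (simp add: add_pos_nonneg)
      then show ?thesis using that by (intro mult_right_mono) auto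
    qed
    then show "AE \<xi> in lborel. norm ((cmod (\<i> * of_real \<xi> * fourier f \<xi>))\<^sup>2) \<le> norm ((1 + \<xi>\<^sup>2) powr 1 * (cmod (fourier f \<xi>))\<^sup>2)"
      by (simp add: norm_mult power_mult_distrib)
  qed measurable
  then have L: "(\<lambda>\<xi>. \<i> * of_real \<xi> * fourier f \<xi>) \<in> L2" by (simp add: L2_def)
  have "hasd (cl f) (Fi (cl (\<lambda>\<xi>. \<i> * of_real \<xi> * fourier f \<xi>)))"
    unfolding hasd_def Fo_Fi using rp_cl[OF L] rp_Fo[OF f] by eventually_elim simp
  then show "\<exists>g. hasd (cl f) g" by blast
next
  assume "f \<in> L2 \<and> (\<exists>g. hasd (cl f) g)"
  then show "f \<in> sobolev 1" using sobolev_weight(1)[of f] unfolding sobolev_def by blast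
qed

lemma sobolev_plus_1_iff: "f \<in> sobolev_plus 1 \<longleftrightarrow> f \<in> L2 \<and> (\<exists>g. hasd (cl f) g) \<and> Sz (cl f) = cl f"
proof -
  have "(AE \<xi> in lborel. \<xi> < 0 \<longrightarrow> fourier f \<xi> = 0) \<longleftrightarrow> Sz (cl f) = cl f" if f: "f \<in> L2"
    unfolding Sz_eq_iff using rp_Fo[OF f] by (auto elim: eventually_elim2)
  then show ?thesis unfolding sobolev_plus_def using sobolev_1_iff by auto
qed

lemma sobolev_norm_1:
  assumes "f \<in> L2" "hasd (cl f) g"
  shows "norm (cl f) \<le> sobolev_norm 1 f" "norm g \<le> sobolev_norm 1 f"
proof -
  have "sobolev_norm 1 f = sqrt (2 * pi * ((norm (cl f))\<^sup>2 + (norm g)\<^sup>2))" unfolding sobolev_norm_def sobolev_weight(2)[OF assms] ..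
  moreover have "x\<^sup>2 + y\<^sup>2 \<le> 2 * pi * (x\<^sup>2 + y\<^sup>2)" for x y :: real
  proof -
    have "1 * (x\<^sup>2 + y\<^sup>2) \<le> (2 * pi) * (x\<^sup>2 + y\<^sup>2)" using pi_ge_two by (intro mult_right_mono) auto
    then show ?thesis by simp
  qed
  ultimately have *: "sqrt ((norm (cl f))\<^sup>2 + (norm g)\<^sup>2) \<le> sobolev_norm 1 f" by simp
  show "norm (cl f) \<le> sobolev_norm 1 f" by (rule order_trans[OF real_sqrt_sum_squares_ge1 *])
  show "norm g \<le> sobolev_norm 1 f" by (rule order_trans[OF real_sqrt_sum_squares_ge2 *])
qed

subsection \<open>Products of Sobolev functions\<close>

definition H1 :: "l2 \<Rightarrow> bool" where "H1 f \<longleftrightarrow> (\<exists>g. hasd f g)"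
definition dx :: "l2 \<Rightarrow> l2" where "dx f = (SOME g. hasd f g)"

lemma hasd_dx: "H1 f \<Longrightarrow> hasd f (dx f)"
  unfolding H1_def dx_def by (rule someI_ex)

lemma hasd_iff: "hasd f g \<longleftrightarrow> H1 f \<and> dx f = g"
  using hasd_dx hasd_unique H1_def by blast

lemma hasdD: "hasd f g \<Longrightarrow> H1 f" "hasd f g \<Longrightarrow> dx f = g" by (simp_all add: hasd_iff)

lemma H1_add [simp]: "H1 f \<Longrightarrow> H1 g \<Longrightarrow> H1 (f + g)" and dx_add: "H1 f \<Longrightarrow> H1 g \<Longrightarrow> dx (f + g) = dx f + dx g"
  using hasd_add[OF hasd_dx hasd_dx] unfolding hasd_iff by auto
lemma H1_diff [simp]: "H1 f \<Longrightarrow> H1 g \<Longrightarrow> H1 (f - g)" and dx_diff: "H1 f \<Longrightarrow> H1 g \<Longrightarrow> dx (f - g) = dx f - dx g"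
  using hasd_diff[OF hasd_dx hasd_dx] unfolding hasd_iff by auto
lemma H1_cs [simp]: "H1 f \<Longrightarrow> H1 (cs c f)" and dx_cs: "H1 f \<Longrightarrow> dx (cs c f) = cs c (dx f)"
  using hasd_cs[OF hasd_dx] unfolding hasd_iff by auto
lemma H1_minus [simp]: "H1 f \<Longrightarrow> H1 (- f)" and dx_minus: "H1 f \<Longrightarrow> dx (- f) = - dx f"
  using hasd_minus[OF hasd_dx] unfolding hasd_iff by auto
lemma H1_cj [simp]: "H1 f \<Longrightarrow> H1 (cj f)" and dx_cj: "H1 f \<Longrightarrow> dx (cj f) = cj (dx f)"
  using hasd_cj[OF hasd_dx] unfolding hasd_iff by auto
lemma H1_Sz [simp]: "H1 f \<Longrightarrow> H1 (Sz f)" and dx_Sz: "H1 f \<Longrightarrow> dx (Sz f) = Sz (dx f)"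
  using hasd_Sz[OF hasd_dx] unfolding hasd_iff by auto
lemma H1_zero [simp]: "H1 0" and dx_zero [simp]: "dx 0 = 0"
  using hasd_zero unfolding hasd_iff by auto

lemma dx_ibp: "H1 f \<Longrightarrow> H1 g \<Longrightarrow> cip (dx f) g = - cip f (dx g)"
  by (rule hasd_ibp[OF hasd_dx hasd_dx])

text \<open>
  The product in \<^const>\<open>mop\<close> is the pointwise one only if one of the factors is essentially
  bounded, in particular if it lies in H^1.
\<close>

instantiation l2 :: times
begin
definition times_l2 where "f * g = mop (rp f) g"
instance ..
end

lemma mul_comm: "f * g = g * (f :: l2)" unfolding times_l2_def by (rule mop_swap)

lemma H1_bmult: "H1 f \<Longrightarrow> bmult (rp f)" unfolding H1_def using hasd_bmult by blast

lemma mul_add: "H1 f \<Longrightarrow> f * (g + h) = f * g + f * h"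
  unfolding times_l2_def by (rule mop_add[OF H1_bmult])
lemma mul_diff: "H1 f \<Longrightarrow> f * (g - h) = f * g - f * h"
  unfolding times_l2_def by (rule mop_diff[OF H1_bmult])
lemma mul_cs: "H1 f \<Longrightarrow> f * cs c g = cs c (f * g)"
  unfolding times_l2_def by (rule mop_cs[OF H1_bmult])
lemma diff_mul_H1: "H1 f \<Longrightarrow> H1 g \<Longrightarrow> (f - g) * h = f * h - g * h"
  unfolding times_l2_def by (rule mop_rp_diff[OF H1_bmult H1_bmult])
lemma mul_zero [simp]: "f * 0 = 0" "0 * f = (0 :: l2)"
proof -
  have "0 * f = (0 :: l2)" using diff_mul_H1[of 0 0 f] by simp
  then show "0 * f = 0" "f * 0 = 0" by (simp_all add: mul_comm[of f])
qed

lemma rp_mul: "H1 f \<Longrightarrow> AE x in lborel. rp (f * g) x = rp f x * rp g x"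
  unfolding times_l2_def by (rule rp_mop[OF H1_bmult])

lemma H1_mul [simp]: "H1 f \<Longrightarrow> H1 g \<Longrightarrow> H1 (f * g)"
  and dx_mul: "H1 f \<Longrightarrow> H1 g \<Longrightarrow> dx (f * g) = dx f * g + f * dx g"
  using hasd_mul[OF hasd_dx hasd_dx, of f g] unfolding hasd_iff times_l2_def[symmetric] by (auto simp: mul_comm[of g])

lemma mul_assoc: assumes "H1 f" "H1 g" shows "f * g * h = f * (g * h)"
proof -
  have "f * g * h = mop (\<lambda>x. rp f x * rp g x) h"
    unfolding times_l2_def[of "f * g"] using assms by (intro mop_cong bmult_times H1_bmult rp_mul) auto
  also have "\<dots> = f * (g * h)" unfolding times_l2_def by (rule mop_mop[symmetric]) (intro H1_bmult assms)+
  finally show ?thesis .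
qed

lemma mul_lcomm: "H1 f \<Longrightarrow> H1 g \<Longrightarrow> f * (g * h) = g * (f * h)"
  by (metis mul_assoc mul_comm)

lemma cj_mul: assumes "H1 f" shows "cj (f * g) = cj f * cj g"
proof -
  have "cj (f * g) = mop (\<lambda>x. cnj (rp f x)) (cj g)" unfolding times_l2_def by (rule cj_mop[OF H1_bmult[OF assms]])
  also have "\<dots> = cj f * cj g" unfolding times_l2_def
    by (rule mop_cong) (use assms rp_cj[of f] in \<open>auto intro: H1_bmult bmult_cnj\<close>)
  finally show ?thesis .
qed

lemma cip_mul: assumes "H1 f" shows "cip (f * g) h = cip g (cj f * h)"
proof -
  have "cip (f * g) h = cip g (mop (\<lambda>x. cnj (rp f x)) h)" unfolding times_l2_def by (rule cip_mop_left[OF H1_bmult[OF assms]])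
  also have "mop (\<lambda>x. cnj (rp f x)) h = cj f * h" unfolding times_l2_def
    by (rule mop_cong) (use assms rp_cj[of f] in \<open>auto intro: H1_bmult bmult_cnj\<close>)
  finally show ?thesis .
qed

lemma cip_mul_right: "H1 f \<Longrightarrow> cip g (f * h) = cip (cj f * g) h"
  using cip_mul[of "cj f" g h] by simp

definition nH1 :: "l2 \<Rightarrow> real" where "nH1 f = norm f + norm (dx f)"

lemma nH1_nonneg [simp]: "0 \<le> nH1 f" by (simp add: nH1_def)

lemma norm_mul: "H1 f \<Longrightarrow> norm (f * g) \<le> Ksup * nH1 f * norm g"
  unfolding times_l2_def nH1_def by (rule norm_mop_hasd[OF hasd_dx])

lemma bounded_linear_mul: "H1 f \<Longrightarrow> bounded_linear (\<lambda>g. f * g)"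
  unfolding times_l2_def by (rule bounded_linear_mop[OF H1_bmult])

lemmas tendsto_mul_H1 = bounded_linear.tendsto[OF bounded_linear_mul]

lemma nH1_cj: "H1 f \<Longrightarrow> nH1 (cj f) = nH1 f" by (simp add: nH1_def dx_cj)

lemma Sz_mul': "H1 f \<Longrightarrow> Sz f = f \<Longrightarrow> Sz h = h \<Longrightarrow> Sz (f * h) = f * h"
  unfolding times_l2_def using Sz_mul[OF hasd_dx] .

subsection \<open>The Lax operator\<close>

definition Tv :: "l2 \<Rightarrow> l2 \<Rightarrow> l2" where "Tv v h = v * Sz (cj v * h)"

text \<open>The operator is taken on all of H^1 and not only on the Hardy space, so that free
  resolvents are plain Fourier multipliers. \<open>Sz_rsv\<close> later shows that its resolvents
  preserve the Hardy space.\<close>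

definition Lx :: "l2 \<Rightarrow> l2 \<Rightarrow> l2" where "Lx v g = cs (- \<i>) (dx g) - Tv v g"

lemma norm_Tv: assumes "H1 v" shows "norm (Tv v h) \<le> (Ksup * nH1 v)\<^sup>2 * norm h"
proof -
  have "norm (Tv v h) \<le> Ksup * nH1 v * norm (Sz (cj v * h))" unfolding Tv_def by (rule norm_mul[OF assms])
  also have "\<dots> \<le> Ksup * nH1 v * (Ksup * nH1 v * norm h)"
    using norm_mul[of "cj v" h] assms Ksup_nonneg by (intro mult_left_mono order_trans[OF norm_Sz_le]) (auto simp: nH1_cj)
  finally show ?thesis by (simp add: power2_eq_square mult_ac)
qed

lemma Tv_diff: "H1 v \<Longrightarrow> Tv v (g - h) = Tv v g - Tv v h" by (simp add: Tv_def mul_diff Sz_diff)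
lemma Tv_cs: "H1 v \<Longrightarrow> Tv v (cs c g) = cs c (Tv v g)" by (simp add: Tv_def mul_cs Sz_cs)
lemma bounded_linear_Tv: assumes "H1 v" shows "bounded_linear (Tv v)"
  unfolding Tv_def[abs_def]
  using bounded_linear_compose[OF bounded_linear_mul[OF assms] bounded_linear_compose[OF bounded_linear_Sz bounded_linear_mul[OF H1_cj[OF assms]]]] .
lemma cip_Tv: "H1 v \<Longrightarrow> cip (Tv v g) h = cip g (Tv v h)"
  unfolding Tv_def by (simp add: cip_mul cip_Sz)
lemma Sz_Tv: "H1 v \<Longrightarrow> Sz v = v \<Longrightarrow> Sz (Tv v h) = Tv v h"
  unfolding Tv_def by (rule Sz_mul') auto

lemma Lx_diff: "H1 v \<Longrightarrow> H1 g \<Longrightarrow> H1 h \<Longrightarrow> Lx v (g - h) = Lx v g - Lx v h"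
  by (simp add: Lx_def dx_diff cs_diff Tv_diff)
lemma Lx_cs: "H1 v \<Longrightarrow> H1 g \<Longrightarrow> Lx v (cs c g) = cs c (Lx v g)"
  by (simp add: Lx_def dx_cs cs_diff Tv_cs mult.commute)
lemma cip_Lx: "H1 v \<Longrightarrow> H1 g \<Longrightarrow> H1 h \<Longrightarrow> cip (Lx v g) h = cip g (Lx v h)"
  by (simp add: Lx_def cip_diff_left cip_diff_right cip_Tv dx_ibp)

text \<open>Symmetry makes <L g, g> real, so the imaginary part of <(L - z) g, g> is -Im z times the
  squared norm of g; Cauchy-Schwarz concludes.\<close>

lemma Lx_resolvent_bound:
  assumes "H1 v" "H1 g" shows "\<bar>Im z\<bar> * norm g \<le> norm (Lx v g - cs z g)"
proof (cases "g = 0")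
  case False
  have "Im (cip (Lx v g) g) = 0" using cip_Lx[OF assms(1,2,2)] cip_commute[of g "Lx v g"] by (metis cnj.simps(2) neg_equal_zero)
  then have "Im (cip (Lx v g - cs z g) g) = - Im z * (norm g)\<^sup>2"
    by (simp add: cip_diff_left cip_self_norm)
  then have "\<bar>Im z\<bar> * (norm g)\<^sup>2 = \<bar>Im (cip (Lx v g - cs z g) g)\<bar>" by (simp add: abs_mult)
  also have "\<dots> \<le> norm (Lx v g - cs z g) * norm g" by (rule order_trans[OF abs_Im_le_cmod cmod_cip_le])
  finally have "(\<bar>Im z\<bar> * norm g) * norm g \<le> norm (Lx v g - cs z g) * norm g" by (simp add: power2_eq_square mult_ac)
  then show ?thesis using False by (simp add: mult_le_cancel_right)
qed simp

text \<open>The multiplier 1 / (xi - z) is bounded, and so is its product with xi, which equals 1 +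
  z / (xi - z); the latter puts the solution in H^1.\<close>

lemma free_resolvent:
  assumes z: "Im z \<noteq> 0"
  shows "\<exists>G. \<forall>f. H1 (G f) \<and> cs (- \<i>) (dx (G f)) - cs z (G f) = f"
proof -
  define m where "m \<xi> = 1 / (of_real \<xi> - z)" for \<xi> :: real
  define n where "n \<xi> = \<i> * of_real \<xi> * m \<xi>" for \<xi> :: real
  have nz: "of_real \<xi> - z \<noteq> 0" for \<xi> :: real using z by (auto simp: complex_eq_iff)
  have mz: "of_real \<xi> * m \<xi> = 1 + z * m \<xi>" for \<xi> using nz[of \<xi>] by (simp add: m_def field_simps)
  have mb: "cmod (m \<xi>) \<le> 1 / \<bar>Im z\<bar>" for \<xi>
  proof -
    have "\<bar>Im z\<bar> \<le> cmod (of_real \<xi> - z)" using abs_Im_le_cmod[of "of_real \<xi> - z"] by simp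
    then show ?thesis using z unfolding m_def norm_divide by (simp add: frac_le)
  qed
  have bm: "bmult m"
  proof (rule bmultI[OF _ mb])
    show "m \<in> borel_measurable borel" unfolding m_def[abs_def] by measurable
  qed
  have bn: "bmult n"
  proof (rule bmultI[of _ "1 + cmod z * (1 / \<bar>Im z\<bar>)"])
    show "n \<in> borel_measurable borel" unfolding n_def[abs_def] m_def by measurable
    fix \<xi>
    have "cmod (n \<xi>) = cmod (1 + z * m \<xi>)" unfolding n_def mult.assoc mz by (simp add: norm_mult)
    also have "\<dots> \<le> 1 + cmod z * (1 / \<bar>Im z\<bar>)"
      by (rule order_trans[OF norm_triangle_ineq]) (use mult_left_mono[OF mb[of \<xi>], of "cmod z"] in \<open>simp add: norm_mult\<close>)
    finally show "cmod (n \<xi>) \<le> 1 + cmod z * (1 / \<bar>Im z\<bar>)" .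
  qed
  have "H1 (fm m f) \<and> cs (- \<i>) (dx (fm m f)) - cs z (fm m f) = f" for f
  proof -
    have h: "hasd (fm m f) (fm n f)"
      unfolding hasd_def Fo_fm using rp_mop[OF bm, of "Fo f"] rp_mop[OF bn, of "Fo f"]
      by eventually_elim (simp add: n_def)
    have "cs (- \<i>) (fm n f) - cs z (fm m f) = f"
    proof (rule Fo_inj, rule l2_eqI)
      show "AE x in lborel. rp (Fo (cs (- \<i>) (fm n f) - cs z (fm m f))) x = rp (Fo f) x"
        unfolding Fo_diff Fo_cs Fo_fm
        using rp_diff[of "cs (-\<i>) (mop n (Fo f))" "cs z (mop m (Fo f))"] rp_cs[of "-\<i>" "mop n (Fo f)"] rp_cs[of z "mop m (Fo f)"]
          rp_mop[OF bm, of "Fo f"] rp_mop[OF bn, of "Fo f"]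
      proof eventually_elim
        case (elim x)
        show ?case unfolding elim n_def mult.assoc[symmetric] by (simp add: mz algebra_simps)
      qed
    qed
    then show ?thesis using hasdD[OF h] by simp
  qed
  then show ?thesis by blast
qed

section \<open>Existence of resolvents off the real axis\<close>

definition solvable :: "l2 \<Rightarrow> complex \<Rightarrow> bool" where
  "solvable v z \<longleftrightarrow> (\<forall>f. \<exists>g. H1 g \<and> Lx v g - cs z g = f)"

lemma contraction_solve:
  fixes S :: "l2 \<Rightarrow> l2"
  assumes "0 \<le> c" "c < 1" "\<And>g h. norm (S g - S h) \<le> c * norm (g - h)"
  obtains g where "S g = g"
proof -
  have "\<exists>!x. S x = x"
    by (rule banach_fix_type[of c]) (use assms in \<open>auto simp: dist_norm\<close>)
  then show ?thesis using that by blast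
qed

text \<open>A solution is a fixed point of g = G (f + T g) for the free resolvent \<open>G\<close>,
  of norm at most 1 / |Im z|. The map contracts as soon as |Im z| exceeds the bound for
  \<open>Tv v\<close>.\<close>

lemma solvable_large:
  assumes v: "H1 v" and z: "(Ksup * nH1 v)\<^sup>2 < \<bar>Im z\<bar>"
  shows "solvable v z"
  unfolding solvable_def
proof
  fix f
  define M where "M = (Ksup * nH1 v)\<^sup>2"
  have M: "0 \<le> M" "M < \<bar>Im z\<bar>" using z by (simp_all add: M_def)
  then have z0: "Im z \<noteq> 0" by auto
  obtain G where G: "\<And>f. H1 (G f)" "\<And>f. cs (- \<i>) (dx (G f)) - cs z (G f) = f" using free_resolvent[OF z0] by blast
  have bd: "\<bar>Im z\<bar> * norm (G f - G g) \<le> norm (f - g)" for f g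
  proof -
    have "Lx 0 (G f - G g) - cs z (G f - G g) = (cs (- \<i>) (dx (G f)) - cs z (G f)) - (cs (- \<i>) (dx (G g)) - cs z (G g))"
      by (simp add: Lx_def Tv_def dx_diff G(1) cs_diff del: cs_minus_left)
    then have "Lx 0 (G f - G g) - cs z (G f - G g) = f - g" by (simp only: G(2))
    then show ?thesis using Lx_resolvent_bound[of 0 "G f - G g" z] G(1) by simp
  qed
  have "norm (G (f + Tv v g) - G (f + Tv v h)) \<le> M / \<bar>Im z\<bar> * norm (g - h)" for g h
  proof -
    have "\<bar>Im z\<bar> * norm (G (f + Tv v g) - G (f + Tv v h)) \<le> norm (Tv v (g - h))"
      using bd[of "f + Tv v g" "f + Tv v h"] by (simp add: Tv_diff v)
    also have "\<dots> \<le> M * norm (g - h)" unfolding M_def by (rule norm_Tv[OF v])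
    finally show ?thesis using z0 by (simp add: field_simps)
  qed
  moreover have "0 \<le> M / \<bar>Im z\<bar>" "M / \<bar>Im z\<bar> < 1" using M by auto
  ultimately obtain g where g: "G (f + Tv v g) = g" using contraction_solve[of "M / \<bar>Im z\<bar>" "\<lambda>g. G (f + Tv v g)"] by metis
  have "Lx v g - cs z g = f"
    using G(2)[of "f + Tv v g"] unfolding g Lx_def by (simp add: algebra_simps)
  moreover have "H1 g" using G(1)[of "f + Tv v g"] unfolding g .
  ultimately show "\<exists>g. H1 g \<and> Lx v g - cs z g = f" by blast
qed

text \<open>The equation at \<open>z\<close> reads (L - w) g = f + (z - w) g. The bound on the
  resolvent at \<open>w\<close> makes this a contraction in a disc that does not touch the real
  axis, of radius |Im w|.\<close>

lemma solvable_step: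
  assumes v: "H1 v" and z0: "solvable v w" and z: "cmod (z - w) < \<bar>Im w\<bar>"
  shows "solvable v z"
  unfolding solvable_def
proof
  fix f
  have w0: "\<bar>Im w\<bar> > 0" using z norm_ge_zero[of "z - w"] by linarith
  obtain G where G: "\<And>f. H1 (G f)" "\<And>f. Lx v (G f) - cs w (G f) = f" using z0 unfolding solvable_def by metis
  have bd: "\<bar>Im w\<bar> * norm (G f - G g) \<le> norm (f - g)" for f g
  proof -
    have "Lx v (G f - G g) - cs w (G f - G g) = (Lx v (G f) - cs w (G f)) - (Lx v (G g) - cs w (G g))"
      by (simp add: Lx_diff v G(1) cs_diff)
    then have "Lx v (G f - G g) - cs w (G f - G g) = f - g" by (simp only: G(2))
    then show ?thesis using Lx_resolvent_bound[OF v H1_diff[OF G(1) G(1)], of w f g] by simp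
  qed
  define c where "c = cmod (z - w) / \<bar>Im w\<bar>"
  have "norm (G (f + cs (z - w) g) - G (f + cs (z - w) h)) \<le> c * norm (g - h)" for g h
  proof -
    have "\<bar>Im w\<bar> * norm (G (f + cs (z - w) g) - G (f + cs (z - w) h)) \<le> norm (cs (z - w) (g - h))"
      using bd[of "f + cs (z - w) g" "f + cs (z - w) h"] by (simp add: cs_diff)
    then show ?thesis using w0 by (simp add: c_def field_simps)
  qed
  moreover have "0 \<le> c" "c < 1" using z w0 by (auto simp: c_def)
  ultimately obtain g where g: "G (f + cs (z - w) g) = g" using contraction_solve[of c "\<lambda>g. G (f + cs (z - w) g)"] by metis
  have "Lx v g - cs w g = f + cs (z - w) g" using G(2)[of "f + cs (z - w) g"] unfolding g .
  moreover have "cs (z - w) g = cs z g - cs w g" using cs_add_left[of "z - w" w g] by simp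
  ultimately have "Lx v g - cs z g = f" by (simp add: algebra_simps)
  moreover have "H1 g" using G(1)[of "f + cs (z - w) g"] unfolding g .
  ultimately show "\<exists>g. H1 g \<and> Lx v g - cs z g = f" by blast
qed

lemma solvable_nonreal:
  assumes v: "H1 v" and z: "Im z \<noteq> 0" shows "solvable v z"
proof -
  define M where "M = (Ksup * nH1 v)\<^sup>2"
  have main: "Im z \<noteq> 0 \<Longrightarrow> M < (3 / 2) ^ n * \<bar>Im z\<bar> \<Longrightarrow> solvable v z" for n z
  proof (induction n arbitrary: z)
    case 0
    then show ?case using solvable_large[OF v] by (simp add: M_def)
  next
    case (Suc n)
    \<comment> \<open>The distance from \<open>z\<close> to \<open>w\<close> is |Im z| / 2, below
      |Im w| = 3 |Im z| / 2. Each step therefore lowers the imaginary part by the factor 2 / 3,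
      starting from the range of \<open>solvable_large\<close>.\<close>
    define w where "w = Complex (Re z) (3 / 2 * Im z)"
    have "solvable v w" by (rule Suc.IH) (use Suc.prems in \<open>simp_all add: w_def abs_mult mult_ac\<close>)
    moreover have "cmod (z - w) < \<bar>Im w\<bar>"
    proof -
      have "z - w = Complex 0 (- (Im z / 2))" by (simp add: complex_eq_iff w_def)
      then have "cmod (z - w) = \<bar>Im z\<bar> / 2" by (simp add: cmod_def)
      then show ?thesis using Suc.prems(1) by (simp add: w_def abs_mult)
    qed
    ultimately show ?case by (rule solvable_step[OF v])
  qed
  obtain n where "M / \<bar>Im z\<bar> < (3 / 2) ^ n" using real_arch_pow[of "3/2" "M / \<bar>Im z\<bar>"] by auto
  then have "M < (3 / 2) ^ n * \<bar>Im z\<bar>" using z by (simp add: field_simps)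
  then show ?thesis by (rule main[OF z])
qed

definition rsv :: "l2 \<Rightarrow> complex \<Rightarrow> l2 \<Rightarrow> l2" where
  "rsv v z f = (SOME g. H1 g \<and> Lx v g - cs z g = f)"

lemma rsv: assumes "H1 v" "Im z \<noteq> 0" shows "H1 (rsv v z f)" "Lx v (rsv v z f) - cs z (rsv v z f) = f"
proof -
  have "\<exists>g. H1 g \<and> Lx v g - cs z g = f" using solvable_nonreal[OF assms] by (simp add: solvable_def)
  from someI_ex[OF this] show "H1 (rsv v z f)" "Lx v (rsv v z f) - cs z (rsv v z f) = f" by (simp_all add: rsv_def)
qed

text \<open>The image of \<open>Tv v\<close> lies in the Hardy space, so the component of the
  solution outside that space solves the free homogeneous equation, and this has only the zero
  solution for nonreal \<open>z\<close>.\<close>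

lemma Sz_rsv: assumes v: "H1 v" "Sz v = v" and z: "Im z \<noteq> 0" and f: "Sz f = f" shows "Sz (rsv v z f) = rsv v z f"
proof -
  define g where "g = rsv v z f"
  note g = rsv[OF v(1) z, of f, folded g_def]
  have e: "cs (- \<i>) (dx g) - cs z g = f + Tv v g" using g(2) by (simp add: Lx_def algebra_simps)
  have "cs (- \<i>) (dx (Sz g)) - cs z (Sz g) = Sz (cs (- \<i>) (dx g) - cs z g)" using g(1) by (simp only: dx_Sz Sz_diff Sz_cs)
  also have "\<dots> = f + Tv v g" unfolding e Sz_add f Sz_Tv[OF v] ..
  finally have "cs (- \<i>) (dx (g - Sz g)) - cs z (g - Sz g) = 0"
    using e g(1) by (simp add: dx_diff cs_diff algebra_simps)
  then have "Lx 0 (g - Sz g) - cs z (g - Sz g) = 0" by (simp add: Lx_def Tv_def)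
  then have "\<bar>Im z\<bar> * norm (g - Sz g) \<le> 0" using Lx_resolvent_bound[of 0 "g - Sz g" z] g(1) by simp
  then show ?thesis using z by (simp add: mult_le_0_iff g_def)
qed

definition eig :: "l2 \<Rightarrow> real \<Rightarrow> l2 \<Rightarrow> bool" where
  "eig v l h \<longleftrightarrow> H1 h \<and> Sz h = h \<and> Lx v h = cs (of_real l) h"

subsection \<open>Projections to eigenspaces\<close>

lemma cs_diff_left: "cs (c - d) f = cs c f - cs d f"
  using cs_add_left[of "c - d" d f] by simp

definition ares :: "l2 \<Rightarrow> real \<Rightarrow> real \<Rightarrow> l2 \<Rightarrow> l2" where
  "ares v l e f = cs (- \<i> * of_real e) (rsv v (Complex l e) f)"

lemma ares:
  assumes v: "H1 v" and e: "e \<noteq> 0"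
  shows "H1 (ares v l e f)" "Lx v (ares v l e f) = cs (of_real l) (ares v l e f) - cs (\<i> * of_real e) (f - ares v l e f)"
proof -
  have z: "Im (Complex l e) \<noteq> 0" using e by simp
  note r = rsv[OF v z, of f]
  show "H1 (ares v l e f)" using r(1) by (simp add: ares_def)
  define g where "g = rsv v (Complex l e) f"
  have "Lx v g = f + cs (Complex l e) g" using r(2) by (simp add: g_def algebra_simps)
  then have "Lx v (ares v l e f) = cs (- \<i> * of_real e) (f + cs (Complex l e) g)"
    unfolding ares_def g_def[symmetric] by (subst Lx_cs[OF v]) (use r(1) in \<open>simp_all add: g_def\<close>)
  also have "\<dots> = cs (- \<i> * of_real e) f + cs (of_real l * (- \<i> * of_real e) + (\<i> * of_real e) * (- \<i> * of_real e)) g"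
  proof -
    have "- \<i> * of_real e * Complex l e = of_real l * (- \<i> * of_real e) + (\<i> * of_real e) * (- \<i> * of_real e)"
      by (simp add: complex_eq_iff)
    then show ?thesis unfolding cs_add cs_cs by (simp only:)
  qed
  also have "\<dots> = cs (of_real l) (ares v l e f) - cs (\<i> * of_real e) (f - ares v l e f)"
    unfolding ares_def g_def[symmetric] cs_diff cs_cs cs_add_left by simp
  finally show "Lx v (ares v l e f) = cs (of_real l) (ares v l e f) - cs (\<i> * of_real e) (f - ares v l e f)" .
qed

text \<open>Symmetry of \<open>Lx\<close> for two of these vectors, with their images rewritten by
  \<open>ares(2)\<close>. The terms in \<open>l\<close> cancel because \<open>l\<close> is
  real.\<close>

lemma ares_cip:
  assumes v: "H1 v" and e: "e \<noteq> 0" and d: "d \<noteq> 0"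
  shows "of_real (e + d) * cip (ares v l e f) (ares v l d f) = of_real e * cip f (ares v l d f) + of_real d * cip (ares v l e f) f"
proof -
  let ?a = "ares v l e f" and ?b = "ares v l d f"
  have "cip (Lx v ?a) ?b = cip ?a (Lx v ?b)" by (intro cip_Lx v ares e d)
  then have "- \<i> * of_real e * (cip f ?b - cip ?a ?b) = \<i> * of_real d * (cip ?a f - cip ?a ?b)"
    unfolding ares(2)[OF v e] ares(2)[OF v d] by (simp add: cip_diff_left cip_diff_right)
  then have "\<i> * (of_real (e + d) * cip ?a ?b) = \<i> * (of_real e * cip f ?b + of_real d * cip ?a f)"
    by (simp add: algebra_simps)
  then show ?thesis by simp
qed

lemma norm_diff_cip: "(norm (f - g :: l2))\<^sup>2 = (norm f)\<^sup>2 + (norm g)\<^sup>2 - 2 * Re (cip f g)"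
  using dot_norm_neg[of f g] by (simp add: inner_l2_def)

lemma ares_norm:
  assumes v: "H1 v" and e: "e \<noteq> 0"
  shows "(norm (ares v l e f))\<^sup>2 = Re (cip f (ares v l e f))" "norm (ares v l e f) \<le> norm f"
proof -
  let ?a = "ares v l e f"
  have "of_real (e + e) * cip ?a ?a = of_real e * (cip f ?a + cip ?a f)"
    using ares_cip[OF v e e] by (simp add: algebra_simps)
  then have "of_real e * (cip f ?a + cip ?a f) = of_real e * (2 * cip ?a ?a)" by (simp add: algebra_simps)
  then have "cip f ?a + cip ?a f = 2 * cip ?a ?a" unfolding mult_cancel_left using e by simp
  then have "Re (cip f ?a) + Re (cip ?a f) = 2 * (norm ?a)\<^sup>2" by (metis Re_complex_of_real cip_self_norm of_real_mult of_real_numeral plus_complex.simps(1))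
  moreover have "Re (cip ?a f) = Re (cip f ?a)" using cip_commute[of ?a f] by simp
  ultimately show 1: "(norm ?a)\<^sup>2 = Re (cip f ?a)" by simp
  have "(norm ?a)\<^sup>2 \<le> norm f * norm ?a" unfolding 1 by (rule order_trans[OF complex_Re_le_cmod cmod_cip_le])
  then show "norm ?a \<le> norm f" by (cases "norm ?a = 0") (auto simp: power2_eq_square)
qed

text \<open>There is an exact identity (e + d) |a - b|^2 = (e - d) (|a|^2 - |b|^2), where a and b
  belong to e and d. It shows that the norm grows with the parameter, and the claim follows from e -
  d <= e + d.\<close>

lemma ares_mono:
  assumes v: "H1 v" and d: "0 < d" and e: "d \<le> e"
  shows "(norm (ares v l e f - ares v l d f))\<^sup>2 \<le> (norm (ares v l e f))\<^sup>2 - (norm (ares v l d f))\<^sup>2"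
proof -
  let ?a = "ares v l e f" and ?b = "ares v l d f"
  define A where "A = (norm ?a)\<^sup>2"
  define B where "B = (norm ?b)\<^sup>2"
  have e0: "e \<noteq> 0" "d \<noteq> 0" using d e by auto
  have "Re (of_real (e + d) * cip ?a ?b) = e * Re (cip f ?b) + d * Re (cip ?a f)"
    unfolding ares_cip[OF v e0] by simp
  moreover have "Re (cip ?a f) = A" using cip_commute[of ?a f] ares_norm(1)[OF v e0(1), of l f] by (simp add: A_def)
  moreover have "Re (cip f ?b) = B" using ares_norm(1)[OF v e0(2), of l f] by (simp add: B_def)
  ultimately have c: "(e + d) * Re (cip ?a ?b) = e * B + d * A" by simp
  have n: "(norm (?a - ?b))\<^sup>2 = A + B - 2 * Re (cip ?a ?b)" unfolding norm_diff_cip A_def B_def ..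
  then have "(e + d) * (norm (?a - ?b))\<^sup>2 = (e + d) * (A + B) - 2 * ((e + d) * Re (cip ?a ?b))" unfolding n by (simp add: algebra_simps)
  then have 1: "(e + d) * (norm (?a - ?b))\<^sup>2 = (e - d) * (A - B)" unfolding c by (simp add: algebra_simps)
  have AB: "e \<noteq> d \<Longrightarrow> 0 \<le> A - B"
  proof -
    assume "e \<noteq> d"
    have "0 \<le> (e - d) * (A - B)" unfolding 1[symmetric] using d e by simp
    then show ?thesis using \<open>e \<noteq> d\<close> e by (simp add: zero_le_mult_iff)
  qed
  have "(e + d) * (norm (?a - ?b))\<^sup>2 \<le> (e + d) * (A - B)"
  proof (cases "e = d")
    case True
    then show ?thesis by (simp add: A_def B_def)
  next
    case False
    then show ?thesis unfolding 1 using AB d by (intro mult_right_mono) auto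
  qed
  then show ?thesis using d e unfolding A_def[symmetric] B_def[symmetric] by (simp add: mult_le_cancel_left)
qed

definition aseq :: "l2 \<Rightarrow> real \<Rightarrow> nat \<Rightarrow> l2" where "aseq v l n = ares v l (1 / (1 + real n)) v"

lemma aseq_mono:
  assumes v: "H1 v" and "m \<le> n"
  shows "(norm (aseq v l m - aseq v l n))\<^sup>2 \<le> (norm (aseq v l m))\<^sup>2 - (norm (aseq v l n))\<^sup>2"
  unfolding aseq_def by (rule ares_mono[OF v]) (use assms(2) in \<open>auto simp: field_simps\<close>)

lemma aseq_norm_convergent: assumes v: "H1 v" shows "convergent (\<lambda>n. (norm (aseq v l n))\<^sup>2)"
proof (rule decseq_convergent[of _ 0])
  show "decseq (\<lambda>n. (norm (aseq v l n))\<^sup>2)"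
    unfolding decseq_def
  proof (intro allI impI)
    fix m n :: nat assume "m \<le> n"
    then show "(norm (aseq v l n))\<^sup>2 \<le> (norm (aseq v l m))\<^sup>2" using aseq_mono[OF v, of m n l] zero_le_power2[of "norm (aseq v l m - aseq v l n)"] by linarith
  qed
qed (auto simp: convergent_def)

text \<open>By \<open>aseq_mono\<close> the Cauchy modulus of the sequence is read off from its
  norms alone. If these are the same for all \<open>t\<close>, convergence is uniform in
  \<open>t\<close>.\<close>

lemma aseq_uniform:
  assumes c: "convergent c" and v: "\<And>t. t \<in> I \<Longrightarrow> H1 (v t)" and n: "\<And>t n. t \<in> I \<Longrightarrow> (norm (aseq (v t) l n))\<^sup>2 = c n"
  shows "uniform_limit I (\<lambda>n t. aseq (v t) l n) (\<lambda>t. lim (\<lambda>n. aseq (v t) l n)) sequentially"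
proof -
  have "uniformly_Cauchy_on I (\<lambda>n t. aseq (v t) l n)"
    unfolding uniformly_Cauchy_on_def
  proof (intro allI impI)
    fix e :: real assume e: "e > 0"
    have "Cauchy c" by (rule convergent_Cauchy[OF c])
    then obtain M where M: "\<And>m n. m \<ge> M \<Longrightarrow> n \<ge> M \<Longrightarrow> \<bar>c m - c n\<bar> < e\<^sup>2"
      unfolding Cauchy_def dist_real_def using e by (meson zero_less_power)
    have lt: "norm (aseq (v t) l m - aseq (v t) l n) < e" if "t \<in> I" "M \<le> m" "m \<le> n" for t m n
    proof -
      have "(norm (aseq (v t) l m - aseq (v t) l n))\<^sup>2 \<le> c m - c n" using aseq_mono[OF v[OF that(1)] that(3), of l] n[OF that(1)] by simp
      also have "\<dots> < e\<^sup>2" using M[of m n] that by auto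
      finally show ?thesis using e by (intro power_less_imp_less_base[of _ 2 e]) auto
    qed
    show "\<exists>M. \<forall>t\<in>I. \<forall>m\<ge>M. \<forall>n\<ge>M. dist (aseq (v t) l m) (aseq (v t) l n) < e"
    proof (intro exI[of _ M] ballI allI impI)
      fix t m n assume "t \<in> I" "M \<le> m" "M \<le> n"
      then show "dist (aseq (v t) l m) (aseq (v t) l n) < e"
        using lt[of t m n] lt[of t n m] by (cases "m \<le> n") (auto simp: dist_norm norm_minus_commute)
    qed
  qed
  then have "uniformly_convergent_on I (\<lambda>n t. aseq (v t) l n)" by (rule Cauchy_uniformly_convergent)
  then show ?thesis by (simp add: uniformly_convergent_uniform_limit_iff)
qed

definition alim :: "l2 \<Rightarrow> real \<Rightarrow> l2" where "alim v l = lim (aseq v l)"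

lemma aseq_lim: assumes v: "H1 v" shows "aseq v l \<longlonglongrightarrow> alim v l"
proof -
  have "uniform_limit {()} (\<lambda>n t. aseq v l n) (\<lambda>t. lim (\<lambda>n. aseq v l n)) sequentially"
    by (rule aseq_uniform[OF aseq_norm_convergent[OF v]]) (use v in auto)
  from tendsto_uniform_limitI[OF this, of "()"] show ?thesis by (simp add: alim_def)
qed

lemma cip_eig:
  assumes v: "H1 v" and e: "e \<noteq> 0" and p: "eig v l p" shows "cip (ares v l e f) p = cip f p"
proof -
  have h: "H1 p" "Lx v p = cs (of_real l) p" using p by (auto simp: eig_def)
  have "cip (Lx v (ares v l e f)) p = cip (ares v l e f) (Lx v p)" by (intro cip_Lx v ares e h)
  then show ?thesis unfolding ares(2)[OF v e] h(2) using e by (simp add: cip_diff_left)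
qed

lemma Sz_ares: "H1 v \<Longrightarrow> Sz v = v \<Longrightarrow> e \<noteq> 0 \<Longrightarrow> Sz f = f \<Longrightarrow> Sz (ares v l e f) = ares v l e f"
  unfolding ares_def Sz_cs by (subst Sz_rsv) auto

text \<open>The defining equation gives the derivative of \<open>aseq v l n\<close> as a bounded
  operator applied to it plus an error of order 1 / (1 + n), so the derivatives converge too and
  closedness applies. The last claim says that \<open>alim v l\<close> is the orthogonal projection
  of \<open>v\<close> to the eigenspace.\<close>

lemma alim:
  assumes v: "H1 v" and Sv: "Sz v = v"
  shows "eig v l (alim v l)" "dx (alim v l) = cs \<i> (Tv v (alim v l) + cs (of_real l) (alim v l))"
    "\<And>p. eig v l p \<Longrightarrow> cip (alim v l) p = cip v p"
proof -
  define e where "e n = 1 / (1 + real n)" for n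
  have e0: "e n \<noteq> 0" for n by (simp add: e_def)
  have el: "e \<longlonglongrightarrow> 0" unfolding e_def by real_asymp
  have as: "aseq v l n = ares v l (e n) v" for n by (simp add: aseq_def e_def)
  have d: "dx (aseq v l n) = cs \<i> (Tv v (aseq v l n) + cs (of_real l) (aseq v l n) - cs (\<i> * of_real (e n)) (v - aseq v l n))" for n
  proof -
    have "cs (- \<i>) (dx (aseq v l n)) = Tv v (aseq v l n) + (cs (of_real l) (aseq v l n) - cs (\<i> * of_real (e n)) (v - aseq v l n))"
      using ares(2)[OF v e0[of n], of l v] unfolding as[symmetric] Lx_def by (metis add_diff_cancel_left' add_diff_eq diff_add_cancel)
    then have "cs \<i> (cs (- \<i>) (dx (aseq v l n))) = cs \<i> (Tv v (aseq v l n) + (cs (of_real l) (aseq v l n) - cs (\<i> * of_real (e n)) (v - aseq v l n)))" by (rule arg_cong)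
    then show ?thesis by (simp add: algebra_simps)
  qed
  note L = aseq_lim[OF v, of l]
  have cl: "(\<lambda>n. cs (\<i> * of_real (e n)) (v - aseq v l n)) \<longlonglongrightarrow> 0"
  proof (rule tendsto_norm_zero_cancel)
    have "(\<lambda>n. cmod (\<i> * of_real (e n)) * norm (v - aseq v l n)) \<longlonglongrightarrow> cmod (\<i> * of_real 0) * norm (v - alim v l)"
      by (intro tendsto_intros el L)
    then show "(\<lambda>n. norm (cs (\<i> * of_real (e n)) (v - aseq v l n))) \<longlonglongrightarrow> 0" by simp
  qed
  have dl: "(\<lambda>n. dx (aseq v l n)) \<longlonglongrightarrow> cs \<i> (Tv v (alim v l) + cs (of_real l) (alim v l) - 0)"
    unfolding d by (intro tendsto_intros bounded_linear.tendsto[OF bounded_linear_Tv[OF v]] L cl)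
  have "H1 (aseq v l n)" for n unfolding as by (rule ares(1)[OF v e0])
  then have "hasd (alim v l) (cs \<i> (Tv v (alim v l) + cs (of_real l) (alim v l)))"
    using hasd_closed[OF hasd_dx L dl] by simp
  then have h: "H1 (alim v l)" "dx (alim v l) = cs \<i> (Tv v (alim v l) + cs (of_real l) (alim v l))" by (simp_all add: hasd_iff)
  show "dx (alim v l) = cs \<i> (Tv v (alim v l) + cs (of_real l) (alim v l))" by fact
  have "(\<lambda>n. Sz (aseq v l n)) \<longlonglongrightarrow> Sz (alim v l)" by (rule tendsto_Sz[OF L])
  moreover have "Sz (aseq v l n) = aseq v l n" for n unfolding as by (rule Sz_ares[OF v Sv e0 Sv])
  ultimately have "(\<lambda>n. aseq v l n) \<longlonglongrightarrow> Sz (alim v l)" by (simp only:)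
  from LIMSEQ_unique[OF this L] have "Sz (alim v l) = alim v l" .
  then show "eig v l (alim v l)" using h by (simp add: eig_def Lx_def)
  fix p assume "eig v l p"
  then have "cip (aseq v l n) p = cip v p" for n unfolding as by (rule cip_eig[OF v e0])
  then have "(\<lambda>n. cip (aseq v l n) p) \<longlonglongrightarrow> cip v p" by simp
  moreover have "(\<lambda>n. cip (aseq v l n) p) \<longlonglongrightarrow> cip (alim v l) p" by (intro tendsto_cip tendsto_const L)
  ultimately show "cip (alim v l) p = cip v p" by (rule LIMSEQ_unique[symmetric])
qed

subsection \<open>The identity for eigenvectors\<close>

text \<open>
  Multiplication by \<^term>\<open>ch (- a)\<close> shifts the spectrum to the left by \<^term>\<open>a\<close>; its commutator
  with the Lax operator on the Hardy space is, up to the term \<^term>\<open>a\<close>, of rank one as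
  \<^term>\<open>a\<close> tends to 0.
\<close>

lemma hasd_ch: assumes "hasd f f'"
  shows "hasd (mop (ch a) f) (cs (\<i> * of_real a) (mop (ch a) f) + mop (ch a) f')"
proof -
  have "AE \<xi> in lborel. rp (Fo f') (\<xi> + - a) = \<i> * of_real (\<xi> + - a) * rp (Fo f) (\<xi> + - a)"
    using assms unfolding hasd_def by (rule AE_shift)
  then show ?thesis unfolding hasd_def Fo_add Fo_cs Fo_mop_ch
    using rp_add[of "cs (\<i> * of_real a) (tau (-a) (Fo f))" "tau (-a) (Fo f')"] rp_cs[of "\<i> * of_real a" "tau (-a) (Fo f)"]
      rp_tau[of "-a" "Fo f"] rp_tau[of "-a" "Fo f'"]
  proof eventually_elim
    case (elim x)
    show ?case unfolding elim(2,3,4,5) elim(1) by (simp add: algebra_simps)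
  qed
qed

lemma cip_mop_ch: "cip (mop (ch a) f) g = cip f (mop (ch (- a)) g)"
  by (subst cip_mop_left) (simp_all add: exp_cnj)

lemma mop_ch_mul: "H1 v \<Longrightarrow> mop (ch a) (v * f) = v * mop (ch a) f"
  unfolding times_l2_def by (rule mop_commute) (auto intro: H1_bmult)

text \<open>The pairing of \<open>Lx v (Sz (mop (ch (- a)) p))\<close> with \<open>p\<close> is
  computed twice: symmetry yields the eigenvalue \<open>l\<close>, while differentiating the
  character yields \<open>l - a\<close> and leaves terms in \<open>m\<close>.\<close>

lemma eig_commutator:
  assumes v: "H1 v" "Sz v = v" and p: "eig v l p" and a: "a > 0"
  defines "m \<equiv> cj v * p"
  shows "of_real a * cip (mop (ch (- a)) p) p = cip (mop (ch (- a)) (Sz m) - Sz (mop (ch (- a)) (Sz m))) m"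
proof -
  let ?e = "mop (ch (- a))"
  have p1: "H1 p" "Sz p = p" "Lx v p = cs (of_real l) p" using p by (auto simp: eig_def)
  have d: "hasd (?e p) (cs (\<i> * of_real (- a)) (?e p) + ?e (dx p))" by (rule hasd_ch[OF hasd_dx[OF p1(1)]])
  note h = hasdD[OF d]
  have dp: "cs (- \<i>) (dx p) = cs (of_real l) p + v * Sz m"
    using p1(3) by (simp add: Lx_def Tv_def m_def algebra_simps)
  have "cs (- \<i>) (dx (?e p)) = cs (- of_real a) (?e p) + ?e (cs (- \<i>) (dx p))"
    unfolding h(2) cs_add cs_cs mop_cs[OF bmult_ch, of "- a" "- \<i>" "dx p"] by simp
  also have "\<dots> = cs (of_real l - of_real a) (?e p) + v * ?e (Sz m)"
    unfolding dp mop_add[OF bmult_ch] mop_cs[OF bmult_ch] mop_ch_mul[OF v(1)] cs_diff_left by simp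
  finally have de: "cs (- \<i>) (dx (?e p)) = cs (of_real l - of_real a) (?e p) + v * ?e (Sz m)" .
  have "cip (Lx v (Sz (?e p))) p = cip (Sz (?e p)) (Lx v p)" by (intro cip_Lx v p1 H1_Sz h)
  then have "cip (Lx v (Sz (?e p))) p = of_real l * cip (?e p) p" by (simp add: p1(2,3) cip_Sz)
  moreover have "cip (Lx v (Sz (?e p))) p = cip (cs (- \<i>) (dx (?e p))) p - cip (Tv v (Sz (?e p))) p"
    unfolding Lx_def dx_Sz[OF h(1)] cip_diff_left cip_cs_left cip_Sz p1(2) ..
  moreover have "cip (cs (- \<i>) (dx (?e p))) p = (of_real l - of_real a) * cip (?e p) p + cip (?e (Sz m)) m"
    unfolding de cip_add_left by (simp add: cip_mul v m_def)
  moreover have "cip (Tv v (Sz (?e p))) p = cip (Sz (?e (Sz m))) m"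
  proof -
    \<comment> \<open>As \<open>v\<close> maps the Hardy space to itself, multiplication by its
      conjugate maps the orthogonal complement to itself.\<close>
    have 1: "cip (Sz (cj v * k)) m = 0" if "Sz k = 0" for k
    proof -
      have "cip (Sz (cj v * k)) m = cip k (v * Sz m)" by (simp add: cip_Sz cip_mul v)
      also have "\<dots> = cip k (Sz (v * Sz m))" using Sz_mul'[OF v, of "Sz m"] by simp
      also have "\<dots> = 0" unfolding cip_Sz[symmetric] that by simp
      finally show ?thesis .
    qed
    \<comment> \<open>A shift of the spectrum to the left keeps negative frequencies
      negative.\<close>
    have 2: "Sz (?e k) = 0" if "Sz k = 0" for k
    proof (rule cip_right_eqI)
      fix h
      have "cip (Sz (?e k)) h = cip k (mop (ch a) (Sz h))" by (simp only: cip_Sz cip_mop_ch minus_minus)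
      also have "\<dots> = cip k (Sz (mop (ch a) (Sz h)))" using Sz_ch[of "Sz h" a] a by simp
      also have "\<dots> = 0" unfolding cip_Sz[symmetric] that by simp
      finally show "cip (Sz (?e k)) h = cip 0 h" by simp
    qed
    have "cip (Tv v (Sz (?e p))) p = cip (Sz (cj v * Sz (?e p))) m" by (simp add: Tv_def cip_mul v m_def)
    also have "\<dots> = cip (Sz (cj v * ?e p)) m - cip (Sz (cj v * (?e p - Sz (?e p)))) m"
      by (simp add: mul_diff v Sz_diff cip_diff_left)
    also have "cip (Sz (cj v * (?e p - Sz (?e p)))) m = 0" by (rule 1) (simp add: Sz_diff)
    also have "cj v * ?e p = ?e m" unfolding m_def by (rule mop_ch_mul[symmetric]) (simp add: v)
    also have "?e m = ?e (m - Sz m + Sz m)" by (simp only: diff_add_cancel)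
    also have "\<dots> = ?e (m - Sz m) + ?e (Sz m)" by (rule mop_add[OF bmult_ch])
    also have "Sz \<dots> = Sz (?e (Sz m)) + Sz (?e (m - Sz m))" by (simp only: Sz_add add.commute)
    also have "Sz (?e (m - Sz m)) = 0" by (rule 2) (simp add: Sz_diff)
    finally show ?thesis by simp
  qed
  ultimately have "of_real l * cip (?e p) p = (of_real l - of_real a) * cip (?e p) p + cip (?e (Sz m)) m - cip (Sz (?e (Sz m))) m" by simp
  then show ?thesis unfolding cip_diff_left by (simp add: algebra_simps)
qed

text \<open>Once shifted, \<open>Sz m\<close> has its spectrum in [-a, \<infinity>), and removing
  the half-line from 0 on leaves a window of width \<open>a\<close>.\<close>

lemma shifted_pairing:
  assumes a: "a > 0"
  shows "cip (mop (ch (- a)) (Sz m) - Sz (mop (ch (- a)) (Sz m))) m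
    = (LINT \<xi>|lborel. indicator {-a..<0} \<xi> * (rp (Fo m) (\<xi> + a) * cnj (rp (Fo m) \<xi>))) / of_real (2 * pi)"
proof -
  let ?k = "mop (ch (- a)) (Sz m)"
  have i: "bmult (indicator {0..} :: real \<Rightarrow> complex)" by (rule bmult_indicator) simp
  have sh: "AE \<xi> in lborel. rp (Fo (Sz m)) (\<xi> + a) = indicator {0..} (\<xi> + a) * rp (Fo m) (\<xi> + a)"
    using rp_mop[OF i, of "Fo m"] unfolding Sz_def Fo_fm by (rule AE_shift)
  have Fk: "Fo (Sz ?k) = mop (indicator {0..}) (Fo ?k)" by (simp only: Sz_def Fo_fm)
  have ae: "AE \<xi> in lborel. rp (Fo (?k - Sz ?k)) \<xi> * cnj (rp (Fo m) \<xi>) = indicator {-a..<0} \<xi> * (rp (Fo m) (\<xi> + a) * cnj (rp (Fo m) \<xi>))"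
    using sh rp_mop[OF i, of "Fo ?k", folded Fk] rp_diff[of "Fo ?k" "Fo (Sz ?k)"] rp_tau[of a "Fo (Sz m)"]
    unfolding Fo_diff Fo_mop_ch minus_minus
    by eventually_elim (auto simp: indicator_def)
  have "of_real (2 * pi) * cip (?k - Sz ?k) m = cip (Fo (?k - Sz ?k)) (Fo m)" by (rule cip_Fo[symmetric])
  also have "\<dots> = (LINT \<xi>|lborel. indicator {-a..<0} \<xi> * (rp (Fo m) (\<xi> + a) * cnj (rp (Fo m) \<xi>)))"
    unfolding cip_def L2_inner_def by (rule integral_cong_AE[OF _ _ ae]) measurable
  finally show ?thesis by (simp add: field_simps del: of_real_mult)
qed

text \<open>For integrable \<open>m\<close> the transform is continuous, and the quotient is 1 / (2
  pi) times the mean over a shrinking window of F(xi + a) times the conjugate of F(xi), both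
  arguments tending to 0.\<close>

lemma shifted_pairing_lim:
  assumes m: "integrable lborel (rp m)"
  shows "((\<lambda>a. cip (mop (ch (- a)) (Sz m) - Sz (mop (ch (- a)) (Sz m))) m / of_real a) \<longlongrightarrow> of_real ((cmod (ft (rp m) 0))\<^sup>2 / (2 * pi))) (at_right 0)"
proof -
  define F where "F = ft (rp m)"
  have Fo: "Fo m = cl F" "F \<in> L2" using Fo_L1[OF rp_L2 m] by (simp_all add: F_def)
  have c: "isCont F 0" unfolding F_def continuous_at_sequentially by (auto simp: o_def intro: ft_cont_0[OF m])
  have ae0: "AE \<xi> in lborel. rp (Fo m) \<xi> = F \<xi>" unfolding Fo(1) by (rule rp_cl[OF Fo(2)])
  have [measurable]: "F \<in> borel_measurable borel" using L2_meas[OF Fo(2)] .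
  define J where "J a = (LINT \<xi>|lborel. indicator {-a..<0} \<xi> * (F (\<xi> + a) * cnj (F \<xi>)))" for a
  have J: "cip (mop (ch (- a)) (Sz m) - Sz (mop (ch (- a)) (Sz m))) m = J a / of_real (2 * pi)" if a: "a > 0" for a
  proof -
    have ae: "AE \<xi> in lborel. indicator {-a..<0} \<xi> * (rp (Fo m) (\<xi> + a) * cnj (rp (Fo m) \<xi>)) = indicator {-a..<0} \<xi> * (F (\<xi> + a) * cnj (F \<xi>))"
      using ae0 AE_shift[OF ae0, of a] by eventually_elim simp
    have "(LINT \<xi>|lborel. indicator {-a..<0} \<xi> * (rp (Fo m) (\<xi> + a) * cnj (rp (Fo m) \<xi>))) = J a"
      unfolding J_def by (rule integral_cong_AE[OF _ _ ae]) measurable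
    then show ?thesis unfolding shifted_pairing[OF a] by simp
  qed
  define c0 where "c0 = F 0 * cnj (F 0)"
  have lim: "((\<lambda>a. J a / of_real a) \<longlongrightarrow> c0) (at_right 0)"
  proof (rule tendstoI)
    fix e :: real assume e: "e > 0"
    have "((\<lambda>z. F (fst z) * cnj (F (snd z))) \<longlongrightarrow> F (fst (0::real,0::real)) * cnj (F (snd (0::real,0::real)))) (nhds (0::real,0::real))"
    proof (intro tendsto_mult tendsto_cnj)
      have fst0: "((\<lambda>z. fst z) \<longlongrightarrow> fst (0::real, 0::real)) (nhds (0::real, 0::real))" using tendsto_fst[OF filterlim_ident, of "(0::real, 0::real)"] by simp
      have snd0: "((\<lambda>z. snd z) \<longlongrightarrow> snd (0::real, 0::real)) (nhds (0::real, 0::real))" using tendsto_snd[OF filterlim_ident, of "(0::real, 0::real)"] by simp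
      show "((\<lambda>z. F (fst z)) \<longlongrightarrow> F (fst (0::real,0::real))) (nhds (0::real,0::real))"
        by (rule isCont_tendsto_compose[where g = F, OF _ fst0]) (use c in simp)
      show "((\<lambda>z. F (snd z)) \<longlongrightarrow> F (snd (0::real,0::real))) (nhds (0::real,0::real))"
        by (rule isCont_tendsto_compose[where g = F, OF _ snd0]) (use c in simp)
    qed
    from tendstoD[OF this, of "e / 2"] e
    have "\<forall>\<^sub>F z in nhds (0,0). dist (F (fst z) * cnj (F (snd z))) c0 < e / 2" by (simp only: c0_def fst_conv snd_conv half_gt_zero)
    then obtain d where d: "d > 0" "\<And>z. dist z (0,0) < d \<Longrightarrow> dist (F (fst z) * cnj (F (snd z))) c0 < e / 2"
      unfolding eventually_nhds_metric by blast
    have "dist (J a / of_real a) c0 < e" if a: "0 < a" "a < d / 2" for a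
    proof -
      have b: "cmod (F (\<xi> + a) * cnj (F \<xi>) - c0) \<le> e / 2" if x: "\<xi> \<in> {-a..<0}" for \<xi>
      proof -
        have "dist (\<xi> + a, \<xi>) (0, 0) \<le> \<bar>\<xi> + a\<bar> + \<bar>\<xi>\<bar>" unfolding dist_Pair_Pair using sqrt_sum_squares_le_sum_abs[of "\<xi> + a" \<xi>] by (simp add: dist_real_def)
        also have "\<dots> < d" using x a by auto
        finally show ?thesis using d(2)[of "(\<xi> + a, \<xi>)"] by (simp add: dist_norm)
      qed
      have ii: "integrable lborel (indicator {-a..<0} :: real \<Rightarrow> real)" by (rule integrable_real_indicator) (use a in auto)
      have integrable_indicator_complex: "integrable lborel (indicator {-a..<0} :: real \<Rightarrow> complex)"
        using integrable_of_real[OF ii, where 'a = complex] by (simp add: of_real_indicator)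
      have i0: "integrable lborel (\<lambda>\<xi>. indicator {-a..<0} \<xi> * c0)"
        by (intro integrable_mult_left integrable_indicator_complex)
      have i1: "integrable lborel (\<lambda>\<xi>. indicator {-a..<0} \<xi> * (F (\<xi> + a) * cnj (F \<xi>) - c0))"
      proof (rule Bochner_Integration.integrable_bound[of _ "\<lambda>\<xi>. (e / 2) * indicator {-a..<0} \<xi>"])
        show "integrable lborel (\<lambda>\<xi>. (e / 2) * indicator {-a..<0} \<xi> :: real)" using ii by simp
        show "AE \<xi> in lborel. norm (indicator {-a..<0} \<xi> * (F (\<xi> + a) * cnj (F \<xi>) - c0)) \<le> norm ((e / 2) * indicator {-a..<0} \<xi> :: real)"
          using b e by (auto simp: indicator_def)
      qed measurable
      have "J a = (LINT \<xi>|lborel. indicator {-a..<0} \<xi> * (F (\<xi> + a) * cnj (F \<xi>) - c0) + indicator {-a..<0} \<xi> * c0)"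
        unfolding J_def by (simp add: algebra_simps)
      also have "\<dots> = (LINT \<xi>|lborel. indicator {-a..<0} \<xi> * (F (\<xi> + a) * cnj (F \<xi>) - c0)) + (LINT \<xi>|lborel. indicator {-a..<0} \<xi> * c0)"
        by (rule Bochner_Integration.integral_add[OF i1 i0])
      also have "(LINT \<xi>|lborel. indicator {-a..<0} \<xi> * c0) = of_real a * c0"
      proof -
        have "(LINT \<xi>|lborel. (indicator {-a..<0} \<xi> :: real) *\<^sub>R c0) = measure lborel {-a..<0} *\<^sub>R c0"
          using a by simp
        then show ?thesis using a by (simp add: scaleR_conv_of_real of_real_indicator)
      qed
      finally have "J a - of_real a * c0 = (LINT \<xi>|lborel. indicator {-a..<0} \<xi> * (F (\<xi> + a) * cnj (F \<xi>) - c0))" by simp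
      also have "cmod \<dots> \<le> (LINT \<xi>|lborel. (e / 2) * indicator {-a..<0} \<xi>)"
      proof (rule Bochner_Integration.integral_norm_bound_integral[OF i1])
        show "integrable lborel (\<lambda>\<xi>. (e / 2) * indicator {-a..<0} \<xi> :: real)" using ii by simp
      qed (use b e in \<open>auto simp: indicator_def\<close>)
      also have "\<dots> = e / 2 * a" using a by simp
      finally have *: "cmod (J a - of_real a * c0) \<le> e / 2 * a" .
      have "J a / of_real a - c0 = (J a - of_real a * c0) / of_real a" using a by (simp add: field_simps)
      then have "dist (J a / of_real a) c0 \<le> e / 2" unfolding dist_norm using * a by (simp add: norm_divide field_simps)
      then show ?thesis using e by linarith
    qed
    then show "\<forall>\<^sub>F a in at_right 0. dist (J a / of_real a) c0 < e"
      using d(1) unfolding eventually_at_right_field by (intro exI[of _ "d / 2"]) auto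
  qed
  have "((\<lambda>a. J a / of_real a / of_real (2 * pi)) \<longlongrightarrow> c0 / of_real (2 * pi)) (at_right 0)" by (intro tendsto_divide lim tendsto_const) simp
  moreover have "\<forall>\<^sub>F a in at_right 0. J a / of_real a / of_real (2 * pi) = cip (mop (ch (- a)) (Sz m) - Sz (mop (ch (- a)) (Sz m))) m / of_real a"
    using eventually_at_right_less[of 0] by eventually_elim (simp only: J divide_divide_eq_left mult.commute[of "of_real _ :: complex" "of_real (2 * pi)"])
  ultimately have "((\<lambda>a. cip (mop (ch (- a)) (Sz m) - Sz (mop (ch (- a)) (Sz m))) m / of_real a) \<longlongrightarrow> c0 / of_real (2 * pi)) (at_right 0)"
    by (rule Lim_transform_eventually)
  moreover have "c0 / of_real (2 * pi) = of_real ((cmod (ft (rp m) 0))\<^sup>2 / (2 * pi))"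
    by (simp add: c0_def F_def complex_norm_square[symmetric])
  ultimately show ?thesis by simp
qed

lemma mop_ch_lim: "((\<lambda>a. mop (ch (- a)) p) \<longlongrightarrow> p) (at_right 0)"
proof -
  have "((\<lambda>a. tau a (Fo p)) \<longlongrightarrow> Fo p) (at_right 0)" by (rule tendsto_mono[OF _ tau_cont]) (simp add: at_le)
  then have "((\<lambda>a. Fi (tau a (Fo p))) \<longlongrightarrow> Fi (Fo p)) (at_right 0)" by (rule bounded_linear.tendsto[OF bounded_linear_Fi])
  moreover have "Fi (tau a (Fo p)) = mop (ch (- a)) p" for a using Fo_mop_ch[of "- a" p] by (metis Fi_Fo minus_minus)
  ultimately show ?thesis by simp
qed

text \<open>Divide \<open>eig_commutator\<close> by \<open>a\<close> and let \<open>a\<close> tend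
  to 0. The transform at 0 of the integrable function p times the conjugate of v is <p, v>, and the
  factor 2 pi is that of Plancherel.\<close>

lemma eig_norm:
  assumes v: "H1 v" "Sz v = v" and p: "eig v l p"
  shows "(cmod (cip v p))\<^sup>2 = 2 * pi * (norm p)\<^sup>2"
proof -
  define m where "m = cj v * p"
  have aem: "AE x in lborel. rp m x = rp p x * cnj (rp v x)"
    using rp_mul[of "cj v" p] rp_cj[of v] v unfolding m_def by (auto elim!: eventually_elim2)
  have i: "integrable lborel (\<lambda>x. rp p x * cnj (rp v x))" by simp
  have m: "integrable lborel (rp m)"
    by (rule integrable_cong_AE_imp[OF i]) (use aem in \<open>auto elim: eventually_mono\<close>)
  have "ft (rp m) 0 = (LINT x|lborel. rp m x)" by (simp add: ft_def)
  also have "\<dots> = cip p v" unfolding cip_def L2_inner_def by (rule integral_cong_AE[OF _ _ aem]) measurable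
  finally have f0: "ft (rp m) 0 = cip p v" .
  have "((\<lambda>a. cip (mop (ch (- a)) p) p) \<longlongrightarrow> cip p p) (at_right 0)" by (intro tendsto_cip mop_ch_lim tendsto_const)
  moreover have "\<forall>\<^sub>F a in at_right 0. cip (mop (ch (- a)) p) p = cip (mop (ch (- a)) (Sz m) - Sz (mop (ch (- a)) (Sz m))) m / of_real a"
    using eventually_at_right_less[of 0]
  proof eventually_elim
    case (elim a)
    then show ?case using eig_commutator[OF v p elim] unfolding m_def[symmetric] by (simp add: field_simps)
  qed
  ultimately have "((\<lambda>a. cip (mop (ch (- a)) (Sz m) - Sz (mop (ch (- a)) (Sz m))) m / of_real a) \<longlongrightarrow> cip p p) (at_right 0)"
    by (rule Lim_transform_eventually)
  then have "cip p p = of_real ((cmod (cip p v))\<^sup>2 / (2 * pi))"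
    using tendsto_unique[OF _ _ shifted_pairing_lim[OF m]] unfolding f0 by (simp add: trivial_limit_at_right_real)
  then have "(norm p)\<^sup>2 = (cmod (cip p v))\<^sup>2 / (2 * pi)" unfolding cip_self_norm of_real_eq_iff .
  then show ?thesis using cip_commute[of v p] by (simp add: field_simps)
qed

subsection \<open>Convergence in the Sobolev space\<close>

text \<open>Convergence in H^1, with every value of \<open>f\<close> in H^1 and not only those far
  along the filter. Product and derivative rules then hold without provisos; the price is that the
  flow is later extended by 0 outside its interval.\<close>

definition tH1 :: "('a \<Rightarrow> l2) \<Rightarrow> l2 \<Rightarrow> 'a filter \<Rightarrow> bool" where
  "tH1 f l F \<longleftrightarrow> (\<forall>x. H1 (f x)) \<and> H1 l \<and> (f \<longlongrightarrow> l) F \<and> ((\<lambda>x. dx (f x)) \<longlongrightarrow> dx l) F"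

lemma tH1I: "(\<And>x. H1 (f x)) \<Longrightarrow> H1 l \<Longrightarrow> (f \<longlongrightarrow> l) F \<Longrightarrow> ((\<lambda>x. dx (f x)) \<longlongrightarrow> dx l) F \<Longrightarrow> tH1 f l F"
  by (simp add: tH1_def)

lemma tH1D: assumes "tH1 f l F" shows "H1 (f x)" "H1 l" "(f \<longlongrightarrow> l) F" "((\<lambda>x. dx (f x)) \<longlongrightarrow> dx l) F"
  using assms by (auto simp: tH1_def)

lemma tH1_const: "H1 f \<Longrightarrow> tH1 (\<lambda>x. f) f F" by (simp add: tH1_def)
lemma tH1_add: "tH1 f l F \<Longrightarrow> tH1 g m F \<Longrightarrow> tH1 (\<lambda>x. f x + g x) (l + m) F"
  by (auto simp: tH1_def dx_add intro!: tendsto_add)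
lemma tH1_cs: "tH1 f l F \<Longrightarrow> tH1 (\<lambda>x. cs c (f x)) (cs c l) F"
  by (auto simp: tH1_def dx_cs intro!: tendsto_cs)
lemma tH1_cj: "tH1 f l F \<Longrightarrow> tH1 (\<lambda>x. cj (f x)) (cj l) F"
  by (auto simp: tH1_def dx_cj intro!: bounded_linear.tendsto[OF bounded_linear_cj])
lemma tH1_Sz: "tH1 f l F \<Longrightarrow> tH1 (\<lambda>x. Sz (f x)) (Sz l) F"
  by (auto simp: tH1_def dx_Sz intro!: tendsto_Sz)

lemma tH1_nH1: assumes "tH1 f l F" shows "((\<lambda>x. nH1 (f x - l)) \<longlongrightarrow> 0) F"
proof -
  have "((\<lambda>x. norm (f x - l) + norm (dx (f x) - dx l)) \<longlongrightarrow> norm (l - l) + norm (dx l - dx l)) F"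
    by (intro tendsto_intros tH1D[OF assms])
  then show ?thesis using tH1D(1,2)[OF assms] by (simp add: nH1_def dx_diff)
qed

lemma tendsto_mul:
  assumes f: "tH1 f l F" and g: "(g \<longlongrightarrow> m) F" shows "((\<lambda>x. f x * g x) \<longlongrightarrow> l * m) F"
proof -
  note D = tH1D[OF f]
  have "((\<lambda>x. (f x - l) * g x) \<longlongrightarrow> 0) F"
  proof (rule Lim_null_comparison)
    show "\<forall>\<^sub>F x in F. norm ((f x - l) * g x) \<le> Ksup * nH1 (f x - l) * norm (g x)"
      using D by (intro always_eventually allI norm_mul) auto
    have "((\<lambda>x. Ksup * nH1 (f x - l) * norm (g x)) \<longlongrightarrow> Ksup * 0 * norm m) F"
      by (intro tendsto_intros tH1_nH1[OF f] g)
    then show "((\<lambda>x. Ksup * nH1 (f x - l) * norm (g x)) \<longlongrightarrow> 0) F" by simp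
  qed
  moreover have "((\<lambda>x. l * g x) \<longlongrightarrow> l * m) F" by (rule tendsto_mul_H1[OF D(2) g])
  ultimately have "((\<lambda>x. (f x - l) * g x + l * g x) \<longlongrightarrow> 0 + l * m) F" by (rule tendsto_add)
  then show ?thesis using D(1,2) by (simp add: diff_mul_H1)
qed

lemma tendsto_mul': "(g \<longlongrightarrow> m) F \<Longrightarrow> tH1 f l F \<Longrightarrow> ((\<lambda>x. g x * f x) \<longlongrightarrow> m * l) F"
  using tendsto_mul by (simp add: mul_comm[of "g _"] mul_comm[of m])

lemma tH1_mul: assumes f: "tH1 f l F" and g: "tH1 g m F" shows "tH1 (\<lambda>x. f x * g x) (l * m) F"
proof (rule tH1I)
  note D = tH1D[OF f] tH1D[OF g]
  show "((\<lambda>x. f x * g x) \<longlongrightarrow> l * m) F" by (rule tendsto_mul[OF f D(7)])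
  show "((\<lambda>x. dx (f x * g x)) \<longlongrightarrow> dx (l * m)) F"
    unfolding dx_mul[OF D(1,5)] dx_mul[OF D(2,6)] by (intro tendsto_add tendsto_mul[OF f] tendsto_mul'[OF _ g] D)
qed (use tH1D[OF f] tH1D[OF g] in auto)

lemma tH1_Tv: "tH1 v l F \<Longrightarrow> tH1 g m F \<Longrightarrow> tH1 (\<lambda>x. Tv (v x) (g x)) (Tv l m) F"
  unfolding Tv_def by (intro tH1_mul tH1_Sz tH1_cj)

lemma tendsto_Tv: "tH1 v l F \<Longrightarrow> (g \<longlongrightarrow> m) F \<Longrightarrow> ((\<lambda>x. Tv (v x) (g x)) \<longlongrightarrow> Tv l m) F"
  unfolding Tv_def by (intro tendsto_mul tendsto_Sz tH1_cj)

subsection \<open>The Lax pair\<close>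

definition Bop :: "l2 \<Rightarrow> l2 \<Rightarrow> l2" where
  "Bop v g = cs \<i> (dx (dx g)) + cs 2 (v * dx (Sz (cj v * g)))"

text \<open>Since H - i = -2 i Pi, the nonlinearity of the equation is -2 i times this term, so that
  formally the equation is u' = i u_xx + 2 nl(u).\<close>

definition nl :: "l2 \<Rightarrow> l2" where "nl v = v * Sz (dx (v * cj v))"

text \<open>One space derivative is moved to the test function, so that the expression makes sense,
  and is continuous, for both arguments in H^1.\<close>

definition Ev :: "l2 \<Rightarrow> l2 \<Rightarrow> complex" where
  "Ev v \<psi> = - \<i> * cip (dx v) (dx \<psi>) + 2 * cip (nl v) \<psi>"

text \<open>The equation formally reads u' = B_u u. As \<open>v\<close> has too few derivatives for
  B_v v, antisymmetry is used to put the operator on \<open>w\<close>.\<close>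

lemma Ev_Bop:
  assumes v: "H1 v" and w: "H1 w" "H1 (dx w)"
  shows "Ev v w = - cip v (Bop v w)"
proof -
  have 1: "cip v (v * dx (Sz (cj v * w))) = - cip (nl v) w"
  proof -
    have "cip v (v * dx (Sz (cj v * w))) = cip (v * cj v) (dx (Sz (cj v * w)))" using v by (simp add: cip_mul_right mul_comm)
    also have "\<dots> = - cip (dx (v * cj v)) (Sz (cj v * w))" using v w by (simp add: dx_ibp)
    also have "\<dots> = - cip (nl v) w" using v by (simp add: cip_Sz[symmetric] cip_mul_right nl_def)
    finally show ?thesis .
  qed
  have 2: "cip v (dx (dx w)) = - cip (dx v) (dx w)" using dx_ibp[OF v w(2)] by simp
  show ?thesis unfolding Ev_def Bop_def cip_add_right cip_cs_right 1 2 by simp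
qed

text \<open>The second derivative with its factor i is antisymmetric; so is the other term, because
  \<open>Sz\<close> is symmetric and commutes with the antisymmetric first derivative.\<close>

lemma Bop_antisym:
  assumes v: "H1 v" and g: "H1 g" "H1 (dx g)" and w: "H1 w" "H1 (dx w)"
  shows "cip (Bop v g) w = - cip g (Bop v w)"
proof -
  define p where "p = Sz (cj v * g)"
  define q where "q = Sz (cj v * w)"
  have pq: "H1 p" "H1 q" "Sz p = p" "Sz q = q" using v g w by (simp_all add: p_def q_def)
  have "cip (dx (dx g)) w = cip g (dx (dx w))" using g w by (simp add: dx_ibp)
  moreover have "cip (v * dx p) w = - cip g (v * dx q)"
  proof -
    have "cip (v * dx p) w = cip (Sz (dx p)) (cj v * w)" using dx_Sz[OF pq(1)] by (simp add: cip_mul v pq(3))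
    also have "\<dots> = cip (dx p) q" by (simp add: cip_Sz q_def)
    also have "\<dots> = - cip p (dx q)" by (rule dx_ibp[OF pq(1,2)])
    also have "cip p (dx q) = cip (cj v * g) (Sz (dx q))" by (simp add: p_def cip_Sz)
    also have "\<dots> = cip g (v * dx q)" using dx_Sz[OF pq(2)] by (simp add: cip_mul v pq(4))
    finally show ?thesis .
  qed
  ultimately show ?thesis unfolding Bop_def p_def[symmetric] q_def[symmetric] cip_add_left cip_add_right cip_cs_left cip_cs_right by simp
qed

lemma Sz_Bop: assumes v: "H1 v" "Sz v = v" and g: "H1 g" "H1 (dx g)" "Sz g = g" shows "Sz (Bop v g) = Bop v g"
proof -
  have "Sz (dx (dx g)) = dx (dx g)" using dx_Sz[OF g(2)] dx_Sz[OF g(1)] g(3) by simp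
  moreover have "Sz (v * dx (Sz (cj v * g))) = v * dx (Sz (cj v * g))"
    using v g by (intro Sz_mul') (simp_all add: dx_Sz)
  ultimately show ?thesis by (simp add: Bop_def Sz_add Sz_cs)
qed

text \<open>Product rules redistribute the derivatives until only p, Sz (cj v * w) and w are paired.
  The projection may be inserted in one term because \<open>p\<close> and its derivative lie in the
  Hardy space.\<close>

lemma lax_cross_term:
  assumes v: "H1 v" and p: "H1 p" "Sz p = p" and w: "H1 w"
  shows "cip (dx v) (dx (w * cj p)) = cip (dx v * p) (dx w) + cip (dx p) (dx (Sz (cj v * w))) - cip (v * dx p) (dx w)"
proof -
  have "cip (dx v) (dx (w * cj p)) = cip (dx v) (cj p * dx w) + cip (dx v) (w * cj (dx p))"
    using p w by (simp add: dx_mul dx_cj cip_add_right mul_comm)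
  also have "cip (dx v) (cj p * dx w) = cip (dx v * p) (dx w)" using p by (simp add: cip_mul_right mul_comm)
  also have "cip (dx v) (w * cj (dx p)) = cip (dx p) (cj (dx v) * w)"
  proof -
    have "cip (dx v) (w * cj (dx p)) = cip (cj (w * cj (dx v))) (cj (dx p))" using w by (simp add: cip_mul_right cj_mul)
    also have "\<dots> = cip (dx p) (w * cj (dx v))" unfolding cip_cj by (rule cip_commute[symmetric])
    finally show ?thesis by (simp add: mul_comm)
  qed
  also have "cip (dx p) (cj (dx v) * w) = cip (dx p) (dx (cj v * w)) - cip (dx p) (cj v * dx w)"
    using v w by (simp add: dx_mul dx_cj cip_add_right)
  also have "cip (dx p) (cj v * dx w) = cip (v * dx p) (dx w)" using v by (simp add: cip_mul)
  also have "cip (dx p) (dx (cj v * w)) = cip (dx p) (dx (Sz (cj v * w)))"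
  proof -
    have "cip (dx p) (dx (cj v * w)) = cip (Sz (dx p)) (dx (cj v * w))" using dx_Sz[OF p(1)] p(2) by simp
    then show ?thesis using v w by (simp add: cip_Sz dx_Sz)
  qed
  finally show ?thesis by simp
qed

lemma lax_nonlinear_term:
  assumes v: "H1 v" and p: "H1 p" "Sz p = p" and w: "H1 w"
  shows "cip (nl v) (w * cj p) = cip (p * Sz (dx (v * cj v))) (Sz (cj v * w))"
proof -
  let ?D = "Sz (dx (v * cj v))"
  have "cip (nl v) (w * cj p) = cip (p * (v * ?D)) w" using p by (simp add: mul_comm[of w] cip_mul_right nl_def)
  also have "\<dots> = cip (p * ?D) (cj v * w)" using v p by (simp add: mul_lcomm[of p v] cip_mul)
  also have "\<dots> = cip (p * ?D) (Sz (cj v * w))" using Sz_mul'[OF p, of ?D] by (simp add: cip_Sz[symmetric])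
  finally show ?thesis .
qed

text \<open>The weak form of the Lax equation dL/dt = [B, L]. The left-hand side is the derivative
  of <T_v g, w> when v moves by the equation, hence minus that of <L_v g, w>; the right-hand side is
  minus the commutator, by antisymmetry of B and symmetry of L.\<close>

lemma lax_identity:
  assumes v: "H1 v" and g: "H1 g" "H1 (dx g)" and w: "H1 w" "H1 (dx w)"
  shows "Ev v (w * cj (Sz (cj v * g))) + cnj (Ev v (g * cj (Sz (cj v * w))))
    = cip (Lx v g) (Bop v w) + cip (Bop v g) (Lx v w)"
proof -
  define p where "p = Sz (cj v * g)"
  define q where "q = Sz (cj v * w)"
  define r where "r = v * cj v"
  have pq: "H1 p" "H1 q" "Sz p = p" "Sz q = q" using v g w by (simp_all add: p_def q_def)
  have r: "H1 r" "cj r = r" using v by (simp_all add: r_def cj_mul mul_comm)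
  let ?D = "Sz (dx r)"
  have X1: "cip (dx g) (dx (dx w)) = - cip (dx (dx g)) (dx w)" using dx_ibp[OF g(2) w(2)] by simp
  have X3: "cip (v * p) (dx (dx w)) = - (cip (dx v * p) (dx w) + cip (v * dx p) (dx w))"
    using dx_ibp[of "v * p" "dx w"] v pq w by (simp add: dx_mul cip_add_left)
  have Y2: "cip (dx (dx g)) (v * q) = - (cip (dx g) (dx v * q) + cip (dx g) (v * dx q))"
    using dx_ibp[of "dx g" "v * q"] v pq g by (simp add: dx_mul cip_add_right)
  \<comment> \<open>An integration by parts of |v|^2 p against q: the terms without a derivative on
    |v|^2 recombine and cancel.\<close>
  have XY: "cip (v * p) (v * dx q) + cip (v * dx p) (v * q) = - cip (dx r * p) q"
  proof -
    have "cip (v * p) (v * dx q) = cip (r * p) (dx q)" using v by (simp add: cip_mul_right r_def mul_assoc mul_lcomm mul_comm[of v "cj v"])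
    also have "\<dots> = - cip (dx (r * p)) q" using dx_ibp[of "r * p" q] r pq by simp
    also have "\<dots> = - cip (dx r * p) q - cip (r * dx p) q" using r pq by (simp add: dx_mul cip_add_left)
    also have "cip (r * dx p) q = cip (v * dx p) (v * q)" using v by (simp add: cip_mul_right r_def mul_assoc mul_lcomm mul_comm[of v "cj v"])
    finally show ?thesis by simp
  qed
  have E1: "cip (dx v) (dx (w * cj p)) = cip (dx v * p) (dx w) + cip (dx p) (dx q) - cip (v * dx p) (dx w)"
    unfolding q_def by (rule lax_cross_term[OF v pq(1,3) w(1)])
  have "cip (dx v) (dx (g * cj q)) = cip (dx v * q) (dx g) + cip (dx q) (dx p) - cip (v * dx q) (dx g)"
    unfolding p_def by (rule lax_cross_term[OF v pq(2,4) g(1)])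
  then have E2: "cnj (cip (dx v) (dx (g * cj q))) = cip (dx g) (dx v * q) + cip (dx p) (dx q) - cip (dx g) (v * dx q)"
    by (simp add: cip_commute[symmetric])
  have N1: "cip (nl v) (w * cj p) = cip (p * ?D) q"
    unfolding q_def r_def by (rule lax_nonlinear_term[OF v pq(1,3) w(1)])
  have N2: "cnj (cip (nl v) (g * cj q)) = cip (p * cj ?D) q"
  proof -
    have "cnj (cip (nl v) (g * cj q)) = cip p (q * ?D)"
      unfolding p_def r_def using lax_nonlinear_term[OF v pq(2,4) g(1)] by (simp add: cip_commute[symmetric])
    also have "\<dots> = cip (p * cj q) ?D" using pq by (simp add: cip_mul_right mul_comm)
    also have "\<dots> = cip (cj q) (cj (p * cj ?D))" using pq by (simp add: cip_mul cj_mul)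
    also have "\<dots> = cip (p * cj ?D) q" unfolding cip_cj by (rule cip_commute[symmetric])
    finally show ?thesis .
  qed
  \<comment> \<open>As |v|^2 is real, \<open>Sz (dx r)\<close> and its conjugate contribute the two
    halves of the spectrum and add up to \<open>dx r\<close>. This is the term that matches
    \<open>XY\<close>.\<close>
  have N: "cip (nl v) (w * cj p) + cnj (cip (nl v) (g * cj q)) = cip (dx r * p) q"
  proof -
    have "?D + cj ?D = dx r" using Sz_plus_cj[of "dx r"] dx_cj[OF r(1)] r(2) by simp
    then have "p * dx r = p * ?D + p * cj ?D" using mul_add[OF pq(1), of ?D "cj ?D"] by simp
    then show ?thesis unfolding N1 N2 cip_add_left[symmetric] by (simp add: mul_comm[of p])
  qed
  have "Ev v (w * cj p) + cnj (Ev v (g * cj q)) = - \<i> * cip (dx v) (dx (w * cj p)) + \<i> * cnj (cip (dx v) (dx (g * cj q)))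
      + 2 * (cip (nl v) (w * cj p) + cnj (cip (nl v) (g * cj q)))"
    by (simp add: Ev_def algebra_simps)
  also have "\<dots> = cip (Lx v g) (Bop v w) + cip (Bop v g) (Lx v w)"
  proof -
    have "cip (Lx v g) (Bop v w) + cip (Bop v g) (Lx v w) =
       - cip (dx g) (dx (dx w)) - 2 * \<i> * cip (dx g) (v * dx q) + \<i> * cip (v * p) (dx (dx w)) - 2 * cip (v * p) (v * dx q)
       + (- cip (dx (dx g)) (dx w) - \<i> * cip (dx (dx g)) (v * q) + 2 * \<i> * cip (v * dx p) (dx w) - 2 * cip (v * dx p) (v * q))"
      unfolding Lx_def Bop_def Tv_def p_def[symmetric] q_def[symmetric]
      by (simp add: cip_diff_left cip_diff_right cip_add_left cip_add_right algebra_simps)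
    also have "\<dots> = - \<i> * cip (dx g) (v * dx q) + \<i> * cip (dx g) (dx v * q) - \<i> * cip (dx v * p) (dx w) + \<i> * cip (v * dx p) (dx w)
       - 2 * (cip (v * p) (v * dx q) + cip (v * dx p) (v * q))"
      unfolding X1 X3 Y2 by (simp add: algebra_simps)
    finally show ?thesis unfolding XY E1 E2 N by (simp add: algebra_simps)
  qed
  finally show ?thesis unfolding p_def q_def .
qed

subsection \<open>From weak to strong differentiability\<close>

definition H2 :: "l2 \<Rightarrow> bool" where "H2 f \<longleftrightarrow> H1 f \<and> H1 (dx f)"

lemma band_limited:
  "H1 (fm (indicator {-real n..real n}) f)"
  "\<exists>h. dx (fm (indicator {-real n..real n}) f) = fm (indicator {-real n..real n}) h"
proof -
  let ?i = "indicator {-real n..real n} :: real \<Rightarrow> complex"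
  define m where "m \<xi> = \<i> * of_real \<xi> * ?i \<xi>" for \<xi> :: real
  have i: "bmult ?i" by (rule bmult_indicator) simp
  have m: "bmult m"
  proof (rule bmultI[of _ "real n"])
    show "m \<in> borel_measurable borel" unfolding m_def[abs_def] by measurable
    show "cmod (m x) \<le> real n" for x by (auto simp: m_def norm_mult indicator_def)
  qed
  have "hasd (fm ?i f) (fm ?i (fm m f))"
    unfolding hasd_def Fo_fm using rp_mop[OF m, of "Fo f"] rp_mop[OF i, of "Fo f"] rp_mop[OF i, of "mop m (Fo f)"]
    by eventually_elim (simp add: m_def indicator_def)
  from hasdD[OF this] show "H1 (fm ?i f)" "\<exists>h. dx (fm ?i f) = fm ?i h" by auto
qed

lemma H2_dense:
  assumes S: "Sz f = f" and e: "e > 0"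
  shows "\<exists>h. H2 h \<and> Sz h = h \<and> norm (h - f) < e"
proof -
  define X where "X n = fm (indicator {-real n..real n}) f" for n
  have "H2 (X n)" for n unfolding H2_def X_def using band_limited[of n f] band_limited(1)[of n] by metis
  moreover have "Sz (X n) = X n" for n
    using fm_commute[of "indicator {0..}" "indicator {-real n..real n}" f] S unfolding X_def Sz_def by (simp add: bmult_indicator)
  moreover have "X \<longlonglongrightarrow> f"
  proof -
    have "(\<lambda>n. Fi (tr (real n) (Fo f))) \<longlonglongrightarrow> Fi (Fo f)"
      by (rule bounded_linear.tendsto[OF bounded_linear_Fi filterlim_compose[OF tr_lim filterlim_real_sequentially]])
    then show ?thesis by (simp add: X_def[abs_def] fm_def tr_def)
  qed
  then obtain n where "norm (X n - f) < e" using LIMSEQ_D[of X f e] e by blast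
  ultimately show ?thesis by blast
qed

lemma vector_mean_value:
  fixes f :: "real \<Rightarrow> complex"
  assumes d: "\<And>r. \<bar>r - t\<bar> < \<delta> \<Longrightarrow> (f has_vector_derivative f' r) (at r)"
    and b: "\<And>r. \<bar>r - t\<bar> < \<delta> \<Longrightarrow> cmod (f' r - c) \<le> M" and s: "\<bar>s - t\<bar> < \<delta>"
  shows "cmod (f s - f t - of_real (s - t) * c) \<le> M * \<bar>s - t\<bar>"
proof -
  define k where "k r = f r - of_real r * c" for r
  have "norm (k s - k t) \<le> M * norm (s - t)"
  proof (rule differentiable_bound[of "ball t \<delta>" k "\<lambda>x h. h *\<^sub>R (f' x - c)"])
    fix r assume "r \<in> ball t \<delta>"
    then have r: "\<bar>r - t\<bar> < \<delta>" by (simp add: dist_real_def abs_minus_commute)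
    have "(k has_vector_derivative f' r - c) (at r)"
    proof -
      have "((\<lambda>x. of_real x * c) has_vector_derivative c) (at r)"
        unfolding has_vector_derivative_def by (auto intro!: derivative_eq_intros simp: scaleR_conv_of_real)
      from has_vector_derivative_diff[OF d[OF r] this] show ?thesis by (simp add: k_def[abs_def])
    qed
    then show "(k has_derivative (\<lambda>h. h *\<^sub>R (f' r - c))) (at r within ball t \<delta>)"
      unfolding has_vector_derivative_def by (rule has_derivative_at_withinI)
    have "0 \<le> M" using b[OF r] norm_ge_zero order_trans by blast
    then show "onorm (\<lambda>h. h *\<^sub>R (f' r - c)) \<le> M"
      using b[OF r] by (intro onorm_bound) (auto simp: mult.commute[of M] intro: mult_left_mono)
  qed (use s in \<open>auto simp: dist_real_def abs_minus_commute\<close>)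
  then show ?thesis by (simp add: k_def algebra_simps)
qed

text \<open>The mean value theorem bounds the remainder, paired with \<open>\<zeta>\<close>, by e |s
  - t| times the norm of \<open>\<zeta>\<close>, on an interval that does not depend on
  \<open>\<zeta>\<close>. Such \<open>\<zeta>\<close> are dense in the Hardy space, which contains
  the remainder, so the bound holds for its norm.\<close>

lemma weak_to_strong_derivative:
  assumes I: "open I" "t \<in> I"
    and d: "\<And>\<zeta> r. r \<in> I \<Longrightarrow> H2 \<zeta> \<Longrightarrow> Sz \<zeta> = \<zeta> \<Longrightarrow> ((\<lambda>s. cip (g s) \<zeta>) has_vector_derivative cip (b r) \<zeta>) (at r)"
    and c: "(b \<longlongrightarrow> b t) (at t)" and S: "\<And>s. Sz (g s) = g s" "Sz (b t) = b t"
  shows "(g has_vector_derivative b t) (at t)"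
  unfolding has_vector_derivative_def has_derivative_at_alt
proof (intro conjI allI impI)
  show "bounded_linear (\<lambda>h. h *\<^sub>R b t)" by (rule bounded_linear_scaleR_left)
  fix e :: real assume e: "e > 0"
  obtain \<delta>1 where \<delta>1: "\<delta>1 > 0" "\<And>r. \<bar>r - t\<bar> < \<delta>1 \<Longrightarrow> r \<in> I"
    using I unfolding open_dist by (auto simp: dist_real_def)
  obtain \<delta>2 where \<delta>2: "\<delta>2 > 0" "\<And>r. r \<noteq> t \<Longrightarrow> \<bar>r - t\<bar> < \<delta>2 \<Longrightarrow> norm (b r - b t) < e"
    using tendstoD[OF c e] unfolding eventually_at by (auto simp: dist_real_def dist_norm)
  define \<delta> where "\<delta> = min \<delta>1 \<delta>2"
  have \<delta>: "\<delta> > 0" "\<And>r. \<bar>r - t\<bar> < \<delta> \<Longrightarrow> r \<in> I" using \<delta>1 \<delta>2(1) by (auto simp: \<delta>_def)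
  have be: "norm (b r - b t) \<le> e" if "\<bar>r - t\<bar> < \<delta>" for r
    using \<delta>2(2)[of r] that e by (cases "r = t") (auto simp: \<delta>_def intro: less_imp_le)
  show "\<exists>\<delta>>0. \<forall>y. norm (y - t) < \<delta> \<longrightarrow> norm (g y - g t - (y - t) *\<^sub>R b t) \<le> e * norm (y - t)"
  proof (intro exI[of _ \<delta>] conjI allI impI \<delta>(1))
    fix s assume "norm (s - t) < \<delta>"
    then have s: "\<bar>s - t\<bar> < \<delta>" by simp
    define k where "k = g s - g t - (s - t) *\<^sub>R b t"
    have Sk: "Sz k = k" unfolding k_def Sz_diff S linear_scale[OF bounded_linear.linear[OF bounded_linear_Sz]] ..
    have 1: "cmod (cip k \<zeta>) \<le> e * \<bar>s - t\<bar> * norm \<zeta>" if \<zeta>: "H2 \<zeta>" "Sz \<zeta> = \<zeta>" for \<zeta>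
    proof -
      have "cmod (cip (g s) \<zeta> - cip (g t) \<zeta> - of_real (s - t) * cip (b t) \<zeta>) \<le> (e * norm \<zeta>) * \<bar>s - t\<bar>"
      proof (rule vector_mean_value[OF _ _ s])
        fix r assume r: "\<bar>r - t\<bar> < \<delta>"
        show "((\<lambda>s. cip (g s) \<zeta>) has_vector_derivative cip (b r) \<zeta>) (at r)" by (rule d[OF \<delta>(2)[OF r] \<zeta>])
        have "cmod (cip (b r) \<zeta> - cip (b t) \<zeta>) \<le> norm (b r - b t) * norm \<zeta>"
          unfolding cip_diff_left[symmetric] by (rule cmod_cip_le)
        also have "\<dots> \<le> e * norm \<zeta>" by (rule mult_right_mono[OF be[OF r]]) simp
        finally show "cmod (cip (b r) \<zeta> - cip (b t) \<zeta>) \<le> e * norm \<zeta>" .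
      qed
      then show ?thesis by (simp add: k_def cip_diff_left mult_ac)
    qed
    \<comment> \<open>The vector \<open>k\<close> need not be smooth enough to be its own test
      vector; it is replaced by one within \<open>\<eta>\<close>, and \<open>\<eta>\<close> tends to
      0 below.\<close>
    have 2: "(norm k)\<^sup>2 \<le> e * \<bar>s - t\<bar> * norm k + \<eta> * (e * \<bar>s - t\<bar> + norm k)" if \<eta>: "\<eta> > 0" for \<eta>
    proof -
      obtain \<zeta> where \<zeta>: "H2 \<zeta>" "Sz \<zeta> = \<zeta>" "norm (\<zeta> - k) < \<eta>" using H2_dense[OF Sk \<eta>] by blast
      have "(norm k)\<^sup>2 = cmod (cip k k)" by (simp add: cip_self_norm norm_power)
      also have "cip k k = cip k \<zeta> - cip k (\<zeta> - k)" by (simp add: cip_diff_right)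
      also have "cmod \<dots> \<le> e * \<bar>s - t\<bar> * norm \<zeta> + norm k * norm (\<zeta> - k)"
        by (rule order_trans[OF norm_triangle_ineq4 add_mono[OF 1[OF \<zeta>(1,2)] cmod_cip_le]])
      also have "\<dots> \<le> e * \<bar>s - t\<bar> * (norm k + \<eta>) + norm k * \<eta>"
      proof -
        have "norm \<zeta> \<le> norm k + \<eta>" using norm_triangle_ineq[of k "\<zeta> - k"] \<zeta>(3) by simp
        then show ?thesis using \<zeta>(3) e by (intro add_mono mult_left_mono) auto
      qed
      finally show ?thesis by (simp add: algebra_simps)
    qed
    have "(norm k)\<^sup>2 \<le> e * \<bar>s - t\<bar> * norm k + 0 * (e * \<bar>s - t\<bar> + norm k)"
    proof (rule tendsto_lowerbound)
      show "((\<lambda>\<eta>. e * \<bar>s - t\<bar> * norm k + \<eta> * (e * \<bar>s - t\<bar> + norm k)) \<longlongrightarrow> e * \<bar>s - t\<bar> * norm k + 0 * (e * \<bar>s - t\<bar> + norm k)) (at_right 0)"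
        by (intro tendsto_intros)
      show "\<forall>\<^sub>F \<eta> in at_right 0. (norm k)\<^sup>2 \<le> e * \<bar>s - t\<bar> * norm k + \<eta> * (e * \<bar>s - t\<bar> + norm k)"
        using eventually_at_right_less[of 0] by (rule eventually_mono) (rule 2)
    qed simp
    then show "norm (g s - g t - (s - t) *\<^sub>R b t) \<le> e * norm (s - t)"
      unfolding k_def[symmetric] using e by (cases "norm k = 0") (auto simp: power2_eq_square)
  qed
qed

lemma has_vector_derivative_iff_quotient_at:
  fixes f :: "real \<Rightarrow> 'a::real_normed_vector"
  shows "(f has_vector_derivative D) (at t) \<longleftrightarrow> ((\<lambda>s. (1 / (s - t)) *\<^sub>R (f s - f t)) \<longlongrightarrow> D) (at t)"
  unfolding has_vector_derivative_iff_quotient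
  using LIM_offset_zero[of "\<lambda>s. (1 / (s - t)) *\<^sub>R (f s - f t)" D t] LIM_offset_zero_cancel[of "\<lambda>s. (1 / (s - t)) *\<^sub>R (f s - f t)" t D]
  by auto

lemma tendsto_norm_bound:
  fixes f :: "'a \<Rightarrow> 'b::real_normed_vector"
  assumes "\<forall>\<^sub>F x in F. norm (f x - l) \<le> g x" "(g \<longlongrightarrow> 0) F" shows "(f \<longlongrightarrow> l) F"
  by (rule LIM_zero_cancel[OF Lim_null_comparison[OF assms]])

lemma Ev_add: "H1 f \<Longrightarrow> H1 g \<Longrightarrow> Ev v (f + g) = Ev v f + Ev v g"
  by (simp add: Ev_def dx_add cip_add_right algebra_simps)

lemma tendsto_nl: assumes "tH1 v l F" shows "((\<lambda>x. nl (v x)) \<longlongrightarrow> nl l) F"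
  unfolding nl_def by (intro tendsto_mul[OF assms] tendsto_Sz tH1D(4)[OF tH1_mul[OF assms tH1_cj[OF assms]]])

lemma tendsto_Ev: assumes "tH1 v l F" "tH1 f m F" shows "((\<lambda>x. Ev (v x) (f x)) \<longlongrightarrow> Ev l m) F"
  unfolding Ev_def by (intro tendsto_add tendsto_mult tendsto_const tendsto_cip tH1D[OF assms(1)] tH1D[OF assms(2)] tendsto_nl[OF assms(1)])

lemma tendsto_Bop:
  assumes v: "tH1 v l F" and g: "tH1 g m F" "tH1 (\<lambda>x. dx (g x)) (dx m) F"
  shows "((\<lambda>x. Bop (v x) (g x)) \<longlongrightarrow> Bop l m) F"
  unfolding Bop_def
  by (intro tendsto_add tendsto_cs tH1D(4)[OF g(2)] tendsto_mul[OF v] tH1D(4)[OF tH1_Sz[OF tH1_mul[OF tH1_cj[OF v] g(1)]]])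

lemma Bop_cs: "H1 v \<Longrightarrow> H1 g \<Longrightarrow> H1 (dx g) \<Longrightarrow> Bop v (cs c g) = cs c (Bop v g)"
  by (simp add: Bop_def dx_cs mul_cs Sz_cs cs_add mult.commute)

text \<open>The resolvent equation solved for the derivative. With data in H^1 the right-hand side
  is in H^1, which is the source of the second derivative and, below, of its continuity.\<close>

lemma dx_rsv: assumes "H1 v" "Im z \<noteq> 0"
  shows "dx (rsv v z f) = cs \<i> (Tv v (rsv v z f) + cs z (rsv v z f) + f)"
proof -
  let ?g = "rsv v z f"
  have "cs (- \<i>) (dx ?g) = Tv v ?g + cs z ?g + f" using rsv(2)[OF assms, of f] unfolding Lx_def by (metis add_diff_cancel_left' add_diff_eq diff_add_cancel add.assoc add.commute)
  then have "cs \<i> (cs (- \<i>) (dx ?g)) = cs \<i> (Tv v ?g + cs z ?g + f)" by (rule arg_cong)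
  then show ?thesis by simp
qed

lemma H1_Tv: "H1 v \<Longrightarrow> H1 g \<Longrightarrow> H1 (Tv v g)" by (simp add: Tv_def)

lemma H1_dx_rsv: "H1 v \<Longrightarrow> Im z \<noteq> 0 \<Longrightarrow> H1 f \<Longrightarrow> H1 (dx (rsv v z f))"
  by (simp add: dx_rsv H1_Tv rsv)

text \<open>The limit \<open>g\<close> is inserted in the equation of the approximants: (L - z) (G x
  - g) then involves only f x - m and the change of \<open>Tv\<close> on the fixed vector
  \<open>g\<close>. The resolvent bound gives L^2 convergence, and \<open>dx_rsv\<close> lifts it to
  H^1.\<close>

lemma tH1_rsv:
  assumes v: "tH1 v l F" and z: "Im z \<noteq> 0" and f: "(f \<longlongrightarrow> m) F"
  shows "tH1 (\<lambda>x. rsv (v x) z (f x)) (rsv l z m) F"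
proof -
  note V = tH1D[OF v]
  define G where "G x = rsv (v x) z (f x)" for x
  define g where "g = rsv l z m"
  have HG: "H1 (G x)" for x unfolding G_def by (rule rsv(1)[OF V(1) z])
  have Hg: "H1 g" unfolding g_def by (rule rsv(1)[OF V(2) z])
  have le: "\<bar>Im z\<bar> * norm (G x - g) \<le> norm (f x - m + (Tv (v x) g - Tv l g))" for x
  proof -
    have "Lx (v x) (G x - g) = Lx (v x) (G x) - Lx (v x) g" by (rule Lx_diff[OF V(1) HG Hg])
    moreover have "Lx (v x) g = Lx l g - (Tv (v x) g - Tv l g)" by (simp add: Lx_def)
    ultimately have "Lx (v x) (G x - g) - cs z (G x - g) = (Lx (v x) (G x) - cs z (G x)) - (Lx l g - cs z g) + (Tv (v x) g - Tv l g)"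
      by (simp add: cs_diff)
    also have "\<dots> = f x - m + (Tv (v x) g - Tv l g)"
      using rsv(2)[OF V(1) z, of x "f x"] rsv(2)[OF V(2) z, of m] by (simp add: G_def g_def)
    finally show ?thesis using Lx_resolvent_bound[OF V(1)[of x] H1_diff[OF HG[of x] Hg], of z] by simp
  qed
  have G: "(G \<longlongrightarrow> g) F"
  proof (rule tendsto_norm_bound)
    show "\<forall>\<^sub>F x in F. norm (G x - g) \<le> norm (f x - m + (Tv (v x) g - Tv l g)) / \<bar>Im z\<bar>"
      using le z by (intro always_eventually allI) (simp add: field_simps)
    have "((\<lambda>x. norm (f x - m + (Tv (v x) g - Tv l g)) / \<bar>Im z\<bar>) \<longlongrightarrow> norm (m - m + (Tv l g - Tv l g)) / \<bar>Im z\<bar>) F"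
      using z by (intro tendsto_intros f tendsto_Tv[OF v tendsto_const]) simp
    then show "((\<lambda>x. norm (f x - m + (Tv (v x) g - Tv l g)) / \<bar>Im z\<bar>) \<longlongrightarrow> 0) F" by simp
  qed
  show ?thesis unfolding G_def[symmetric] g_def[symmetric]
  proof (rule tH1I[OF HG Hg G])
    show "((\<lambda>x. dx (G x)) \<longlongrightarrow> dx g) F"
      unfolding G_def g_def dx_rsv[OF V(1) z] dx_rsv[OF V(2) z] unfolding G_def[symmetric] g_def[symmetric]
      by (intro tendsto_cs tendsto_add tendsto_Tv[OF v] G f)
  qed
qed

lemma tH1_dx_rsv:
  assumes v: "tH1 v l F" and z: "Im z \<noteq> 0" and f: "tH1 f m F"
  shows "tH1 (\<lambda>x. dx (rsv (v x) z (f x))) (dx (rsv l z m)) F"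
  unfolding dx_rsv[OF tH1D(1)[OF v] z] dx_rsv[OF tH1D(2)[OF v] z]
  by (intro tH1_cs tH1_add tH1_Tv[OF v] tH1_rsv[OF v z] tH1D(3)[OF f] f)

subsection \<open>Evolution of resolvents and projections\<close>

text \<open>A curve in the Hardy part of H^1 with the equation in its weakest form, tested against
  fixed test functions. Regularity is asked for at all real times, so that curves built from
  \<open>u\<close> are in H^1 everywhere, while continuity and the equation concern \<open>I\<close>
  only.\<close>

locale flow =
  fixes I :: "real set" and u :: "real \<Rightarrow> l2"
  assumes open_I: "open I" and convex_I: "convex I"
    and uH: "H1 (u t)" and uS: "Sz (u t) = u t"
    and uc: "t \<in> I \<Longrightarrow> tH1 u (u t) (at t)"
    and ud: "t \<in> I \<Longrightarrow> \<psi> \<in> test_functions \<Longrightarrow>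
      ((\<lambda>s. cip (u s) (cj (cl \<psi>))) has_vector_derivative Ev (u t) (cj (cl \<psi>))) (at t)"
begin

lemma I_ball: assumes "t \<in> I" obtains \<delta> where "\<delta> > 0" "\<And>r. \<bar>r - t\<bar> < \<delta> \<Longrightarrow> r \<in> I"
  using open_I assms unfolding open_dist by (auto simp: dist_real_def)

text \<open>
  The mean value theorem for the pairing with a fixed function, uniformly in that function: this
  makes it possible to test the equation with functions depending on time.
\<close>

lemma increment:
  assumes t: "t \<in> I" and e: "e > 0"
  obtains \<delta> where "\<delta> > 0" "\<And>s \<psi>. \<bar>s - t\<bar> < \<delta> \<Longrightarrow> H1 \<psi> \<Longrightarrow>
    cmod (cip (u s - u t) \<psi> - of_real (s - t) * Ev (u t) \<psi>) \<le> e * nH1 \<psi> * \<bar>s - t\<bar>"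
proof -
  obtain \<delta>1 where \<delta>1: "\<delta>1 > 0" "\<And>r. \<bar>r - t\<bar> < \<delta>1 \<Longrightarrow> r \<in> I" using I_ball[OF t] by blast
  have e2: "e / 2 > 0" using e by simp
  have "\<forall>\<^sub>F r in at t. dist (dx (u r)) (dx (u t)) < e \<and> dist (nl (u r)) (nl (u t)) < e / 2"
    by (intro eventually_conj tendstoD[OF tH1D(4)[OF uc[OF t]] e] tendstoD[OF tendsto_nl[OF uc[OF t]] e2])
  then obtain \<delta>2 where \<delta>2: "\<delta>2 > 0" "\<And>r. r \<noteq> t \<Longrightarrow> \<bar>r - t\<bar> < \<delta>2 \<Longrightarrow> dist (dx (u r)) (dx (u t)) < e \<and> dist (nl (u r)) (nl (u t)) < e / 2"
    unfolding eventually_at by (auto simp: dist_real_def)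
  define \<delta> where "\<delta> = min \<delta>1 \<delta>2"
  have n: "norm (dx (u r) - dx (u t)) \<le> e \<and> norm (nl (u r) - nl (u t)) \<le> e / 2" if "\<bar>r - t\<bar> < \<delta>" for r
    using \<delta>2(2)[of r] that e by (cases "r = t") (auto simp: \<delta>_def dist_norm intro: less_imp_le)
  have 1: "cmod (cip (u s - u t) \<psi> - of_real (s - t) * Ev (u t) \<psi>) \<le> e * nH1 \<psi> * \<bar>s - t\<bar>"
    if s: "\<bar>s - t\<bar> < \<delta>" and \<psi>: "\<psi> = cj (cl \<phi>)" "\<phi> \<in> test_functions" for s \<psi> \<phi>
    unfolding cip_diff_left
  proof (rule vector_mean_value[OF _ _ s])
    fix r assume r: "\<bar>r - t\<bar> < \<delta>"
    have rI: "r \<in> I" using \<delta>1(2)[of r] r by (simp add: \<delta>_def)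
    show "((\<lambda>s. cip (u s) \<psi>) has_vector_derivative Ev (u r) \<psi>) (at r)" unfolding \<psi>(1) by (rule ud[OF rI \<psi>(2)])
    have "Ev (u r) \<psi> - Ev (u t) \<psi> = - \<i> * cip (dx (u r) - dx (u t)) (dx \<psi>) + 2 * cip (nl (u r) - nl (u t)) \<psi>"
      by (simp add: Ev_def cip_diff_left algebra_simps)
    also have "cmod \<dots> \<le> cmod (cip (dx (u r) - dx (u t)) (dx \<psi>)) + 2 * cmod (cip (nl (u r) - nl (u t)) \<psi>)"
      by (rule order_trans[OF norm_triangle_ineq]) (simp add: norm_mult)
    also have "\<dots> \<le> norm (dx (u r) - dx (u t)) * norm (dx \<psi>) + 2 * (norm (nl (u r) - nl (u t)) * norm \<psi>)"
      by (intro add_mono mult_left_mono cmod_cip_le) simp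
    also have "\<dots> \<le> e * norm (dx \<psi>) + 2 * (e / 2 * norm \<psi>)"
      using n[OF r] by (intro add_mono mult_left_mono mult_right_mono) auto
    also have "\<dots> = e * nH1 \<psi>" by (simp add: nH1_def algebra_simps)
    finally show "cmod (Ev (u r) \<psi> - Ev (u t) \<psi>) \<le> e * nH1 \<psi>" .
  qed
  \<comment> \<open>Both sides are continuous in \<open>\<psi>\<close> for the H^1 topology, and
    conjugated test functions are dense in H^1.\<close>
  have "cmod (cip (u s - u t) \<psi> - of_real (s - t) * Ev (u t) \<psi>) \<le> e * nH1 \<psi> * \<bar>s - t\<bar>"
    if s: "\<bar>s - t\<bar> < \<delta>" and \<psi>: "H1 \<psi>" for s \<psi>
  proof -
    have "\<exists>\<phi>\<in>test_functions. norm (cl \<phi> - cj \<psi>) < 1 / (1 + real n) \<and> norm (cl (vderiv \<phi>) - cj (dx \<psi>)) < 1 / (1 + real n)" for n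
      by (rule test_dense) (use hasd_dx[OF H1_cj[OF \<psi>]] \<psi> in \<open>simp_all add: dx_cj\<close>)
    then obtain \<phi> where \<phi>: "\<And>n. \<phi> n \<in> test_functions" "\<And>n. norm (cl (\<phi> n) - cj \<psi>) < 1 / (1 + real n)"
      "\<And>n. norm (cl (vderiv (\<phi> n)) - cj (dx \<psi>)) < 1 / (1 + real n)" by metis
    define X where "X n = cj (cl (\<phi> n))" for n
    have H: "H1 (cl (\<phi> n))" "dx (cl (\<phi> n)) = cl (vderiv (\<phi> n))" for n using hasdD[OF test_hasd[OF \<phi>(1)]] by auto
    have l0: "(\<lambda>n. 1 / (1 + real n)) \<longlonglongrightarrow> 0" by real_asymp
    have c1: "(\<lambda>n. cl (\<phi> n)) \<longlonglongrightarrow> cj \<psi>"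
      by (rule tendsto_norm_bound[OF _ l0]) (use \<phi>(2) in \<open>auto intro!: always_eventually less_imp_le\<close>)
    have c2: "(\<lambda>n. cl (vderiv (\<phi> n))) \<longlonglongrightarrow> cj (dx \<psi>)"
      by (rule tendsto_norm_bound[OF _ l0]) (use \<phi>(3) in \<open>auto intro!: always_eventually less_imp_le\<close>)
    have "tH1 (\<lambda>n. cl (\<phi> n)) (cj \<psi>) sequentially"
      by (rule tH1I) (use H c1 c2 \<psi> in \<open>simp_all add: dx_cj\<close>)
    from tH1_cj[OF this] have X: "tH1 X \<psi> sequentially" by (simp add: X_def[abs_def])
    have "(\<lambda>n. cmod (cip (u s - u t) (X n) - of_real (s - t) * Ev (u t) (X n))) \<longlonglongrightarrow> cmod (cip (u s - u t) \<psi> - of_real (s - t) * Ev (u t) \<psi>)"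
      by (intro tendsto_intros tendsto_cip tH1D(3)[OF X] tendsto_Ev[OF tH1_const X] uH)
    moreover have "(\<lambda>n. e * nH1 (X n) * \<bar>s - t\<bar>) \<longlonglongrightarrow> e * nH1 \<psi> * \<bar>s - t\<bar>"
      unfolding nH1_def by (intro tendsto_intros tH1D(3,4)[OF X])
    ultimately show ?thesis
      by (rule LIMSEQ_le) (use 1[OF s] \<phi>(1) in \<open>auto simp: X_def\<close>)
  qed
  then show ?thesis using that[of \<delta>] \<delta>1(1) \<delta>2(1) by (auto simp: \<delta>_def)
qed

text \<open>The error in \<open>increment\<close> is proportional to \<open>nH1 \<psi>\<close>,
  which stays bounded along a convergent family; hence the test function may vary with
  \<open>s\<close>.\<close>

lemma quotient:
  assumes t: "t \<in> I" and \<psi>: "tH1 \<psi> \<psi>t (at t)"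
  shows "((\<lambda>s. (1 / (s - t)) *\<^sub>R cip (u s - u t) (\<psi> s)) \<longlongrightarrow> Ev (u t) \<psi>t) (at t)"
proof -
  have "((\<lambda>s. (1 / (s - t)) *\<^sub>R cip (u s - u t) (\<psi> s) - Ev (u t) (\<psi> s)) \<longlongrightarrow> 0) (at t)"
  proof (rule tendstoI)
    fix \<eta> :: real assume \<eta>: "\<eta> > 0"
    define C where "C = nH1 \<psi>t + 1"
    have C: "C > 0" by (simp add: C_def add_nonneg_pos)
    define e where "e = \<eta> / (2 * C)"
    have e: "e > 0" "e * C < \<eta>" using \<eta> C by (simp_all add: e_def)
    obtain \<delta> where \<delta>: "\<delta> > 0" "\<And>s \<psi>. \<bar>s - t\<bar> < \<delta> \<Longrightarrow> H1 \<psi> \<Longrightarrow>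
      cmod (cip (u s - u t) \<psi> - of_real (s - t) * Ev (u t) \<psi>) \<le> e * nH1 \<psi> * \<bar>s - t\<bar>" using increment[OF t e(1)] by blast
    have "((\<lambda>s. nH1 (\<psi> s)) \<longlongrightarrow> nH1 \<psi>t) (at t)" unfolding nH1_def by (intro tendsto_intros tH1D(3,4)[OF \<psi>])
    then have "\<forall>\<^sub>F s in at t. nH1 (\<psi> s) < C" by (rule order_tendstoD(2)) (simp add: C_def)
    moreover have "\<forall>\<^sub>F s in at t. \<bar>s - t\<bar> < \<delta>" using \<delta>(1) unfolding eventually_at by (auto simp: dist_real_def)
    moreover have "\<forall>\<^sub>F s in at t. s \<noteq> t" by (auto simp: eventually_at_filter)
    ultimately show "\<forall>\<^sub>F s in at t. dist ((1 / (s - t)) *\<^sub>R cip (u s - u t) (\<psi> s) - Ev (u t) (\<psi> s)) 0 < \<eta>"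
    proof eventually_elim
      case (elim s)
      have "(1 / (s - t)) *\<^sub>R cip (u s - u t) (\<psi> s) - Ev (u t) (\<psi> s) = (1 / (s - t)) *\<^sub>R (cip (u s - u t) (\<psi> s) - of_real (s - t) * Ev (u t) (\<psi> s))"
        using elim(3) by (simp add: scaleR_conv_of_real field_simps)
      also have "cmod \<dots> = 1 / \<bar>s - t\<bar> * cmod (cip (u s - u t) (\<psi> s) - of_real (s - t) * Ev (u t) (\<psi> s))" by simp
      also have "\<dots> \<le> 1 / \<bar>s - t\<bar> * (e * nH1 (\<psi> s) * \<bar>s - t\<bar>)"
        by (rule mult_left_mono[OF \<delta>(2)[OF elim(2) tH1D(1)[OF \<psi>]]]) simp
      also have "\<dots> = e * nH1 (\<psi> s)" using elim(3) by simp
      also have "\<dots> \<le> e * C" using elim(1) e(1) by (intro mult_left_mono) auto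
      also have "\<dots> < \<eta>" by (rule e(2))
      finally show ?case by simp
    qed
  qed
  from tendsto_add[OF this tendsto_Ev[OF tH1_const[OF uH[of t]] \<psi>]] show ?thesis by simp
qed

definition gz :: "complex \<Rightarrow> real \<Rightarrow> l2" where "gz z t = rsv (u t) z (u t)"

lemma gz: assumes "Im z \<noteq> 0"
  shows "H1 (gz z t)" "H1 (dx (gz z t))" "Sz (gz z t) = gz z t" "Lx (u t) (gz z t) = cs z (gz z t) + u t"
proof -
  show "H1 (gz z t)" "H1 (dx (gz z t))" "Sz (gz z t) = gz z t"
    using rsv(1)[OF uH assms] H1_dx_rsv[OF uH assms uH] Sz_rsv[OF uH uS assms uS] by (simp_all add: gz_def)
  show "Lx (u t) (gz z t) = cs z (gz z t) + u t" using rsv(2)[OF uH assms, of t "u t"] by (simp add: gz_def algebra_simps)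
qed

text \<open>Writing \<open>\<zeta>\<close> as (L - cnj z) w with the operator at the time
  \<open>s\<close> and moving it across, one is left with (L_{u(s)} - z) (gz z s - gz z t). By the
  two resolvent equations this depends on \<open>u s - u t\<close> only.\<close>

lemma gz_increment:
  fixes \<zeta> :: l2
  assumes z: "Im z \<noteq> 0"
  defines "w \<equiv> \<lambda>s. rsv (u s) (cnj z) \<zeta>"
  shows "cip (gz z s - gz z t) \<zeta> = cip (u s - u t) (w s + w s * cj (Sz (cj (u s) * gz z t)))
    + cnj (cip (u s - u t) (gz z t * cj (Sz (cj (u t) * w s))))"
proof -
  let ?D = "u s - u t" and ?g = "gz z t"
  have z': "Im (cnj z) \<noteq> 0" using z by simp
  note w = rsv[OF uH z', of s \<zeta>, folded w_def]
  note G = gz[OF z]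
  have D: "H1 ?D" "H1 (u s)" "H1 (u t)" by (simp_all add: uH)
  have W: "H1 (w s)" using w(1) by (simp add: w_def)
  have "cip (gz z s - ?g) \<zeta> = cip (gz z s - ?g) (Lx (u s) (w s) - cs (cnj z) (w s))" using w(2) by (simp add: w_def)
  also have "\<dots> = cip (Lx (u s) (gz z s - ?g) - cs z (gz z s - ?g)) (w s)"
    unfolding cip_diff_right cip_diff_left[of "Lx _ _"] by (subst cip_Lx[OF uH _ W]) (simp_all add: G)
  also have "Lx (u s) (gz z s - ?g) - cs z (gz z s - ?g) = ?D + (Tv (u s) ?g - Tv (u t) ?g)"
  proof -
    have "Lx (u s) ?g = Lx (u t) ?g - (Tv (u s) ?g - Tv (u t) ?g)" by (simp add: Lx_def)
    then show ?thesis by (simp add: Lx_diff uH G cs_diff)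
  qed
  \<comment> \<open>The map \<open>Tv\<close> is linear in one occurrence of its potential and
    antilinear in the other, which are changed one after the other; the antilinear change produces
    the conjugated pairing.\<close>
  also have "Tv (u s) ?g - Tv (u t) ?g = ?D * Sz (cj (u s) * ?g) + u t * Sz (cj ?D * ?g)"
    by (simp add: Tv_def diff_mul_H1 uH cj_diff Sz_diff mul_diff)
  also have "cip (?D + (?D * Sz (cj (u s) * ?g) + u t * Sz (cj ?D * ?g))) (w s)
    = cip ?D (w s + w s * cj (Sz (cj (u s) * ?g))) + cnj (cip ?D (?g * cj (Sz (cj (u t) * w s))))"
  proof -
    have 1: "cip (?D * Sz (cj (u s) * ?g)) (w s) = cip ?D (w s * cj (Sz (cj (u s) * ?g)))"
      using cip_mul[of "Sz (cj (u s) * ?g)" ?D "w s"] by (simp add: uH G mul_comm)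
    have "cip (u t * Sz (cj ?D * ?g)) (w s) = cip (cj ?D * ?g) (Sz (cj (u t) * w s))" by (simp add: cip_mul uH cip_Sz)
    also have "\<dots> = cip ?g (Sz (cj (u t) * w s) * ?D)" using cip_mul[of "cj ?D" ?g "Sz (cj (u t) * w s)"] D by (simp add: mul_comm[of ?D])
    also have "\<dots> = cip (cj (Sz (cj (u t) * w s)) * ?g) ?D" by (rule cip_mul_right) (simp add: uH W)
    also have "\<dots> = cnj (cip ?D (?g * cj (Sz (cj (u t) * w s))))" unfolding cip_commute[of _ ?D] by (simp add: mul_comm)
    finally show ?thesis unfolding cip_add_left cip_add_right 1 by simp
  qed
  finally show ?thesis .
qed

text \<open>In the limit the pairings become values of \<open>Ev\<close>, and
  \<open>lax_identity\<close> applies with L g = z g + u and L w = cnj z w + zeta. The terms in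
  \<open>z\<close> cancel by antisymmetry and <u, B w> cancels against \<open>Ev_Bop\<close>, so
  that <B g, zeta> is left.\<close>

lemma gz_weak_derivative:
  assumes z: "Im z \<noteq> 0" and t: "t \<in> I" and x: "H2 \<zeta>" "Sz \<zeta> = \<zeta>"
  shows "((\<lambda>s. cip (gz z s) \<zeta>) has_vector_derivative cip (Bop (u t) (gz z t)) \<zeta>) (at t)"
proof -
  define w where "w s = rsv (u s) (cnj z) \<zeta>" for s
  have z': "Im (cnj z) \<noteq> 0" using z by simp
  let ?g = "gz z t"
  note G = gz[OF z, of t]
  have W: "H1 (w t)" "H1 (dx (w t))" "Lx (u t) (w t) = cs (cnj z) (w t) + \<zeta>"
    using rsv[OF uH z', of t \<zeta>] H1_dx_rsv[OF uH z', of \<zeta> t] x(1) by (auto simp: w_def H2_def algebra_simps)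
  have tw: "tH1 w (w t) (at t)" unfolding w_def by (rule tH1_rsv[OF uc[OF t] z' tendsto_const])
  have p1: "tH1 (\<lambda>s. w s + w s * cj (Sz (cj (u s) * ?g))) (w t + w t * cj (Sz (cj (u t) * ?g))) (at t)"
    by (intro tH1_add tH1_mul tH1_cj tH1_Sz tw uc[OF t] tH1_const G)
  have p2: "tH1 (\<lambda>s. ?g * cj (Sz (cj (u t) * w s))) (?g * cj (Sz (cj (u t) * w t))) (at t)"
    by (intro tH1_add tH1_mul tH1_cj tH1_Sz tw tH1_const G uH)
  have "((\<lambda>s. (1 / (s - t)) *\<^sub>R cip (u s - u t) (w s + w s * cj (Sz (cj (u s) * ?g)))
      + cnj ((1 / (s - t)) *\<^sub>R cip (u s - u t) (?g * cj (Sz (cj (u t) * w s)))))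
      \<longlongrightarrow> Ev (u t) (w t + w t * cj (Sz (cj (u t) * ?g))) + cnj (Ev (u t) (?g * cj (Sz (cj (u t) * w t))))) (at t)"
    by (intro tendsto_add tendsto_cnj quotient[OF t p1] quotient[OF t p2])
  moreover have "Ev (u t) (w t + w t * cj (Sz (cj (u t) * ?g))) + cnj (Ev (u t) (?g * cj (Sz (cj (u t) * w t)))) = cip (Bop (u t) ?g) \<zeta>"
  proof -
    have "Ev (u t) (w t + w t * cj (Sz (cj (u t) * ?g))) + cnj (Ev (u t) (?g * cj (Sz (cj (u t) * w t))))
      = Ev (u t) (w t) + (Ev (u t) (w t * cj (Sz (cj (u t) * ?g))) + cnj (Ev (u t) (?g * cj (Sz (cj (u t) * w t)))))"
      by (simp add: Ev_add W G uH)
    also have "\<dots> = - cip (u t) (Bop (u t) (w t)) + (cip (cs z ?g + u t) (Bop (u t) (w t)) + cip (Bop (u t) ?g) (cs (cnj z) (w t) + \<zeta>))"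
      unfolding lax_identity[OF uH G(1,2) W(1,2)] Ev_Bop[OF uH W(1,2)] G(4) W(3) ..
    also have "\<dots> = cip (Bop (u t) ?g) \<zeta>"
      using Bop_antisym[OF uH G(1,2) W(1,2)] by (simp add: cip_add_left cip_add_right algebra_simps)
    finally show ?thesis .
  qed
  moreover have "(1 / (s - t)) *\<^sub>R cip (u s - u t) (w s + w s * cj (Sz (cj (u s) * ?g)))
      + cnj ((1 / (s - t)) *\<^sub>R cip (u s - u t) (?g * cj (Sz (cj (u t) * w s)))) = (1 / (s - t)) *\<^sub>R (cip (gz z s) \<zeta> - cip ?g \<zeta>)" for s
    unfolding cip_diff_left[symmetric, of "gz z s"] gz_increment[OF z] w_def
    by (simp add: scaleR_conv_of_real add_divide_distrib del: of_real_diff)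
  ultimately show ?thesis unfolding has_vector_derivative_iff_quotient_at by simp
qed

lemma tendsto_Bop_gz: assumes z: "Im z \<noteq> 0" and t: "t \<in> I"
  shows "((\<lambda>s. Bop (u s) (gz z s)) \<longlongrightarrow> Bop (u t) (gz z t)) (at t)"
  unfolding gz_def
  by (intro tendsto_Bop uc[OF t] tH1_rsv tH1_dx_rsv z tH1D(3)[OF uc[OF t]])

lemma gz_derivative:
  assumes z: "Im z \<noteq> 0" and t: "t \<in> I"
  shows "(gz z has_vector_derivative Bop (u t) (gz z t)) (at t)"
  by (rule weak_to_strong_derivative[where b = "\<lambda>t. Bop (u t) (gz z t)", OF open_I t gz_weak_derivative[OF z] tendsto_Bop_gz[OF z t]])
    (use gz[OF z] Sz_Bop[OF uH uS] in auto)

lemma gz_norm: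
  assumes z: "Im z \<noteq> 0" and st: "s \<in> I" "t \<in> I"
  shows "norm (gz z s) = norm (gz z t)"
proof -
  have "((\<lambda>t. cip (gz z t) (gz z t)) has_vector_derivative 0) (at t within I)" if t: "t \<in> I" for t
  proof -
    have d: "(gz z has_derivative (\<lambda>h. h *\<^sub>R Bop (u t) (gz z t))) (at t within I)"
      using gz_derivative[OF z t] unfolding has_vector_derivative_def by (rule has_derivative_at_withinI)
    have "cip (gz z t) (Bop (u t) (gz z t)) + cip (Bop (u t) (gz z t)) (gz z t) = 0"
      using Bop_antisym[OF uH gz(1,2)[OF z] gz(1,2)[OF z]] by simp
    then have "cip (gz z t) (h *\<^sub>R Bop (u t) (gz z t)) + cip (h *\<^sub>R Bop (u t) (gz z t)) (gz z t) = h *\<^sub>R 0" for h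
      by (simp add: distrib_left[symmetric])
    then show ?thesis unfolding has_vector_derivative_def
      using bounded_bilinear.FDERIV[OF bounded_bilinear_cip d d] by simp
  qed
  then obtain c where "\<And>t. t \<in> I \<Longrightarrow> cip (gz z t) (gz z t) = c"
    using has_vector_derivative_zero_constant[OF convex_I] by metis
  then have "cip (gz z s) (gz z s) = cip (gz z t) (gz z t)" using st by simp
  then show ?thesis unfolding cip_self_norm of_real_eq_iff by (simp add: power2_eq_iff_nonneg)
qed

lemma aseq_gz: "aseq (u t) l n = cs (- \<i> * of_real (1 / (1 + real n))) (gz (Complex l (1 / (1 + real n))) t)"
  by (simp add: aseq_def ares_def gz_def)

lemma im_aseq: "Im (Complex l (1 / (1 + real n))) \<noteq> 0" by (simp add: add_eq_0_iff)

lemma aseq_derivative: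
  assumes t: "t \<in> I"
  shows "((\<lambda>t. aseq (u t) l n) has_vector_derivative Bop (u t) (aseq (u t) l n)) (at t)"
  unfolding aseq_gz Bop_cs[OF uH gz(1,2)[OF im_aseq]]
  by (rule bounded_linear.has_vector_derivative[OF bounded_linear_cs gz_derivative[OF im_aseq t]])

lemma aseq_uniform_flow: "uniform_limit I (\<lambda>n t. aseq (u t) l n) (\<lambda>t. alim (u t) l) sequentially"
proof (cases "I = {}")
  case False
  then obtain s where s: "s \<in> I" by blast
  show ?thesis unfolding alim_def
  proof (rule aseq_uniform[OF aseq_norm_convergent[OF uH[of s], of l] uH])
    show "(norm (aseq (u t) l n))\<^sup>2 = (norm (aseq (u s) l n))\<^sup>2" if "t \<in> I" for t n
      unfolding aseq_gz norm_cs using gz_norm[OF im_aseq that s] by simp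
  qed
qed (simp add: uniform_limit_iff)

lemma alim_norm: assumes st: "s \<in> I" "t \<in> I" shows "norm (alim (u s) l) = norm (alim (u t) l)"
proof -
  have "(\<lambda>n. norm (aseq (u s) l n)) \<longlonglongrightarrow> norm (alim (u s) l)" "(\<lambda>n. norm (aseq (u t) l n)) \<longlonglongrightarrow> norm (alim (u t) l)"
    by (intro tendsto_norm aseq_lim uH)+
  moreover have "norm (aseq (u s) l n) = norm (aseq (u t) l n)" for n
    unfolding aseq_gz norm_cs using gz_norm[OF im_aseq st] by simp
  ultimately show ?thesis using LIMSEQ_unique by simp
qed

lemma alim_cont: assumes t: "t \<in> I" shows "((\<lambda>s. alim (u s) l) \<longlongrightarrow> alim (u t) l) (at t)"
proof -
  have "continuous_on I (\<lambda>t. alim (u t) l)"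
  proof (rule uniform_limit_theorem[OF _ aseq_uniform_flow])
    show "\<forall>\<^sub>F n in sequentially. continuous_on I (\<lambda>t. aseq (u t) l n)"
      by (intro always_eventually allI continuous_at_imp_continuous_on ballI has_vector_derivative_continuous[OF aseq_derivative])
  qed simp
  then show ?thesis using open_I t by (simp add: continuous_on_eq_continuous_at isCont_def)
qed

text \<open>The eigenvalue equation expresses the derivative of \<open>alim\<close> through
  \<open>alim\<close> itself, so continuity in L^2 improves to H^1 and, applied again, to continuity
  of the derivative in H^1.\<close>

lemma alim_tH1: assumes t: "t \<in> I"
  shows "tH1 (\<lambda>s. alim (u s) l) (alim (u t) l) (at t)" "tH1 (\<lambda>s. dx (alim (u s) l)) (dx (alim (u t) l)) (at t)"
proof -
  have H: "H1 (alim (u s) l)" for s using alim(1)[OF uH uS] by (simp add: eig_def)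
  show 1: "tH1 (\<lambda>s. alim (u s) l) (alim (u t) l) (at t)"
  proof (rule tH1I[OF H H alim_cont[OF t]])
    show "((\<lambda>s. dx (alim (u s) l)) \<longlongrightarrow> dx (alim (u t) l)) (at t)"
      unfolding alim(2)[OF uH uS] by (intro tendsto_cs tendsto_add tendsto_Tv uc[OF t] alim_cont[OF t])
  qed
  show "tH1 (\<lambda>s. dx (alim (u s) l)) (dx (alim (u t) l)) (at t)"
    unfolding alim(2)[OF uH uS] by (intro tH1_cs tH1_add tH1_Tv uc[OF t] 1)
qed

lemma alim_H: "H1 (alim (u t) l)" "H1 (dx (alim (u t) l))" "Sz (alim (u t) l) = alim (u t) l"
  using alim(1)[OF uH uS, of t l] by (auto simp: eig_def alim(2)[OF uH uS] H1_Tv uH)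

text \<open>Antisymmetry puts \<open>Bop\<close> on the fixed vector \<open>\<zeta>\<close>, so that
  uniform L^2 convergence of \<open>aseq\<close> controls the time derivatives of the pairings. The
  mean value bound is proved for \<open>aseq\<close> with constants independent of \<open>n\<close>
  and then passed to the limit.\<close>

lemma alim_weak_derivative:
  assumes t: "t \<in> I" and x: "H2 \<zeta>" "Sz \<zeta> = \<zeta>"
  shows "((\<lambda>s. cip (alim (u s) l) \<zeta>) has_vector_derivative cip (Bop (u t) (alim (u t) l)) \<zeta>) (at t)"
  unfolding has_vector_derivative_def has_derivative_at_alt
proof (intro conjI allI impI)
  let ?A = "\<lambda>s. alim (u s) l"
  let ?c = "cip (Bop (u t) (?A t)) \<zeta>"
  show "bounded_linear (\<lambda>h. h *\<^sub>R ?c)" by (rule bounded_linear_scaleR_left)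
  have x': "H1 \<zeta>" "H1 (dx \<zeta>)" using x by (auto simp: H2_def)
  fix e :: real assume e: "e > 0"
  have tB: "((\<lambda>s. Bop (u s) \<zeta>) \<longlongrightarrow> Bop (u t) \<zeta>) (at t)"
    by (intro tendsto_Bop uc[OF t] tH1_const x')
  define C where "C = norm (Bop (u t) \<zeta>) + 1"
  have C: "C > 0" by (simp add: C_def add_nonneg_pos)
  have e2: "e / 2 > 0" using e by simp
  have "((\<lambda>s. norm (Bop (u s) \<zeta>)) \<longlongrightarrow> norm (Bop (u t) \<zeta>)) (at t)" by (intro tendsto_norm tB)
  then have "\<forall>\<^sub>F s in at t. norm (Bop (u s) \<zeta>) < C" by (rule order_tendstoD(2)) (simp add: C_def)
  moreover have "\<forall>\<^sub>F s in at t. dist (cip (?A s) (Bop (u s) \<zeta>)) (cip (?A t) (Bop (u t) \<zeta>)) < e / 2"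
    by (rule tendstoD[OF tendsto_cip[OF alim_cont[OF t] tB] e2])
  ultimately have "\<forall>\<^sub>F s in at t. norm (Bop (u s) \<zeta>) < C \<and> dist (cip (?A s) (Bop (u s) \<zeta>)) (cip (?A t) (Bop (u t) \<zeta>)) < e / 2"
    by (rule eventually_conj)
  then obtain \<delta>2 where \<delta>2: "\<delta>2 > 0" "\<And>r. r \<noteq> t \<Longrightarrow> \<bar>r - t\<bar> < \<delta>2 \<Longrightarrow> norm (Bop (u r) \<zeta>) < C \<and> dist (cip (?A r) (Bop (u r) \<zeta>)) (cip (?A t) (Bop (u t) \<zeta>)) < e / 2"
    unfolding eventually_at by (auto simp: dist_real_def)
  obtain \<delta>1 where \<delta>1: "\<delta>1 > 0" "\<And>r. \<bar>r - t\<bar> < \<delta>1 \<Longrightarrow> r \<in> I" using I_ball[OF t] by blast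
  define \<delta> where "\<delta> = min \<delta>1 \<delta>2"
  have near: "norm (Bop (u r) \<zeta>) \<le> C \<and> cmod (cip (?A r) (Bop (u r) \<zeta>) - cip (?A t) (Bop (u t) \<zeta>)) \<le> e / 2" if "\<bar>r - t\<bar> < \<delta>" for r
    using \<delta>2(2)[of r] that e by (cases "r = t") (auto simp: \<delta>_def C_def dist_norm intro: less_imp_le)
  have eC: "e / (2 * C) > 0" using e C by simp
  \<comment> \<open>An error e / (2 C) uniform in time costs e / 2 once paired with
    \<open>Bop (u r) \<zeta>\<close>, of norm at most \<open>C\<close>; the other half is the
    continuity of the limiting pairing.\<close>
  obtain N where N: "\<And>n r. n \<ge> N \<Longrightarrow> r \<in> I \<Longrightarrow> dist (aseq (u r) l n) (?A r) < e / (2 * C)"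
    using uniform_limitD[OF aseq_uniform_flow[of l] eC] unfolding eventually_sequentially by blast
  have cA: "?c = - cip (?A t) (Bop (u t) \<zeta>)" by (rule Bop_antisym[OF uH alim_H(1,2) x'])
  have bn: "cmod (cip (aseq (u s) l n) \<zeta> - cip (aseq (u t) l n) \<zeta> - of_real (s - t) * ?c) \<le> e * \<bar>s - t\<bar>"
    if s: "\<bar>s - t\<bar> < \<delta>" and n: "n \<ge> N" for s n
  proof (rule vector_mean_value[OF _ _ s])
    fix r assume r: "\<bar>r - t\<bar> < \<delta>"
    have rI: "r \<in> I" using \<delta>1(2)[of r] r by (simp add: \<delta>_def)
    have bl: "bounded_linear (\<lambda>f. cip f \<zeta>)" by (rule bounded_bilinear.bounded_linear_left[OF bounded_bilinear_cip])
    show "((\<lambda>s. cip (aseq (u s) l n) \<zeta>) has_vector_derivative cip (Bop (u r) (aseq (u r) l n)) \<zeta>) (at r)"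
      by (rule bounded_linear.has_vector_derivative[OF bl aseq_derivative[OF rI]])
    have an: "H1 (aseq (u r) l n)" "H1 (dx (aseq (u r) l n))" unfolding aseq_gz dx_cs[OF gz(1)[OF im_aseq]] by (intro H1_cs gz(1,2)[OF im_aseq])+
    have "cip (Bop (u r) (aseq (u r) l n)) \<zeta> - ?c = - (cip (aseq (u r) l n - ?A r) (Bop (u r) \<zeta>) + (cip (?A r) (Bop (u r) \<zeta>) - cip (?A t) (Bop (u t) \<zeta>)))"
      unfolding cA Bop_antisym[OF uH an x'] cip_diff_left by simp
    also have "cmod \<dots> \<le> norm (aseq (u r) l n - ?A r) * norm (Bop (u r) \<zeta>) + e / 2"
      unfolding norm_minus_cancel using near[OF r] by (intro order_trans[OF norm_triangle_ineq] add_mono cmod_cip_le) simp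
    also have "\<dots> \<le> e / (2 * C) * C + e / 2"
      using N[OF n rI] near[OF r] eC by (intro add_mono mult_mono) (auto simp: dist_norm)
    also have "\<dots> = e" using C by simp
    finally show "cmod (cip (Bop (u r) (aseq (u r) l n)) \<zeta> - ?c) \<le> e" .
  qed
  show "\<exists>\<delta>>0. \<forall>y. norm (y - t) < \<delta> \<longrightarrow> norm (cip (?A y) \<zeta> - cip (?A t) \<zeta> - (y - t) *\<^sub>R ?c) \<le> e * norm (y - t)"
  proof (intro exI[of _ \<delta>] conjI allI impI)
    show "\<delta> > 0" using \<delta>1(1) \<delta>2(1) by (simp add: \<delta>_def)
    fix s assume "norm (s - t) < \<delta>"
    then have s: "\<bar>s - t\<bar> < \<delta>" by simp
    have "(\<lambda>n. cmod (cip (aseq (u s) l n) \<zeta> - cip (aseq (u t) l n) \<zeta> - of_real (s - t) * ?c))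
      \<longlonglongrightarrow> cmod (cip (?A s) \<zeta> - cip (?A t) \<zeta> - of_real (s - t) * ?c)"
      by (intro tendsto_norm tendsto_diff tendsto_cip tendsto_const aseq_lim uH)
    then have "cmod (cip (?A s) \<zeta> - cip (?A t) \<zeta> - of_real (s - t) * ?c) \<le> e * \<bar>s - t\<bar>"
      by (rule LIMSEQ_le_const2) (use bn[OF s] in blast)
    then show "norm (cip (?A s) \<zeta> - cip (?A t) \<zeta> - (s - t) *\<^sub>R ?c) \<le> e * norm (s - t)" by (simp add: scaleR_conv_of_real)
  qed
qed

lemma alim_derivative:
  assumes t: "t \<in> I"
  shows "((\<lambda>s. alim (u s) l) has_vector_derivative Bop (u t) (alim (u t) l)) (at t)"
  by (rule weak_to_strong_derivative[where b = "\<lambda>t. Bop (u t) (alim (u t) l)", OF open_I t alim_weak_derivative tendsto_Bop[OF uc[OF t] alim_tH1[OF t]]])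
    (use alim_H Sz_Bop[OF uH uS] in auto)

end

subsection \<open>Representatives\<close>

lemma mul_cl:
  assumes "f \<in> L2" "g \<in> L2" "H1 (cl f)"
  shows "(\<lambda>x. f x * g x) \<in> L2" "cl (\<lambda>x. f x * g x) = cl f * cl g"
proof -
  have ae: "AE x in lborel. f x * g x = rp (cl f * cl g) x"
    using rp_cl[OF assms(1)] rp_cl[OF assms(2)] rp_mul[OF assms(3), of "cl g"] by eventually_elim simp
  have m: "(\<lambda>x. f x * g x) \<in> borel_measurable borel" using L2_meas[OF assms(1)] L2_meas[OF assms(2)] by measurable
  show L: "(\<lambda>x. f x * g x) \<in> L2" by (rule L2_cong[OF rp_L2 m ae])
  show "cl (\<lambda>x. f x * g x) = cl f * cl g" using cl_cong[OF L rp_L2 ae] by simp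
qed

lemma mul_cl_cnj:
  assumes "f \<in> L2" "g \<in> L2" "H1 (cl f)"
  shows "(\<lambda>x. cnj (f x) * g x) \<in> L2" "cl (\<lambda>x. cnj (f x) * g x) = cj (cl f) * cl g"
  using mul_cl[OF L2_cnj[OF assms(1)] assms(2)] assms by (simp_all add: cj_cl[symmetric])

lemma ddx_cl: assumes "f \<in> L2" "H1 (cl f)" shows "ddx f \<in> L2" "cl (ddx f) = dx (cl f)"
  using ddx_hasd[OF assms(1) hasd_dx[OF assms(2)]] by auto

lemma sobolev_plus_1: "f \<in> sobolev_plus 1 \<longleftrightarrow> f \<in> L2 \<and> H1 (cl f) \<and> Sz (cl f) = cl f"
  unfolding sobolev_plus_1_iff H1_def ..

lemma lax_cl:
  assumes v: "v \<in> sobolev_plus 1" and h: "h \<in> L2" "H1 (cl h)"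
  shows "lax v h \<in> L2" "cl (lax v h) = Lx (cl v) (cl h)"
proof -
  have V: "v \<in> L2" "H1 (cl v)" using v by (auto simp: sobolev_plus_1)
  note d = ddx_cl[OF h]
  note m = mul_cl_cnj[OF V(1) h(1) V(2)]
  note s = szego_L2[OF m(1)]
  note p = mul_cl[OF V(1) _ V(2), of "szego (\<lambda>y. cnj (v y) * h y)"]
  have e: "lax v h = (\<lambda>x. - \<i> * ddx h x - v x * szego (\<lambda>y. cnj (v y) * h y) x)" by (rule ext) (simp add: lax_def)
  show "lax v h \<in> L2" unfolding e using s by (intro L2_diff L2_cmult d(1) p(1)) auto
  have "cl (lax v h) = cl (\<lambda>x. - \<i> * ddx h x) - cl (\<lambda>x. v x * szego (\<lambda>y. cnj (v y) * h y) x)"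
    unfolding e using s by (intro cl_diff L2_cmult d(1) p(1)) auto
  also have "cl (\<lambda>x. - \<i> * ddx h x) = cs (- \<i>) (dx (cl h))" using cl_cmult[OF d(1), of "- \<i>"] d(2) by simp
  also have "cl (\<lambda>x. v x * szego (\<lambda>y. cnj (v y) * h y) x) = Tv (cl v) (cl h)"
    using p(2) s m(2) by (simp add: Tv_def)
  finally show "cl (lax v h) = Lx (cl v) (cl h)" by (simp add: Lx_def)
qed

lemma is_lax_eigenvector_iff:
  assumes v: "v \<in> sobolev_plus 1"
  shows "is_lax_eigenvector v l h \<longleftrightarrow> h \<in> L2 \<and> cl h \<noteq> 0 \<and> eig (cl v) l (cl h)"
proof (cases "h \<in> L2 \<and> H1 (cl h)")
  case True
  then have h: "h \<in> L2" "H1 (cl h)" by auto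
  have "(AE x in lborel. h x = 0) \<longleftrightarrow> cl h = 0" using cl_eq_iff[OF h(1) L2_zero] by (simp add: cl_zero)
  moreover have "(AE x in lborel. lax v h x = of_real l * h x) \<longleftrightarrow> Lx (cl v) (cl h) = cs (of_real l) (cl h)"
    using cl_eq_iff[OF lax_cl(1)[OF v h] L2_cmult[OF h(1), of "of_real l"]] by (simp add: lax_cl(2)[OF v h] cl_cmult[OF h(1)])
  ultimately show ?thesis using h by (auto simp: is_lax_eigenvector_def sobolev_plus_1 eig_def)
qed (auto simp: is_lax_eigenvector_def sobolev_plus_1 eig_def)

lemma lax_eigenvalues_iff:
  assumes v: "v \<in> sobolev_plus 1"
  shows "l \<in> lax_eigenvalues v \<longleftrightarrow> alim (cl v) l \<noteq> 0"
proof -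
  have V: "H1 (cl v)" "Sz (cl v) = cl v" using v by (auto simp: sobolev_plus_1)
  have "alim (cl v) l \<noteq> 0" if k: "k \<noteq> 0" "eig (cl v) l k" for k
  proof
    assume "alim (cl v) l = 0"
    then have "cip (cl v) k = 0" using alim(3)[OF V k(2)] by simp
    then show False using eig_norm[OF V k(2)] k(1) by simp
  qed
  moreover have "is_lax_eigenvector v l (rp (alim (cl v) l))" if "alim (cl v) l \<noteq> 0"
    unfolding is_lax_eigenvector_iff[OF v] using that alim(1)[OF V] by simp
  ultimately show ?thesis unfolding lax_eigenvalues_def mem_Collect_eq using is_lax_eigenvector_iff[OF v] by blast
qed

text \<open>Being the projection of \<open>v\<close> to the eigenspace, A = \<open>alim v l\<close>
  satisfies <v, A> = |A|^2. Then \<open>eig_norm\<close> reads |A|^4 = 2 pi |A|^2, which fixes the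
  norm; no phase is left to choose.\<close>

lemma alim_norm_sq:
  assumes V: "H1 v" "Sz v = v" and nz: "alim v l \<noteq> 0"
  shows "(norm (alim v l))\<^sup>2 = 2 * pi" "cip v (alim v l) = of_real (2 * pi)"
proof -
  let ?A = "alim v l"
  have c: "cip v ?A = of_real ((norm ?A)\<^sup>2)" using alim(3)[OF V alim(1)[OF V]] by (simp add: cip_self_norm)
  have "((norm ?A)\<^sup>2)\<^sup>2 = 2 * pi * (norm ?A)\<^sup>2" using eig_norm[OF V alim(1)[OF V], of l] unfolding c by (simp add: norm_power)
  then show "(norm ?A)\<^sup>2 = 2 * pi" using nz by (simp add: power2_eq_square)
  then show "cip v ?A = of_real (2 * pi)" unfolding c by (simp only:)
qed

text \<open>The equality case of the Cauchy-Schwarz inequality determines the standard eigenvector.\<close>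

lemma standard_eigenvector_cl:
  assumes v: "v \<in> sobolev_plus 1" and l: "lax_eigenvalue v j \<in> lax_eigenvalues v"
  shows "standard_eigenvector v j \<in> L2"
    "cl (standard_eigenvector v j) = (1 / sqrt (2 * pi)) *\<^sub>R alim (cl v) (lax_eigenvalue v j)"
proof -
  define l where "l = lax_eigenvalue v j"
  define c where "c = sqrt (2 * pi)"
  have c: "c > 0" "c * c = 2 * pi" by (simp_all add: c_def)
  have V: "v \<in> L2" "H1 (cl v)" "Sz (cl v) = cl v" using v by (auto simp: sobolev_plus_1)
  let ?A = "alim (cl v) l"
  have nz: "?A \<noteq> 0" using assms(2) unfolding lax_eigenvalues_iff[OF v] l_def .
  note A = alim_norm_sq[OF V(2,3) nz]
  define P where "P \<phi> \<longleftrightarrow> is_lax_eigenvector v l \<phi> \<and> L2_norm \<phi> = 1 \<and> L2_inner v \<phi> = of_real (sqrt (2 * pi))" for \<phi>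
  have Pcl: "P \<phi> \<longleftrightarrow> \<phi> \<in> L2 \<and> cl \<phi> \<noteq> 0 \<and> eig (cl v) l (cl \<phi>) \<and> norm (cl \<phi>) = 1 \<and> cip (cl v) (cl \<phi>) = of_real c" for \<phi>
    unfolding P_def is_lax_eigenvector_iff[OF v] c_def using norm_cl[of \<phi>] cip_cl[OF V(1), of \<phi>] by auto
  have "P (rp ((1 / c) *\<^sub>R ?A))"
  proof -
    have "eig (cl v) l ((1 / c) *\<^sub>R ?A)"
      using alim(1)[OF V(2,3), of l] unfolding eig_def cs_of_real[symmetric] by (simp add: Sz_cs Lx_cs V mult.commute)
    moreover have "norm ((1 / c) *\<^sub>R ?A) = 1"
    proof -
      have "(norm ((1 / c) *\<^sub>R ?A))\<^sup>2 = (norm ?A)\<^sup>2 / (c * c)" by (simp add: power_mult_distrib power_divide power2_eq_square)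
      also have "\<dots> = 1" unfolding A c by simp
      finally show ?thesis using norm_ge_zero[of "(1 / c) *\<^sub>R ?A"] by (metis abs_norm_cancel real_sqrt_abs real_sqrt_one)
    qed
    moreover have "cip (cl v) ((1 / c) *\<^sub>R ?A) = of_real c"
    proof -
      have "cip (cl v) ((1 / c) *\<^sub>R ?A) = of_real ((c * c) / c)" unfolding cip_scaleR_right A c of_real_mult[symmetric] by simp
      then show ?thesis using c(1) by simp
    qed
    ultimately show ?thesis unfolding Pcl using nz c(1) by simp
  qed
  moreover have sv: "standard_eigenvector v j = (SOME \<phi>. P \<phi>)" unfolding standard_eigenvector_def P_def l_def ..
  ultimately have "P (standard_eigenvector v j)" using someI[of P] by simp
  then have S: "standard_eigenvector v j \<in> L2" "eig (cl v) l (cl (standard_eigenvector v j))"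
    "norm (cl (standard_eigenvector v j)) = 1" "cip (cl v) (cl (standard_eigenvector v j)) = of_real c" unfolding Pcl by auto
  let ?k = "cl (standard_eigenvector v j)"
  show "standard_eigenvector v j \<in> L2" by (rule S(1))
  have "cip ?A ?k = of_real c" using alim(3)[OF V(2,3) S(2)] S(4) by simp
  then have "(norm (?A - c *\<^sub>R ?k))\<^sup>2 = 2 * pi + c * c - 2 * (c * c)"
    unfolding norm_diff_cip A using S(3) by (simp add: power_mult_distrib power2_eq_square)
  then have "?A = c *\<^sub>R ?k" using c by simp
  then have "(1 / c) *\<^sub>R ?A = ?k" using c(1) by simp
  then show "?k = (1 / sqrt (2 * pi)) *\<^sub>R alim (cl v) (lax_eigenvalue v j)" by (simp add: c_def l_def)
qed

text \<open>Outside \<open>I\<close> the curve is set to 0, which lies in the Hardy part of H^1 as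
  the locale asks at all times. Since \<open>I\<close> is open, neither limits nor derivatives at
  its points see the extension.\<close>

lemma flow_cmdnls:
  assumes I: "open I" "convex I" and c: "continuous_sobolev_plus 1 I u" and s: "cmdnls_solution I u"
  defines "U \<equiv> \<lambda>t. if t \<in> I then cl (u t) else 0"
  shows "flow I U"
proof
  have u: "u t \<in> L2" "H1 (cl (u t))" "Sz (cl (u t)) = cl (u t)" if "t \<in> I" for t
    using c that unfolding continuous_sobolev_plus_def sobolev_plus_1 by auto
  show "open I" "convex I" by fact+
  show UH: "H1 (U t)" for t using u by (simp add: U_def)
  show "Sz (U t) = U t" for t using u linear_0[OF bounded_linear.linear[OF bounded_linear_Sz]] by (simp add: U_def)
  show tU: "tH1 U (U t) (at t)" if t: "t \<in> I" for t
  proof (rule tH1I[OF UH UH])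
    have "((\<lambda>s. sobolev_norm 1 (\<lambda>x. u s x - u t x)) \<longlongrightarrow> 0) (at t)"
      using c t at_within_open[OF t I(1)] unfolding continuous_sobolev_plus_def by metis
    moreover have "\<forall>\<^sub>F s in at t. s \<in> I" using I(1) t by (simp add: eventually_at_in_open')
    moreover have "norm (U s - U t) \<le> sobolev_norm 1 (\<lambda>x. u s x - u t x) \<and> norm (dx (U s) - dx (U t)) \<le> sobolev_norm 1 (\<lambda>x. u s x - u t x)" if "s \<in> I" for s
    proof -
      have L: "(\<lambda>x. u s x - u t x) \<in> L2" by (rule L2_diff[OF u(1)[OF that] u(1)[OF t]])
      have e: "cl (\<lambda>x. u s x - u t x) = U s - U t" using cl_diff[OF u(1)[OF that] u(1)[OF t]] that t by (simp add: U_def)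
      show ?thesis using sobolev_norm_1[OF L hasd_dx, unfolded e] UH by (simp add: dx_diff)
    qed
    ultimately show "(U \<longlongrightarrow> U t) (at t)" "((\<lambda>s. dx (U s)) \<longlongrightarrow> dx (U t)) (at t)"
      by (auto intro!: tendsto_norm_bound[of _ _ "\<lambda>s. sobolev_norm 1 (\<lambda>x. u s x - u t x)"] elim: eventually_mono)
  qed
  show "((\<lambda>s. cip (U s) (cj (cl \<psi>))) has_vector_derivative Ev (U t) (cj (cl \<psi>))) (at t)"
    if t: "t \<in> I" and \<psi>: "\<psi> \<in> test_functions" for t \<psi>
  proof -
    define \<zeta> where "\<zeta> = cj (cl \<psi>)"
    note T = test_L2[OF \<psi>] and T' = test_vderiv[OF \<psi>]
    note T'' = test_vderiv[OF T']
    have x: "H1 \<zeta>" "dx \<zeta> = cj (cl (vderiv \<psi>))" "H1 (dx \<zeta>)" "dx (dx \<zeta>) = cj (cl (vderiv (vderiv \<psi>)))"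
      using hasdD[OF test_hasd[OF \<psi>]] hasdD[OF test_hasd[OF T']] by (simp_all add: \<zeta>_def dx_cj)
    note v = u[OF t]
    define f where "f = (\<lambda>y. complex_of_real ((cmod (u t y))\<^sup>2))"
    define g where "g = ddx f"
    define h where "h x = hilbert g x - \<i> * g x" for x
    have Ut: "U t = cl (u t)" using t by (simp add: U_def)
    have "f = (\<lambda>y. u t y * cnj (u t y))" unfolding f_def complex_norm_square ..
    then have f: "f \<in> L2" "cl f = U t * cj (U t)" using mul_cl[OF v(1) L2_cnj[OF v(1)] v(2)] by (simp_all add: Ut cj_cl[OF v(1)])
    have g: "g \<in> L2" "cl g = dx (U t * cj (U t))" using ddx_cl[OF f(1)] UH unfolding f(2) by (simp_all add: g_def)
    note hg = hilbert_L2[OF g(1)]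
    have h: "h \<in> L2" "cl h = cs (- 2 * \<i>) (Sz (cl g))"
    proof -
      show "h \<in> L2" unfolding h_def[abs_def] using hg by (intro L2_diff L2_cmult g) auto
      have "cl h = Hil (cl g) - cs \<i> (cl g)"
        unfolding h_def[abs_def] using hg cl_diff[of "hilbert g" "\<lambda>x. \<i> * g x"] L2_cmult[OF g(1)] cl_cmult[OF g(1)] by simp
      also have "\<dots> = cs (- 2 * \<i>) (Sz (cl g))" unfolding Sz_Hil[symmetric] cs_cs cs_add by simp
      finally show "cl h = cs (- 2 * \<i>) (Sz (cl g))" .
    qed
    note uh = mul_cl[OF v(1) h(1) v(2)]
    obtain d where d: "((\<lambda>s. LINT x|lborel. u s x * \<psi> x) has_vector_derivative d) (at t)"
      and eq: "\<i> * d + (LINT x|lborel. u t x * vderiv (vderiv \<psi>) x) + (LINT x|lborel. u t x * h x * \<psi> x) = 0"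
      using s t \<psi> unfolding cmdnls_solution_def Let_def h_def g_def f_def by blast
    have "(LINT x|lborel. u t x * vderiv (vderiv \<psi>) x) = cip (U t) (dx (dx \<zeta>))"
      unfolding x(4) Ut by (rule pairing_cip[OF v(1) test_L2[OF T'']])
    also have "\<dots> = - cip (dx (U t)) (dx \<zeta>)" using dx_ibp[OF UH x(3)] by simp
    finally have 1: "(LINT x|lborel. u t x * vderiv (vderiv \<psi>) x) = - cip (dx (U t)) (dx \<zeta>)" .
    have "(LINT x|lborel. u t x * h x * \<psi> x) = cip (U t * cl h) \<zeta>"
      using pairing_cip[OF uh(1) T] uh(2) by (simp add: \<zeta>_def Ut)
    also have "U t * cl h = cs (- 2 * \<i>) (nl (U t))" unfolding h(2) g(2) nl_def by (rule mul_cs[OF UH])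
    finally have 2: "(LINT x|lborel. u t x * h x * \<psi> x) = - 2 * \<i> * cip (nl (U t)) \<zeta>" by simp
    have "\<i> * d = \<i> * Ev (U t) \<zeta>" using eq unfolding 1 2 Ev_def by (simp add: algebra_simps add_eq_0_iff)
    then have dE: "d = Ev (U t) \<zeta>" by simp
    show ?thesis
    proof (rule has_vector_derivative_transform_within_open[OF d[unfolded dE \<zeta>_def] I(1) t])
      fix s assume "s \<in> I"
      then show "(LINT x|lborel. u s x * \<psi> x) = cip (U s) (cj (cl \<psi>))" using pairing_cip[OF u(1) T] by (simp add: U_def)
    qed
  qed
qed

lemma convex_einterval: "convex (einterval a b)"
  unfolding is_interval_convex_1[symmetric] is_interval_1
  by (auto simp: einterval_iff intro: less_le_trans) (meson ereal_less_eq(3) le_less_trans)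

lemma has_L2_derivativeI:
  assumes I: "open I" "t \<in> I" and f: "\<And>s. s \<in> I \<Longrightarrow> f s \<in> L2" "\<And>s. s \<in> I \<Longrightarrow> cl (f s) = F s"
    and d: "(F has_vector_derivative D) (at t)" and g: "g \<in> L2" "cl g = D"
  shows "has_L2_derivative f g t"
  unfolding has_L2_derivative_def
proof (intro conjI g(1))
  have ev: "\<forall>\<^sub>F s in nhds t. s \<in> I" by (rule eventually_nhds_in_open[OF I])
  then show "\<forall>\<^sub>F s in nhds t. f s \<in> L2" by (rule eventually_mono) (rule f(1))
  have "((\<lambda>s. norm ((1 / (s - t)) *\<^sub>R (F s - F t) - D)) \<longlongrightarrow> norm (D - D)) (at t)"
    using d unfolding has_vector_derivative_iff_quotient_at by (intro tendsto_intros)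
  then have "((\<lambda>s. norm ((1 / (s - t)) *\<^sub>R (F s - F t) - D)) \<longlongrightarrow> 0) (at t)" by simp
  moreover have "\<forall>\<^sub>F s in at t. norm ((1 / (s - t)) *\<^sub>R (F s - F t) - D) = L2_norm (\<lambda>x. (f s x - f t x) / of_real (s - t) - g x)"
  proof -
    have "\<forall>\<^sub>F s in at t. s \<in> I" using ev by (simp add: eventually_at_filter eventually_mono)
    then show ?thesis
    proof eventually_elim
      case (elim s)
      define q where "q x = (1 / of_real (s - t)) * (f s x - f t x)" for x
      have L: "(\<lambda>x. f s x - f t x) \<in> L2" by (rule L2_diff[OF f(1)[OF elim] f(1)[OF I(2)]])
      have q: "q \<in> L2" unfolding q_def[abs_def] by (rule L2_cmult[OF L])
      have "cl q = cs (of_real (1 / (s - t))) (F s - F t)"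
        unfolding q_def[abs_def] cl_cmult[OF L] cl_diff[OF f(1)[OF elim] f(1)[OF I(2)]] f(2)[OF elim] f(2)[OF I(2)] by simp
      then have "cl (\<lambda>x. q x - g x) = (1 / (s - t)) *\<^sub>R (F s - F t) - D" unfolding cl_diff[OF q g(1)] g(2) cs_of_real by simp
      moreover have "(\<lambda>x. (f s x - f t x) / of_real (s - t) - g x) = (\<lambda>x. q x - g x)" by (simp add: q_def)
      ultimately show ?case using norm_cl[OF L2_diff[OF q g(1)]] by simp
    qed
  qed
  ultimately show "((\<lambda>s. L2_norm (\<lambda>x. (f s x - f t x) / of_real (s - t) - g x)) \<longlongrightarrow> 0) (at t)"
    by (rule Lim_transform_eventually)
qed

lemma Bop_cl:
  assumes v: "v \<in> L2" "H1 (cl v)" and h: "h \<in> L2" "H1 (cl h)" "H1 (dx (cl h))"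
  defines "r \<equiv> \<lambda>x. \<i> * ddx (ddx h) x + 2 * v x * ddx (szego (\<lambda>y. cnj (v y) * h y)) x"
  shows "r \<in> L2" "cl r = Bop (cl v) (cl h)"
proof -
  note d = ddx_cl[OF h(1,2)]
  note d2 = ddx_cl[OF d(1), unfolded d(2), OF h(3)]
  note m = mul_cl_cnj[OF v(1) h(1) v(2)]
  define p where "p = szego (\<lambda>y. cnj (v y) * h y)"
  have p: "p \<in> L2" "cl p = Sz (cj (cl v) * cl h)" using szego_L2[OF m(1)] m(2) by (simp_all add: p_def)
  have dp: "ddx p \<in> L2" "cl (ddx p) = dx (Sz (cj (cl v) * cl h))" using ddx_cl[OF p(1)] v h unfolding p(2) by simp_all
  note vp = mul_cl[OF v(1) dp(1) v(2)]
  have r: "r = (\<lambda>x. \<i> * ddx (ddx h) x + 2 * (v x * ddx p x))" by (simp add: r_def p_def mult.assoc)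
  show "r \<in> L2" unfolding r by (intro L2_add L2_cmult d2 vp)
  show "cl r = Bop (cl v) (cl h)" unfolding r
    by (subst cl_add) (simp_all add: L2_cmult d2 vp cl_cmult dp Bop_def)
qed

theorem theorem1p6:
  fixes Tm Tp :: ereal and u :: "real \<Rightarrow> real \<Rightarrow> complex" and u0 :: "real \<Rightarrow> complex"
    and \<phi> :: "nat \<Rightarrow> real \<Rightarrow> real \<Rightarrow> complex"
  assumes "Tm < 0" and "0 < Tp"
    and "u0 \<in> sobolev_plus 1"
    and "continuous_sobolev_plus 1 (einterval Tm Tp) u"
    and "cmdnls_solution (einterval Tm Tp) u"
    and "AE x in lborel. u 0 x = u0 x"
    and \<phi>_def: "\<And>j t. \<phi> j t = standard_eigenvector (u t) j"
  shows "\<forall>j\<in>{1..card (lax_eigenvalues u0)}. \<forall>t\<in>einterval Tm Tp.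
    has_L2_derivative (\<phi> j)
      (\<lambda>x. \<i> * ddx (ddx (\<phi> j t)) x
         + 2 * u t x * ddx (szego (\<lambda>y. cnj (u t y) * \<phi> j t y)) x) t"
proof (intro ballI)
  fix j t assume j: "j \<in> {1..card (lax_eigenvalues u0)}" and t: "t \<in> einterval Tm Tp"
  define I where "I = einterval Tm Tp"
  have I: "open I" "convex I" "0 \<in> I" "t \<in> I"
    using assms(1,2) t by (simp_all add: I_def open_einterval convex_einterval) (simp add: einterval_iff flip: zero_ereal_def)
  define U where "U t = (if t \<in> I then cl (u t) else 0)" for t
  interpret flow I U
    using flow_cmdnls[OF I(1,2) assms(4,5)[folded I_def]] by (simp add: U_def[abs_def])
  have up: "u s \<in> sobolev_plus 1" if "s \<in> I" for s using assms(4) that by (auto simp: continuous_sobolev_plus_def I_def)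
  have uL: "u s \<in> L2" "U s = cl (u s)" if "s \<in> I" for s using up[OF that] that by (auto simp: sobolev_plus_1 U_def)
  define S where "S = lax_eigenvalues u0"
  have S: "lax_eigenvalues (u s) = S" if s: "s \<in> I" for s
  proof -
    have "u0 \<in> L2" using assms(3) by (simp add: sobolev_plus_1)
    then have "cl u0 = U 0" using cl_cong[OF uL(1)[OF I(3)] _ assms(6)] uL(2)[OF I(3)] by simp
    then have "l \<in> lax_eigenvalues (u s) \<longleftrightarrow> l \<in> S" for l
      unfolding S_def lax_eigenvalues_iff[OF up[OF s]] lax_eigenvalues_iff[OF assms(3)]
      using alim_norm[OF s I(3), of l] uL(2)[OF s] by (metis norm_eq_zero)
    then show ?thesis by blast
  qed
  define l where "l = sorted_list_of_set S ! (j - 1)"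
  have "l \<in> S"
  proof -
    \<comment> \<open>An infinite set has cardinality 0, so the mere existence of an admissible
      \<open>j\<close> implies that the set of eigenvalues is finite.\<close>
    have fin: "finite S" using j by (intro card_ge_0_finite) (simp add: S_def)
    have "j - 1 < length (sorted_list_of_set S)" using j fin by (auto simp: S_def)
    then have "l \<in> set (sorted_list_of_set S)" unfolding l_def by (rule nth_mem)
    then show ?thesis using fin by simp
  qed
  then have le: "lax_eigenvalue (u s) j = l" "lax_eigenvalue (u s) j \<in> lax_eigenvalues (u s)" if "s \<in> I" for s
    by (simp_all add: lax_eigenvalue_def S[OF that] l_def)
  define F where "F s = (1 / sqrt (2 * pi)) *\<^sub>R alim (U s) l" for s
  have \<phi>: "\<phi> j s \<in> L2" "cl (\<phi> j s) = F s" if s: "s \<in> I" for s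
    using standard_eigenvector_cl[OF up[OF s] le(2)[OF s]] unfolding \<phi>_def le(1)[OF s] by (simp_all add: F_def uL(2)[OF s])
  have F: "F s = cs (of_real (1 / sqrt (2 * pi))) (alim (U s) l)" for s unfolding F_def cs_of_real ..
  have HF: "H1 (F s)" "H1 (dx (F s))" for s unfolding F dx_cs[OF alim_H(1)] by (intro H1_cs alim_H)+
  have D: "(F has_vector_derivative Bop (U t) (F t)) (at t)"
    unfolding F Bop_cs[OF uH alim_H(1,2)] F[abs_def]
    by (rule bounded_linear.has_vector_derivative[OF bounded_linear_cs alim_derivative[OF I(4)]])
  show "has_L2_derivative (\<phi> j) (\<lambda>x. \<i> * ddx (ddx (\<phi> j t)) x
         + 2 * u t x * ddx (szego (\<lambda>y. cnj (u t y) * \<phi> j t y)) x) t"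
  proof (rule has_L2_derivativeI[OF I(1,4) _ _ D])
    show "\<phi> j s \<in> L2" "cl (\<phi> j s) = F s" if "s \<in> I" for s using \<phi>[OF that] by auto
    have H: "H1 (cl (u t))" "H1 (cl (\<phi> j t))" "H1 (dx (cl (\<phi> j t)))"
      using uH[of t] HF[of t] unfolding uL(2)[OF I(4)] \<phi>(2)[OF I(4)] by auto
    note B = Bop_cl[OF uL(1)[OF I(4)] H(1) \<phi>(1)[OF I(4)] H(2,3)]
    show "(\<lambda>x. \<i> * ddx (ddx (\<phi> j t)) x + 2 * u t x * ddx (szego (\<lambda>y. cnj (u t y) * \<phi> j t y)) x) \<in> L2" by (rule B(1))
    show "cl (\<lambda>x. \<i> * ddx (ddx (\<phi> j t)) x + 2 * u t x * ddx (szego (\<lambda>y. cnj (u t y) * \<phi> j t y)) x) = Bop (U t) (F t)"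
      using B(2) unfolding \<phi>(2)[OF I(4)] uL(2)[OF I(4)] .
  qed
qed

end
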